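(* Let $\mathcal A$ be a finite tensor category. A (left) $\mathcal A$-module category $\mathcal M$ has a left and a right relative Serre functor if and only if it is exact as a module category over $\mathcal A$.
   Context: $\Bbbk$ is an algebraically closed field; all categories and functors are $\Bbbk$-linear. A finite linear category is one equivalent to the category of finite-dimensional modules over a finite-dimensional $\Bbbk$-algebra. A finite tensor category is a finite linear category that is rigid monoidal with bilinear tensor product and $\mathrm{End}(\mathbf 1)\cong\Bbbk$. The right dual $c^\vee$ comes with $c^\vee\otimes c\to\mathbf 1$, $\mathbf 1\to c\otimes c^\vee$; the left dual ${}^\vee c$ with $c\otimes{}^\vee c\to\mathbf 1$, $\mathbf 1\to{}^\vee c\otimes c$. A left $\mathcal A$-module category is a finite linear category $\mathcal M$ with a bilinear action $(a,m)\mapsto a.m$, exact in the $\mathcal A$-variable, and associativity and unit isomorphisms satisfying pentagon and triangle axioms; it is exact if $p.m$ is projective for every projective $p\in\mathcal A$ and every $m\in\mathcal M$. The inner Hom $\underline{\mathrm{Hom}}(m,n)\in\mathcal A$ is defined by natural isomorphisms $\mathrm{Hom}_{\mathcal A}(a,\underline{\mathrm{Hom}}(m,n))\cong\mathrm{Hom}_{\mathcal M}(a.m,n)$ for $a\in\mathcal A$, $m,n\in\mathcal M$. A right relative Serre functor on $\mathcal M$ is an endofunctor $\mathrm S^{\rm r}_{\mathcal M}$ of $\mathcal M$ together with isomorphisms $\underline{\mathrm{Hom}}(m,n)^\vee\cong\underline{\mathrm{Hom}}(n,\mathrm S^{\rm r}_{\mathcal M}(m))$ natural in $m,n\in\mathcal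 M$; a left relative Serre functor is an endofunctor $\mathrm S^{\rm l}_{\mathcal M}$ together with isomorphisms ${}^\vee\underline{\mathrm{Hom}}(m,n)\cong\underline{\mathrm{Hom}}(\mathrm S^{\rm l}_{\mathcal M}(n),m)$ natural in $m,n\in\mathcal M$. *)

theory Defs
  imports "HOL-Algebra.Algebra"
begin

section \<open>Categories, functors and natural transformations\<close>

record ('o, 'm) cat =
  Ob :: "'o set"
  Arr :: "'m set"
  Dom :: "'m \<Rightarrow> 'o"
  Cod :: "'m \<Rightarrow> 'o"
  Id :: "'o \<Rightarrow> 'm"
  Comp :: "'m \<Rightarrow> 'm \<Rightarrow> 'm" (infixr \<open>\<bullet>\<index>\<close> 75)

definition Hom :: "('o, 'm, 'z) cat_scheme \<Rightarrow> 'o \<Rightarrow> 'o \<Rightarrow> 'm set" where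
  "Hom C x y = {f \<in> Arr C. Dom C f = x \<and> Cod C f = y}"

locale category =
  fixes C :: "('o, 'm, 'z) cat_scheme" (structure)
  assumes dom_in_Ob: "f \<in> Arr C \<Longrightarrow> Dom C f \<in> Ob C"
    and cod_in_Ob: "f \<in> Arr C \<Longrightarrow> Cod C f \<in> Ob C"
    and id_in_Hom: "x \<in> Ob C \<Longrightarrow> Id C x \<in> Hom C x x"
    and comp_in_Hom: "\<lbrakk>f \<in> Hom C x y; g \<in> Hom C y z\<rbrakk> \<Longrightarrow> g \<bullet> f \<in> Hom C x z"
    and id_comp: "f \<in> Hom C x y \<Longrightarrow> Id C y \<bullet> f = f"
    and comp_id: "f \<in> Hom C x y \<Longrightarrow> f \<bullet> Id C x = f"
    and comp_assoc: "\<lbrakk>f \<in> Hom C w x; g \<in> Hom C x y; h \<in> Hom C y z\<rbrakk>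
      \<Longrightarrow> (h \<bullet> g) \<bullet> f = h \<bullet> (g \<bullet> f)"

definition is_iso :: "('o, 'm, 'z) cat_scheme \<Rightarrow> 'm \<Rightarrow> bool" where
  "is_iso C f \<longleftrightarrow> f \<in> Arr C \<and>
     (\<exists>g \<in> Hom C (Cod C f) (Dom C f).
        g \<bullet>\<^bsub>C\<^esub> f = Id C (Dom C f) \<and> f \<bullet>\<^bsub>C\<^esub> g = Id C (Cod C f))"

definition is_epi :: "('o, 'm, 'z) cat_scheme \<Rightarrow> 'm \<Rightarrow> bool" where
  "is_epi C e \<longleftrightarrow> e \<in> Arr C \<and>
     (\<forall>z \<in> Ob C. \<forall>g \<in> Hom C (Cod C e) z. \<forall>h \<in> Hom C (Cod C e) z.
        g \<bullet>\<^bsub>C\<^esub> e = h \<bullet>\<^bsub>C\<^esub> e \<longrightarrow> g = h)"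

definition projective :: "('o, 'm, 'z) cat_scheme \<Rightarrow> 'o \<Rightarrow> bool" where
  "projective C p \<longleftrightarrow> p \<in> Ob C \<and>
     (\<forall>e. is_epi C e \<longrightarrow>
        (\<forall>f \<in> Hom C p (Cod C e). \<exists>g \<in> Hom C p (Dom C e). e \<bullet>\<^bsub>C\<^esub> g = f))"

definition prod_cat ::
  "('o1, 'm1, 'y) cat_scheme \<Rightarrow> ('o2, 'm2, 'z) cat_scheme \<Rightarrow> ('o1 \<times> 'o2, 'm1 \<times> 'm2) cat" where
  "prod_cat C D = \<lparr>
     Ob = Ob C \<times> Ob D,
     Arr = Arr C \<times> Arr D,
     Dom = (\<lambda>(f, g). (Dom C f, Dom D g)),
     Cod = (\<lambda>(f, g). (Cod C f, Cod D g)),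
     Id = (\<lambda>(x, y). (Id C x, Id D y)),
     Comp = (\<lambda>(f', g') (f, g). (f' \<bullet>\<^bsub>C\<^esub> f, g' \<bullet>\<^bsub>D\<^esub> g))\<rparr>"

record ('o1, 'm1, 'o2, 'm2) ftor =
  omap :: "'o1 \<Rightarrow> 'o2"
  amap :: "'m1 \<Rightarrow> 'm2"

definition is_functor ::
  "('o1, 'm1, 'y) cat_scheme \<Rightarrow> ('o2, 'm2, 'z) cat_scheme \<Rightarrow> ('o1, 'm1, 'o2, 'm2) ftor \<Rightarrow> bool" where
  "is_functor C D F \<longleftrightarrow>
     (\<forall>x \<in> Ob C. omap F x \<in> Ob D) \<and>
     (\<forall>x \<in> Ob C. \<forall>y \<in> Ob C. \<forall>f \<in> Hom C x y. amap F f \<in> Hom D (omap F x) (omap F y)) \<and>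
     (\<forall>x \<in> Ob C. amap F (Id C x) = Id D (omap F x)) \<and>
     (\<forall>x \<in> Ob C. \<forall>y \<in> Ob C. \<forall>z \<in> Ob C. \<forall>f \<in> Hom C x y. \<forall>g \<in> Hom C y z.
        amap F (g \<bullet>\<^bsub>C\<^esub> f) = amap F g \<bullet>\<^bsub>D\<^esub> amap F f)"

definition id_ftor :: "('o, 'm, 'o, 'm) ftor" where
  "id_ftor = \<lparr>omap = (\<lambda>x. x), amap = (\<lambda>f. f)\<rparr>"

definition comp_ftor ::
  "('o2, 'm2, 'o3, 'm3) ftor \<Rightarrow> ('o1, 'm1, 'o2, 'm2) ftor \<Rightarrow> ('o1, 'm1, 'o3, 'm3) ftor" where
  "comp_ftor G F = \<lparr>omap = (\<lambda>x. omap G (omap F x)), amap = (\<lambda>f. amap G (amap F f))\<rparr>"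

definition nat_iso ::
  "('o1, 'm1, 'y) cat_scheme \<Rightarrow> ('o2, 'm2, 'z) cat_scheme \<Rightarrow>
   ('o1, 'm1, 'o2, 'm2) ftor \<Rightarrow> ('o1, 'm1, 'o2, 'm2) ftor \<Rightarrow> ('o1 \<Rightarrow> 'm2) \<Rightarrow> bool" where
  "nat_iso C D F G \<eta> \<longleftrightarrow>
     (\<forall>x \<in> Ob C. \<eta> x \<in> Hom D (omap F x) (omap G x) \<and> is_iso D (\<eta> x)) \<and>
     (\<forall>x \<in> Ob C. \<forall>y \<in> Ob C. \<forall>f \<in> Hom C x y.
        \<eta> y \<bullet>\<^bsub>D\<^esub> amap F f = amap G f \<bullet>\<^bsub>D\<^esub> \<eta> x)"

section \<open>Linear categories\<close>

text \<open>The operations \<open>HAdd\<close> and \<open>HSmult\<close> are only meaningful on parallel arrows.\<close>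

record ('o, 'm, 'k) lincat = "('o, 'm) cat" +
  HZero :: "'o \<Rightarrow> 'o \<Rightarrow> 'm"
  HAdd :: "'m \<Rightarrow> 'm \<Rightarrow> 'm"
  HSmult :: "'k \<Rightarrow> 'm \<Rightarrow> 'm"

text \<open>In HOL-Algebra the record of a module extends that of a ring; the multiplicative
  fields play no role for Hom-spaces.\<close>

definition hom_space :: "('o, 'm, 'k, 'z) lincat_scheme \<Rightarrow> 'o \<Rightarrow> 'o \<Rightarrow> ('k, 'm) module" where
  "hom_space C x y = \<lparr>
     carrier = Hom C x y, monoid.mult = undefined, one = undefined,
     ring.zero = HZero C x y, add = HAdd C, smult = HSmult C\<rparr>"

definition end_algebra :: "('o, 'm, 'k, 'z) lincat_scheme \<Rightarrow> 'o \<Rightarrow> ('k, 'm) module" where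
  "end_algebra C x = (hom_space C x x)\<lparr>monoid.mult := Comp C, one := Id C x\<rparr>"

definition linear_map ::
  "('k, 'y) ring_scheme \<Rightarrow> ('k, 'v, 'a) module_scheme \<Rightarrow> ('k, 'w, 'b) module_scheme \<Rightarrow>
   ('v \<Rightarrow> 'w) \<Rightarrow> bool" where
  "linear_map K V W f \<longleftrightarrow>
     f \<in> carrier V \<rightarrow> carrier W \<and>
     (\<forall>u \<in> carrier V. \<forall>v \<in> carrier V. f (u \<oplus>\<^bsub>V\<^esub> v) = f u \<oplus>\<^bsub>W\<^esub> f v) \<and>
     (\<forall>c \<in> carrier K. \<forall>v \<in> carrier V. f (c \<odot>\<^bsub>V\<^esub> v) = c \<odot>\<^bsub>W\<^esub> f v)"

locale linear_category = K: field K + category C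
  for K :: "('k, 'y) ring_scheme" and C :: "('o, 'm, 'k, 'z) lincat_scheme" (structure) +
  assumes hom_space_module: "\<lbrakk>x \<in> Ob C; y \<in> Ob C\<rbrakk> \<Longrightarrow> module K (hom_space C x y)"
    and comp_linear_left: "\<lbrakk>x \<in> Ob C; y \<in> Ob C; z \<in> Ob C; f \<in> Hom C x y\<rbrakk>
      \<Longrightarrow> linear_map K (hom_space C y z) (hom_space C x z) (\<lambda>g. g \<bullet> f)"
    and comp_linear_right: "\<lbrakk>x \<in> Ob C; y \<in> Ob C; z \<in> Ob C; g \<in> Hom C y z\<rbrakk>
      \<Longrightarrow> linear_map K (hom_space C x y) (hom_space C x z) (\<lambda>f. g \<bullet> f)"

definition op_cat :: "('o, 'm, 'k, 'z) lincat_scheme \<Rightarrow> ('o, 'm, 'k) lincat" where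
  "op_cat C = \<lparr>
     Ob = Ob C, Arr = Arr C, Dom = Cod C, Cod = Dom C, Id = Id C,
     Comp = (\<lambda>g f. f \<bullet>\<^bsub>C\<^esub> g),
     HZero = (\<lambda>x y. HZero C y x), HAdd = HAdd C, HSmult = HSmult C\<rparr>"

definition linear_functor ::
  "('k, 'x) ring_scheme \<Rightarrow> ('o1, 'm1, 'k, 'y) lincat_scheme \<Rightarrow> ('o2, 'm2, 'k, 'z) lincat_scheme \<Rightarrow>
   ('o1, 'm1, 'o2, 'm2) ftor \<Rightarrow> bool" where
  "linear_functor K C D F \<longleftrightarrow> is_functor C D F \<and>
     (\<forall>x \<in> Ob C. \<forall>y \<in> Ob C.
        linear_map K (hom_space C x y) (hom_space D (omap F x) (omap F y)) (amap F))"

definition bilinear_functor ::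
  "('k, 'w) ring_scheme \<Rightarrow> ('o1, 'm1, 'k, 'x) lincat_scheme \<Rightarrow> ('o2, 'm2, 'k, 'y) lincat_scheme \<Rightarrow>
   ('o3, 'm3, 'k, 'z) lincat_scheme \<Rightarrow> ('o1 \<times> 'o2, 'm1 \<times> 'm2, 'o3, 'm3) ftor \<Rightarrow> bool" where
  "bilinear_functor K C D E F \<longleftrightarrow> is_functor (prod_cat C D) E F \<and>
     (\<forall>x \<in> Ob C. linear_functor K D E
        \<lparr>omap = (\<lambda>y. omap F (x, y)), amap = (\<lambda>g. amap F (Id C x, g))\<rparr>) \<and>
     (\<forall>y \<in> Ob D. linear_functor K C E
        \<lparr>omap = (\<lambda>x. omap F (x, y)), amap = (\<lambda>f. amap F (f, Id D y))\<rparr>)"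

definition linearly_equivalent ::
  "('k, 'x) ring_scheme \<Rightarrow> ('o1, 'm1, 'k, 'y) lincat_scheme \<Rightarrow> ('o2, 'm2, 'k, 'z) lincat_scheme \<Rightarrow>
   bool" where
  "linearly_equivalent K C D \<longleftrightarrow>
     (\<exists>F G \<eta> \<epsilon>. linear_functor K C D F \<and> linear_functor K D C G \<and>
        nat_iso C C id_ftor (comp_ftor G F) \<eta> \<and> nat_iso D D (comp_ftor F G) id_ftor \<epsilon>)"

definition is_kernel :: "('o, 'm, 'k, 'z) lincat_scheme \<Rightarrow> 'm \<Rightarrow> 'm \<Rightarrow> bool" where
  "is_kernel C f k \<longleftrightarrow> f \<in> Arr C \<and> k \<in> Arr C \<and> Cod C k = Dom C f \<and>
     f \<bullet>\<^bsub>C\<^esub> k = HZero C (Dom C k) (Cod C f) \<and>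
     (\<forall>z \<in> Ob C. \<forall>h \<in> Hom C z (Dom C f). f \<bullet>\<^bsub>C\<^esub> h = HZero C z (Cod C f) \<longrightarrow>
        (\<exists>!u. u \<in> Hom C z (Dom C k) \<and> k \<bullet>\<^bsub>C\<^esub> u = h))"

definition is_cokernel :: "('o, 'm, 'k, 'z) lincat_scheme \<Rightarrow> 'm \<Rightarrow> 'm \<Rightarrow> bool" where
  "is_cokernel C f q \<longleftrightarrow> f \<in> Arr C \<and> q \<in> Arr C \<and> Dom C q = Cod C f \<and>
     q \<bullet>\<^bsub>C\<^esub> f = HZero C (Dom C f) (Cod C q) \<and>
     (\<forall>z \<in> Ob C. \<forall>h \<in> Hom C (Cod C f) z. h \<bullet>\<^bsub>C\<^esub> f = HZero C (Dom C f) z \<longrightarrow>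
        (\<exists>!u. u \<in> Hom C (Cod C q) z \<and> u \<bullet>\<^bsub>C\<^esub> q = h))"

definition short_exact :: "('o, 'm, 'k, 'z) lincat_scheme \<Rightarrow> 'm \<Rightarrow> 'm \<Rightarrow> bool" where
  "short_exact C f g \<longleftrightarrow> is_kernel C g f \<and> is_cokernel C f g"

definition exact_functor ::
  "('o1, 'm1, 'k, 'y) lincat_scheme \<Rightarrow> ('o2, 'm2, 'k, 'z) lincat_scheme \<Rightarrow>
   ('o1, 'm1, 'o2, 'm2) ftor \<Rightarrow> bool" where
  "exact_functor C D F \<longleftrightarrow> is_functor C D F \<and>
     (\<forall>f g. short_exact C f g \<longrightarrow> short_exact D (amap F f) (amap F g))"

section \<open>Finite linear categories\<close>

definition finite_dimensional ::
  "('k, 'y) ring_scheme \<Rightarrow> ('k, 'v, 'z) module_scheme \<Rightarrow> bool" where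
  "finite_dimensional K V \<longleftrightarrow> module K V \<and>
     (\<exists>S. finite S \<and> S \<subseteq> carrier V \<and> (\<forall>U. submodule U K V \<and> S \<subseteq> U \<longrightarrow> U = carrier V))"

text \<open>Associative unital, not necessarily commutative (unlike the locale \<open>algebra\<close>).\<close>

definition fd_algebra :: "('k, 'y) ring_scheme \<Rightarrow> ('k, 'b) module \<Rightarrow> bool" where
  "fd_algebra K B \<longleftrightarrow> ring B \<and> finite_dimensional K B \<and>
     (\<forall>c \<in> carrier K. \<forall>x \<in> carrier B. \<forall>y \<in> carrier B.
        (c \<odot>\<^bsub>B\<^esub> x) \<otimes>\<^bsub>B\<^esub> y = c \<odot>\<^bsub>B\<^esub> (x \<otimes>\<^bsub>B\<^esub> y) \<and>
        x \<otimes>\<^bsub>B\<^esub> (c \<odot>\<^bsub>B\<^esub> y) = c \<odot>\<^bsub>B\<^esub> (x \<otimes>\<^bsub>B\<^esub> y))"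

text \<open>Left modules over a not necessarily commutative ring (unlike the locale \<open>module\<close>).\<close>

locale left_module = B: ring B + V: abelian_group V
  for B :: "('b, 'y) ring_scheme" and V :: "('b, 'v, 'z) module_scheme" +
  assumes act_closed: "\<lbrakk>a \<in> carrier B; v \<in> carrier V\<rbrakk> \<Longrightarrow> a \<odot>\<^bsub>V\<^esub> v \<in> carrier V"
    and act_l_distr: "\<lbrakk>a \<in> carrier B; b \<in> carrier B; v \<in> carrier V\<rbrakk>
      \<Longrightarrow> (a \<oplus>\<^bsub>B\<^esub> b) \<odot>\<^bsub>V\<^esub> v = a \<odot>\<^bsub>V\<^esub> v \<oplus>\<^bsub>V\<^esub> b \<odot>\<^bsub>V\<^esub> v"
    and act_r_distr: "\<lbrakk>a \<in> carrier B; v \<in> carrier V; w \<in> carrier V\<rbrakk>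
      \<Longrightarrow> a \<odot>\<^bsub>V\<^esub> (v \<oplus>\<^bsub>V\<^esub> w) = a \<odot>\<^bsub>V\<^esub> v \<oplus>\<^bsub>V\<^esub> a \<odot>\<^bsub>V\<^esub> w"
    and act_assoc: "\<lbrakk>a \<in> carrier B; b \<in> carrier B; v \<in> carrier V\<rbrakk>
      \<Longrightarrow> (a \<otimes>\<^bsub>B\<^esub> b) \<odot>\<^bsub>V\<^esub> v = a \<odot>\<^bsub>V\<^esub> (b \<odot>\<^bsub>V\<^esub> v)"
    and act_one: "v \<in> carrier V \<Longrightarrow> \<one>\<^bsub>B\<^esub> \<odot>\<^bsub>V\<^esub> v = v"

text \<open>The vector space underlying a module over an algebra: \<open>c\<close> acts as \<open>c 1\<^sub>B\<close>.\<close>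

definition underlying_space :: "('k, 'b) module \<Rightarrow> ('b, 'v) module \<Rightarrow> ('k, 'v) module" where
  "underlying_space B V = \<lparr>
     carrier = carrier V, monoid.mult = monoid.mult V, one = monoid.one V, ring.zero = ring.zero V, add = add V,
     smult = (\<lambda>c v. (c \<odot>\<^bsub>B\<^esub> \<one>\<^bsub>B\<^esub>) \<odot>\<^bsub>V\<^esub> v)\<rparr>"

definition fd_modules :: "('k, 'y) ring_scheme \<Rightarrow> ('k, 'b) module \<Rightarrow> ('b, 'v) module set" where
  "fd_modules K B = {V. left_module B V \<and> finite_dimensional K (underlying_space B V)}"

definition module_homs :: "('k, 'b) module \<Rightarrow> ('b, 'v) module \<Rightarrow> ('b, 'v) module \<Rightarrow> ('v \<Rightarrow> 'v) set" where
  "module_homs B V W = {f \<in> carrier V \<rightarrow>\<^sub>E carrier W.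
     (\<forall>u \<in> carrier V. \<forall>v \<in> carrier V. f (u \<oplus>\<^bsub>V\<^esub> v) = f u \<oplus>\<^bsub>W\<^esub> f v) \<and>
     (\<forall>b \<in> carrier B. \<forall>v \<in> carrier V. f (b \<odot>\<^bsub>V\<^esub> v) = b \<odot>\<^bsub>W\<^esub> f v)}"

text \<open>An arrow is a module homomorphism together with its source and target.\<close>

definition fd_module_cat ::
  "('k, 'y) ring_scheme \<Rightarrow> ('k, 'b) module \<Rightarrow>
   (('b, 'v) module, ('b, 'v) module \<times> ('v \<Rightarrow> 'v) \<times> ('b, 'v) module, 'k) lincat" where
  "fd_module_cat K B = \<lparr>
     Ob = fd_modules K B,
     Arr = {(V, f, W). V \<in> fd_modules K B \<and> W \<in> fd_modules K B \<and> f \<in> module_homs B V W},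
     Dom = (\<lambda>(V, f, W). V),
     Cod = (\<lambda>(V, f, W). W),
     Id = (\<lambda>V. (V, \<lambda>v \<in> carrier V. v, V)),
     Comp = (\<lambda>(V', g, W) (V, f, W'). (V, \<lambda>v \<in> carrier V. g (f v), W)),
     HZero = (\<lambda>V W. (V, \<lambda>v \<in> carrier V. \<zero>\<^bsub>W\<^esub>, W)),
     HAdd = (\<lambda>(V, f, W) (V', g, W'). (V, \<lambda>v \<in> carrier V. f v \<oplus>\<^bsub>W\<^esub> g v, W)),
     HSmult = (\<lambda>c (V, f, W). (V, \<lambda>v \<in> carrier V. c \<odot>\<^bsub>underlying_space B W\<^esub> f v, W))\<rparr>"

text \<open>Every finite-dimensional algebra and every finite-dimensional module over it has an
  isomorphic copy carried by a subset of the type \<open>nat \<Rightarrow> 'k\<close>, which contains \<open>K\<^sup>n\<close> for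
  all \<open>n\<close>. Using this type for algebras and modules is therefore no loss of generality.\<close>

definition finite_linear_category ::
  "('k, 'y) ring_scheme \<Rightarrow> ('o, 'm, 'k, 'z) lincat_scheme \<Rightarrow> bool" where
  "finite_linear_category K C \<longleftrightarrow> linear_category K C \<and>
     (\<exists>B :: ('k, nat \<Rightarrow> 'k) module. fd_algebra K B \<and>
        linearly_equivalent K C
          (fd_module_cat K B ::
            ((nat \<Rightarrow> 'k, nat \<Rightarrow> 'k) module,
             (nat \<Rightarrow> 'k, nat \<Rightarrow> 'k) module \<times> ((nat \<Rightarrow> 'k) \<Rightarrow> (nat \<Rightarrow> 'k)) \<times>
               (nat \<Rightarrow> 'k, nat \<Rightarrow> 'k) module, 'k) lincat))"

section \<open>Finite tensor categories\<close>

record ('o, 'm, 'k) moncat = "('o, 'm, 'k) lincat" +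
  Tensor :: "('o \<times> 'o, 'm \<times> 'm, 'o, 'm) ftor"
  Unit :: "'o"
  Assoc :: "'o \<Rightarrow> 'o \<Rightarrow> 'o \<Rightarrow> 'm"
  LUnit :: "'o \<Rightarrow> 'm"
  RUnit :: "'o \<Rightarrow> 'm"

abbreviation tensor_ob (infixr \<open>\<boxtimes>\<index>\<close> 80) where
  "x \<boxtimes>\<^bsub>A\<^esub> y \<equiv> omap (Tensor A) (x, y)"

abbreviation tensor_arr (infixr \<open>\<boxdot>\<index>\<close> 80) where
  "f \<boxdot>\<^bsub>A\<^esub> g \<equiv> amap (Tensor A) (f, g)"

locale monoidal_linear_category = linear_category K A
  for K :: "('k, 'y) ring_scheme" and A :: "('o, 'm, 'k, 'z) moncat_scheme" (structure) +
  assumes tensor_bilinear: "bilinear_functor K A A A (Tensor A)"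
    and unit_in_Ob: "Unit A \<in> Ob A"
    and assoc_nat_iso: "nat_iso (prod_cat (prod_cat A A) A) A
      \<lparr>omap = (\<lambda>((a, b), c). (a \<boxtimes> b) \<boxtimes> c), amap = (\<lambda>((f, g), h). (f \<boxdot> g) \<boxdot> h)\<rparr>
      \<lparr>omap = (\<lambda>((a, b), c). a \<boxtimes> (b \<boxtimes> c)), amap = (\<lambda>((f, g), h). f \<boxdot> (g \<boxdot> h))\<rparr>
      (\<lambda>((a, b), c). Assoc A a b c)"
    and lunit_nat_iso: "nat_iso A A
      \<lparr>omap = (\<lambda>a. Unit A \<boxtimes> a), amap = (\<lambda>f. Id A (Unit A) \<boxdot> f)\<rparr> id_ftor (LUnit A)"
    and runit_nat_iso: "nat_iso A A
      \<lparr>omap = (\<lambda>a. a \<boxtimes> Unit A), amap = (\<lambda>f. f \<boxdot> Id A (Unit A))\<rparr> id_ftor (RUnit A)"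
    and pentagon: "\<lbrakk>a \<in> Ob A; b \<in> Ob A; c \<in> Ob A; d \<in> Ob A\<rbrakk> \<Longrightarrow>
      Assoc A a b (c \<boxtimes> d) \<bullet> Assoc A (a \<boxtimes> b) c d =
      (Id A a \<boxdot> Assoc A b c d) \<bullet> Assoc A a (b \<boxtimes> c) d \<bullet> (Assoc A a b c \<boxdot> Id A d)"
    and triangle: "\<lbrakk>a \<in> Ob A; b \<in> Ob A\<rbrakk> \<Longrightarrow>
      (Id A a \<boxdot> LUnit A b) \<bullet> Assoc A a (Unit A) b = RUnit A a \<boxdot> Id A b"

definition inv_arr :: "('o, 'm, 'z) cat_scheme \<Rightarrow> 'm \<Rightarrow> 'm" where
  "inv_arr C f = (THE g. g \<in> Hom C (Cod C f) (Dom C f) \<and>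
     g \<bullet>\<^bsub>C\<^esub> f = Id C (Dom C f) \<and> f \<bullet>\<^bsub>C\<^esub> g = Id C (Cod C f))"

text \<open>\<open>d\<close> is a right dual of \<open>c\<close> with \<open>ev : d \<otimes> c \<rightarrow> 1\<close> and \<open>coev : 1 \<rightarrow> c \<otimes> d\<close>, subject to the
  two snake identities.\<close>

definition is_right_dual ::
  "('o, 'm, 'k, 'z) moncat_scheme \<Rightarrow> 'o \<Rightarrow> 'o \<Rightarrow> 'm \<Rightarrow> 'm \<Rightarrow> bool" where
  "is_right_dual A c d ev coev \<longleftrightarrow> c \<in> Ob A \<and> d \<in> Ob A \<and>
     ev \<in> Hom A (d \<boxtimes>\<^bsub>A\<^esub> c) (Unit A) \<and> coev \<in> Hom A (Unit A) (c \<boxtimes>\<^bsub>A\<^esub> d) \<and>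
     RUnit A c \<bullet>\<^bsub>A\<^esub> (Id A c \<boxdot>\<^bsub>A\<^esub> ev) \<bullet>\<^bsub>A\<^esub> Assoc A c d c \<bullet>\<^bsub>A\<^esub> (coev \<boxdot>\<^bsub>A\<^esub> Id A c)
       \<bullet>\<^bsub>A\<^esub> inv_arr A (LUnit A c) = Id A c \<and>
     LUnit A d \<bullet>\<^bsub>A\<^esub> (ev \<boxdot>\<^bsub>A\<^esub> Id A d) \<bullet>\<^bsub>A\<^esub> inv_arr A (Assoc A d c d) \<bullet>\<^bsub>A\<^esub> (Id A d \<boxdot>\<^bsub>A\<^esub> coev)
       \<bullet>\<^bsub>A\<^esub> inv_arr A (RUnit A d) = Id A d"

text \<open>\<open>e\<close> is a left dual of \<open>c\<close> with \<open>ev : c \<otimes> e \<rightarrow> 1\<close> and \<open>coev : 1 \<rightarrow> e \<otimes> c\<close>; interchanging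
  the roles of the two objects gives exactly the data and identities of a right dual.\<close>

definition is_left_dual ::
  "('o, 'm, 'k, 'z) moncat_scheme \<Rightarrow> 'o \<Rightarrow> 'o \<Rightarrow> 'm \<Rightarrow> 'm \<Rightarrow> bool" where
  "is_left_dual A c e ev coev \<longleftrightarrow> is_right_dual A e c ev coev"

definition rigid :: "('o, 'm, 'k, 'z) moncat_scheme \<Rightarrow> bool" where
  "rigid A \<longleftrightarrow> (\<forall>c \<in> Ob A.
     (\<exists>d ev coev. is_right_dual A c d ev coev) \<and> (\<exists>e ev coev. is_left_dual A c e ev coev))"

definition finite_tensor_category ::
  "('k, 'y) ring_scheme \<Rightarrow> ('o, 'm, 'k, 'z) moncat_scheme \<Rightarrow> bool" where
  "finite_tensor_category K A \<longleftrightarrow>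
     finite_linear_category K A \<and> monoidal_linear_category K A \<and> rigid A \<and>
     (\<exists>\<phi> \<in> ring_iso (end_algebra A (Unit A)) K.
        \<forall>c \<in> carrier K. \<forall>f \<in> Hom A (Unit A) (Unit A). \<phi> (HSmult A c f) = c \<otimes>\<^bsub>K\<^esub> \<phi> f)"

section \<open>Dual functors\<close>

record ('o, 'm) duality =
  Dual :: "'o \<Rightarrow> 'o"
  Ev :: "'o \<Rightarrow> 'm"
  Coev :: "'o \<Rightarrow> 'm"

definition right_duality :: "('o, 'm, 'k, 'z) moncat_scheme \<Rightarrow> ('o, 'm) duality \<Rightarrow> bool" where
  "right_duality A D \<longleftrightarrow> (\<forall>c \<in> Ob A. is_right_dual A c (Dual D c) (Ev D c) (Coev D c))"

definition left_duality :: "('o, 'm, 'k, 'z) moncat_scheme \<Rightarrow> ('o, 'm) duality \<Rightarrow> bool" where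
  "left_duality A D \<longleftrightarrow> (\<forall>c \<in> Ob A. is_left_dual A c (Dual D c) (Ev D c) (Coev D c))"

text \<open>For \<open>f : a \<rightarrow> b\<close> the right transpose is the composite
  \<open>b\<^sup>\<or> \<rightarrow> b\<^sup>\<or> \<otimes> 1 \<rightarrow> b\<^sup>\<or> \<otimes> (a \<otimes> a\<^sup>\<or>) \<rightarrow> b\<^sup>\<or> \<otimes> (b \<otimes> a\<^sup>\<or>) \<rightarrow> (b\<^sup>\<or> \<otimes> b) \<otimes> a\<^sup>\<or> \<rightarrow> 1 \<otimes> a\<^sup>\<or> \<rightarrow> a\<^sup>\<or>\<close>.\<close>

definition right_dual_ftor ::
  "('o, 'm, 'k, 'z) moncat_scheme \<Rightarrow> ('o, 'm) duality \<Rightarrow> ('o, 'm, 'o, 'm) ftor" where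
  "right_dual_ftor A D = \<lparr>
     omap = Dual D,
     amap = (\<lambda>f. let a = Dom A f; b = Cod A f; a' = Dual D a; b' = Dual D b in
       LUnit A a' \<bullet>\<^bsub>A\<^esub> (Ev D b \<boxdot>\<^bsub>A\<^esub> Id A a') \<bullet>\<^bsub>A\<^esub> inv_arr A (Assoc A b' b a')
         \<bullet>\<^bsub>A\<^esub> (Id A b' \<boxdot>\<^bsub>A\<^esub> (f \<boxdot>\<^bsub>A\<^esub> Id A a')) \<bullet>\<^bsub>A\<^esub> (Id A b' \<boxdot>\<^bsub>A\<^esub> Coev D a)
         \<bullet>\<^bsub>A\<^esub> inv_arr A (RUnit A b'))\<rparr>"

text \<open>For \<open>f : a \<rightarrow> b\<close> the left transpose is the composite
  \<open>\<^sup>\<or>b \<rightarrow> 1 \<otimes> \<^sup>\<or>b \<rightarrow> (\<^sup>\<or>a \<otimes> a) \<otimes> \<^sup>\<or>b \<rightarrow> (\<^sup>\<or>a \<otimes> b) \<otimes> \<^sup>\<or>b \<rightarrow> \<^sup>\<or>a \<otimes> (b \<otimes> \<^sup>\<or>b) \<rightarrow> \<^sup>\<or>a \<otimes> 1 \<rightarrow> \<^sup>\<or>a\<close>.\<close>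

definition left_dual_ftor ::
  "('o, 'm, 'k, 'z) moncat_scheme \<Rightarrow> ('o, 'm) duality \<Rightarrow> ('o, 'm, 'o, 'm) ftor" where
  "left_dual_ftor A D = \<lparr>
     omap = Dual D,
     amap = (\<lambda>f. let a = Dom A f; b = Cod A f; a' = Dual D a; b' = Dual D b in
       RUnit A a' \<bullet>\<^bsub>A\<^esub> (Id A a' \<boxdot>\<^bsub>A\<^esub> Ev D b) \<bullet>\<^bsub>A\<^esub> Assoc A a' b b'
         \<bullet>\<^bsub>A\<^esub> ((Id A a' \<boxdot>\<^bsub>A\<^esub> f) \<boxdot>\<^bsub>A\<^esub> Id A b') \<bullet>\<^bsub>A\<^esub> (Coev D a \<boxdot>\<^bsub>A\<^esub> Id A b')
         \<bullet>\<^bsub>A\<^esub> inv_arr A (LUnit A b'))\<rparr>"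

section \<open>Module categories\<close>

record ('oa, 'ma, 'o, 'm, 'k) modcat = "('o, 'm, 'k) lincat" +
  Act :: "('oa \<times> 'o, 'ma \<times> 'm, 'o, 'm) ftor"
  MAssoc :: "'oa \<Rightarrow> 'oa \<Rightarrow> 'o \<Rightarrow> 'm"
  MUnit :: "'o \<Rightarrow> 'm"

abbreviation act_ob (infixr \<open>\<rhd>\<index>\<close> 80) where
  "a \<rhd>\<^bsub>M\<^esub> m \<equiv> omap (Act M) (a, m)"

abbreviation act_arr (infixr \<open>\<unrhd>\<index>\<close> 80) where
  "f \<unrhd>\<^bsub>M\<^esub> g \<equiv> amap (Act M) (f, g)"

definition module_category ::
  "('k, 'x) ring_scheme \<Rightarrow> ('oa, 'ma, 'k, 'y) moncat_scheme \<Rightarrow>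
   ('oa, 'ma, 'o, 'm, 'k, 'z) modcat_scheme \<Rightarrow> bool" where
  "module_category K A M \<longleftrightarrow>
     finite_linear_category K M \<and>
     bilinear_functor K A M M (Act M) \<and>
     (\<forall>m \<in> Ob M. exact_functor A M
        \<lparr>omap = (\<lambda>a. a \<rhd>\<^bsub>M\<^esub> m), amap = (\<lambda>f. f \<unrhd>\<^bsub>M\<^esub> Id M m)\<rparr>) \<and>
     nat_iso (prod_cat (prod_cat A A) M) M
       \<lparr>omap = (\<lambda>((a, b), m). (a \<boxtimes>\<^bsub>A\<^esub> b) \<rhd>\<^bsub>M\<^esub> m),
        amap = (\<lambda>((f, g), h). (f \<boxdot>\<^bsub>A\<^esub> g) \<unrhd>\<^bsub>M\<^esub> h)\<rparr>
       \<lparr>omap = (\<lambda>((a, b), m). a \<rhd>\<^bsub>M\<^esub> (b \<rhd>\<^bsub>M\<^esub> m)),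
        amap = (\<lambda>((f, g), h). f \<unrhd>\<^bsub>M\<^esub> (g \<unrhd>\<^bsub>M\<^esub> h))\<rparr>
       (\<lambda>((a, b), m). MAssoc M a b m) \<and>
     nat_iso M M
       \<lparr>omap = (\<lambda>m. Unit A \<rhd>\<^bsub>M\<^esub> m), amap = (\<lambda>f. Id A (Unit A) \<unrhd>\<^bsub>M\<^esub> f)\<rparr> id_ftor (MUnit M) \<and>
     (\<forall>a \<in> Ob A. \<forall>b \<in> Ob A. \<forall>c \<in> Ob A. \<forall>m \<in> Ob M.
        MAssoc M a b (c \<rhd>\<^bsub>M\<^esub> m) \<bullet>\<^bsub>M\<^esub> MAssoc M (a \<boxtimes>\<^bsub>A\<^esub> b) c m =
        (Id A a \<unrhd>\<^bsub>M\<^esub> MAssoc M b c m) \<bullet>\<^bsub>M\<^esub> MAssoc M a (b \<boxtimes>\<^bsub>A\<^esub> c) m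
          \<bullet>\<^bsub>M\<^esub> (Assoc A a b c \<unrhd>\<^bsub>M\<^esub> Id M m)) \<and>
     (\<forall>a \<in> Ob A. \<forall>m \<in> Ob M.
        (Id A a \<unrhd>\<^bsub>M\<^esub> MUnit M m) \<bullet>\<^bsub>M\<^esub> MAssoc M a (Unit A) m = RUnit A a \<unrhd>\<^bsub>M\<^esub> Id M m)"

definition exact_module_category ::
  "('oa, 'ma, 'k, 'y) moncat_scheme \<Rightarrow> ('oa, 'ma, 'o, 'm, 'k, 'z) modcat_scheme \<Rightarrow> bool" where
  "exact_module_category A M \<longleftrightarrow>
     (\<forall>p m. projective A p \<and> m \<in> Ob M \<longrightarrow> projective M (p \<rhd>\<^bsub>M\<^esub> m))"

section \<open>Inner Homs and relative Serre functors\<close>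

text \<open>\<open>IHom\<close> is contravariant in the first argument; \<open>IAdj a m n\<close> is the isomorphism
  \<open>Hom(a, IHom(m, n)) \<rightarrow> Hom(a.m, n)\<close>.\<close>

record ('oa, 'ma, 'o, 'm) inner_hom =
  IHom :: "('o \<times> 'o, 'm \<times> 'm, 'oa, 'ma) ftor"
  IAdj :: "'oa \<Rightarrow> 'o \<Rightarrow> 'o \<Rightarrow> 'ma \<Rightarrow> 'm"

definition is_inner_hom ::
  "('k, 'x) ring_scheme \<Rightarrow> ('oa, 'ma, 'k, 'y) moncat_scheme \<Rightarrow>
   ('oa, 'ma, 'o, 'm, 'k, 'z) modcat_scheme \<Rightarrow> ('oa, 'ma, 'o, 'm) inner_hom \<Rightarrow> bool" where
  "is_inner_hom K A M H \<longleftrightarrow>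
     bilinear_functor K (op_cat M) M A (IHom H) \<and>
     (\<forall>a \<in> Ob A. \<forall>m \<in> Ob M. \<forall>n \<in> Ob M.
        linear_map K (hom_space A a (omap (IHom H) (m, n))) (hom_space M (a \<rhd>\<^bsub>M\<^esub> m) n) (IAdj H a m n) \<and>
        bij_betw (IAdj H a m n) (Hom A a (omap (IHom H) (m, n))) (Hom M (a \<rhd>\<^bsub>M\<^esub> m) n)) \<and>
     (\<forall>a \<in> Ob A. \<forall>a' \<in> Ob A. \<forall>m \<in> Ob M. \<forall>m' \<in> Ob M. \<forall>n \<in> Ob M. \<forall>n' \<in> Ob M.
        \<forall>f \<in> Hom A a' a. \<forall>g \<in> Hom M m' m. \<forall>h \<in> Hom M n n'. \<forall>u \<in> Hom A a (omap (IHom H) (m, n)).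
          IAdj H a' m' n' (amap (IHom H) (g, h) \<bullet>\<^bsub>A\<^esub> u \<bullet>\<^bsub>A\<^esub> f) =
          h \<bullet>\<^bsub>M\<^esub> IAdj H a m n u \<bullet>\<^bsub>M\<^esub> (f \<unrhd>\<^bsub>M\<^esub> g))"

text \<open>All functors of \<open>(m, n)\<close> in the next two definitions are covariant in \<open>m\<close> and
  contravariant in \<open>n\<close>. The dual of \<open>IHom\<close> is such a functor since an arrow of
  \<open>M \<times> M\<^sup>o\<^sup>p\<close> is an arrow of \<open>M\<^sup>o\<^sup>p \<times> M\<close> in the opposite direction.\<close>

definition is_right_relative_Serre_functor ::
  "('k, 'x) ring_scheme \<Rightarrow> ('oa, 'ma, 'k, 'y) moncat_scheme \<Rightarrow>
   ('oa, 'ma, 'o, 'm, 'k, 'z) modcat_scheme \<Rightarrow> ('oa, 'ma) duality \<Rightarrow>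
   ('oa, 'ma, 'o, 'm) inner_hom \<Rightarrow> ('o, 'm, 'o, 'm) ftor \<Rightarrow> ('o \<times> 'o \<Rightarrow> 'ma) \<Rightarrow> bool" where
  "is_right_relative_Serre_functor K A M D H S \<phi> \<longleftrightarrow>
     linear_functor K M M S \<and>
     nat_iso (prod_cat M (op_cat M)) A
       (comp_ftor (right_dual_ftor A D) (IHom H))
       \<lparr>omap = (\<lambda>(m, n). omap (IHom H) (n, omap S m)),
        amap = (\<lambda>(g, h). amap (IHom H) (h, amap S g))\<rparr>
       \<phi>"

definition is_left_relative_Serre_functor ::
  "('k, 'x) ring_scheme \<Rightarrow> ('oa, 'ma, 'k, 'y) moncat_scheme \<Rightarrow>
   ('oa, 'ma, 'o, 'm, 'k, 'z) modcat_scheme \<Rightarrow> ('oa, 'ma) duality \<Rightarrow>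
   ('oa, 'ma, 'o, 'm) inner_hom \<Rightarrow> ('o, 'm, 'o, 'm) ftor \<Rightarrow> ('o \<times> 'o \<Rightarrow> 'ma) \<Rightarrow> bool" where
  "is_left_relative_Serre_functor K A M D H S \<phi> \<longleftrightarrow>
     linear_functor K M M S \<and>
     nat_iso (prod_cat M (op_cat M)) A
       (comp_ftor (left_dual_ftor A D) (IHom H))
       \<lparr>omap = (\<lambda>(m, n). omap (IHom H) (omap S n, m)),
        amap = (\<lambda>(g, h). amap (IHom H) (amap S h, g))\<rparr>
       \<phi>"

text \<open>Duals and inner Homs are unique up to unique (natural) isomorphism, so the choices of
  \<open>D\<close> and \<open>H\<close> do not affect the existence of \<open>S\<close>.\<close>

definition has_right_relative_Serre_functor ::
  "('k, 'x) ring_scheme \<Rightarrow> ('oa, 'ma, 'k, 'y) moncat_scheme \<Rightarrow>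
   ('oa, 'ma, 'o, 'm, 'k, 'z) modcat_scheme \<Rightarrow> bool" where
  "has_right_relative_Serre_functor K A M \<longleftrightarrow>
     (\<exists>D H S \<phi>. right_duality A D \<and> is_inner_hom K A M H \<and>
        is_right_relative_Serre_functor K A M D H S \<phi>)"

definition has_left_relative_Serre_functor ::
  "('k, 'x) ring_scheme \<Rightarrow> ('oa, 'ma, 'k, 'y) moncat_scheme \<Rightarrow>
   ('oa, 'ma, 'o, 'm, 'k, 'z) modcat_scheme \<Rightarrow> bool" where
  "has_left_relative_Serre_functor K A M \<longleftrightarrow>
     (\<exists>D H S \<phi>. left_duality A D \<and> is_inner_hom K A M H \<and>
        is_left_relative_Serre_functor K A M D H S \<phi>)"

end

theory Submission imports Defs begin

text \<open>A finite linear category is abelian with noetherian Hom-spaces and a projective generator; hence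
  a contravariant functor \<open>x \<mapsto> Hom(T x, d)\<close> on it is representable as soon as the linear functor \<open>T\<close> is
  right exact. If \<open>M\<close> is exact, then \<open>p.m\<close> is projective for projective \<open>p\<close>, so \<open>IHom(m, -)\<close> is
  exact, and an object \<open>S m\<close> represents \<open>n \<mapsto> Hom(IHom(m, n), 1)\<close>. The chain
  \<open>Hom(a, IHom(n, S m)) = Hom(a.n, S m) = Hom(IHom(m, a.n), 1) = Hom(a \<otimes> IHom(m, n), 1)
  = Hom(a, IHom(m, n)\<^sup>\<or>)\<close> and the Yoneda lemma make \<open>S\<close> a right relative Serre functor. For the left one
  the same representability criterion is applied to \<open>IHom(-, n)\<close> on \<open>M\<^sup>o\<^sup>p\<close>; it needs an injective
  cogenerator of \<open>M\<close>, and over an exact module category the projective generator is one, because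
  every object \<open>m\<close> is a quotient and a subobject of objects \<open>p.x\<close> with \<open>p\<close> projective.

  Conversely, \<open>IHom(-, x)\<close> sends epimorphisms to monomorphisms in any case. A right relative Serre functor
  identifies \<open>IHom(m, -)\<^sup>\<or>\<close> with \<open>IHom(-, S m)\<close>, so \<open>IHom(m, -)\<close> preserves epimorphisms, and
  \<open>Hom(p.m, -) = Hom(p, IHom(m, -))\<close> shows that \<open>p.m\<close> is projective.\<close>

section \<open>Categories and linear categories\<close>

text \<open>Three devices carry the argument. (1) If \<open>b\<close> is a right dual of
  \<open>a\<close>, the action of \<open>b\<close> is left adjoint to that of \<open>a\<close>. This
  is proved without strictness for an arbitrary linear action and reused for \<open>A\<close> acting
  on itself and for \<open>A\<close> with reversed tensor product, so that left and right versions
  of facts on duals need one proof. (2) A representing object is the cokernel of an arrow between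
  finite sums of the projective generator: generators of the functor, then relations. Noetherian
  Hom-spaces make both families finite, and right exactness of \<open>T\<close> lets the universal
  element descend. (3) The chain of bijections is not inverted step by step: each Serre isomorphism
  is the element that a bijection, natural in \<open>a\<close>, sends to the evaluation of the dual.
  The delicate point is injectivity in \<open>M\<close>. Acting with a projective p splits every
  monomorphism, because the cokernel becomes projective; Hom(-, p.(l.x)) = Hom(p.(r.-), x), with l
  and r the left and right duals of p, then gives extensions of arrows into p.(l.x), of which the
  generator is a retract for suitable p and x.\<close>

lemma Hom_iff: "f \<in> Hom C x y \<longleftrightarrow> f \<in> Arr C \<and> Dom C f = x \<and> Cod C f = y"
  by (auto simp: Hom_def)

lemma HomD:
  assumes "f \<in> Hom C x y"
  shows "f \<in> Arr C" "Dom C f = x" "Cod C f = y"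
  using assms by (auto simp: Hom_def)

context category
begin

lemma arr_comp [simp]: "\<lbrakk>f \<in> Arr C; g \<in> Arr C; Dom C g = Cod C f\<rbrakk> \<Longrightarrow> g \<bullet> f \<in> Arr C"
  and dom_comp [simp]: "\<lbrakk>f \<in> Arr C; g \<in> Arr C; Dom C g = Cod C f\<rbrakk> \<Longrightarrow> Dom C (g \<bullet> f) = Dom C f"
  and cod_comp [simp]: "\<lbrakk>f \<in> Arr C; g \<in> Arr C; Dom C g = Cod C f\<rbrakk> \<Longrightarrow> Cod C (g \<bullet> f) = Cod C g"
  using comp_in_Hom[of f "Dom C f" "Cod C f" g "Cod C g"] by (auto simp: Hom_iff)

lemma dom_Ob [simp]: "f \<in> Arr C \<Longrightarrow> Dom C f \<in> Ob C"
  and cod_Ob [simp]: "f \<in> Arr C \<Longrightarrow> Cod C f \<in> Ob C"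
  by (auto intro: dom_in_Ob cod_in_Ob)

lemma arr_id [simp]: "x \<in> Ob C \<Longrightarrow> Id C x \<in> Arr C"
  and dom_id [simp]: "x \<in> Ob C \<Longrightarrow> Dom C (Id C x) = x"
  and cod_id [simp]: "x \<in> Ob C \<Longrightarrow> Cod C (Id C x) = x"
  using id_in_Hom[of x] by (auto simp: Hom_iff)

lemma id_comp' [simp]: "\<lbrakk>f \<in> Arr C; Cod C f = y\<rbrakk> \<Longrightarrow> Id C y \<bullet> f = f"
  and comp_id' [simp]: "\<lbrakk>f \<in> Arr C; Dom C f = x\<rbrakk> \<Longrightarrow> f \<bullet> Id C x = f"
  by (auto intro: id_comp comp_id simp: Hom_iff)

lemma comp_assoc' [simp]:
  "\<lbrakk>f \<in> Arr C; g \<in> Arr C; h \<in> Arr C; Dom C g = Cod C f; Dom C h = Cod C g\<rbrakk>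
    \<Longrightarrow> (h \<bullet> g) \<bullet> f = h \<bullet> g \<bullet> f"
  by (rule comp_assoc) (auto simp: Hom_iff)

lemma is_isoI:
  assumes "f \<in> Hom C x y" "g \<in> Hom C y x" "g \<bullet> f = Id C x" "f \<bullet> g = Id C y"
  shows "is_iso C f"
  using assms by (auto simp: is_iso_def Hom_iff intro!: bexI[of _ g])

text \<open>A two-sided inverse is unique, so exhibiting one evaluates the definite description in
  \<open>inv_arr\<close>.\<close>

lemma inv_arr_eqI:
  assumes "f \<in> Hom C x y" "g \<in> Hom C y x" "g \<bullet> f = Id C x" "f \<bullet> g = Id C y"
  shows "inv_arr C f = g"
  unfolding inv_arr_def
proof (rule the_equality)
  show "g \<in> Hom C (Cod C f) (Dom C f) \<and> g \<bullet> f = Id C (Dom C f) \<and> f \<bullet> g = Id C (Cod C f)"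
    using assms by (auto simp: Hom_iff)
next
  fix h assume h: "h \<in> Hom C (Cod C f) (Dom C f) \<and> h \<bullet> f = Id C (Dom C f) \<and> f \<bullet> h = Id C (Cod C f)"
  have "h = h \<bullet> f \<bullet> g" using assms h by (auto simp: Hom_iff)
  also have "\<dots> = (h \<bullet> f) \<bullet> g" using assms h by (subst comp_assoc') (auto simp: Hom_iff)
  also have "\<dots> = g" using assms h by (auto simp: Hom_iff)
  finally show "h = g" .
qed

lemma inv_arr:
  assumes "is_iso C f"
  shows "inv_arr C f \<in> Arr C" "Dom C (inv_arr C f) = Cod C f" "Cod C (inv_arr C f) = Dom C f"
    "inv_arr C f \<bullet> f = Id C (Dom C f)" "f \<bullet> inv_arr C f = Id C (Cod C f)"
proof -
  from assms obtain g where g: "g \<in> Hom C (Cod C f) (Dom C f)"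
      "g \<bullet> f = Id C (Dom C f)" "f \<bullet> g = Id C (Cod C f)" and f: "f \<in> Arr C"
    unfolding is_iso_def by blast
  have e: "inv_arr C f = g"
    by (rule inv_arr_eqI[of _ "Dom C f" "Cod C f"]) (use g f in \<open>auto simp: Hom_iff\<close>)
  from g show "inv_arr C f \<in> Arr C" "Dom C (inv_arr C f) = Cod C f" "Cod C (inv_arr C f) = Dom C f"
    "inv_arr C f \<bullet> f = Id C (Dom C f)" "f \<bullet> inv_arr C f = Id C (Cod C f)"
    unfolding e by (auto simp: Hom_iff)
qed

lemma is_iso_arr: "is_iso C f \<Longrightarrow> f \<in> Arr C"
  by (simp add: is_iso_def)

text \<open>Cancellation at the head of a composite nested to the right, the normal form that
  \<open>comp_assoc'\<close> produces.\<close>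

lemma inv_arr_comp_cancel:
  assumes "is_iso C f" "g \<in> Arr C"
  shows "Cod C g = Dom C f \<Longrightarrow> inv_arr C f \<bullet> f \<bullet> g = g"
    and "Cod C g = Cod C f \<Longrightarrow> f \<bullet> inv_arr C f \<bullet> g = g"
proof -
  note i = inv_arr[OF assms(1)] is_iso_arr[OF assms(1)]
  { assume "Cod C g = Dom C f"
    with i assms(2) show "inv_arr C f \<bullet> f \<bullet> g = g" by (subst comp_assoc'[symmetric]) auto }
  { assume "Cod C g = Cod C f"
    with i assms(2) show "f \<bullet> inv_arr C f \<bullet> g = g" by (subst comp_assoc'[symmetric]) auto }
qed

lemma is_iso_inv_arr:
  assumes "is_iso C f"
  shows "is_iso C (inv_arr C f)" and "inv_arr C (inv_arr C f) = f"
  using inv_arr[OF assms] is_iso_arr[OF assms]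
  by (auto intro!: is_isoI[of _ "Cod C f" "Dom C f" f] inv_arr_eqI[of _ "Cod C f" "Dom C f" f] simp: Hom_iff)

lemma is_iso_id: "x \<in> Ob C \<Longrightarrow> is_iso C (Id C x)"
  by (rule is_isoI[of _ x x "Id C x"]) (auto simp: Hom_iff)

lemma inv_arr_id: "x \<in> Ob C \<Longrightarrow> inv_arr C (Id C x) = Id C x"
  by (rule inv_arr_eqI[of _ x x]) (auto simp: Hom_iff)

lemma iso_cancel_left:
  assumes "is_iso C f" "g \<in> Arr C" "h \<in> Arr C" "Cod C g = Dom C f" "Cod C h = Dom C f" "f \<bullet> g = f \<bullet> h"
  shows "g = h"
  using inv_arr_comp_cancel(1)[OF assms(1,2)] inv_arr_comp_cancel(1)[OF assms(1,3)] assms by metis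

lemma iso_cancel_right:
  assumes "is_iso C f" "g \<in> Arr C" "h \<in> Arr C" "Dom C g = Cod C f" "Dom C h = Cod C f" "g \<bullet> f = h \<bullet> f"
  shows "g = h"
proof -
  note i = inv_arr[OF assms(1)] is_iso_arr[OF assms(1)]
  have "g = (g \<bullet> f) \<bullet> inv_arr C f" using i assms(2,4) by simp
  also have "\<dots> = (h \<bullet> f) \<bullet> inv_arr C f" by (simp only: assms(6))
  also have "\<dots> = h" using i assms(3,5) by simp
  finally show ?thesis .
qed

lemma is_iso_comp:
  assumes "is_iso C f" "is_iso C g" "Dom C g = Cod C f"
  shows "is_iso C (g \<bullet> f)" and "inv_arr C (g \<bullet> f) = inv_arr C f \<bullet> inv_arr C g"
proof -
  note i = inv_arr[OF assms(1)] inv_arr[OF assms(2)] is_iso_arr[OF assms(1)] is_iso_arr[OF assms(2)]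
  have 1: "(inv_arr C f \<bullet> inv_arr C g) \<bullet> g \<bullet> f = Id C (Dom C f)"
    using i assms(3) by (simp add: inv_arr_comp_cancel[OF assms(2)])
  have 2: "(g \<bullet> f) \<bullet> (inv_arr C f \<bullet> inv_arr C g) = Id C (Cod C g)"
    using i assms(3) by (simp add: inv_arr_comp_cancel[OF assms(1)])
  show "is_iso C (g \<bullet> f)"
    by (rule is_isoI[OF _ _ 1 2]) (use i assms(3) in \<open>auto simp: Hom_iff\<close>)
  show "inv_arr C (g \<bullet> f) = inv_arr C f \<bullet> inv_arr C g"
    by (rule inv_arr_eqI[OF _ _ 1 2]) (use i assms(3) in \<open>auto simp: Hom_iff\<close>)
qed

end

lemma is_functorD:
  assumes "is_functor C D F"
  shows "x \<in> Ob C \<Longrightarrow> omap F x \<in> Ob D"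
    and "\<lbrakk>category C; f \<in> Arr C\<rbrakk> \<Longrightarrow> amap F f \<in> Arr D"
    and "\<lbrakk>category C; f \<in> Arr C\<rbrakk> \<Longrightarrow> Dom D (amap F f) = omap F (Dom C f)"
    and "\<lbrakk>category C; f \<in> Arr C\<rbrakk> \<Longrightarrow> Cod D (amap F f) = omap F (Cod C f)"
    and "x \<in> Ob C \<Longrightarrow> amap F (Id C x) = Id D (omap F x)"
    and "\<lbrakk>category C; f \<in> Arr C; g \<in> Arr C; Dom C g = Cod C f\<rbrakk>
      \<Longrightarrow> amap F (g \<bullet>\<^bsub>C\<^esub> f) = amap F g \<bullet>\<^bsub>D\<^esub> amap F f"
proof -
  note F = assms[unfolded is_functor_def]
  show "x \<in> Ob C \<Longrightarrow> omap F x \<in> Ob D" "x \<in> Ob C \<Longrightarrow> amap F (Id C x) = Id D (omap F x)"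
    using F by blast+
  { assume C: "category C" and f: "f \<in> Arr C"
    interpret category C by fact
    have "amap F f \<in> Hom D (omap F (Dom C f)) (omap F (Cod C f))"
      using F f by (meson Hom_iff dom_Ob cod_Ob)
    then show "amap F f \<in> Arr D" "Dom D (amap F f) = omap F (Dom C f)"
      "Cod D (amap F f) = omap F (Cod C f)"
      by (simp_all add: Hom_iff)
    assume g: "g \<in> Arr C" "Dom C g = Cod C f"
    have "f \<in> Hom C (Dom C f) (Cod C f)" "g \<in> Hom C (Cod C f) (Cod C g)"
      using f g by (simp_all add: Hom_iff)
    then show "amap F (g \<bullet>\<^bsub>C\<^esub> f) = amap F g \<bullet>\<^bsub>D\<^esub> amap F f"
      using F f g dom_Ob cod_Ob by blast }
qed

section \<open>Finitely generated and noetherian vector spaces\<close>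

text \<open>Negatives are multiples by the scalar -1, so the subgroup condition never has to be
  checked separately.\<close>

lemma submodule_iff:
  assumes "module K V"
  shows "submodule U K V \<longleftrightarrow> U \<subseteq> carrier V \<and> \<zero>\<^bsub>V\<^esub> \<in> U \<and> (\<forall>u\<in>U. \<forall>v\<in>U. u \<oplus>\<^bsub>V\<^esub> v \<in> U)
    \<and> (\<forall>c\<in>carrier K. \<forall>u\<in>U. c \<odot>\<^bsub>V\<^esub> u \<in> U)"
proof -
  interpret V: module K V by fact
  show ?thesis
  proof
    assume s: "submodule U K V"
    show "U \<subseteq> carrier V \<and> \<zero>\<^bsub>V\<^esub> \<in> U \<and> (\<forall>u\<in>U. \<forall>v\<in>U. u \<oplus>\<^bsub>V\<^esub> v \<in> U) \<and> (\<forall>c\<in>carrier K. \<forall>u\<in>U. c \<odot>\<^bsub>V\<^esub> u \<in> U)"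
      using V.submoduleE[OF s] subgroup.one_closed[OF submodule.axioms(1)[OF s]] by auto
  next
    assume a: "U \<subseteq> carrier V \<and> \<zero>\<^bsub>V\<^esub> \<in> U \<and> (\<forall>u\<in>U. \<forall>v\<in>U. u \<oplus>\<^bsub>V\<^esub> v \<in> U) \<and> (\<forall>c\<in>carrier K. \<forall>u\<in>U. c \<odot>\<^bsub>V\<^esub> u \<in> U)"
    show "submodule U K V"
    proof (rule V.submoduleI)
      fix u assume u: "u \<in> U"
      then have "(\<ominus>\<^bsub>K\<^esub> \<one>\<^bsub>K\<^esub>) \<odot>\<^bsub>V\<^esub> u = \<ominus>\<^bsub>V\<^esub> u" using a by (subst V.smult_l_minus) auto
      then show "\<ominus>\<^bsub>V\<^esub> u \<in> U" using a u by (metis V.R.a_inv_closed V.R.one_closed)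
    qed (use a in auto)
  qed
qed

text \<open>The span of S is replaced by a quantifier over all subspaces containing S, so that no
  linear combinations have to be handled.\<close>

definition fin_gen :: "('k, 'y) ring_scheme \<Rightarrow> ('k, 'v, 'z) module_scheme \<Rightarrow> 'v set \<Rightarrow> bool" where
  "fin_gen K V N \<longleftrightarrow> (\<exists>S. finite S \<and> S \<subseteq> N \<and> (\<forall>U. submodule U K V \<and> S \<subseteq> U \<longrightarrow> N \<subseteq> U))"

definition noetherian_space :: "('k, 'y) ring_scheme \<Rightarrow> ('k, 'v, 'z) module_scheme \<Rightarrow> bool" where
  "noetherian_space K V \<longleftrightarrow> module K V \<and> (\<forall>N. submodule N K V \<longrightarrow> fin_gen K V N)"

lemma submodule_self: "module K V \<Longrightarrow> submodule (carrier V) K V"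
  by (subst submodule_iff) (auto simp: module_def module_axioms_def abelian_group_def
      abelian_monoid.a_closed abelian_monoid.zero_closed)

lemma submodule_Int: "\<lbrakk>module K V; submodule U K V; submodule W K V\<rbrakk> \<Longrightarrow> submodule (U \<inter> W) K V"
  by (simp add: submodule_iff) blast

text \<open>The sum of U and the line through s: an upper bound for the span of
  \<open>insert s S\<close>, needed in the induction over generators.\<close>

lemma submodule_insert_span:
  assumes "module K V" "submodule U K V" "s \<in> carrier V"
  shows "submodule {u \<oplus>\<^bsub>V\<^esub> c \<odot>\<^bsub>V\<^esub> s |u c. u \<in> U \<and> c \<in> carrier K} K V"
proof -
  interpret V: module K V by fact
  note U = assms(2)[unfolded submodule_iff[OF assms(1)]]
  show ?thesis unfolding submodule_iff[OF assms(1)]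
  proof (intro conjI subsetI ballI)
    fix w assume "w \<in> {u \<oplus>\<^bsub>V\<^esub> c \<odot>\<^bsub>V\<^esub> s |u c. u \<in> U \<and> c \<in> carrier K}"
    then show "w \<in> carrier V" using U assms(3) by auto
  next
    show "\<zero>\<^bsub>V\<^esub> \<in> {u \<oplus>\<^bsub>V\<^esub> c \<odot>\<^bsub>V\<^esub> s |u c. u \<in> U \<and> c \<in> carrier K}"
      using U assms(3) by (auto intro!: exI[of _ "\<zero>\<^bsub>V\<^esub>"] exI[of _ "\<zero>\<^bsub>K\<^esub>"])
  next
    fix v w assume v: "v \<in> {u \<oplus>\<^bsub>V\<^esub> c \<odot>\<^bsub>V\<^esub> s |u c. u \<in> U \<and> c \<in> carrier K}"
      and w: "w \<in> {u \<oplus>\<^bsub>V\<^esub> c \<odot>\<^bsub>V\<^esub> s |u c. u \<in> U \<and> c \<in> carrier K}"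
    obtain a c where v: "v = a \<oplus>\<^bsub>V\<^esub> c \<odot>\<^bsub>V\<^esub> s" "a \<in> U" "c \<in> carrier K" using v by auto
    obtain b d where w: "w = b \<oplus>\<^bsub>V\<^esub> d \<odot>\<^bsub>V\<^esub> s" "b \<in> U" "d \<in> carrier K" using w by auto
    have "v \<oplus>\<^bsub>V\<^esub> w = (a \<oplus>\<^bsub>V\<^esub> b) \<oplus>\<^bsub>V\<^esub> (c \<oplus>\<^bsub>K\<^esub> d) \<odot>\<^bsub>V\<^esub> s"
      using v w U assms(3) by (simp add: V.smult_l_distr V.a_ac subset_iff)
    then show "v \<oplus>\<^bsub>V\<^esub> w \<in> {u \<oplus>\<^bsub>V\<^esub> c \<odot>\<^bsub>V\<^esub> s |u c. u \<in> U \<and> c \<in> carrier K}"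
      using v w U by blast
  next
    fix d w assume d: "d \<in> carrier K" and w: "w \<in> {u \<oplus>\<^bsub>V\<^esub> c \<odot>\<^bsub>V\<^esub> s |u c. u \<in> U \<and> c \<in> carrier K}"
    obtain a c where w: "w = a \<oplus>\<^bsub>V\<^esub> c \<odot>\<^bsub>V\<^esub> s" "a \<in> U" "c \<in> carrier K" using w by auto
    have "d \<odot>\<^bsub>V\<^esub> w = d \<odot>\<^bsub>V\<^esub> a \<oplus>\<^bsub>V\<^esub> (d \<otimes>\<^bsub>K\<^esub> c) \<odot>\<^bsub>V\<^esub> s"
      using w U assms(3) d by (simp add: V.smult_r_distr V.smult_assoc1 subset_iff)
    then show "d \<odot>\<^bsub>V\<^esub> w \<in> {u \<oplus>\<^bsub>V\<^esub> c \<odot>\<^bsub>V\<^esub> s |u c. u \<in> U \<and> c \<in> carrier K}"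
      using w U d by blast
  qed
qed

text \<open>Induction on the generating set, in place of dimension theory. The last hypothesis says
  that N lies in the span of S. When a generator s is added to S, let W be the span of the old S: N
  \<inter> W is finitely generated by induction, and modulo W the space N is at most
  one-dimensional, so one further vector of N suffices.\<close>

lemma fin_gen_submodule:
  assumes K: "field K" and V: "module K V"
    and fin: "finite S" "S \<subseteq> carrier V"
    and N: "submodule N K V" "\<forall>U. submodule U K V \<and> S \<subseteq> U \<longrightarrow> N \<subseteq> U"
  shows "fin_gen K V N"
  using fin N
proof (induction S arbitrary: N rule: finite_induct)
  case empty
  then show ?case unfolding fin_gen_def by (intro exI[of _ "{}"]) auto
next
  case (insert s S)
  interpret K: field K by fact
  interpret V: module K V by fact
  define W where "W = \<Inter>{U. submodule U K V \<and> S \<subseteq> U}"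
  have W: "submodule W K V"
  proof -
    have c: "carrier V \<in> {U. submodule U K V \<and> S \<subseteq> U}"
      using submodule_self[OF V] insert.prems(1) by simp
    have i: "U \<subseteq> carrier V" "\<zero>\<^bsub>V\<^esub> \<in> U" "\<And>u v. u \<in> U \<Longrightarrow> v \<in> U \<Longrightarrow> u \<oplus>\<^bsub>V\<^esub> v \<in> U"
      "\<And>c u. c \<in> carrier K \<Longrightarrow> u \<in> U \<Longrightarrow> c \<odot>\<^bsub>V\<^esub> u \<in> U" if "submodule U K V" for U
      using that unfolding submodule_iff[OF V] by auto
    show ?thesis unfolding submodule_iff[OF V]
    proof (intro conjI ballI)
      show "W \<subseteq> carrier V" using c unfolding W_def by (rule Inter_lower)
      show "\<zero>\<^bsub>V\<^esub> \<in> W" using i(2) unfolding W_def by simp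
      show "u \<oplus>\<^bsub>V\<^esub> v \<in> W" if "u \<in> W" "v \<in> W" for u v
        using that i(3) unfolding W_def by simp
      show "c \<odot>\<^bsub>V\<^esub> u \<in> W" if "c \<in> carrier K" "u \<in> W" for c u
        using that i(4) unfolding W_def by simp
    qed
  qed
  have WS: "S \<subseteq> W" unfolding W_def by blast
  note Wd = W[unfolded submodule_iff[OF V]] and Nd = insert.prems(2)[unfolded submodule_iff[OF V]]
  have s: "s \<in> carrier V" using insert.prems by auto
  show ?case
  proof (cases "N \<subseteq> W")
    case True
    then show ?thesis using insert.IH[of N] insert.prems unfolding W_def by blast
  next
    case False
    then obtain n where n: "n \<in> N" "n \<notin> W" by blast
    have span: "\<exists>u c. v = u \<oplus>\<^bsub>V\<^esub> c \<odot>\<^bsub>V\<^esub> s \<and> u \<in> W \<and> c \<in> carrier K" if "v \<in> N" for v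
    proof -
      have "insert s S \<subseteq> {u \<oplus>\<^bsub>V\<^esub> c \<odot>\<^bsub>V\<^esub> s |u c. u \<in> W \<and> c \<in> carrier K}"
      proof (rule insert_subsetI)
        show "s \<in> {u \<oplus>\<^bsub>V\<^esub> c \<odot>\<^bsub>V\<^esub> s |u c. u \<in> W \<and> c \<in> carrier K}"
          using Wd s by (auto intro!: exI[of _ "\<zero>\<^bsub>V\<^esub>"] exI[of _ "\<one>\<^bsub>K\<^esub>"])
        show "S \<subseteq> {u \<oplus>\<^bsub>V\<^esub> c \<odot>\<^bsub>V\<^esub> s |u c. u \<in> W \<and> c \<in> carrier K}"
        proof
          fix t assume "t \<in> S"
          then show "t \<in> {u \<oplus>\<^bsub>V\<^esub> c \<odot>\<^bsub>V\<^esub> s |u c. u \<in> W \<and> c \<in> carrier K}"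
            using WS Wd s by (auto intro!: exI[of _ t] exI[of _ "\<zero>\<^bsub>K\<^esub>"] simp: subset_iff)
        qed
      qed
      then have "N \<subseteq> {u \<oplus>\<^bsub>V\<^esub> c \<odot>\<^bsub>V\<^esub> s |u c. u \<in> W \<and> c \<in> carrier K}"
        using insert.prems(3) submodule_insert_span[OF V W s] by blast
      then show ?thesis using that by blast
    qed
    obtain u c where uc: "n = u \<oplus>\<^bsub>V\<^esub> c \<odot>\<^bsub>V\<^esub> s" "u \<in> W" "c \<in> carrier K" using span n by blast
    \<comment> \<open>Otherwise n would lie in W. As K is a field, n can now be used to cancel the
      s-component of every vector of N.\<close>
    have c: "c \<noteq> \<zero>\<^bsub>K\<^esub>" using uc n Wd s by auto
    then have cu: "inv\<^bsub>K\<^esub> c \<in> carrier K" "inv\<^bsub>K\<^esub> c \<otimes>\<^bsub>K\<^esub> c = \<one>\<^bsub>K\<^esub>"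
      using uc K.field_Units by auto
    have "fin_gen K V (N \<inter> W)"
      by (rule insert.IH) (use insert.prems submodule_Int[OF V] W in \<open>auto simp: W_def\<close>)
    then obtain T where T: "finite T" "T \<subseteq> N \<inter> W" "\<forall>U. submodule U K V \<and> T \<subseteq> U \<longrightarrow> N \<inter> W \<subseteq> U"
      unfolding fin_gen_def by blast
    have "N \<subseteq> U" if U: "submodule U K V" "insert n T \<subseteq> U" for U
    proof
      note Ud = U(1)[unfolded submodule_iff[OF V]]
      fix v assume v: "v \<in> N"
      obtain u' c' where v': "v = u' \<oplus>\<^bsub>V\<^esub> c' \<odot>\<^bsub>V\<^esub> s" "u' \<in> W" "c' \<in> carrier K" using span v by blast
      \<comment> \<open>The scalar for which d n has the same s-component as v; then v - d n lies in
        N \<inter> W.\<close>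
      define d where "d = c' \<otimes>\<^bsub>K\<^esub> inv\<^bsub>K\<^esub> c"
      have d: "d \<in> carrier K" "d \<otimes>\<^bsub>K\<^esub> c = c'" using cu v' uc by (auto simp: d_def K.m_assoc)
      have "d \<odot>\<^bsub>V\<^esub> n = d \<odot>\<^bsub>V\<^esub> u \<oplus>\<^bsub>V\<^esub> c' \<odot>\<^bsub>V\<^esub> s"
        using d uc s Wd by (simp add: V.smult_r_distr V.smult_assoc1[symmetric] subset_iff)
      then have "(\<ominus>\<^bsub>K\<^esub> d) \<odot>\<^bsub>V\<^esub> n = (\<ominus>\<^bsub>K\<^esub> d) \<odot>\<^bsub>V\<^esub> u \<oplus>\<^bsub>V\<^esub> \<ominus>\<^bsub>V\<^esub> (c' \<odot>\<^bsub>V\<^esub> s)"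
        using d uc s Wd v' by (simp add: V.smult_l_minus V.minus_add subset_iff)
      moreover have "(p \<oplus>\<^bsub>V\<^esub> x) \<oplus>\<^bsub>V\<^esub> (y \<oplus>\<^bsub>V\<^esub> \<ominus>\<^bsub>V\<^esub> x) = p \<oplus>\<^bsub>V\<^esub> y"
        if "p \<in> carrier V" "x \<in> carrier V" "y \<in> carrier V" for p x y
        using that by (simp add: V.a_assoc V.a_comm[of y] V.r_neg2)
      ultimately have "v \<oplus>\<^bsub>V\<^esub> (\<ominus>\<^bsub>K\<^esub> d) \<odot>\<^bsub>V\<^esub> n = u' \<oplus>\<^bsub>V\<^esub> (\<ominus>\<^bsub>K\<^esub> d) \<odot>\<^bsub>V\<^esub> u"
        using d uc s Wd v' by (simp add: subset_iff)
      moreover have "u' \<oplus>\<^bsub>V\<^esub> (\<ominus>\<^bsub>K\<^esub> d) \<odot>\<^bsub>V\<^esub> u \<in> W" using v' uc d Wd by auto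
      moreover have "v \<oplus>\<^bsub>V\<^esub> (\<ominus>\<^bsub>K\<^esub> d) \<odot>\<^bsub>V\<^esub> n \<in> N" using v n d Nd by auto
      ultimately have "v \<oplus>\<^bsub>V\<^esub> (\<ominus>\<^bsub>K\<^esub> d) \<odot>\<^bsub>V\<^esub> n \<in> U" using T(3) U by auto
      then have "(v \<oplus>\<^bsub>V\<^esub> (\<ominus>\<^bsub>K\<^esub> d) \<odot>\<^bsub>V\<^esub> n) \<oplus>\<^bsub>V\<^esub> d \<odot>\<^bsub>V\<^esub> n \<in> U" using d U Ud by auto
      moreover have "(v \<oplus>\<^bsub>V\<^esub> (\<ominus>\<^bsub>K\<^esub> d) \<odot>\<^bsub>V\<^esub> n) \<oplus>\<^bsub>V\<^esub> d \<odot>\<^bsub>V\<^esub> n = v"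
        using d v n Nd by (simp add: V.smult_l_minus V.a_assoc V.l_neg subset_iff)
      ultimately show "v \<in> U" by simp
    qed
    then show ?thesis unfolding fin_gen_def using T n by (intro exI[of _ "insert n T"]) auto
  qed
qed

lemma finite_dimensional_noetherian:
  assumes "field K" "finite_dimensional K V"
  shows "noetherian_space K V"
proof -
  from assms(2) obtain S where S: "module K V" "finite S" "S \<subseteq> carrier V"
      "\<forall>U. submodule U K V \<and> S \<subseteq> U \<longrightarrow> U = carrier V"
    unfolding finite_dimensional_def by blast
  then have "fin_gen K V N" if N: "submodule N K V" for N
    using fin_gen_submodule[OF assms(1) S(1-3) N] N[unfolded submodule_iff[OF S(1)]] by blast
  then show ?thesis using S(1) by (simp add: noetherian_space_def)
qed

section \<open>Linear categories and their opposites\<close>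

lemma is_epiD:
  "\<lbrakk>is_epi C e; z \<in> Ob C; g \<in> Hom C (Cod C e) z; h \<in> Hom C (Cod C e) z; g \<bullet>\<^bsub>C\<^esub> e = h \<bullet>\<^bsub>C\<^esub> e\<rbrakk> \<Longrightarrow> g = h"
  unfolding is_epi_def by blast

lemma hom_space_simps [simp]:
  "carrier (hom_space C x y) = Hom C x y" "\<zero>\<^bsub>hom_space C x y\<^esub> = HZero C x y"
  "(\<oplus>\<^bsub>hom_space C x y\<^esub>) = HAdd C" "(\<odot>\<^bsub>hom_space C x y\<^esub>) = HSmult C"
  by (simp_all add: hom_space_def)

lemma linear_map_zero:
  assumes "module K V" "module K W" "linear_map K V W f"
  shows "f \<zero>\<^bsub>V\<^esub> = \<zero>\<^bsub>W\<^esub>"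
proof -
  interpret V: module K V by fact
  interpret W: module K W by fact
  have "f (\<zero>\<^bsub>K\<^esub> \<odot>\<^bsub>V\<^esub> \<zero>\<^bsub>V\<^esub>) = \<zero>\<^bsub>K\<^esub> \<odot>\<^bsub>W\<^esub> f \<zero>\<^bsub>V\<^esub>"
    using assms(3) unfolding linear_map_def by blast
  moreover have "f \<zero>\<^bsub>V\<^esub> \<in> carrier W" using assms(3) unfolding linear_map_def by blast
  ultimately show ?thesis by simp
qed

context linear_category
begin

lemma zero_arr [simp]:
  "\<lbrakk>x \<in> Ob C; y \<in> Ob C\<rbrakk> \<Longrightarrow> HZero C x y \<in> Arr C"
  "\<lbrakk>x \<in> Ob C; y \<in> Ob C\<rbrakk> \<Longrightarrow> Dom C (HZero C x y) = x"
  "\<lbrakk>x \<in> Ob C; y \<in> Ob C\<rbrakk> \<Longrightarrow> Cod C (HZero C x y) = y"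
proof -
  assume "x \<in> Ob C" "y \<in> Ob C"
  then interpret V: module K "hom_space C x y" by (rule hom_space_module)
  show "HZero C x y \<in> Arr C" "Dom C (HZero C x y) = x" "Cod C (HZero C x y) = y"
    using V.zero_closed by (simp_all add: Hom_iff)
qed

lemma add_arr [simp]:
  assumes "f \<in> Arr C" "g \<in> Arr C" "Dom C f = Dom C g" "Cod C f = Cod C g"
  shows "HAdd C f g \<in> Arr C" "Dom C (HAdd C f g) = Dom C g" "Cod C (HAdd C f g) = Cod C g"
proof -
  interpret V: module K "hom_space C (Dom C f) (Cod C f)" using assms by (intro hom_space_module) auto
  show "HAdd C f g \<in> Arr C" "Dom C (HAdd C f g) = Dom C g" "Cod C (HAdd C f g) = Cod C g"
    using V.a_closed[of f g] assms by (simp_all add: Hom_iff)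
qed

lemma smult_arr [simp]:
  assumes "f \<in> Arr C" "c \<in> carrier K"
  shows "HSmult C c f \<in> Arr C" "Dom C (HSmult C c f) = Dom C f" "Cod C (HSmult C c f) = Cod C f"
proof -
  interpret V: module K "hom_space C (Dom C f) (Cod C f)" using assms by (intro hom_space_module) auto
  show "HSmult C c f \<in> Arr C" "Dom C (HSmult C c f) = Dom C f" "Cod C (HSmult C c f) = Cod C f"
    using V.smult_closed[of c f] assms by (simp_all add: Hom_iff)
qed

lemma add_zero [simp]:
  assumes "f \<in> Arr C" "Dom C f = x" "Cod C f = y"
  shows "HAdd C (HZero C x y) f = f" "HAdd C f (HZero C x y) = f"
proof -
  interpret V: module K "hom_space C x y" using assms by (intro hom_space_module) auto
  show "HAdd C (HZero C x y) f = f" "HAdd C f (HZero C x y) = f"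
    using V.l_zero[of f] V.r_zero[of f] assms by (simp_all add: Hom_iff)
qed

lemma comp_add_left:
  assumes "f \<in> Arr C" "g \<in> Arr C" "h \<in> Arr C" "Dom C g = Cod C f" "Dom C h = Cod C f" "Cod C g = Cod C h"
  shows "HAdd C g h \<bullet> f = HAdd C (g \<bullet> f) (h \<bullet> f)"
  using comp_linear_left[of "Dom C f" "Cod C f" "Cod C g" f] assms
  unfolding linear_map_def by (simp add: Hom_iff)

lemma comp_add_right:
  assumes "f \<in> Arr C" "g \<in> Arr C" "h \<in> Arr C" "Cod C g = Dom C f" "Cod C h = Dom C f" "Dom C g = Dom C h"
  shows "f \<bullet> HAdd C g h = HAdd C (f \<bullet> g) (f \<bullet> h)"
  using comp_linear_right[of "Dom C g" "Dom C f" "Cod C f" f] assms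
  unfolding linear_map_def by (simp add: Hom_iff)

lemma comp_smult_left:
  assumes "f \<in> Arr C" "g \<in> Arr C" "Dom C g = Cod C f" "c \<in> carrier K"
  shows "HSmult C c g \<bullet> f = HSmult C c (g \<bullet> f)"
  using comp_linear_left[of "Dom C f" "Cod C f" "Cod C g" f] assms
  unfolding linear_map_def by (simp add: Hom_iff)

lemma comp_smult_right:
  assumes "f \<in> Arr C" "g \<in> Arr C" "Cod C g = Dom C f" "c \<in> carrier K"
  shows "f \<bullet> HSmult C c g = HSmult C c (f \<bullet> g)"
  using comp_linear_right[of "Dom C g" "Dom C f" "Cod C f" f] assms
  unfolding linear_map_def by (simp add: Hom_iff)

lemma zero_comp [simp]:
  assumes "f \<in> Arr C" "Cod C f = y" "z \<in> Ob C"
  shows "HZero C y z \<bullet> f = HZero C (Dom C f) z"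
  using linear_map_zero[OF hom_space_module hom_space_module comp_linear_left[of "Dom C f" y z f]] assms
  by (auto simp: Hom_iff)

lemma comp_zero [simp]:
  assumes "f \<in> Arr C" "Dom C f = y" "x \<in> Ob C"
  shows "f \<bullet> HZero C x y = HZero C x (Cod C f)"
  using linear_map_zero[OF hom_space_module hom_space_module comp_linear_right[of x y "Cod C f" f]] assms
  by (auto simp: Hom_iff)

text \<open>Difference of parallel arrows. Being written with \<open>HAdd\<close> and
  \<open>HSmult\<close> alone, it mentions no Hom-space, so source and target need not be carried
  along.\<close>

definition hsub :: "'m \<Rightarrow> 'm \<Rightarrow> 'm" where
  "hsub f g = HAdd C f (HSmult C (\<ominus>\<^bsub>K\<^esub> \<one>\<^bsub>K\<^esub>) g)"

lemma hsub_arr [simp]: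
  assumes "f \<in> Arr C" "g \<in> Arr C" "Dom C f = Dom C g" "Cod C f = Cod C g"
  shows "hsub f g \<in> Arr C" "Dom C (hsub f g) = Dom C g" "Cod C (hsub f g) = Cod C g"
  using assms by (simp_all add: hsub_def)

lemma comp_hsub_left:
  assumes "f \<in> Arr C" "g \<in> Arr C" "h \<in> Arr C" "Dom C g = Cod C f" "Dom C h = Cod C f" "Cod C g = Cod C h"
  shows "hsub g h \<bullet> f = hsub (g \<bullet> f) (h \<bullet> f)"
  using assms by (simp add: hsub_def comp_add_left comp_smult_left)

lemma comp_hsub_right:
  assumes "f \<in> Arr C" "g \<in> Arr C" "h \<in> Arr C" "Cod C g = Dom C f" "Cod C h = Dom C f" "Dom C g = Dom C h"
  shows "f \<bullet> hsub g h = hsub (f \<bullet> g) (f \<bullet> h)"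
  using assms by (simp add: hsub_def comp_add_right comp_smult_right)

lemma hsub_facts:
  assumes "f \<in> Arr C" "g \<in> Arr C" "Dom C f = Dom C g" "Cod C f = Cod C g"
  shows "hsub f f = HZero C (Dom C f) (Cod C f)"
    and "hsub f g = HZero C (Dom C f) (Cod C f) \<longleftrightarrow> f = g"
    and "HAdd C (hsub f g) g = f"
proof -
  interpret V: module K "hom_space C (Dom C f) (Cod C f)" using assms by (intro hom_space_module) auto
  have m: "hsub h k = h \<ominus>\<^bsub>hom_space C (Dom C f) (Cod C f)\<^esub> k"
    if "h \<in> Hom C (Dom C f) (Cod C f)" "k \<in> Hom C (Dom C f) (Cod C f)" for h k
    using that V.smult_l_minus[of "\<one>\<^bsub>K\<^esub>" k] V.smult_one[of k] by (simp add: V.minus_eq hsub_def)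
  have fg: "f \<in> Hom C (Dom C f) (Cod C f)" "g \<in> Hom C (Dom C f) (Cod C f)"
    using assms by (auto simp: Hom_iff)
  show "hsub f f = HZero C (Dom C f) (Cod C f)"
    using V.r_neg[of f] fg by (simp add: m V.minus_eq)
  have "HAdd C (hsub f g) g = (f \<ominus>\<^bsub>hom_space C (Dom C f) (Cod C f)\<^esub> g) \<oplus>\<^bsub>hom_space C (Dom C f) (Cod C f)\<^esub> g"
    using fg by (simp add: m)
  also have "\<dots> = f" using fg V.add.inv_solve_right[of "f \<ominus>\<^bsub>hom_space C (Dom C f) (Cod C f)\<^esub> g" f g]
    V.minus_closed[of f g] unfolding V.minus_eq by simp
  finally show 1: "HAdd C (hsub f g) g = f" .
  show "hsub f g = HZero C (Dom C f) (Cod C f) \<longleftrightarrow> f = g"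
    using 1 assms \<open>hsub f f = _\<close> by (metis add_zero(1))
qed

text \<open>Composition is bilinear, so two arrows agree after e exactly when e kills their
  difference.\<close>

lemma is_epi_iff:
  "is_epi C e \<longleftrightarrow> e \<in> Arr C \<and> (\<forall>g \<in> Arr C. Dom C g = Cod C e \<longrightarrow>
     g \<bullet> e = HZero C (Dom C e) (Cod C g) \<longrightarrow> g = HZero C (Cod C e) (Cod C g))"
proof (intro iffI conjI ballI impI)
  assume e: "is_epi C e"
  then show "e \<in> Arr C" by (simp add: is_epi_def)
  fix g assume g: "g \<in> Arr C" "Dom C g = Cod C e" "g \<bullet> e = HZero C (Dom C e) (Cod C g)"
  have "g \<bullet> e = HZero C (Cod C e) (Cod C g) \<bullet> e" using g \<open>e \<in> Arr C\<close> by simp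
  then show "g = HZero C (Cod C e) (Cod C g)"
    by (intro is_epiD[OF e, of "Cod C g" g "HZero C (Cod C e) (Cod C g)"]) (use g \<open>e \<in> Arr C\<close> in \<open>auto simp: Hom_iff\<close>)
next
  assume a: "e \<in> Arr C \<and> (\<forall>g \<in> Arr C. Dom C g = Cod C e \<longrightarrow>
     g \<bullet> e = HZero C (Dom C e) (Cod C g) \<longrightarrow> g = HZero C (Cod C e) (Cod C g))"
  show "is_epi C e" unfolding is_epi_def
  proof (intro conjI ballI impI)
    fix z g h assume gh: "z \<in> Ob C" "g \<in> Hom C (Cod C e) z" "h \<in> Hom C (Cod C e) z" "g \<bullet> e = h \<bullet> e"
    have "hsub g h \<bullet> e = hsub (h \<bullet> e) (h \<bullet> e)" using gh a by (subst comp_hsub_left) (auto simp: Hom_iff)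
    also have "\<dots> = HZero C (Dom C e) z" using gh a hsub_facts(1)[of "h \<bullet> e" "h \<bullet> e"] by (auto simp: Hom_iff)
    finally have "hsub g h = HZero C (Cod C e) z"
      using a[THEN conjunct2, THEN bspec, of "hsub g h"] gh by (auto simp: Hom_iff)
    then show "g = h" using hsub_facts(2)[of g h] gh by (auto simp: Hom_iff)
  qed (use a in auto)
qed

text \<open>The uniqueness half of the universal property is traded for \<open>is_epi C q\<close>,
  and the existence half no longer mentions the target object separately.
  \<open>is_cokernelI\<close> goes the other way.\<close>

lemma is_cokernelD:
  assumes "is_cokernel C f q"
  shows "f \<in> Arr C" "q \<in> Arr C" "Dom C q = Cod C f" "q \<bullet> f = HZero C (Dom C f) (Cod C q)" "is_epi C q"
    and "\<lbrakk>h \<in> Arr C; Dom C h = Cod C f; h \<bullet> f = HZero C (Dom C f) (Cod C h)\<rbrakk>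
      \<Longrightarrow> \<exists>u. u \<in> Hom C (Cod C q) (Cod C h) \<and> u \<bullet> q = h"
proof -
  show 1: "f \<in> Arr C" "q \<in> Arr C" "Dom C q = Cod C f" "q \<bullet> f = HZero C (Dom C f) (Cod C q)"
    using assms by (simp_all add: is_cokernel_def)
  have 2: "\<exists>!u. u \<in> Hom C (Cod C q) z \<and> u \<bullet> q = h"
    if "z \<in> Ob C" "h \<in> Hom C (Cod C f) z" "h \<bullet> f = HZero C (Dom C f) z" for z h
    using assms that by (simp add: is_cokernel_def)
  show "\<lbrakk>h \<in> Arr C; Dom C h = Cod C f; h \<bullet> f = HZero C (Dom C f) (Cod C h)\<rbrakk>
      \<Longrightarrow> \<exists>u. u \<in> Hom C (Cod C q) (Cod C h) \<and> u \<bullet> q = h"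
    using 2[of "Cod C h" h] by (auto simp: Hom_iff)
  show "is_epi C q" unfolding is_epi_def
  proof (intro conjI ballI impI)
    fix z g h assume gh: "z \<in> Ob C" "g \<in> Hom C (Cod C q) z" "h \<in> Hom C (Cod C q) z" "g \<bullet> q = h \<bullet> q"
    have "(h \<bullet> q) \<bullet> f = HZero C (Dom C f) z" using 1 gh by (auto simp: Hom_iff)
    then have "\<exists>!u. u \<in> Hom C (Cod C q) z \<and> u \<bullet> q = h \<bullet> q"
      using 2[of z "h \<bullet> q"] 1 gh by (auto simp: Hom_iff)
    then show "g = h" using gh by auto
  qed (use 1 in auto)
qed

lemma is_cokernelI:
  assumes "f \<in> Arr C" "Dom C q = Cod C f" "q \<bullet> f = HZero C (Dom C f) (Cod C q)" "is_epi C q"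
    and "\<And>h. \<lbrakk>h \<in> Arr C; Dom C h = Cod C f; h \<bullet> f = HZero C (Dom C f) (Cod C h)\<rbrakk>
      \<Longrightarrow> \<exists>u. u \<in> Hom C (Cod C q) (Cod C h) \<and> u \<bullet> q = h"
  shows "is_cokernel C f q"
  unfolding is_cokernel_def
proof (intro conjI ballI impI)
  show "f \<in> Arr C" "q \<in> Arr C" "Dom C q = Cod C f" "q \<bullet> f = HZero C (Dom C f) (Cod C q)"
    using assms by (auto simp: is_epi_def)
  fix z h assume h: "z \<in> Ob C" "h \<in> Hom C (Cod C f) z" "h \<bullet> f = HZero C (Dom C f) z"
  then obtain u where u: "u \<in> Hom C (Cod C q) z" "u \<bullet> q = h" using assms(5)[of h] by (auto simp: Hom_iff)
  show "\<exists>!u. u \<in> Hom C (Cod C q) z \<and> u \<bullet> q = h"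
    using u assms(4) h(1) unfolding is_epi_def by (intro ex1I[of _ u]) auto
qed

end

section \<open>Opposite categories and duality\<close>

lemma op_cat_simps [simp]:
  "Ob (op_cat C) = Ob C" "Arr (op_cat C) = Arr C" "Dom (op_cat C) = Cod C" "Cod (op_cat C) = Dom C"
  "Id (op_cat C) = Id C" "g \<bullet>\<^bsub>op_cat C\<^esub> f = f \<bullet>\<^bsub>C\<^esub> g" "HZero (op_cat C) x y = HZero C y x"
  "HAdd (op_cat C) = HAdd C" "HSmult (op_cat C) = HSmult C" "Hom (op_cat C) x y = Hom C y x"
  "hom_space (op_cat C) x y = hom_space C y x"
  by (auto simp: op_cat_def Hom_def hom_space_def)

lemma is_kernel_op [simp]: "is_kernel (op_cat C) f k \<longleftrightarrow> is_cokernel C f k"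
  and is_cokernel_op [simp]: "is_cokernel (op_cat C) f k \<longleftrightarrow> is_kernel C f k"
  by (auto simp: is_kernel_def is_cokernel_def)

lemma short_exact_op [simp]: "short_exact (op_cat C) f g \<longleftrightarrow> short_exact C g f"
  by (auto simp: short_exact_def)

text \<open>From here on statements about epimorphisms and cokernels can be dualised by
  instantiation; a monomorphism is written \<open>is_epi (op_cat C)\<close>.\<close>

lemma (in linear_category) linear_category_op: "linear_category K (op_cat C)"
proof (intro linear_category.intro linear_category_axioms.intro category.intro)
  fix x y z f assume "x \<in> Ob (op_cat C)" "y \<in> Ob (op_cat C)" "z \<in> Ob (op_cat C)" "f \<in> Hom (op_cat C) x y"
  then show "linear_map K (hom_space (op_cat C) y z) (hom_space (op_cat C) x z) (\<lambda>g. g \<bullet>\<^bsub>op_cat C\<^esub> f)"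
    using comp_linear_right[of z y x f] by simp
next
  fix x y z f assume "x \<in> Ob (op_cat C)" "y \<in> Ob (op_cat C)" "z \<in> Ob (op_cat C)" "f \<in> Hom (op_cat C) y z"
  then show "linear_map K (hom_space (op_cat C) x y) (hom_space (op_cat C) x z) (\<lambda>g. f \<bullet>\<^bsub>op_cat C\<^esub> g)"
    using comp_linear_left[of z y x f] by simp
qed (auto simp: Hom_iff hom_space_module K.field_axioms)

context linear_category
begin

lemma is_kernelD:
  assumes "is_kernel C f k"
  shows "f \<in> Arr C" "k \<in> Arr C" "Cod C k = Dom C f" "f \<bullet> k = HZero C (Dom C k) (Cod C f)" "is_epi (op_cat C) k"
    and "\<lbrakk>h \<in> Arr C; Cod C h = Dom C f; f \<bullet> h = HZero C (Dom C h) (Cod C f)\<rbrakk>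
      \<Longrightarrow> \<exists>u. u \<in> Hom C (Dom C h) (Dom C k) \<and> k \<bullet> u = h"
  using linear_category.is_cokernelD[OF linear_category_op, of f k] assms by auto

lemma is_kernelI:
  assumes "f \<in> Arr C" "Cod C k = Dom C f" "f \<bullet> k = HZero C (Dom C k) (Cod C f)" "is_epi (op_cat C) k"
    and "\<And>h. \<lbrakk>h \<in> Arr C; Cod C h = Dom C f; f \<bullet> h = HZero C (Dom C h) (Cod C f)\<rbrakk>
      \<Longrightarrow> \<exists>u. u \<in> Hom C (Dom C h) (Dom C k) \<and> k \<bullet> u = h"
  shows "is_kernel C f k"
  using linear_category.is_cokernelI[OF linear_category_op, of f k] assms by auto

lemma mono_cancel:
  assumes "is_epi (op_cat C) k" "g \<in> Arr C" "h \<in> Arr C" "Cod C g = Dom C k" "Cod C h = Dom C k"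
    "Dom C g = Dom C h" "k \<bullet> g = k \<bullet> h"
  shows "g = h"
  by (rule is_epiD[OF assms(1), of "Dom C h"]) (use assms(2-) in \<open>auto simp: Hom_iff\<close>)

lemma epi_cancel:
  assumes "is_epi C k" "g \<in> Arr C" "h \<in> Arr C" "Dom C g = Cod C k" "Dom C h = Cod C k"
    "Cod C g = Cod C h" "g \<bullet> k = h \<bullet> k"
  shows "g = h"
  by (rule is_epiD[OF assms(1), of "Cod C h"]) (use assms(2-) in \<open>auto simp: Hom_iff\<close>)

lemma is_mono_iff:
  "is_epi (op_cat C) e \<longleftrightarrow> e \<in> Arr C \<and> (\<forall>g \<in> Arr C. Cod C g = Dom C e \<longrightarrow>
     e \<bullet> g = HZero C (Dom C g) (Cod C e) \<longrightarrow> g = HZero C (Dom C g) (Dom C e))"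
  using linear_category.is_epi_iff[OF linear_category_op, of e] by simp

lemma epi_comp:
  assumes "is_epi C f" "is_epi C g" "Dom C g = Cod C f"
  shows "is_epi C (g \<bullet> f)"
  unfolding is_epi_def
proof (intro conjI ballI impI)
  have a: "f \<in> Arr C" "g \<in> Arr C" using assms by (auto simp: is_epi_def)
  then show "g \<bullet> f \<in> Arr C" using assms by simp
  fix z h k assume "z \<in> Ob C" "h \<in> Hom C (Cod C (g \<bullet> f)) z" "k \<in> Hom C (Cod C (g \<bullet> f)) z"
    and e: "h \<bullet> g \<bullet> f = k \<bullet> g \<bullet> f"
  then have hk: "h \<in> Arr C" "k \<in> Arr C" "Dom C h = Cod C g" "Dom C k = Cod C g" "Cod C h = Cod C k"
    using a assms by (auto simp: Hom_iff)
  have "(h \<bullet> g) \<bullet> f = (k \<bullet> g) \<bullet> f" using e hk a assms(3) by simp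
  then have "h \<bullet> g = k \<bullet> g" by (rule epi_cancel[OF assms(1), rotated -1]) (use hk a assms(3) in auto)
  then show "h = k" by (rule epi_cancel[OF assms(2), rotated -1]) (use hk a assms(3) in auto)
qed

lemma epi_of_comp:
  assumes "is_epi C (g \<bullet> f)" "f \<in> Arr C" "g \<in> Arr C" "Dom C g = Cod C f"
  shows "is_epi C g"
  unfolding is_epi_def
proof (intro conjI ballI impI)
  show "g \<in> Arr C" by fact
  fix z h k assume hk: "z \<in> Ob C" "h \<in> Hom C (Cod C g) z" "k \<in> Hom C (Cod C g) z" "h \<bullet> g = k \<bullet> g"
  have "(h \<bullet> g) \<bullet> f = (k \<bullet> g) \<bullet> f" by (simp only: hk)
  then have "h \<bullet> g \<bullet> f = k \<bullet> g \<bullet> f" using hk(1-3) assms by (simp add: Hom_iff)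
  then show "h = k" by (rule epi_cancel[OF assms(1), rotated -1]) (use hk assms in \<open>auto simp: Hom_iff\<close>)
qed

lemma is_iso_epi: "is_iso C f \<Longrightarrow> is_epi C f"
  unfolding is_epi_def using iso_cancel_right is_iso_arr by (auto simp: Hom_iff)

lemma projective_lift:
  assumes "projective C p" "is_epi C e" "f \<in> Arr C" "Dom C f = p" "Cod C f = Cod C e"
  obtains g where "g \<in> Arr C" "Dom C g = p" "Cod C g = Dom C e" "e \<bullet> g = f"
proof -
  have "f \<in> Hom C p (Cod C e)" using assms by (simp add: Hom_iff)
  then obtain g where "g \<in> Hom C p (Dom C e)" "e \<bullet> g = f"
    using assms(1,2) unfolding projective_def by blast
  then show thesis using that by (auto simp: Hom_iff)
qed

end

lemma linear_functorD:
  assumes "linear_category K C" "linear_category K D" "linear_functor K C D F"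
  shows "is_functor C D F"
    and "x \<in> Ob C \<Longrightarrow> omap F x \<in> Ob D"
    and "f \<in> Arr C \<Longrightarrow> amap F f \<in> Arr D"
    and "f \<in> Arr C \<Longrightarrow> Dom D (amap F f) = omap F (Dom C f)"
    and "f \<in> Arr C \<Longrightarrow> Cod D (amap F f) = omap F (Cod C f)"
    and "x \<in> Ob C \<Longrightarrow> amap F (Id C x) = Id D (omap F x)"
    and "\<lbrakk>f \<in> Arr C; g \<in> Arr C; Dom C g = Cod C f\<rbrakk> \<Longrightarrow> amap F (g \<bullet>\<^bsub>C\<^esub> f) = amap F g \<bullet>\<^bsub>D\<^esub> amap F f"
    and "\<lbrakk>x \<in> Ob C; y \<in> Ob C\<rbrakk> \<Longrightarrow> amap F (HZero C x y) = HZero D (omap F x) (omap F y)"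
    and "\<lbrakk>f \<in> Arr C; g \<in> Arr C; Dom C f = Dom C g; Cod C f = Cod C g\<rbrakk>
      \<Longrightarrow> amap F (HAdd C f g) = HAdd D (amap F f) (amap F g)"
    and "\<lbrakk>f \<in> Arr C; c \<in> carrier K\<rbrakk> \<Longrightarrow> amap F (HSmult C c f) = HSmult D c (amap F f)"
proof -
  interpret C: linear_category K C by fact
  interpret D: linear_category K D by fact
  show F: "is_functor C D F" using assms(3) by (simp add: linear_functor_def)
  note Fs = is_functorD[OF F]
  show "x \<in> Ob C \<Longrightarrow> omap F x \<in> Ob D" "f \<in> Arr C \<Longrightarrow> amap F f \<in> Arr D"
    "f \<in> Arr C \<Longrightarrow> Dom D (amap F f) = omap F (Dom C f)" "f \<in> Arr C \<Longrightarrow> Cod D (amap F f) = omap F (Cod C f)"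
    "x \<in> Ob C \<Longrightarrow> amap F (Id C x) = Id D (omap F x)"
    "\<lbrakk>f \<in> Arr C; g \<in> Arr C; Dom C g = Cod C f\<rbrakk> \<Longrightarrow> amap F (g \<bullet>\<^bsub>C\<^esub> f) = amap F g \<bullet>\<^bsub>D\<^esub> amap F f"
    using Fs C.category_axioms by blast+
  have l: "linear_map K (hom_space C x y) (hom_space D (omap F x) (omap F y)) (amap F)"
    if "x \<in> Ob C" "y \<in> Ob C" for x y
    using assms(3) that by (simp add: linear_functor_def)
  show "\<lbrakk>x \<in> Ob C; y \<in> Ob C\<rbrakk> \<Longrightarrow> amap F (HZero C x y) = HZero D (omap F x) (omap F y)"
    using linear_map_zero[OF C.hom_space_module D.hom_space_module l] Fs(1) by auto
  show "\<lbrakk>f \<in> Arr C; g \<in> Arr C; Dom C f = Dom C g; Cod C f = Cod C g\<rbrakk>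
      \<Longrightarrow> amap F (HAdd C f g) = HAdd D (amap F f) (amap F g)"
    using l[of "Dom C f" "Cod C f"] by (simp add: linear_map_def Hom_iff)
  show "\<lbrakk>f \<in> Arr C; c \<in> carrier K\<rbrakk> \<Longrightarrow> amap F (HSmult C c f) = HSmult D c (amap F f)"
    using l[of "Dom C f" "Cod C f"] by (simp add: linear_map_def Hom_iff)
qed

lemma linear_functor_id: "linear_functor K C C id_ftor"
  by (auto simp: linear_functor_def is_functor_def id_ftor_def linear_map_def)

section \<open>Abelian categories with a projective generator\<close>

lemma (in linear_category) epi_zeroD:
  "\<lbrakk>is_epi C e; g \<in> Arr C; Dom C g = Cod C e; g \<bullet> e = HZero C (Dom C e) (Cod C g)\<rbrakk>
    \<Longrightarrow> g = HZero C (Cod C e) (Cod C g)"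
  unfolding is_epi_iff by blast

text \<open>The relations q i = 0 and p j = 0 are left out since they follow from the others.
  Exchanging injections and projections gives a biproduct in the opposite category.\<close>

definition is_biprod ::
  "('o, 'm, 'k, 'z) lincat_scheme \<Rightarrow> 'o \<Rightarrow> 'o \<Rightarrow> 'o \<Rightarrow> 'm \<Rightarrow> 'm \<Rightarrow> 'm \<Rightarrow> 'm \<Rightarrow> bool" where
  "is_biprod C x y z i j p q \<longleftrightarrow> i \<in> Hom C x z \<and> j \<in> Hom C y z \<and> p \<in> Hom C z x \<and> q \<in> Hom C z y \<and>
     p \<bullet>\<^bsub>C\<^esub> i = Id C x \<and> q \<bullet>\<^bsub>C\<^esub> j = Id C y \<and> HAdd C (i \<bullet>\<^bsub>C\<^esub> p) (j \<bullet>\<^bsub>C\<^esub> q) = Id C z"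

text \<open>Abelianness is expressed by the image factorization, a form that is visibly self-dual and
  transports easily along equivalences.\<close>

locale fin_ab = linear_category K C
  for K :: "('k, 'y) ring_scheme" and C :: "('o, 'm, 'k, 'z) lincat_scheme" (structure) +
  assumes zero_object: "\<exists>z \<in> Ob C. Id C z = HZero C z z"
    and biproducts: "\<lbrakk>x \<in> Ob C; y \<in> Ob C\<rbrakk> \<Longrightarrow> \<exists>z i j p q. is_biprod C x y z i j p q"
    and image_factorization: "f \<in> Arr C \<Longrightarrow>
      \<exists>k q i c. short_exact C k q \<and> short_exact C i c \<and> Dom C i = Cod C q \<and> i \<bullet> q = f"
    and hom_noetherian: "\<lbrakk>x \<in> Ob C; y \<in> Ob C\<rbrakk> \<Longrightarrow> noetherian_space K (hom_space C x y)"

text \<open>A generator: Hom(P, -) is faithful, stated for zero arrows only, which suffices by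
  linearity.\<close>

definition faithful_ob :: "('o, 'm, 'k, 'z) lincat_scheme \<Rightarrow> 'o \<Rightarrow> bool" where
  "faithful_ob C P \<longleftrightarrow> P \<in> Ob C \<and> (\<forall>g \<in> Arr C.
     (\<forall>u \<in> Hom C P (Dom C g). g \<bullet>\<^bsub>C\<^esub> u = HZero C P (Cod C g)) \<longrightarrow> g = HZero C (Dom C g) (Cod C g))"

lemma faithful_obD:
  "\<lbrakk>faithful_ob C P; g \<in> Arr C; \<And>u. u \<in> Hom C P (Dom C g) \<Longrightarrow> g \<bullet>\<^bsub>C\<^esub> u = HZero C P (Cod C g)\<rbrakk>
    \<Longrightarrow> g = HZero C (Dom C g) (Cod C g)"
  unfolding faithful_ob_def by blast

definition proj_gen :: "('o, 'm, 'k, 'z) lincat_scheme \<Rightarrow> 'o \<Rightarrow> bool" where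
  "proj_gen C P \<longleftrightarrow> projective C P \<and> faithful_ob C P"

lemma is_biprod_op: "is_biprod (op_cat C) x y z i j p q \<longleftrightarrow> is_biprod C x y z p q i j"
  by (auto simp: is_biprod_def)

text \<open>Every axiom of \<open>fin_ab\<close> is self-dual. This is what allows the
  representability criterion to be applied to the opposite of \<open>M\<close>.\<close>

lemma (in fin_ab) fin_ab_op: "fin_ab K (op_cat C)"
proof (intro fin_ab.intro fin_ab_axioms.intro linear_category_op)
  show "\<exists>z\<in>Ob (op_cat C). Id (op_cat C) z = HZero (op_cat C) z z"
    using zero_object by simp
  show "\<exists>z i j p q. is_biprod (op_cat C) x y z i j p q" if "x \<in> Ob (op_cat C)" "y \<in> Ob (op_cat C)" for x y
    using biproducts[of x y] that unfolding is_biprod_op op_cat_simps by blast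
  show "\<exists>k q i c. short_exact (op_cat C) k q \<and> short_exact (op_cat C) i c \<and>
      Dom (op_cat C) i = Cod (op_cat C) q \<and> i \<bullet>\<^bsub>op_cat C\<^esub> q = f" if f: "f \<in> Arr (op_cat C)" for f
  proof -
    obtain k q i c where "short_exact C k q" "short_exact C i c" "Dom C i = Cod C q" "i \<bullet> q = f"
      using image_factorization[of f] f by auto
    then show ?thesis by (intro exI[of _ c] exI[of _ i] exI[of _ q] exI[of _ k]) simp
  qed
qed (use hom_noetherian in auto)

context fin_ab
begin

text \<open>For the two orthogonality relations: p = p i p + p j q = p + p j q gives p j q = 0, and
  composing with j gives p j = 0; likewise for q i.\<close>

lemma biprodD:
  assumes "is_biprod C x y z i j p q"
  shows "x \<in> Ob C" "y \<in> Ob C" "z \<in> Ob C"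
    "i \<in> Arr C" "Dom C i = x" "Cod C i = z" "j \<in> Arr C" "Dom C j = y" "Cod C j = z"
    "p \<in> Arr C" "Dom C p = z" "Cod C p = x" "q \<in> Arr C" "Dom C q = z" "Cod C q = y"
    "p \<bullet> i = Id C x" "q \<bullet> j = Id C y" "HAdd C (i \<bullet> p) (j \<bullet> q) = Id C z"
    "q \<bullet> i = HZero C x y" "p \<bullet> j = HZero C y x"
proof -
  show a: "x \<in> Ob C" "y \<in> Ob C" "z \<in> Ob C"
    "i \<in> Arr C" "Dom C i = x" "Cod C i = z" "j \<in> Arr C" "Dom C j = y" "Cod C j = z"
    "p \<in> Arr C" "Dom C p = z" "Cod C p = x" "q \<in> Arr C" "Dom C q = z" "Cod C q = y"
    "p \<bullet> i = Id C x" "q \<bullet> j = Id C y" "HAdd C (i \<bullet> p) (j \<bullet> q) = Id C z"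
    using assms by (auto simp: is_biprod_def Hom_iff)
  have cancel: "r \<bullet> s = HZero C (Dom C s) (Cod C r)"
    if rs: "r \<in> Arr C" "s \<in> Arr C" "t \<in> Arr C" "Dom C r = Cod C s" "Dom C s = Cod C t" "Dom C r = Dom C t"
      "HAdd C (r \<bullet> s \<bullet> t) r = r" "t \<bullet> s = Id C (Dom C s)" for r s t
  proof -
    have "r \<bullet> s \<bullet> t = HZero C (Dom C r) (Cod C r)"
      using hsub_facts(2)[of "r \<bullet> s \<bullet> t" "r \<bullet> s \<bullet> t"] rs
    proof -
      interpret V: module K "hom_space C (Dom C r) (Cod C r)" using rs by (intro hom_space_module) auto
      show ?thesis using rs V.add.r_cancel_one'[of r "r \<bullet> s \<bullet> t"] by (auto simp: Hom_iff)
    qed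
    then have "(r \<bullet> s \<bullet> t) \<bullet> s = HZero C (Dom C r) (Cod C r) \<bullet> s" by simp
    then show ?thesis using rs by simp
  qed
  have "q \<bullet> HAdd C (i \<bullet> p) (j \<bullet> q) = q" "p \<bullet> HAdd C (i \<bullet> p) (j \<bullet> q) = p" unfolding a(18) using a by simp_all
  then have *: "HAdd C (q \<bullet> i \<bullet> p) (q \<bullet> j \<bullet> q) = q" "HAdd C (p \<bullet> i \<bullet> p) (p \<bullet> j \<bullet> q) = p"
    using a(1-15) by (simp_all add: comp_add_right)
  have qq: "q \<bullet> j \<bullet> q = q" "p \<bullet> i \<bullet> p = p"
    using a comp_assoc'[of q j q] comp_assoc'[of p i p] by simp_all
  interpret W: module K "hom_space C z x" using a by (intro hom_space_module) auto
  have "HAdd C (p \<bullet> j \<bullet> q) p = p"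
    using * qq a W.a_comm[of p "p \<bullet> j \<bullet> q"] by (simp add: Hom_iff)
  then show "p \<bullet> j = HZero C y x" using cancel[of p j q] a by simp
  show "q \<bullet> i = HZero C x y" using cancel[of q i p] a * qq by simp
qed

lemma mono_epi_factorization:
  assumes "f \<in> Arr C"
  obtains k q i c where "short_exact C k q" "short_exact C i c" "is_epi C q" "is_epi (op_cat C) i"
    "q \<in> Arr C" "i \<in> Arr C" "Dom C q = Dom C f" "Dom C i = Cod C q" "Cod C i = Cod C f" "i \<bullet> q = f"
proof -
  obtain k q i c where *: "short_exact C k q" "short_exact C i c" "Dom C i = Cod C q" "i \<bullet> q = f"
    using image_factorization[OF assms] by blast
  have "is_epi C q" "is_epi (op_cat C) i" "q \<in> Arr C" "i \<in> Arr C"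
    using is_cokernelD(2,5)[of k q] is_kernelD(2,5)[of c i] * by (simp_all add: short_exact_def)
  then show thesis using that[of k q i c] * by auto
qed

text \<open>Factor q = i e through its image, with i the kernel of c. From c q = 0 and q epi it
  follows that c = 0, so the identity factors through i and i is invertible with inverse s. Hence q
  and e differ by an isomorphism, and the k that belongs to e also belongs to q.\<close>

lemma epi_short_exact:
  assumes "is_epi C q"
  obtains k where "short_exact C k q"
proof -
  have q: "q \<in> Arr C" using assms by (simp add: is_epi_def)
  obtain k e i c where e: "short_exact C k e" "short_exact C i c" "is_epi C e" "is_epi (op_cat C) i"
    "e \<in> Arr C" "i \<in> Arr C" "Dom C e = Dom C q" "Dom C i = Cod C e" "Cod C i = Cod C q" "i \<bullet> e = q"
    by (rule mono_epi_factorization[OF q])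
  have kc: "is_kernel C c i" "is_kernel C e k" "is_cokernel C k e" using e by (auto simp: short_exact_def)
  note c = is_kernelD[OF kc(1)] and k = is_kernelD[OF kc(2)] and ke = is_cokernelD[OF kc(3)]
  have "c \<bullet> q = (c \<bullet> i) \<bullet> e" using c(1,3) e by auto
  also have "\<dots> = HZero C (Dom C q) (Cod C c)" using c e by (simp del: comp_assoc')
  finally have "c = HZero C (Cod C q) (Cod C c)"
    using assms[unfolded is_epi_iff] c(1,3) e by auto
  then have "c \<bullet> Id C (Cod C q) = HZero C (Cod C q) (Cod C c)" using c(1,3) e by simp
  then obtain s where s: "s \<in> Arr C" "Dom C s = Cod C q" "Cod C s = Dom C i" "i \<bullet> s = Id C (Cod C q)"
    using c(6)[of "Id C (Cod C q)"] q c(1,3) e by (auto simp: Hom_iff)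
  have "i \<bullet> (s \<bullet> i) = (i \<bullet> s) \<bullet> i" using s e by (subst comp_assoc') auto
  also have "\<dots> = i \<bullet> Id C (Dom C i)" using s e by simp
  finally have si: "s \<bullet> i = Id C (Dom C i)"
    by (rule mono_cancel[OF e(4), rotated -1]) (use s e in auto)
  have esq: "s \<bullet> q = e"
  proof -
    have "s \<bullet> q = (s \<bullet> i) \<bullet> e" using s e by (subst e(10)[symmetric], subst comp_assoc') auto
    then show ?thesis using si e by simp
  qed
  have "short_exact C k q" unfolding short_exact_def
  proof
    have "q \<bullet> k = i \<bullet> (e \<bullet> k)" using e k by (subst e(10)[symmetric], subst comp_assoc') auto
    then have qk: "q \<bullet> k = HZero C (Dom C k) (Cod C q)" using k e by auto
    show "is_kernel C q k"
    proof (rule is_kernelI)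
      fix h assume h: "h \<in> Arr C" "Cod C h = Dom C q" "q \<bullet> h = HZero C (Dom C h) (Cod C q)"
      have "e \<bullet> h = s \<bullet> q \<bullet> h" using esq s q h e by (subst esq[symmetric], subst comp_assoc') auto
      also have "\<dots> = HZero C (Dom C h) (Cod C e)" using h s e by simp
      finally show "\<exists>u. u \<in> Hom C (Dom C h) (Dom C k) \<and> k \<bullet> u = h" using k(6)[of h] h e by auto
    qed (use q k qk e in auto)
    show "is_cokernel C k q"
    proof (rule is_cokernelI)
      fix h assume h: "h \<in> Arr C" "Dom C h = Cod C k" "h \<bullet> k = HZero C (Dom C k) (Cod C h)"
      then obtain u where u: "u \<in> Arr C" "Dom C u = Cod C e" "Cod C u = Cod C h" "u \<bullet> e = h"
        using ke(6)[of h] by (auto simp: Hom_iff)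
      have "(u \<bullet> s) \<bullet> q = h" using u s q e esq by simp
      then show "\<exists>u. u \<in> Hom C (Cod C q) (Cod C h) \<and> u \<bullet> q = h"
        using u s q e by (intro exI[of _ "u \<bullet> s"]) (auto simp: Hom_iff)
    qed (use q k qk e assms in auto)
  qed
  then show thesis using that by blast
qed

lemma mono_short_exact:
  assumes "is_epi (op_cat C) i"
  obtains c where "short_exact C i c"
  using fin_ab.epi_short_exact[OF fin_ab_op assms] by auto

end

text \<open>Finite direct sums of copies of P. A relation rather than a function of the number of
  copies, because zero objects and biproducts exist but are not chosen.\<close>

inductive sum_of :: "('o, 'm, 'k, 'z) lincat_scheme \<Rightarrow> 'o \<Rightarrow> 'o \<Rightarrow> bool" for C P where
  zero: "\<lbrakk>z \<in> Ob C; Id C z = HZero C z z\<rbrakk> \<Longrightarrow> sum_of C P z"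
| plus: "\<lbrakk>sum_of C P x; is_biprod C x P z i j p q\<rbrakk> \<Longrightarrow> sum_of C P z"

section \<open>Finite sums of a projective generator, and representable functors\<close>

locale fin_cat = fin_ab K C
  for K :: "('k, 'y) ring_scheme" and C :: "('o, 'm, 'k, 'z) lincat_scheme" (structure) +
  fixes P :: 'o
  assumes proj_gen: "proj_gen C P"
begin

lemma P_Ob [simp]: "P \<in> Ob C" and P_projective: "projective C P"
  using proj_gen by (auto simp: proj_gen_def projective_def)

lemma sum_of_Ob: "sum_of C P z \<Longrightarrow> z \<in> Ob C"
  by (induction rule: sum_of.induct) (auto dest: biprodD)

text \<open>Lift on each summand separately, precompose the lifts with the projections and add
  them.\<close>

lemma sum_of_projective: "sum_of C P z \<Longrightarrow> projective C z"
proof (induction rule: sum_of.induct)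
  case (zero z)
  show ?case unfolding projective_def
  proof (intro conjI allI impI ballI)
    fix e f assume e: "is_epi C e" and f: "f \<in> Hom C z (Cod C e)"
    have eA: "e \<in> Arr C" using e by (simp add: is_epi_def)
    have "f = f \<bullet> Id C z" using f by (simp add: Hom_iff)
    also have "\<dots> = HZero C z (Cod C e)" using zero f by (simp add: Hom_iff)
    finally show "\<exists>g\<in>Hom C z (Dom C e). e \<bullet> g = f"
      using zero eA by (intro bexI[of _ "HZero C z (Dom C e)"]) (auto simp: Hom_iff)
  qed fact
next
  case (plus x z i j p q)
  note b = biprodD[OF plus(2)]
  show ?case unfolding projective_def
  proof (intro conjI allI impI ballI)
    fix e f assume e: "is_epi C e" and f: "f \<in> Hom C z (Cod C e)"
    have eA: "e \<in> Arr C" using e by (simp add: is_epi_def)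
    obtain g where g: "g \<in> Arr C" "Dom C g = x" "Cod C g = Dom C e" "e \<bullet> g = f \<bullet> i"
      by (rule projective_lift[OF plus.IH e, of "f \<bullet> i"]) (use b f in \<open>auto simp: Hom_iff\<close>)
    obtain h where h: "h \<in> Arr C" "Dom C h = P" "Cod C h = Dom C e" "e \<bullet> h = f \<bullet> j"
      by (rule projective_lift[OF P_projective e, of "f \<bullet> j"]) (use b f in \<open>auto simp: Hom_iff\<close>)
    have "e \<bullet> HAdd C (g \<bullet> p) (h \<bullet> q) = HAdd C (e \<bullet> g \<bullet> p) (e \<bullet> h \<bullet> q)"
      using g h b eA by (simp add: comp_add_right)
    also have "e \<bullet> g \<bullet> p = f \<bullet> i \<bullet> p" using comp_assoc'[of p g e] g b eA f by (simp add: Hom_iff)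
    also have "e \<bullet> h \<bullet> q = f \<bullet> j \<bullet> q" using comp_assoc'[of q h e] h b eA f by (simp add: Hom_iff)
    also have "HAdd C (f \<bullet> i \<bullet> p) (f \<bullet> j \<bullet> q) = f \<bullet> HAdd C (i \<bullet> p) (j \<bullet> q)"
      using b(1-15) f by (simp add: comp_add_right Hom_iff)
    also have "\<dots> = f" using b f by (simp add: Hom_iff)
    finally show "\<exists>g\<in>Hom C z (Dom C e). e \<bullet> g = f"
      using g h b by (intro bexI[of _ "HAdd C (g \<bullet> p) (h \<bullet> q)"]) (auto simp: Hom_iff)
  qed (use b in auto)
qed

text \<open>The predicate \<open>Q\<close> cuts out a subfunctor of the contravariant functor
  \<open>x \<mapsto> Hom(T x, d)\<close>; a finite generating set of its value at \<open>P\<close> is assembled into one element of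
  its value at a finite sum of copies of \<open>P\<close>.\<close>

lemma generating_element:
  assumes D: "linear_category K D" and T: "linear_functor K C D T" and d: "d \<in> Ob D"
    and fg: "fin_gen K (hom_space D (omap T P) d) {\<xi> \<in> Hom D (omap T P) d. Q \<xi>}"
    and Q0: "\<And>x. x \<in> Ob C \<Longrightarrow> Q (HZero D (omap T x) d)"
    and Qadd: "\<And>x \<xi> \<eta>. \<lbrakk>x \<in> Ob C; \<xi> \<in> Hom D (omap T x) d; \<eta> \<in> Hom D (omap T x) d; Q \<xi>; Q \<eta>\<rbrakk>
      \<Longrightarrow> Q (HAdd D \<xi> \<eta>)"
    and Qcomp: "\<And>f \<xi>. \<lbrakk>f \<in> Arr C; \<xi> \<in> Hom D (omap T (Cod C f)) d; Q \<xi>\<rbrakk> \<Longrightarrow> Q (\<xi> \<bullet>\<^bsub>D\<^esub> amap T f)"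
  shows "\<exists>p \<xi>. sum_of C P p \<and> \<xi> \<in> Hom D (omap T p) d \<and> Q \<xi> \<and>
    (\<forall>\<eta> \<in> Hom D (omap T P) d. Q \<eta> \<longrightarrow> (\<exists>v \<in> Hom C P p. \<xi> \<bullet>\<^bsub>D\<^esub> amap T v = \<eta>))"
proof -
  interpret D: linear_category K D by fact
  note Ts = linear_functorD[OF linear_category_axioms D T]
  let ?N = "{\<xi> \<in> Hom D (omap T P) d. Q \<xi>}"
  obtain S where S: "finite S" "S \<subseteq> ?N" "\<forall>U. submodule U K (hom_space D (omap T P) d) \<and> S \<subseteq> U \<longrightarrow> ?N \<subseteq> U"
    using fg unfolding fin_gen_def by (elim exE conjE) (rule that)
  have "\<exists>p \<xi>. sum_of C P p \<and> \<xi> \<in> Hom D (omap T p) d \<and> Q \<xi> \<and> S \<subseteq> {\<xi> \<bullet>\<^bsub>D\<^esub> amap T v |v. v \<in> Hom C P p}"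
    using S(1,2)
  proof (induction S rule: finite_induct)
    case empty
    obtain z where z: "z \<in> Ob C" "Id C z = HZero C z z" using zero_object by blast
    then show ?case using Q0[of z] d Ts(2)[of z]
      by (intro exI[of _ z] exI[of _ "HZero D (omap T z) d"]) (auto simp: Hom_iff intro: sum_of.zero)
  next
    case (insert s S)
    then obtain p \<xi> where p: "sum_of C P p" "\<xi> \<in> Hom D (omap T p) d" "Q \<xi>" "S \<subseteq> {\<xi> \<bullet>\<^bsub>D\<^esub> amap T v |v. v \<in> Hom C P p}"
      by blast
    have pO: "p \<in> Ob C" using p sum_of_Ob by blast
    obtain z i j a b where bp: "is_biprod C p P z i j a b" using biproducts[OF pO P_Ob] by blast
    note bs = biprodD[OF bp]
    have s: "s \<in> Hom D (omap T P) d" "Q s" using insert by auto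
    \<comment> \<open>The arrow on the biproduct with components \<xi> and s: its precomposites
      include those of \<xi> and also s itself.\<close>
    define \<zeta> where "\<zeta> = HAdd D (\<xi> \<bullet>\<^bsub>D\<^esub> amap T a) (s \<bullet>\<^bsub>D\<^esub> amap T b)"
    have \<zeta>: "\<zeta> \<in> Hom D (omap T z) d" using p s bs by (simp add: \<zeta>_def Hom_iff Ts)
    have "Q \<zeta>" unfolding \<zeta>_def
      by (rule Qadd[of z]) (use p s bs in \<open>auto simp: Hom_iff Ts intro!: Qcomp\<close>)
    have "\<zeta> \<bullet>\<^bsub>D\<^esub> amap T i = HAdd D (\<xi> \<bullet>\<^bsub>D\<^esub> amap T (a \<bullet> i)) (s \<bullet>\<^bsub>D\<^esub> amap T (b \<bullet> i))"
      using p s bs(1-15) by (simp add: \<zeta>_def D.comp_add_left Ts Hom_iff)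
    then have \<zeta>i: "\<zeta> \<bullet>\<^bsub>D\<^esub> amap T i = \<xi>" using p s bs by (simp add: Ts Hom_iff)
    have "\<zeta> \<bullet>\<^bsub>D\<^esub> amap T j = HAdd D (\<xi> \<bullet>\<^bsub>D\<^esub> amap T (a \<bullet> j)) (s \<bullet>\<^bsub>D\<^esub> amap T (b \<bullet> j))"
      using p s bs(1-15) by (simp add: \<zeta>_def D.comp_add_left Ts Hom_iff)
    then have \<zeta>j: "\<zeta> \<bullet>\<^bsub>D\<^esub> amap T j = s" using p s bs by (simp add: Ts Hom_iff)
    have "insert s S \<subseteq> {\<zeta> \<bullet>\<^bsub>D\<^esub> amap T v |v. v \<in> Hom C P z}"
    proof
      fix t assume "t \<in> insert s S"
      then consider "t = s" | "t \<in> S" by blast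
      then show "t \<in> {\<zeta> \<bullet>\<^bsub>D\<^esub> amap T v |v. v \<in> Hom C P z}"
      proof cases
        case 1 then show ?thesis using \<zeta>j bs by (auto intro!: exI[of _ j] simp: Hom_iff)
      next
        case 2
        then obtain v where v: "v \<in> Hom C P p" "t = \<xi> \<bullet>\<^bsub>D\<^esub> amap T v" using p by blast
        have "t = \<zeta> \<bullet>\<^bsub>D\<^esub> amap T (i \<bullet> v)"
          unfolding v(2) \<zeta>i[symmetric] using v(1) \<zeta> bs by (simp add: Ts Hom_iff)
        then show ?thesis using v bs by (auto intro!: exI[of _ "i \<bullet> v"] simp: Hom_iff)
      qed
    qed
    then show ?case
      using sum_of.plus[OF p(1) bp] \<zeta> \<open>Q \<zeta>\<close> by (intro exI[of _ z] exI[of _ \<zeta>] conjI)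
  qed
  then obtain p \<xi> where p: "sum_of C P p" "\<xi> \<in> Hom D (omap T p) d" "Q \<xi>" "S \<subseteq> {\<xi> \<bullet>\<^bsub>D\<^esub> amap T v |v. v \<in> Hom C P p}"
    by blast
  have pO: "p \<in> Ob C" using p sum_of_Ob by blast
  \<comment> \<open>Everything obtained from \<xi> by precomposition. Linearity of T makes this a
    subspace; as it contains S, it contains the whole subfunctor at P.\<close>
  let ?U = "{\<xi> \<bullet>\<^bsub>D\<^esub> amap T v |v. v \<in> Hom C P p}"
  have "submodule ?U K (hom_space D (omap T P) d)"
    unfolding submodule_iff[OF D.hom_space_module[OF Ts(2)[OF P_Ob] d]]
  proof (intro conjI ballI subsetI)
    fix u assume "u \<in> ?U"
    then show "u \<in> carrier (hom_space D (omap T P) d)" using p by (auto simp: Hom_iff Ts)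
  next
    show "\<zero>\<^bsub>hom_space D (omap T P) d\<^esub> \<in> ?U"
      using p pO d Ts(2)[of P] by (auto simp: Hom_iff Ts intro!: exI[of _ "HZero C P p"])
  next
    fix u v assume "u \<in> ?U" "v \<in> ?U"
    then obtain a b where ab: "a \<in> Hom C P p" "b \<in> Hom C P p" "u = \<xi> \<bullet>\<^bsub>D\<^esub> amap T a" "v = \<xi> \<bullet>\<^bsub>D\<^esub> amap T b" by blast
    then show "u \<oplus>\<^bsub>hom_space D (omap T P) d\<^esub> v \<in> ?U"
      using p by (auto simp: Hom_iff Ts D.comp_add_right[symmetric] intro!: exI[of _ "HAdd C a b"])
  next
    fix c u assume "c \<in> carrier K" "u \<in> ?U"
    then obtain a where ab: "a \<in> Hom C P p" "u = \<xi> \<bullet>\<^bsub>D\<^esub> amap T a" by blast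
    then show "c \<odot>\<^bsub>hom_space D (omap T P) d\<^esub> u \<in> ?U"
      using p \<open>c \<in> carrier K\<close> by (auto simp: Hom_iff Ts D.comp_smult_right[symmetric] intro!: exI[of _ "HSmult C c a"])
  qed
  then have "?N \<subseteq> ?U" using S(3) p(4) by blast
  then have "\<forall>\<eta> \<in> Hom D (omap T P) d. Q \<eta> \<longrightarrow> (\<exists>v \<in> Hom C P p. \<xi> \<bullet>\<^bsub>D\<^esub> amap T v = \<eta>)" by blast
  then show ?thesis using p(1-3) by (intro exI[of _ p] exI[of _ \<xi>] conjI)
qed

lemma fin_gen_Hom:
  assumes "x \<in> Ob C" "submodule N K (hom_space C P x)"
  shows "fin_gen K (hom_space C P x) N"
  using hom_noetherian[OF P_Ob assms(1)] assms(2) by (simp add: noetherian_space_def)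

text \<open>The case of the identity functor with a trivial predicate: p is a sum of enough copies
  of P to generate Hom(P, y). No minimality is claimed. Every arrow from P to y factors through w,
  so w is epi because P is a generator.\<close>

lemma projective_cover:
  assumes y: "y \<in> Ob C"
  obtains p w where "sum_of C P p" "w \<in> Hom C p y" "is_epi C w" "\<And>u. u \<in> Hom C P y \<Longrightarrow> \<exists>v \<in> Hom C P p. w \<bullet> v = u"
proof -
  note gen = generating_element[OF linear_category_axioms linear_functor_id y, where Q = "\<lambda>_. True",
    unfolded id_ftor_def ftor.simps]
  have "\<exists>p w. sum_of C P p \<and> w \<in> Hom C p y \<and> True \<and>
    (\<forall>u \<in> Hom C P y. True \<longrightarrow> (\<exists>v \<in> Hom C P p. w \<bullet> v = u))"
  proof (rule gen)
    show "fin_gen K (hom_space C P y) {\<xi> \<in> Hom C P y. True}"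
      using fin_gen_Hom[OF y submodule_self[OF hom_space_module[OF P_Ob y]]] by simp
  qed auto
  then obtain p w where p: "sum_of C P p" "w \<in> Hom C p y" "\<forall>u \<in> Hom C P y. \<exists>v \<in> Hom C P p. w \<bullet> v = u"
    by auto
  have "is_epi C w" unfolding is_epi_iff
  proof (intro conjI ballI impI)
    show "w \<in> Arr C" using p by (simp add: Hom_iff)
    fix g assume g: "g \<in> Arr C" "Dom C g = Cod C w" "g \<bullet> w = HZero C (Dom C w) (Cod C g)"
    have "g \<bullet> u = HZero C P (Cod C g)" if u: "u \<in> Hom C P (Dom C g)" for u
    proof -
      have "u \<in> Hom C P y" using p(2) u g by (simp add: Hom_iff)
      then obtain v where v: "v \<in> Hom C P p" "w \<bullet> v = u" using p(3) by blast
      have "g \<bullet> u = (g \<bullet> w) \<bullet> v" using v g p by (subst v(2)[symmetric], subst comp_assoc') (auto simp: Hom_iff)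
      then show ?thesis using g v p by (simp add: Hom_iff del: comp_assoc')
    qed
    then show "g = HZero C (Cod C w) (Cod C g)"
      using proj_gen[unfolded proj_gen_def] faithful_obD[of C P g] g by simp
  qed
  then show thesis using that[of p w] p by blast
qed


text \<open>The value at d of a right adjoint of T, by generators and relations. Write F x = Hom(T
  x, d). An element \<xi> of F p, with p a finite sum of copies of P, generates F at P; an arrow w
  from a second finite sum p' generates the arrows into p on which \<xi> vanishes. The object r is
  the cokernel of w, and \<xi> descends to the universal element \<epsilon>. Bijectivity of Hom(x,
  r) -> F x is shown for P, then for finite sums, and finally for all x by a presentation.\<close>

lemma right_adjoint_ob:
  assumes D: "linear_category K D" and T: "linear_functor K C D T" and d: "d \<in> Ob D"
    and noeth: "\<And>x. x \<in> Ob D \<Longrightarrow> noetherian_space K (hom_space D x d)"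
    and rex: "\<And>k q. short_exact C k q \<Longrightarrow> is_cokernel D (amap T k) (amap T q)"
  shows "\<exists>r \<epsilon>. r \<in> Ob C \<and> \<epsilon> \<in> Hom D (omap T r) d \<and>
    (\<forall>x \<in> Ob C. \<forall>\<xi> \<in> Hom D (omap T x) d. \<exists>!u. u \<in> Hom C x r \<and> \<epsilon> \<bullet>\<^bsub>D\<^esub> amap T u = \<xi>)"
proof -
  interpret D: linear_category K D by fact
  note Ts = linear_functorD[OF linear_category_axioms D T]
  have "\<exists>p \<xi>. sum_of C P p \<and> \<xi> \<in> Hom D (omap T p) d \<and> True \<and>
    (\<forall>\<eta> \<in> Hom D (omap T P) d. True \<longrightarrow> (\<exists>v \<in> Hom C P p. \<xi> \<bullet>\<^bsub>D\<^esub> amap T v = \<eta>))"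
  proof (rule generating_element[OF D T d, where Q = "\<lambda>_. True"])
    show "fin_gen K (hom_space D (omap T P) d) {\<xi> \<in> Hom D (omap T P) d. True}"
      using noeth[OF Ts(2)[OF P_Ob]] submodule_self[OF D.hom_space_module[OF Ts(2)[OF P_Ob] d]]
      unfolding noetherian_space_def by simp
  qed auto
  then obtain p \<xi> where p: "sum_of C P p" "\<xi> \<in> Arr D" "Dom D \<xi> = omap T p" "Cod D \<xi> = d"
      and pc: "\<forall>\<eta> \<in> Hom D (omap T P) d. \<exists>v \<in> Hom C P p. \<xi> \<bullet>\<^bsub>D\<^esub> amap T v = \<eta>"
    by (auto simp: Hom_iff)
  have pO [simp]: "p \<in> Ob C" using p sum_of_Ob by blast
  \<comment> \<open>Cuts out the subfunctor of Hom(-, p) formed by the relations on \<xi>.\<close>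
  define Q where "Q u \<longleftrightarrow> \<xi> \<bullet>\<^bsub>D\<^esub> amap T u = HZero D (omap T (Dom C u)) d" for u
  note gen = generating_element[OF linear_category_axioms linear_functor_id pO, where Q = Q,
    unfolded id_ftor_def ftor.simps]
  have "\<exists>p' w. sum_of C P p' \<and> w \<in> Hom C (p') p \<and> Q w \<and>
    (\<forall>u \<in> Hom C P p. Q u \<longrightarrow> (\<exists>v \<in> Hom C P p'. w \<bullet> v = u))"
  proof (rule gen)
    have "submodule {u \<in> Hom C P p. Q u} K (hom_space C P p)"
      unfolding submodule_iff[OF hom_space_module[OF P_Ob pO]] Q_def
      using p Ts(2)[of P] Ts(2)[OF pO] d
      by (auto simp: Hom_iff Ts D.comp_add_right D.comp_smult_right
          module.smult_r_null[OF D.hom_space_module[of "omap T P" d], simplified])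
    then show "fin_gen K (hom_space C P p) {u \<in> Hom C P p. Q u}"
      using fin_gen_Hom[OF pO] by simp
  next
    fix x assume "x \<in> Ob C"
    then show "Q (HZero C x p)" using p Ts(2)[of x] by (simp add: Q_def Ts)
  next
    fix x f g assume "x \<in> Ob C" "f \<in> Hom C x p" "g \<in> Hom C x p" "Q f" "Q g"
    then show "Q (HAdd C f g)"
      using p Ts(2)[of x] d by (simp add: Q_def Ts Hom_iff D.comp_add_right)
  next
    fix f g assume fg: "f \<in> Arr C" "g \<in> Hom C (Cod C f) p" "Q g"
    then have "\<xi> \<bullet>\<^bsub>D\<^esub> amap T g \<bullet>\<^bsub>D\<^esub> amap T f = (\<xi> \<bullet>\<^bsub>D\<^esub> amap T g) \<bullet>\<^bsub>D\<^esub> amap T f"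
      using p by (subst D.comp_assoc') (auto simp: Ts Hom_iff)
    also have "\<dots> = HZero D (omap T (Dom C f)) d"
      using fg p d Ts(2)[of "Cod C f"] unfolding Q_def by (simp add: Ts Hom_iff del: D.comp_assoc')
    finally show "Q (g \<bullet> f)" using fg p by (simp add: Q_def Ts Hom_iff)
  qed
  then obtain p' w where w: "sum_of C P p'" "w \<in> Arr C" "Dom C w = p'" "Cod C w = p" "Q w"
      and wc: "\<forall>u \<in> Hom C P p. Q u \<longrightarrow> (\<exists>v \<in> Hom C P p'. w \<bullet> v = u)"
    by (auto simp: Hom_iff)
  \<comment> \<open>A cokernel is at hand only for the mono part i of w. That is enough: T q is epi
    by right exactness, so \<xi> vanishes on T i once it vanishes on T w.\<close>
  obtain k q i c where f: "short_exact C k q" "short_exact C i c" "is_epi C q" "is_epi (op_cat C) i"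
    "q \<in> Arr C" "i \<in> Arr C" "Dom C q = Dom C w" "Dom C i = Cod C q" "Cod C i = Cod C w" "i \<bullet> q = w"
    by (rule mono_epi_factorization[OF w(2)])
  have ci: "is_cokernel C i c" using f by (simp add: short_exact_def)
  note c = is_cokernelD[OF ci]
  note Tq = D.is_cokernelD[OF rex[OF f(1)]] and Tc = D.is_cokernelD[OF rex[OF f(2)]]
  define r where "r = Cod C c"
  have rO [simp]: "r \<in> Ob C" using c by (simp add: r_def)
  have "(\<xi> \<bullet>\<^bsub>D\<^esub> amap T i) \<bullet>\<^bsub>D\<^esub> amap T q = \<xi> \<bullet>\<^bsub>D\<^esub> amap T w"
    using p f(5-9) w(2-4) by (subst f(10)[symmetric]) (simp add: Ts)
  also have "\<dots> = HZero D (omap T (Dom C q)) d" using w f unfolding Q_def by simp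
  finally have "\<xi> \<bullet>\<^bsub>D\<^esub> amap T i = HZero D (omap T (Dom C i)) d"
    using D.epi_zeroD[OF Tq(5), of "\<xi> \<bullet>\<^bsub>D\<^esub> amap T i"] p f w by (simp add: Ts del: D.comp_assoc')
  then obtain \<epsilon> where e: "\<epsilon> \<in> Arr D" "Dom D \<epsilon> = omap T r" "Cod D \<epsilon> = d" "\<epsilon> \<bullet>\<^bsub>D\<^esub> amap T c = \<xi>"
    using Tc(6)[of \<xi>] p f w c by (auto simp: Hom_iff Ts r_def)
  have eTc: "\<epsilon> \<bullet>\<^bsub>D\<^esub> amap T (c \<bullet> v) = \<xi> \<bullet>\<^bsub>D\<^esub> amap T v" if "v \<in> Arr C" "Cod C v = p" for v
  proof -
    have "\<epsilon> \<bullet>\<^bsub>D\<^esub> amap T (c \<bullet> v) = (\<epsilon> \<bullet>\<^bsub>D\<^esub> amap T c) \<bullet>\<^bsub>D\<^esub> amap T v"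
      using that c(1-3) w(2-4) f(9) e(1-3) by (simp add: Ts r_def)
    then show ?thesis unfolding e(4) .
  qed
  \<comment> \<open>Injectivity, in its linear form, and surjectivity of the comparison map Hom(x,
    r) -> Hom(T x, d).\<close>
  define G where "G x \<longleftrightarrow> (\<forall>u \<in> Hom C x r. \<epsilon> \<bullet>\<^bsub>D\<^esub> amap T u = HZero D (omap T x) d \<longrightarrow> u = HZero C x r) \<and>
    (\<forall>\<eta> \<in> Hom D (omap T x) d. \<exists>u \<in> Hom C x r. \<epsilon> \<bullet>\<^bsub>D\<^esub> amap T u = \<eta>)" for x
  have GP: "G P" unfolding G_def
  proof (intro conjI ballI impI)
    fix u assume u: "u \<in> Hom C P r" "\<epsilon> \<bullet>\<^bsub>D\<^esub> amap T u = HZero D (omap T P) d"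
    obtain v where v: "v \<in> Arr C" "Dom C v = P" "Cod C v = p" "c \<bullet> v = u"
      by (rule projective_lift[OF P_projective c(5), of u]) (use u c w f in \<open>auto simp: Hom_iff r_def\<close>)
    have "\<xi> \<bullet>\<^bsub>D\<^esub> amap T v = \<epsilon> \<bullet>\<^bsub>D\<^esub> amap T u" using eTc[OF v(1,3)] unfolding v(4) by simp
    then have "Q v" using u v by (simp add: Q_def)
    moreover have "v \<in> Hom C P p" using v by (simp add: Hom_iff)
    ultimately obtain t where t: "t \<in> Hom C P p'" "w \<bullet> t = v" using wc by blast
    have "c \<bullet> (i \<bullet> q) \<bullet> t = (c \<bullet> i) \<bullet> q \<bullet> t"
      using t(1) w(2-4) f(5-9) c(1-3) by (simp add: Hom_iff)
    then have "u = (c \<bullet> i) \<bullet> q \<bullet> t" unfolding f(10) t(2) v(4) .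
    also have "\<dots> = HZero C P r"
      unfolding c(4) using t(1) w(2-4) f(5-9) c(1-3) by (simp add: Hom_iff r_def)
    finally show "u = HZero C P r" .
  next
    fix \<eta> assume "\<eta> \<in> Hom D (omap T P) d"
    then obtain v where v: "v \<in> Hom C P p" "\<xi> \<bullet>\<^bsub>D\<^esub> amap T v = \<eta>" using pc by blast
    then show "\<exists>u\<in>Hom C P r. \<epsilon> \<bullet>\<^bsub>D\<^esub> amap T u = \<eta>"
      using eTc[of v] c(2,3) w(4) f(9) by (intro bexI[of _ "c \<bullet> v"]) (simp_all add: Hom_iff r_def)
  qed
  have Gs: "G x" if "sum_of C P x" for x
    using that
  proof induction
    case (zero z)
    have 1: "u = HZero C z r" if "u \<in> Hom C z r" for u
    proof -
      have "u = u \<bullet> Id C z" using that zero(1) by (simp add: Hom_iff)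
      then show ?thesis using that zero by (simp add: Hom_iff)
    qed
    have 2: "\<eta> = HZero D (omap T z) d" if "\<eta> \<in> Hom D (omap T z) d" for \<eta>
    proof -
      have "\<eta> = \<eta> \<bullet>\<^bsub>D\<^esub> amap T (Id C z)" using that zero(1) by (simp add: Hom_iff Ts)
      also have "\<dots> = HZero D (omap T z) d"
        unfolding zero(2) using that zero(1) Ts(2)[of z] by (simp add: Hom_iff Ts)
      finally show ?thesis .
    qed
    show ?case unfolding G_def using 1 2 zero e
      by (auto simp: Hom_iff Ts intro!: bexI[of _ "HZero C z r"])
  next
    case (plus x z i j a b)
    note bs = biprodD[OF plus(2)]
    show ?case unfolding G_def
    proof (intro conjI ballI impI)
      fix u assume u: "u \<in> Hom C z r" "\<epsilon> \<bullet>\<^bsub>D\<^esub> amap T u = HZero D (omap T z) d"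
      have "\<epsilon> \<bullet>\<^bsub>D\<^esub> amap T (u \<bullet> s) = HZero D (omap T (Dom C s)) d" if "s \<in> Arr C" "Cod C s = z" for s
      proof -
        have "\<epsilon> \<bullet>\<^bsub>D\<^esub> amap T (u \<bullet> s) = (\<epsilon> \<bullet>\<^bsub>D\<^esub> amap T u) \<bullet>\<^bsub>D\<^esub> amap T s"
          using u(1) that e(1-3) by (simp add: Hom_iff Ts)
        also have "\<dots> = HZero D (omap T (Dom C s)) d" using that d unfolding u(2) by (simp add: Ts)
        finally show ?thesis .
      qed
      then have "u \<bullet> i = HZero C x r" "u \<bullet> j = HZero C P r"
        using plus.IH GP bs u unfolding G_def by (simp_all add: Hom_iff)
      moreover have "u = u \<bullet> HAdd C (i \<bullet> a) (j \<bullet> b)" using bs u by (simp add: Hom_iff)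
      moreover have "u \<bullet> HAdd C (i \<bullet> a) (j \<bullet> b) = HAdd C ((u \<bullet> i) \<bullet> a) ((u \<bullet> j) \<bullet> b)"
        using bs(1-15) u by (simp add: Hom_iff comp_add_right)
      ultimately show "u = HZero C z r" using bs(1-15) u by simp
    next
      fix \<eta> assume h: "\<eta> \<in> Hom D (omap T z) d"
      have "\<eta> \<bullet>\<^bsub>D\<^esub> amap T i \<in> Hom D (omap T x) d" "\<eta> \<bullet>\<^bsub>D\<^esub> amap T j \<in> Hom D (omap T P) d"
        using h bs by (auto simp: Hom_iff Ts)
      then obtain u v where uv: "u \<in> Hom C x r" "v \<in> Hom C P r" "\<epsilon> \<bullet>\<^bsub>D\<^esub> amap T u = \<eta> \<bullet>\<^bsub>D\<^esub> amap T i"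
          "\<epsilon> \<bullet>\<^bsub>D\<^esub> amap T v = \<eta> \<bullet>\<^bsub>D\<^esub> amap T j"
        using plus.IH GP unfolding G_def by blast
      have "\<epsilon> \<bullet>\<^bsub>D\<^esub> amap T (HAdd C (u \<bullet> a) (v \<bullet> b)) = HAdd D ((\<epsilon> \<bullet>\<^bsub>D\<^esub> amap T u) \<bullet>\<^bsub>D\<^esub> amap T a) ((\<epsilon> \<bullet>\<^bsub>D\<^esub> amap T v) \<bullet>\<^bsub>D\<^esub> amap T b)"
        using uv(1,2) bs(1-15) e(1-3) by (simp add: Hom_iff Ts D.comp_add_right)
      also have "\<dots> = \<eta> \<bullet>\<^bsub>D\<^esub> amap T (HAdd C (i \<bullet> a) (j \<bullet> b))"
        unfolding uv(3,4) using h bs(1-15) by (simp add: Hom_iff Ts D.comp_add_right)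
      also have "\<dots> = \<eta>" unfolding bs(18) using h bs(3) by (simp add: Hom_iff Ts)
      finally show "\<exists>u\<in>Hom C z r. \<epsilon> \<bullet>\<^bsub>D\<^esub> amap T u = \<eta>"
        using uv(1,2) bs by (intro bexI[of _ "HAdd C (u \<bullet> a) (v \<bullet> b)"]) (auto simp: Hom_iff)
    qed
  qed
  have G0: "u = HZero C y r"
    if "sum_of C P y" "u \<in> Hom C y r" "\<epsilon> \<bullet>\<^bsub>D\<^esub> amap T u = HZero D (omap T y) d" for y u
    using Gs[OF that(1)] that(2,3) unfolding G_def by blast
  have G1: "\<exists>u\<in>Hom C y r. \<epsilon> \<bullet>\<^bsub>D\<^esub> amap T u = \<eta>" if "sum_of C P y" "\<eta> \<in> Hom D (omap T y) d" for y \<eta>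
    using Gs[OF that(1)] that(2) unfolding G_def by blast
  have "\<exists>!u. u \<in> Hom C x r \<and> \<epsilon> \<bullet>\<^bsub>D\<^esub> amap T u = \<xi>" if x: "x \<in> Ob C" and xi: "\<xi> \<in> Hom D (omap T x) d" for x \<xi>
  proof -
    \<comment> \<open>A presentation of x: w0 covers x and w1 covers the kernel of w0. The solution
      s found over p0 vanishes on that kernel, which injectivity at p1 detects, and so descends
      along w0.\<close>
    obtain p0 w0 where p0: "sum_of C P p0" "w0 \<in> Hom C p0 x" "is_epi C w0" using projective_cover[OF x] by blast
    obtain k where k: "short_exact C k w0" using epi_short_exact[OF p0(3)] by blast
    have ck: "is_cokernel C k w0" using k by (simp add: short_exact_def)
    note k' = is_cokernelD[OF ck] and Tk = D.is_cokernelD[OF rex[OF k]]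
    obtain p1 w1 where p1: "sum_of C P p1" "w1 \<in> Hom C p1 (Dom C k)" "is_epi C w1"
      using projective_cover[OF dom_Ob[OF k'(1)]] by blast
    have O: "p0 \<in> Ob C" "p1 \<in> Ob C" using p0 p1 sum_of_Ob by auto
    obtain s where s: "s \<in> Hom C p0 r" "\<epsilon> \<bullet>\<^bsub>D\<^esub> amap T s = \<xi> \<bullet>\<^bsub>D\<^esub> amap T w0"
      using G1[OF p0(1), of "\<xi> \<bullet>\<^bsub>D\<^esub> amap T w0"] xi p0(2) by (auto simp: Hom_iff Ts)
    have "\<epsilon> \<bullet>\<^bsub>D\<^esub> amap T ((s \<bullet> k) \<bullet> w1) = (\<epsilon> \<bullet>\<^bsub>D\<^esub> amap T s) \<bullet>\<^bsub>D\<^esub> amap T (k \<bullet> w1)"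
      using s(1) p0(2) p1(2) k'(1-3) e(1-3) by (simp add: Hom_iff Ts)
    also have "\<dots> = \<xi> \<bullet>\<^bsub>D\<^esub> amap T ((w0 \<bullet> k) \<bullet> w1)"
      unfolding s(2) using p0(2) p1(2) k'(1-3) xi by (simp add: Hom_iff Ts)
    also have "\<dots> = HZero D (omap T p1) d"
      unfolding k'(4) using p0(2) p1(2) k'(1-3) xi x O Ts(2)[of p1] Ts(2)[of x] by (simp add: Hom_iff Ts)
    finally have "(s \<bullet> k) \<bullet> w1 = HZero C p1 r"
      by (intro G0[OF p1(1)]) (use s(1) p0(2) p1(2) k'(1-3) in \<open>simp_all add: Hom_iff\<close>)
    then have "s \<bullet> k = HZero C (Dom C k) r"
      using epi_zeroD[OF p1(3), of "s \<bullet> k"] s(1) p0(2) p1(2) k'(1-3) by (simp add: Hom_iff del: comp_assoc')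
    then obtain u where u: "u \<in> Hom C x r" "u \<bullet> w0 = s"
      using k'(6)[of s] s(1) p0(2) k'(1-3) by (auto simp: Hom_iff)
    have "(\<epsilon> \<bullet>\<^bsub>D\<^esub> amap T u) \<bullet>\<^bsub>D\<^esub> amap T w0 = \<epsilon> \<bullet>\<^bsub>D\<^esub> amap T (u \<bullet> w0)"
      using u(1) p0(2) e(1-3) by (simp add: Hom_iff Ts)
    also have "\<dots> = \<xi> \<bullet>\<^bsub>D\<^esub> amap T w0" unfolding u(2) by (rule s(2))
    finally have eu: "\<epsilon> \<bullet>\<^bsub>D\<^esub> amap T u = \<xi>"
      by (rule D.epi_cancel[OF Tk(5), rotated -1]) (use u(1) p0(2) e(1-3) xi in \<open>auto simp: Hom_iff Ts\<close>)
    show ?thesis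
    proof (rule ex1I[of _ u])
      show "u \<in> Hom C x r \<and> \<epsilon> \<bullet>\<^bsub>D\<^esub> amap T u = \<xi>" using u eu by blast
      fix v assume v: "v \<in> Hom C x r \<and> \<epsilon> \<bullet>\<^bsub>D\<^esub> amap T v = \<xi>"
      let ?h = "hsub v u \<bullet> w0"
      have "\<epsilon> \<bullet>\<^bsub>D\<^esub> amap T (v \<bullet> w0) = (\<epsilon> \<bullet>\<^bsub>D\<^esub> amap T v) \<bullet>\<^bsub>D\<^esub> amap T w0" "\<epsilon> \<bullet>\<^bsub>D\<^esub> amap T (u \<bullet> w0) = (\<epsilon> \<bullet>\<^bsub>D\<^esub> amap T u) \<bullet>\<^bsub>D\<^esub> amap T w0"
        using conjunct1[OF v] u(1) p0(2) e(1-3) by (simp_all add: Hom_iff Ts)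
      then have same: "\<epsilon> \<bullet>\<^bsub>D\<^esub> amap T (v \<bullet> w0) = \<epsilon> \<bullet>\<^bsub>D\<^esub> amap T (u \<bullet> w0)" using eu v by simp
      have Tsub: "amap T (hsub f g) = D.hsub (amap T f) (amap T g)"
        if "f \<in> Arr C" "g \<in> Arr C" "Dom C f = Dom C g" "Cod C f = Cod C g" for f g
        using that by (simp add: hsub_def D.hsub_def Ts)
      have "\<epsilon> \<bullet>\<^bsub>D\<^esub> amap T (hsub (v \<bullet> w0) (u \<bullet> w0)) = D.hsub (\<epsilon> \<bullet>\<^bsub>D\<^esub> amap T (v \<bullet> w0)) (\<epsilon> \<bullet>\<^bsub>D\<^esub> amap T (u \<bullet> w0))"
        using v u(1) p0(2) e(1-3) by (simp add: Tsub Hom_iff D.comp_hsub_right Ts)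
      also have "\<dots> = HZero D (omap T p0) d"
        unfolding same using D.hsub_facts(1)[of "\<epsilon> \<bullet>\<^bsub>D\<^esub> amap T (u \<bullet> w0)" "\<epsilon> \<bullet>\<^bsub>D\<^esub> amap T (u \<bullet> w0)"] u(1) p0(2) e(1-3)
        by (simp add: Hom_iff Ts)
      finally have "hsub (v \<bullet> w0) (u \<bullet> w0) = HZero C p0 r"
        by (intro G0[OF p0(1)]) (use v u(1) p0(2) in \<open>simp_all add: Hom_iff\<close>)
      then have "v \<bullet> w0 = u \<bullet> w0"
        using hsub_facts(2)[of "v \<bullet> w0" "u \<bullet> w0"] v u(1) p0(2) by (simp add: Hom_iff)
      then show "v = u"
        by (rule epi_cancel[OF p0(3), rotated -1]) (use v u(1) p0(2) in \<open>auto simp: Hom_iff\<close>)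
    qed
  qed
  then show ?thesis using e by (intro exI[of _ r] exI[of _ \<epsilon>]) (auto simp: Hom_iff)
qed

end

section \<open>Finite-dimensional modules over an algebra\<close>

lemma (in left_module) zero_act [simp]: "v \<in> carrier V \<Longrightarrow> \<zero>\<^bsub>B\<^esub> \<odot>\<^bsub>V\<^esub> v = \<zero>\<^bsub>V\<^esub>"
  using act_l_distr[of "\<zero>\<^bsub>B\<^esub>" "\<zero>\<^bsub>B\<^esub>" v] act_closed[of "\<zero>\<^bsub>B\<^esub>" v] V.add.r_cancel_one'[of "\<zero>\<^bsub>B\<^esub> \<odot>\<^bsub>V\<^esub> v" "\<zero>\<^bsub>B\<^esub> \<odot>\<^bsub>V\<^esub> v"]
  by auto

lemma (in left_module) act_zero [simp]: "a \<in> carrier B \<Longrightarrow> a \<odot>\<^bsub>V\<^esub> \<zero>\<^bsub>V\<^esub> = \<zero>\<^bsub>V\<^esub>"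
  using act_r_distr[of a "\<zero>\<^bsub>V\<^esub>" "\<zero>\<^bsub>V\<^esub>"] act_closed[of a "\<zero>\<^bsub>V\<^esub>"] V.add.r_cancel_one'[of "a \<odot>\<^bsub>V\<^esub> \<zero>\<^bsub>V\<^esub>" "a \<odot>\<^bsub>V\<^esub> \<zero>\<^bsub>V\<^esub>"]
  by auto

lemma (in left_module) act_minus_one: "v \<in> carrier V \<Longrightarrow> (\<ominus>\<^bsub>B\<^esub> \<one>\<^bsub>B\<^esub>) \<odot>\<^bsub>V\<^esub> v = \<ominus>\<^bsub>V\<^esub> v"
proof -
  assume v: "v \<in> carrier V"
  have "(\<ominus>\<^bsub>B\<^esub> \<one>\<^bsub>B\<^esub>) \<odot>\<^bsub>V\<^esub> v \<oplus>\<^bsub>V\<^esub> v = (\<ominus>\<^bsub>B\<^esub> \<one>\<^bsub>B\<^esub> \<oplus>\<^bsub>B\<^esub> \<one>\<^bsub>B\<^esub>) \<odot>\<^bsub>V\<^esub> v"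
    using v by (simp add: act_l_distr act_one)
  also have "\<dots> = \<zero>\<^bsub>V\<^esub>" using v by (simp add: B.l_neg)
  finally show ?thesis using v by (simp add: V.minus_equality act_closed)
qed

text \<open>A subspace of W containing the images of the generators pulls back along f to a subspace
  of V containing the generators, hence to all of V.\<close>

lemma finite_dimensional_image:
  assumes V: "finite_dimensional K V" and W: "module K W" and f: "linear_map K V W f" "f ` carrier V = carrier W"
  shows "finite_dimensional K W"
proof -
  obtain S where S: "module K V" "finite S" "S \<subseteq> carrier V" "\<forall>U. submodule U K V \<and> S \<subseteq> U \<longrightarrow> U = carrier V"
    using V unfolding finite_dimensional_def by (elim exE conjE) (rule that)
  note fz = linear_map_zero[OF S(1) W f(1)]
  have mV: "\<zero>\<^bsub>V\<^esub> \<in> carrier V" "\<And>u v. u \<in> carrier V \<Longrightarrow> v \<in> carrier V \<Longrightarrow> u \<oplus>\<^bsub>V\<^esub> v \<in> carrier V"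
    "\<And>c u. c \<in> carrier K \<Longrightarrow> u \<in> carrier V \<Longrightarrow> c \<odot>\<^bsub>V\<^esub> u \<in> carrier V"
    using submodule_self[OF S(1)] unfolding submodule_iff[OF S(1)] by auto
  have "U = carrier W" if U: "submodule U K W" "f ` S \<subseteq> U" for U
  proof -
    note Ud = U(1)[unfolded submodule_iff[OF W]]
    have "submodule {v \<in> carrier V. f v \<in> U} K V"
      unfolding submodule_iff[OF S(1)] using Ud f(1) fz mV unfolding linear_map_def by auto
    moreover have "S \<subseteq> {v \<in> carrier V. f v \<in> U}" using U(2) S(3) by auto
    ultimately have "{v \<in> carrier V. f v \<in> U} = carrier V" using S(4) by blast
    then have "carrier W \<subseteq> U" unfolding f(2)[symmetric] by auto
    then show ?thesis using Ud by blast
  qed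
  moreover have "f ` S \<subseteq> carrier W" using S(3) f(2) by blast
  ultimately show ?thesis unfolding finite_dimensional_def using W S(2)
    by (intro conjI exI[of _ "f ` S"]) auto
qed

text \<open>Negation is not listed, since it is the action of minus one
  (\<open>act_minus_one\<close>).\<close>

definition lsub :: "('b, 'y) ring_scheme \<Rightarrow> ('b, 'v, 'z) module_scheme \<Rightarrow> 'v set \<Rightarrow> bool" where
  "lsub B V N \<longleftrightarrow> N \<subseteq> carrier V \<and> \<zero>\<^bsub>V\<^esub> \<in> N \<and> (\<forall>u\<in>N. \<forall>v\<in>N. u \<oplus>\<^bsub>V\<^esub> v \<in> N) \<and> (\<forall>b\<in>carrier B. \<forall>u\<in>N. b \<odot>\<^bsub>V\<^esub> u \<in> N)"

definition quot_rep :: "('b, 'v, 'z) module_scheme \<Rightarrow> 'v set \<Rightarrow> 'v \<Rightarrow> 'v" where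
  "quot_rep V N w = (SOME v. v \<in> carrier V \<and> w \<ominus>\<^bsub>V\<^esub> v \<in> N)"

text \<open>Quotients are carried by representatives, so that they stay within the same type.\<close>

definition quot_mod :: "('b, 'v) module \<Rightarrow> 'v set \<Rightarrow> ('b, 'v) module" where
  "quot_mod V N = \<lparr>carrier = quot_rep V N ` carrier V, monoid.mult = undefined, one = undefined,
     ring.zero = quot_rep V N \<zero>\<^bsub>V\<^esub>, add = (\<lambda>x y. quot_rep V N (x \<oplus>\<^bsub>V\<^esub> y)),
     smult = (\<lambda>b x. quot_rep V N (b \<odot>\<^bsub>V\<^esub> x))\<rparr>"

text \<open>Interleaving of two sequences: a pairing inside \<open>nat \<Rightarrow> 'k\<close>, so
  that products of modules stay in the type that \<open>finite_linear_category\<close>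
  prescribes.\<close>

definition enc :: "(nat \<Rightarrow> 'k) \<Rightarrow> (nat \<Rightarrow> 'k) \<Rightarrow> nat \<Rightarrow> 'k" where
  "enc f g = (\<lambda>n. if even n then f (n div 2) else g (n div 2))"

definition dec1 :: "(nat \<Rightarrow> 'k) \<Rightarrow> nat \<Rightarrow> 'k" where "dec1 h = (\<lambda>n. h (2 * n))"
definition dec2 :: "(nat \<Rightarrow> 'k) \<Rightarrow> nat \<Rightarrow> 'k" where "dec2 h = (\<lambda>n. h (2 * n + 1))"

lemma dec_enc [simp]: "dec1 (enc f g) = f" "dec2 (enc f g) = g"
  by (auto simp: enc_def dec1_def dec2_def)

lemma enc_eq_iff [simp]: "enc a b = enc c d \<longleftrightarrow> a = c \<and> b = d"
  by (metis dec_enc)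

definition prod_mod :: "('b, nat \<Rightarrow> 'k) module \<Rightarrow> ('b, nat \<Rightarrow> 'k) module \<Rightarrow> ('b, nat \<Rightarrow> 'k) module" where
  "prod_mod V W = \<lparr>carrier = {enc v w |v w. v \<in> carrier V \<and> w \<in> carrier W}, monoid.mult = undefined, one = undefined,
     ring.zero = enc \<zero>\<^bsub>V\<^esub> \<zero>\<^bsub>W\<^esub>, add = (\<lambda>x y. enc (dec1 x \<oplus>\<^bsub>V\<^esub> dec1 y) (dec2 x \<oplus>\<^bsub>W\<^esub> dec2 y)),
     smult = (\<lambda>b x. enc (b \<odot>\<^bsub>V\<^esub> dec1 x) (b \<odot>\<^bsub>W\<^esub> dec2 x))\<rparr>"

definition reg_mod :: "('k, 'b) module \<Rightarrow> ('b, 'b) module" where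
  "reg_mod B = \<lparr>carrier = carrier B, monoid.mult = undefined, one = undefined,
     ring.zero = \<zero>\<^bsub>B\<^esub>, add = add B, smult = monoid.mult B\<rparr>"

lemma underlying_simps [simp]:
  "carrier (underlying_space B V) = carrier V" "\<zero>\<^bsub>underlying_space B V\<^esub> = \<zero>\<^bsub>V\<^esub>"
  "(\<oplus>\<^bsub>underlying_space B V\<^esub>) = (\<oplus>\<^bsub>V\<^esub>)" "c \<odot>\<^bsub>underlying_space B V\<^esub> v = (c \<odot>\<^bsub>B\<^esub> \<one>\<^bsub>B\<^esub>) \<odot>\<^bsub>V\<^esub> v"
  by (simp_all add: underlying_space_def)

lemma abelian_group_cong:
  assumes "abelian_group V" "carrier W = carrier V" "(\<oplus>\<^bsub>W\<^esub>) = (\<oplus>\<^bsub>V\<^esub>)" "\<zero>\<^bsub>W\<^esub> = \<zero>\<^bsub>V\<^esub>"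
  shows "abelian_group W"
proof -
  interpret V: abelian_group V by fact
  show ?thesis
    by (rule abelian_groupI) (use assms V.a_closed V.a_assoc V.a_comm V.l_zero in \<open>auto intro: V.add.l_inv_ex\<close>)
qed

locale fd_alg =
  fixes K :: "'k ring" and B :: "('k, 'b) module"
  assumes field: "field K" and fdB: "fd_algebra K B"
begin

sublocale K: field K by (rule field)
sublocale B: ring B using fdB by (simp add: fd_algebra_def)

lemma B_module: "module K B" and B_fd: "finite_dimensional K B"
  using fdB by (simp_all add: fd_algebra_def finite_dimensional_def)

lemma scalar_closed [simp]: "c \<in> carrier K \<Longrightarrow> c \<odot>\<^bsub>B\<^esub> \<one>\<^bsub>B\<^esub> \<in> carrier B"
  using module.smult_closed[OF B_module] by simp

lemma scalar_mult: "\<lbrakk>c \<in> carrier K; b \<in> carrier B\<rbrakk> \<Longrightarrow> (c \<odot>\<^bsub>B\<^esub> \<one>\<^bsub>B\<^esub>) \<otimes>\<^bsub>B\<^esub> b = c \<odot>\<^bsub>B\<^esub> b"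
  using fdB unfolding fd_algebra_def by simp

lemma underlying_module:
  assumes "left_module B V" shows "module K (underlying_space B V)"
proof -
  interpret V: left_module B V by fact
  interpret Bm: module K B by (rule B_module)
  show ?thesis
  proof (rule moduleI)
    show "cring K" by (rule K.is_cring)
    show "abelian_group (underlying_space B V)"
      by (rule abelian_group_cong[OF V.V.abelian_group_axioms]) simp_all
    fix a b x assume a: "a \<in> carrier K" "b \<in> carrier K" "x \<in> carrier (underlying_space B V)"
    have "(a \<otimes>\<^bsub>K\<^esub> b) \<odot>\<^bsub>B\<^esub> \<one>\<^bsub>B\<^esub> = (a \<odot>\<^bsub>B\<^esub> \<one>\<^bsub>B\<^esub>) \<otimes>\<^bsub>B\<^esub> (b \<odot>\<^bsub>B\<^esub> \<one>\<^bsub>B\<^esub>)"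
      using a by (simp add: scalar_mult Bm.smult_assoc1)
    then show "(a \<otimes>\<^bsub>K\<^esub> b) \<odot>\<^bsub>underlying_space B V\<^esub> x = a \<odot>\<^bsub>underlying_space B V\<^esub> (b \<odot>\<^bsub>underlying_space B V\<^esub> x)"
      using a by (simp add: V.act_assoc)
    show "(a \<oplus>\<^bsub>K\<^esub> b) \<odot>\<^bsub>underlying_space B V\<^esub> x = a \<odot>\<^bsub>underlying_space B V\<^esub> x \<oplus>\<^bsub>underlying_space B V\<^esub> b \<odot>\<^bsub>underlying_space B V\<^esub> x"
      using a by (simp add: Bm.smult_l_distr V.act_l_distr)
  qed (auto simp: V.act_closed V.act_r_distr V.act_one)
qed

lemma lsub_submodule:
  assumes "left_module B V" "lsub B V N"
  shows "submodule N K (underlying_space B V)"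
  unfolding submodule_iff[OF underlying_module[OF assms(1)]] using assms(2) by (auto simp: lsub_def)

text \<open>The algebraic laws are inherited; finite dimension of the subspace is where the
  noetherian property of finite-dimensional spaces enters.\<close>

lemma sub_mod:
  assumes V: "V \<in> fd_modules K B" and N: "lsub B V N"
  shows "V\<lparr>carrier := N\<rparr> \<in> fd_modules K B"
proof -
  have lV: "left_module B V" and fV: "finite_dimensional K (underlying_space B V)"
    using V by (auto simp: fd_modules_def)
  interpret V: left_module B V by fact
  have Nd: "N \<subseteq> carrier V" "\<zero>\<^bsub>V\<^esub> \<in> N" "\<And>u v. u \<in> N \<Longrightarrow> v \<in> N \<Longrightarrow> u \<oplus>\<^bsub>V\<^esub> v \<in> N"
    "\<And>b u. b \<in> carrier B \<Longrightarrow> u \<in> N \<Longrightarrow> b \<odot>\<^bsub>V\<^esub> u \<in> N" using N unfolding lsub_def by auto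
  have neg: "\<ominus>\<^bsub>V\<^esub> u \<in> N" if "u \<in> N" for u
    using Nd(4)[of "\<ominus>\<^bsub>B\<^esub> \<one>\<^bsub>B\<^esub>" u] V.act_minus_one[of u] that Nd(1) by auto
  have ab: "abelian_group (V\<lparr>carrier := N\<rparr>)"
  proof (rule abelian_groupI)
    fix x assume x: "x \<in> carrier (V\<lparr>carrier := N\<rparr>)"
    then show "\<exists>y\<in>carrier (V\<lparr>carrier := N\<rparr>). y \<oplus>\<^bsub>V\<lparr>carrier := N\<rparr>\<^esub> x = \<zero>\<^bsub>V\<lparr>carrier := N\<rparr>\<^esub>"
      using neg[of x] Nd(1) by (intro bexI[of _ "\<ominus>\<^bsub>V\<^esub> x"]) (auto simp: V.V.l_neg)
  next
    fix x y assume "x \<in> carrier (V\<lparr>carrier := N\<rparr>)" "y \<in> carrier (V\<lparr>carrier := N\<rparr>)"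
    then show "x \<oplus>\<^bsub>V\<lparr>carrier := N\<rparr>\<^esub> y = y \<oplus>\<^bsub>V\<lparr>carrier := N\<rparr>\<^esub> x"
      using Nd(1) V.V.a_comm[of x y] by auto
  qed (use Nd in \<open>auto simp: V.V.a_assoc subset_iff\<close>)
  have l: "left_module B (V\<lparr>carrier := N\<rparr>)"
    by (intro left_module.intro left_module_axioms.intro ab B.ring_axioms)
      (use Nd in \<open>auto simp: V.act_l_distr V.act_r_distr V.act_assoc V.act_one subset_iff\<close>)
  have "fin_gen K (underlying_space B V) N"
    using finite_dimensional_noetherian[OF field fV] lsub_submodule[OF lV N] by (simp add: noetherian_space_def)
  then obtain S where S: "finite S" "S \<subseteq> N" "\<forall>U. submodule U K (underlying_space B V) \<and> S \<subseteq> U \<longrightarrow> N \<subseteq> U"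
    unfolding fin_gen_def by (elim exE conjE) (rule that)
  have "U = N" if "submodule U K (underlying_space B (V\<lparr>carrier := N\<rparr>))" "S \<subseteq> U" for U
  proof -
    note Ud = that(1)[unfolded submodule_iff[OF underlying_module[OF l]], simplified]
    have "submodule U K (underlying_space B V)"
      unfolding submodule_iff[OF underlying_module[OF lV]] using Ud Nd(1) by auto
    then show ?thesis using S(3) that(2) Ud by blast
  qed
  then have "finite_dimensional K (underlying_space B (V\<lparr>carrier := N\<rparr>))"
    unfolding finite_dimensional_def using underlying_module[OF l] S(1,2) by (intro conjI exI[of _ S]) auto
  then show ?thesis using l by (simp add: fd_modules_def)
qed

text \<open>Congruent vectors satisfy the same choice predicate and therefore receive the same
  representative. This makes \<open>quot_rep\<close> a normal form for cosets.\<close>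

lemma quot_rep:
  assumes V: "left_module B V" and N: "lsub B V N"
  shows "w \<in> carrier V \<Longrightarrow> quot_rep V N w \<in> carrier V"
    and "w \<in> carrier V \<Longrightarrow> w \<ominus>\<^bsub>V\<^esub> quot_rep V N w \<in> N"
    and "\<lbrakk>w \<in> carrier V; w' \<in> carrier V\<rbrakk> \<Longrightarrow> quot_rep V N w = quot_rep V N w' \<longleftrightarrow> w \<ominus>\<^bsub>V\<^esub> w' \<in> N"
proof -
  interpret V: left_module B V by fact
  have Nd: "N \<subseteq> carrier V" "\<zero>\<^bsub>V\<^esub> \<in> N" "\<And>u v. u \<in> N \<Longrightarrow> v \<in> N \<Longrightarrow> u \<oplus>\<^bsub>V\<^esub> v \<in> N"
    "\<And>b u. b \<in> carrier B \<Longrightarrow> u \<in> N \<Longrightarrow> b \<odot>\<^bsub>V\<^esub> u \<in> N" using N unfolding lsub_def by auto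
  have neg: "\<ominus>\<^bsub>V\<^esub> u \<in> N" if "u \<in> N" for u
    using Nd(4)[of "\<ominus>\<^bsub>B\<^esub> \<one>\<^bsub>B\<^esub>" u] V.act_minus_one[of u] that Nd(1) by auto
  have r: "quot_rep V N w \<in> carrier V \<and> w \<ominus>\<^bsub>V\<^esub> quot_rep V N w \<in> N" if "w \<in> carrier V" for w
    unfolding quot_rep_def
    by (rule someI[of "\<lambda>v. v \<in> carrier V \<and> w \<ominus>\<^bsub>V\<^esub> v \<in> N" w]) (use that Nd(2) in \<open>simp add: V.V.minus_eq V.V.r_neg\<close>)
  then show 1: "w \<in> carrier V \<Longrightarrow> quot_rep V N w \<in> carrier V"
    and 2: "w \<in> carrier V \<Longrightarrow> w \<ominus>\<^bsub>V\<^esub> quot_rep V N w \<in> N" for w by auto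
  have tr: "a \<ominus>\<^bsub>V\<^esub> c \<in> N" if "a \<ominus>\<^bsub>V\<^esub> b \<in> N" "b \<ominus>\<^bsub>V\<^esub> c \<in> N" "a \<in> carrier V" "b \<in> carrier V" "c \<in> carrier V" for a b c
  proof -
    have "(a \<ominus>\<^bsub>V\<^esub> b) \<oplus>\<^bsub>V\<^esub> (b \<ominus>\<^bsub>V\<^esub> c) = a \<ominus>\<^bsub>V\<^esub> c"
      using that(3-5) by (simp add: V.V.minus_eq V.V.a_assoc V.V.r_neg1)
    then show ?thesis using Nd(3)[OF that(1,2)] by simp
  qed
  have sy: "b \<ominus>\<^bsub>V\<^esub> a \<in> N" if "a \<ominus>\<^bsub>V\<^esub> b \<in> N" "a \<in> carrier V" "b \<in> carrier V" for a b
  proof -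
    have "\<ominus>\<^bsub>V\<^esub> (a \<ominus>\<^bsub>V\<^esub> b) = b \<ominus>\<^bsub>V\<^esub> a" using that(2,3) by (simp add: V.V.minus_eq V.V.minus_add V.V.a_comm)
    then show ?thesis using neg[OF that(1)] by simp
  qed
  assume w: "w \<in> carrier V" "w' \<in> carrier V"
  show "quot_rep V N w = quot_rep V N w' \<longleftrightarrow> w \<ominus>\<^bsub>V\<^esub> w' \<in> N"
  proof
    assume "quot_rep V N w = quot_rep V N w'"
    then have "w \<ominus>\<^bsub>V\<^esub> quot_rep V N w' \<in> N" using 2[OF w(1)] by simp
    then show "w \<ominus>\<^bsub>V\<^esub> w' \<in> N" using tr[OF _ sy[OF 2[OF w(2)]]] w 1 by blast
  next
    assume h: "w \<ominus>\<^bsub>V\<^esub> w' \<in> N"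
    have "(v \<in> carrier V \<and> w \<ominus>\<^bsub>V\<^esub> v \<in> N) = (v \<in> carrier V \<and> w' \<ominus>\<^bsub>V\<^esub> v \<in> N)" for v
      using tr[OF sy[OF h w]] tr[OF h] w by blast
    then show "quot_rep V N w = quot_rep V N w'" unfolding quot_rep_def by simp
  qed
qed

text \<open>Operations are computed in V and then normalised, so \<open>quot_rep\<close> itself is
  the quotient homomorphism and N its kernel. Finite dimension passes to the surjective
  image.\<close>

lemma quot_mod:
  assumes V: "V \<in> fd_modules K B" and N: "lsub B V N"
  shows "quot_mod V N \<in> fd_modules K B"
    and "u \<in> carrier V \<Longrightarrow> v \<in> carrier V \<Longrightarrow> quot_rep V N (u \<oplus>\<^bsub>V\<^esub> v) = quot_rep V N u \<oplus>\<^bsub>quot_mod V N\<^esub> quot_rep V N v"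
    and "b \<in> carrier B \<Longrightarrow> v \<in> carrier V \<Longrightarrow> quot_rep V N (b \<odot>\<^bsub>V\<^esub> v) = b \<odot>\<^bsub>quot_mod V N\<^esub> quot_rep V N v"
    and "v \<in> carrier V \<Longrightarrow> quot_rep V N v = \<zero>\<^bsub>quot_mod V N\<^esub> \<longleftrightarrow> v \<in> N"
proof -
  have lV: "left_module B V" and fV: "finite_dimensional K (underlying_space B V)"
    using V by (auto simp: fd_modules_def)
  interpret V: left_module B V by fact
  let ?r = "quot_rep V N"
  note r = quot_rep[OF lV N]
  have Nd: "N \<subseteq> carrier V" "\<And>u v. u \<in> N \<Longrightarrow> v \<in> N \<Longrightarrow> u \<oplus>\<^bsub>V\<^esub> v \<in> N"
    "\<And>b u. b \<in> carrier B \<Longrightarrow> u \<in> N \<Longrightarrow> b \<odot>\<^bsub>V\<^esub> u \<in> N" "\<zero>\<^bsub>V\<^esub> \<in> N" using N unfolding lsub_def by auto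
  have ra: "?r (?r u \<oplus>\<^bsub>V\<^esub> ?r v) = ?r (u \<oplus>\<^bsub>V\<^esub> v)" if "u \<in> carrier V" "v \<in> carrier V" for u v
  proof -
    have "(u \<ominus>\<^bsub>V\<^esub> ?r u) \<oplus>\<^bsub>V\<^esub> (v \<ominus>\<^bsub>V\<^esub> ?r v) = (u \<oplus>\<^bsub>V\<^esub> v) \<ominus>\<^bsub>V\<^esub> (?r u \<oplus>\<^bsub>V\<^esub> ?r v)"
      using that r(1) by (simp add: V.V.minus_eq V.V.minus_add V.V.a_ac)
    then show ?thesis using r(3)[of "u \<oplus>\<^bsub>V\<^esub> v" "?r u \<oplus>\<^bsub>V\<^esub> ?r v"] Nd(2)[OF r(2) r(2), OF that]
        r(1) that by simp
  qed
  have rr: "?r (?r u) = ?r u" if "u \<in> carrier V" for u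
    using r(3)[of u "?r u"] r(1,2) that by simp
  have ra1: "?r (?r u \<oplus>\<^bsub>V\<^esub> v) = ?r (u \<oplus>\<^bsub>V\<^esub> v)" "?r (v \<oplus>\<^bsub>V\<^esub> ?r u) = ?r (v \<oplus>\<^bsub>V\<^esub> u)"
    if "u \<in> carrier V" "v \<in> carrier V" for u v
    using ra[of "?r u" v] ra[of u v] ra[of v "?r u"] ra[of v u] rr r(1) that by simp_all
  have rb: "?r (b \<odot>\<^bsub>V\<^esub> ?r v) = ?r (b \<odot>\<^bsub>V\<^esub> v)" if "b \<in> carrier B" "v \<in> carrier V" for b v
  proof -
    have "b \<odot>\<^bsub>V\<^esub> (v \<ominus>\<^bsub>V\<^esub> ?r v) = b \<odot>\<^bsub>V\<^esub> v \<ominus>\<^bsub>V\<^esub> b \<odot>\<^bsub>V\<^esub> ?r v"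
    proof -
      have "b \<odot>\<^bsub>V\<^esub> (v \<ominus>\<^bsub>V\<^esub> ?r v) \<oplus>\<^bsub>V\<^esub> b \<odot>\<^bsub>V\<^esub> ?r v = b \<odot>\<^bsub>V\<^esub> v"
        using that r(1) by (simp add: V.act_r_distr[symmetric] V.V.minus_eq V.V.a_assoc V.V.l_neg)
      then show ?thesis using that r(1) by (metis V.V.add.inv_solve_right V.act_closed V.V.minus_closed V.V.minus_eq)
    qed
    then show ?thesis using r(3)[of "b \<odot>\<^bsub>V\<^esub> v" "b \<odot>\<^bsub>V\<^esub> ?r v"] Nd(3)[OF that(1) r(2)[OF that(2)]]
        r(1) that by (simp add: V.act_closed)
  qed
  have qs [simp]: "carrier (quot_mod V N) = ?r ` carrier V" "\<zero>\<^bsub>quot_mod V N\<^esub> = ?r \<zero>\<^bsub>V\<^esub>"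
    "x \<oplus>\<^bsub>quot_mod V N\<^esub> y = ?r (x \<oplus>\<^bsub>V\<^esub> y)" "b \<odot>\<^bsub>quot_mod V N\<^esub> x = ?r (b \<odot>\<^bsub>V\<^esub> x)" for x y b
    by (simp_all add: quot_mod_def)
  show add: "?r (u \<oplus>\<^bsub>V\<^esub> v) = ?r u \<oplus>\<^bsub>quot_mod V N\<^esub> ?r v" if "u \<in> carrier V" "v \<in> carrier V" for u v
    using that by (simp add: ra)
  show act: "?r (b \<odot>\<^bsub>V\<^esub> v) = b \<odot>\<^bsub>quot_mod V N\<^esub> ?r v" if "b \<in> carrier B" "v \<in> carrier V" for b v
    using that by (simp add: rb)
  show "v \<in> carrier V \<Longrightarrow> ?r v = \<zero>\<^bsub>quot_mod V N\<^esub> \<longleftrightarrow> v \<in> N"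
    using r(3)[of v "\<zero>\<^bsub>V\<^esub>"] V.V.add.inv_one by (simp add: V.V.minus_eq a_inv_def)
  have ab: "abelian_group (quot_mod V N)"
  proof (rule abelian_groupI)
    fix x assume "x \<in> carrier (quot_mod V N)"
    then obtain u where u: "x = ?r u" "u \<in> carrier V" by auto
    show "\<exists>y\<in>carrier (quot_mod V N). y \<oplus>\<^bsub>quot_mod V N\<^esub> x = \<zero>\<^bsub>quot_mod V N\<^esub>"
      using u by (intro bexI[of _ "?r (\<ominus>\<^bsub>V\<^esub> u)"]) (simp_all add: ra V.V.l_neg)
  next
    fix x y assume "x \<in> carrier (quot_mod V N)" "y \<in> carrier (quot_mod V N)"
    then obtain u v where "x = ?r u" "u \<in> carrier V" "y = ?r v" "v \<in> carrier V" by auto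
    then show "x \<oplus>\<^bsub>quot_mod V N\<^esub> y = y \<oplus>\<^bsub>quot_mod V N\<^esub> x" by (simp add: ra V.V.a_comm[of u])
  qed (auto simp: r(1) ra ra1 rr V.V.a_assoc)
  have rab: "?r (a \<odot>\<^bsub>V\<^esub> ?r x \<oplus>\<^bsub>V\<^esub> b \<odot>\<^bsub>V\<^esub> ?r x) = ?r (a \<odot>\<^bsub>V\<^esub> x \<oplus>\<^bsub>V\<^esub> b \<odot>\<^bsub>V\<^esub> x)"
    and rbb: "?r (a \<odot>\<^bsub>V\<^esub> (b \<odot>\<^bsub>V\<^esub> ?r x)) = ?r (a \<odot>\<^bsub>V\<^esub> (b \<odot>\<^bsub>V\<^esub> x))"
    if "a \<in> carrier B" "b \<in> carrier B" "x \<in> carrier V" for a b x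
    using ra[of "a \<odot>\<^bsub>V\<^esub> ?r x" "b \<odot>\<^bsub>V\<^esub> ?r x"] ra[of "a \<odot>\<^bsub>V\<^esub> x" "b \<odot>\<^bsub>V\<^esub> x"]
      rb[of a "b \<odot>\<^bsub>V\<^esub> ?r x"] rb[of a "b \<odot>\<^bsub>V\<^esub> x"] rb[of a x] rb[of b x] r(1)[of x] that V.act_closed
    by simp_all
  have l: "left_module B (quot_mod V N)"
    by (intro left_module.intro left_module_axioms.intro ab B.ring_axioms)
      (auto simp: r(1) rr ra rb ra1 rab rbb V.act_closed V.act_l_distr V.act_r_distr V.act_assoc V.act_one)
  have lm: "linear_map K (underlying_space B V) (underlying_space B (quot_mod V N)) ?r"
    using add act by (auto simp: linear_map_def)
  have "finite_dimensional K (underlying_space B (quot_mod V N))"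
    by (rule finite_dimensional_image[OF fV underlying_module[OF l] lm]) simp
  then show "quot_mod V N \<in> fd_modules K B" using l by (simp add: fd_modules_def)
qed

lemma reg_mod:
  shows "reg_mod B \<in> fd_modules K B"
proof -
  have rs [simp]: "carrier (reg_mod B) = carrier B" "(\<oplus>\<^bsub>reg_mod B\<^esub>) = (\<oplus>\<^bsub>B\<^esub>)" "\<zero>\<^bsub>reg_mod B\<^esub> = \<zero>\<^bsub>B\<^esub>"
     "(\<odot>\<^bsub>reg_mod B\<^esub>) = (\<otimes>\<^bsub>B\<^esub>)" by (simp_all add: reg_mod_def)
  have ab: "abelian_group (reg_mod B)"
    by (rule abelian_group_cong[OF B.abelian_group_axioms]) simp_all
  have l: "left_module B (reg_mod B)"
    by (intro left_module.intro left_module_axioms.intro ab B.ring_axioms) (auto simp: B.m_assoc B.l_distr B.r_distr)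
  have "linear_map K B (underlying_space B (reg_mod B)) (\<lambda>x. x)"
    by (auto simp: linear_map_def scalar_mult)
  then have "finite_dimensional K (underlying_space B (reg_mod B))"
    by (rule finite_dimensional_image[OF B_fd underlying_module[OF l]]) simp
  then show ?thesis using l by (simp add: fd_modules_def)
qed

end

lemma prod_mod_simps [simp]:
  "carrier (prod_mod V W) = {enc v w |v w. v \<in> carrier V \<and> w \<in> carrier W}"
  "\<zero>\<^bsub>prod_mod V W\<^esub> = enc \<zero>\<^bsub>V\<^esub> \<zero>\<^bsub>W\<^esub>"
  "x \<oplus>\<^bsub>prod_mod V W\<^esub> y = enc (dec1 x \<oplus>\<^bsub>V\<^esub> dec1 y) (dec2 x \<oplus>\<^bsub>W\<^esub> dec2 y)"
  "b \<odot>\<^bsub>prod_mod V W\<^esub> x = enc (b \<odot>\<^bsub>V\<^esub> dec1 x) (b \<odot>\<^bsub>W\<^esub> dec2 x)"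
  by (simp_all add: prod_mod_def)

lemma (in fd_alg) prod_mod:
  fixes V W :: "('b, nat \<Rightarrow> 'v) module"
  assumes V: "V \<in> fd_modules K B" and W: "W \<in> fd_modules K B"
  shows "prod_mod V W \<in> fd_modules K B"
proof -
  have lV: "left_module B V" and fV: "finite_dimensional K (underlying_space B V)"
    and lW: "left_module B W" and fW: "finite_dimensional K (underlying_space B W)"
    using V W by (auto simp: fd_modules_def)
  interpret V: left_module B V by fact
  interpret W: left_module B W by fact
  have ab: "abelian_group (prod_mod V W)"
  proof (rule abelian_groupI)
    fix x assume "x \<in> carrier (prod_mod V W)"
    then obtain v w where vw: "x = enc v w" "v \<in> carrier V" "w \<in> carrier W" by auto
    show "\<exists>y\<in>carrier (prod_mod V W). y \<oplus>\<^bsub>prod_mod V W\<^esub> x = \<zero>\<^bsub>prod_mod V W\<^esub>"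
      using vw by (intro bexI[of _ "enc (\<ominus>\<^bsub>V\<^esub> v) (\<ominus>\<^bsub>W\<^esub> w)"]) (auto simp: V.V.l_neg W.V.l_neg)
  next
    fix x y assume "x \<in> carrier (prod_mod V W)" "y \<in> carrier (prod_mod V W)"
    then show "x \<oplus>\<^bsub>prod_mod V W\<^esub> y = y \<oplus>\<^bsub>prod_mod V W\<^esub> x" by (auto simp: V.V.a_comm W.V.a_comm)
  qed (auto simp: V.V.a_assoc W.V.a_assoc)
  have l: "left_module B (prod_mod V W)"
    by (intro left_module.intro left_module_axioms.intro ab B.ring_axioms)
      (auto simp: V.act_closed V.act_l_distr V.act_r_distr V.act_assoc V.act_one
        W.act_closed W.act_l_distr W.act_r_distr W.act_assoc W.act_one)
  obtain S where S: "finite S" "S \<subseteq> carrier V" "\<forall>U. submodule U K (underlying_space B V) \<and> S \<subseteq> U \<longrightarrow> U = carrier V"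
    using fV unfolding finite_dimensional_def by (elim exE conjE) (rule that, simp_all)
  obtain T where T: "finite T" "T \<subseteq> carrier W" "\<forall>U. submodule U K (underlying_space B W) \<and> T \<subseteq> U \<longrightarrow> U = carrier W"
    using fW unfolding finite_dimensional_def by (elim exE conjE) (rule that, simp_all)
  \<comment> \<open>Generators of both factors, padded with zeros. A subspace containing them
    contains each factor separately, hence all sums.\<close>
  let ?S = "(\<lambda>s. enc s \<zero>\<^bsub>W\<^esub>) ` S \<union> enc \<zero>\<^bsub>V\<^esub> ` T"
  have "U = carrier (prod_mod V W)"
    if U: "submodule U K (underlying_space B (prod_mod V W))" "?S \<subseteq> U" for U
  proof -
    note Ud = U(1)[unfolded submodule_iff[OF underlying_module[OF l]], simplified]
    have U0: "enc \<zero>\<^bsub>V\<^esub> \<zero>\<^bsub>W\<^esub> \<in> U" using Ud by auto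
    have Ua: "enc (dec1 u \<oplus>\<^bsub>V\<^esub> dec1 v) (dec2 u \<oplus>\<^bsub>W\<^esub> dec2 v) \<in> U" if "u \<in> U" "v \<in> U" for u v
      using Ud that by auto
    have Uc: "enc ((c \<odot>\<^bsub>B\<^esub> \<one>\<^bsub>B\<^esub>) \<odot>\<^bsub>V\<^esub> dec1 u) ((c \<odot>\<^bsub>B\<^esub> \<one>\<^bsub>B\<^esub>) \<odot>\<^bsub>W\<^esub> dec2 u) \<in> U" if "u \<in> U" "c \<in> carrier K" for u c
      using Ud that by auto
    have "enc (u \<oplus>\<^bsub>V\<^esub> v) \<zero>\<^bsub>W\<^esub> \<in> U" if "enc u \<zero>\<^bsub>W\<^esub> \<in> U" "enc v \<zero>\<^bsub>W\<^esub> \<in> U" for u v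
      using Ua[OF that] by simp
    moreover have "enc ((c \<odot>\<^bsub>B\<^esub> \<one>\<^bsub>B\<^esub>) \<odot>\<^bsub>V\<^esub> u) \<zero>\<^bsub>W\<^esub> \<in> U" if "enc u \<zero>\<^bsub>W\<^esub> \<in> U" "c \<in> carrier K" for u c
      using Uc[OF that] that(2) by simp
    ultimately have "submodule {v \<in> carrier V. enc v \<zero>\<^bsub>W\<^esub> \<in> U} K (underlying_space B V)"
      unfolding submodule_iff[OF underlying_module[OF lV]] using U0 by (auto simp: V.act_closed)
    then have 1: "{v \<in> carrier V. enc v \<zero>\<^bsub>W\<^esub> \<in> U} = carrier V"
      using S(2) U(2) by (intro S(3)[rule_format]) auto
    have "enc \<zero>\<^bsub>V\<^esub> (u \<oplus>\<^bsub>W\<^esub> v) \<in> U" if "enc \<zero>\<^bsub>V\<^esub> u \<in> U" "enc \<zero>\<^bsub>V\<^esub> v \<in> U" for u v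
      using Ua[OF that] by simp
    moreover have "enc \<zero>\<^bsub>V\<^esub> ((c \<odot>\<^bsub>B\<^esub> \<one>\<^bsub>B\<^esub>) \<odot>\<^bsub>W\<^esub> u) \<in> U" if "enc \<zero>\<^bsub>V\<^esub> u \<in> U" "c \<in> carrier K" for u c
      using Uc[OF that] that(2) by simp
    ultimately have "submodule {v \<in> carrier W. enc \<zero>\<^bsub>V\<^esub> v \<in> U} K (underlying_space B W)"
      unfolding submodule_iff[OF underlying_module[OF lW]] using U0 by (auto simp: W.act_closed)
    then have 2: "{v \<in> carrier W. enc \<zero>\<^bsub>V\<^esub> v \<in> U} = carrier W"
      using T(2) U(2) by (intro T(3)[rule_format]) auto
    have "enc v w \<in> U" if "v \<in> carrier V" "w \<in> carrier W" for v w
      using Ua[of "enc v \<zero>\<^bsub>W\<^esub>" "enc \<zero>\<^bsub>V\<^esub> w"] 1 2 that by auto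
    then show ?thesis using Ud by auto
  qed
  moreover have "?S \<subseteq> carrier (prod_mod V W)" using S(2) T(2) by auto
  ultimately have "finite_dimensional K (underlying_space B (prod_mod V W))"
    unfolding finite_dimensional_def using underlying_module[OF l] S(1) T(1)
    by (intro conjI exI[of _ ?S]) auto
  then show ?thesis using l by (simp add: fd_modules_def)
qed

section \<open>Abelian structure and projective generator of a category of modules, seen from
  inside\<close>

text \<open>A linear category whose arrows are, fully and faithfully, the homomorphisms between modules
  \<open>V x\<close>, every finite-dimensional module being isomorphic to some \<open>V x\<close>.\<close>

locale module_like = fd_alg K B + linear_category K C
  for K :: "'k ring" and B :: "('k, nat \<Rightarrow> 'k) module"
    and C :: "('o, 'm, 'k, 'z) lincat_scheme" (structure) +
  fixes V :: "'o \<Rightarrow> (nat \<Rightarrow> 'k, nat \<Rightarrow> 'k) module" and U :: "'m \<Rightarrow> (nat \<Rightarrow> 'k) \<Rightarrow> nat \<Rightarrow> 'k"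
  assumes V_fd: "x \<in> Ob C \<Longrightarrow> V x \<in> fd_modules K B"
    and U_hom: "f \<in> Arr C \<Longrightarrow> U f \<in> module_homs B (V (Dom C f)) (V (Cod C f))"
    and U_id: "\<lbrakk>x \<in> Ob C; v \<in> carrier (V x)\<rbrakk> \<Longrightarrow> U (Id C x) v = v"
    and U_comp: "\<lbrakk>f \<in> Arr C; g \<in> Arr C; Dom C g = Cod C f; v \<in> carrier (V (Dom C f))\<rbrakk>
      \<Longrightarrow> U (g \<bullet> f) v = U g (U f v)"
    and U_zero: "\<lbrakk>x \<in> Ob C; y \<in> Ob C; v \<in> carrier (V x)\<rbrakk> \<Longrightarrow> U (HZero C x y) v = \<zero>\<^bsub>V y\<^esub>"
    and U_add: "\<lbrakk>f \<in> Arr C; g \<in> Arr C; Dom C f = Dom C g; Cod C f = Cod C g; v \<in> carrier (V (Dom C f))\<rbrakk>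
      \<Longrightarrow> U (HAdd C f g) v = U f v \<oplus>\<^bsub>V (Cod C f)\<^esub> U g v"
    and U_smult: "\<lbrakk>f \<in> Arr C; c \<in> carrier K; v \<in> carrier (V (Dom C f))\<rbrakk>
      \<Longrightarrow> U (HSmult C c f) v = (c \<odot>\<^bsub>B\<^esub> \<one>\<^bsub>B\<^esub>) \<odot>\<^bsub>V (Cod C f)\<^esub> U f v"
    and faithful: "\<lbrakk>f \<in> Arr C; g \<in> Arr C; Dom C f = Dom C g; Cod C f = Cod C g;
      \<And>v. v \<in> carrier (V (Dom C f)) \<Longrightarrow> U f v = U g v\<rbrakk> \<Longrightarrow> f = g"
    and full: "\<lbrakk>x \<in> Ob C; y \<in> Ob C; h \<in> module_homs B (V x) (V y)\<rbrakk> \<Longrightarrow> \<exists>f \<in> Hom C x y. U f = h"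
    and realize: "W \<in> fd_modules K B \<Longrightarrow> \<exists>x \<in> Ob C. \<exists>i \<in> module_homs B (V x) W. bij_betw i (carrier (V x)) (carrier W)"
begin

lemma V_left: "x \<in> Ob C \<Longrightarrow> left_module B (V x)"
  and V_fin: "x \<in> Ob C \<Longrightarrow> finite_dimensional K (underlying_space B (V x))"
  using V_fd[of x] by (simp_all add: fd_modules_def)

lemma V_ops [simp]:
  assumes "x \<in> Ob C"
  shows "\<zero>\<^bsub>V x\<^esub> \<in> carrier (V x)"
    "\<lbrakk>u \<in> carrier (V x); v \<in> carrier (V x)\<rbrakk> \<Longrightarrow> u \<oplus>\<^bsub>V x\<^esub> v \<in> carrier (V x)"
    "\<lbrakk>b \<in> carrier B; v \<in> carrier (V x)\<rbrakk> \<Longrightarrow> b \<odot>\<^bsub>V x\<^esub> v \<in> carrier (V x)"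
    "v \<in> carrier (V x) \<Longrightarrow> v \<oplus>\<^bsub>V x\<^esub> \<zero>\<^bsub>V x\<^esub> = v" "v \<in> carrier (V x) \<Longrightarrow> \<zero>\<^bsub>V x\<^esub> \<oplus>\<^bsub>V x\<^esub> v = v"
proof -
  interpret left_module B "V x" by (rule V_left[OF assms])
  show "\<zero>\<^bsub>V x\<^esub> \<in> carrier (V x)"
    "\<lbrakk>u \<in> carrier (V x); v \<in> carrier (V x)\<rbrakk> \<Longrightarrow> u \<oplus>\<^bsub>V x\<^esub> v \<in> carrier (V x)"
    "\<lbrakk>b \<in> carrier B; v \<in> carrier (V x)\<rbrakk> \<Longrightarrow> b \<odot>\<^bsub>V x\<^esub> v \<in> carrier (V x)"
    "v \<in> carrier (V x) \<Longrightarrow> v \<oplus>\<^bsub>V x\<^esub> \<zero>\<^bsub>V x\<^esub> = v" "v \<in> carrier (V x) \<Longrightarrow> \<zero>\<^bsub>V x\<^esub> \<oplus>\<^bsub>V x\<^esub> v = v"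
    using act_closed by auto
qed

lemma U_in [simp]: "\<lbrakk>f \<in> Arr C; v \<in> carrier (V (Dom C f))\<rbrakk> \<Longrightarrow> U f v \<in> carrier (V (Cod C f))"
  and U_hom_add: "\<lbrakk>f \<in> Arr C; u \<in> carrier (V (Dom C f)); v \<in> carrier (V (Dom C f))\<rbrakk>
    \<Longrightarrow> U f (u \<oplus>\<^bsub>V (Dom C f)\<^esub> v) = U f u \<oplus>\<^bsub>V (Cod C f)\<^esub> U f v"
  and U_hom_act: "\<lbrakk>f \<in> Arr C; b \<in> carrier B; v \<in> carrier (V (Dom C f))\<rbrakk>
    \<Longrightarrow> U f (b \<odot>\<^bsub>V (Dom C f)\<^esub> v) = b \<odot>\<^bsub>V (Cod C f)\<^esub> U f v"
  using U_hom[of f] by (auto simp: module_homs_def)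

lemma U_at_zero [simp]: "f \<in> Arr C \<Longrightarrow> U f \<zero>\<^bsub>V (Dom C f)\<^esub> = \<zero>\<^bsub>V (Cod C f)\<^esub>"
proof -
  assume f: "f \<in> Arr C"
  interpret W: left_module B "V (Cod C f)" by (rule V_left) (simp add: f)
  interpret X: left_module B "V (Dom C f)" by (rule V_left) (simp add: f)
  show ?thesis using U_hom_act[of f "\<zero>\<^bsub>B\<^esub>" "\<zero>\<^bsub>V (Dom C f)\<^esub>"] f by simp
qed

lemma U_eq_iff_sub:
  assumes "f \<in> Arr C" "u \<in> carrier (V (Dom C f))" "v \<in> carrier (V (Dom C f))" "U f u = U f v"
  shows "\<exists>w \<in> carrier (V (Dom C f)). U f w = \<zero>\<^bsub>V (Cod C f)\<^esub> \<and> u = v \<oplus>\<^bsub>V (Dom C f)\<^esub> w"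
proof -
  interpret X: left_module B "V (Dom C f)" by (rule V_left) (simp add: assms)
  interpret Y: left_module B "V (Cod C f)" by (rule V_left) (simp add: assms)
  let ?w = "\<ominus>\<^bsub>V (Dom C f)\<^esub> v \<oplus>\<^bsub>V (Dom C f)\<^esub> u"
  have "U f ?w = U f (\<ominus>\<^bsub>V (Dom C f)\<^esub> v) \<oplus>\<^bsub>V (Cod C f)\<^esub> U f v"
    using assms by (simp add: U_hom_add)
  also have "\<dots> = U f (\<ominus>\<^bsub>V (Dom C f)\<^esub> v \<oplus>\<^bsub>V (Dom C f)\<^esub> v)" using assms by (simp add: U_hom_add)
  also have "\<dots> = \<zero>\<^bsub>V (Cod C f)\<^esub>" using assms by (simp add: X.V.l_neg)
  finally show ?thesis using assms by (intro bexI[of _ ?w]) (simp_all add: X.V.r_neg2)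
qed

lemma U_inj:
  assumes "f \<in> Arr C" "\<And>v. v \<in> carrier (V (Dom C f)) \<Longrightarrow> U f v = \<zero>\<^bsub>V (Cod C f)\<^esub> \<Longrightarrow> v = \<zero>\<^bsub>V (Dom C f)\<^esub>"
  shows "inj_on (U f) (carrier (V (Dom C f)))"
proof (rule inj_onI)
  fix u v assume uv: "u \<in> carrier (V (Dom C f))" "v \<in> carrier (V (Dom C f))" "U f u = U f v"
  obtain w where "w \<in> carrier (V (Dom C f))" "U f w = \<zero>\<^bsub>V (Cod C f)\<^esub>" "u = v \<oplus>\<^bsub>V (Dom C f)\<^esub> w"
    using U_eq_iff_sub[OF assms(1) uv] by blast
  then show "u = v" using assms(2)[of w] uv assms(1) by simp
qed

lemma module_hom_comp:
  assumes "f \<in> module_homs B M1 M2" "g \<in> module_homs B M2 M3" "left_module B M1"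
  shows "(\<lambda>v \<in> carrier M1. g (f v)) \<in> module_homs B M1 M3"
proof -
  interpret left_module B M1 by fact
  have fin: "f v \<in> carrier M2" if "v \<in> carrier M1" for v using assms(1) that by (auto simp: module_homs_def)
  show ?thesis using assms(1,2) act_closed fin by (auto simp: module_homs_def)
qed

lemma module_hom_inv:
  assumes i: "i \<in> module_homs B M1 M2" "bij_betw i (carrier M1) (carrier M2)"
    and X: "left_module B M1" and Y: "left_module B M2"
  shows "(\<lambda>w \<in> carrier M2. inv_into (carrier M1) i w) \<in> module_homs B M2 M1"
proof -
  interpret X: left_module B M1 by fact
  interpret Y: left_module B M2 by fact
  let ?j = "inv_into (carrier M1) i"
  have j: "?j w \<in> carrier M1" "i (?j w) = w" if "w \<in> carrier M2" for w
    using that i(2) bij_betw_inv_into_right inv_into_into by (metis bij_betw_imp_surj_on)+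
  have ji: "?j (i v) = v" if "v \<in> carrier M1" for v using that i(2) by (simp add: bij_betw_inv_into_left)
  have hom: "i (u \<oplus>\<^bsub>M1\<^esub> v) = i u \<oplus>\<^bsub>M2\<^esub> i v" "b \<in> carrier B \<Longrightarrow> i (b \<odot>\<^bsub>M1\<^esub> v) = b \<odot>\<^bsub>M2\<^esub> i v"
    if "u \<in> carrier M1" "v \<in> carrier M1" for u v b
    using i(1) that unfolding module_homs_def by blast+
  have "?j (u \<oplus>\<^bsub>M2\<^esub> v) = ?j u \<oplus>\<^bsub>M1\<^esub> ?j v" if "u \<in> carrier M2" "v \<in> carrier M2" for u v
    using hom(1)[of "?j u" "?j v"] ji[of "?j u \<oplus>\<^bsub>M1\<^esub> ?j v"] j that by simp
  moreover have "?j (b \<odot>\<^bsub>M2\<^esub> v) = b \<odot>\<^bsub>M1\<^esub> ?j v" if "b \<in> carrier B" "v \<in> carrier M2" for b v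
    using hom(2)[of "?j v" "?j v" b] ji[of "b \<odot>\<^bsub>M1\<^esub> ?j v"] j that X.act_closed by simp
  ultimately show ?thesis using j Y.act_closed by (auto simp: module_homs_def)
qed

text \<open>\<open>realize\<close> turns the submodule into an object, and \<open>full\<close> turns
  the resulting injection into an arrow.\<close>

lemma sub_ob:
  assumes x: "x \<in> Ob C" and N: "lsub B (V x) N"
  obtains k where "k \<in> Arr C" "Cod C k = x" "inj_on (U k) (carrier (V (Dom C k)))"
    "U k ` carrier (V (Dom C k)) = N"
proof -
  let ?W = "(V x)\<lparr>carrier := N\<rparr>"
  obtain z i where z: "z \<in> Ob C" "i \<in> module_homs B (V z) ?W" "bij_betw i (carrier (V z)) (carrier ?W)"
    using realize[OF sub_mod[OF V_fd[OF x] N]] by blast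
  have "N \<subseteq> carrier (V x)" using N by (simp add: lsub_def)
  then have "i \<in> module_homs B (V z) (V x)" using z(2) by (auto simp: module_homs_def PiE_def)
  then obtain k where k: "k \<in> Hom C z x" "U k = i" using full[OF z(1) x] by blast
  show thesis by (rule that[of k]) (use k z(3) in \<open>auto simp: Hom_iff bij_betw_def\<close>)
qed

text \<open>The quotient map is followed by the inverse of the isomorphism from the realizing
  object; both are homomorphisms, so \<open>full\<close> applies to the composite.\<close>

lemma quot_ob:
  assumes x: "x \<in> Ob C" and N: "lsub B (V x) N"
  obtains q where "q \<in> Arr C" "Dom C q = x" "U q ` carrier (V x) = carrier (V (Cod C q))"
    "\<forall>v \<in> carrier (V x). U q v = \<zero>\<^bsub>V (Cod C q)\<^esub> \<longleftrightarrow> v \<in> N"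
proof -
  let ?W = "quot_mod (V x) N" and ?r = "quot_rep (V x) N"
  note Q = quot_mod[OF V_fd[OF x] N]
  have lW: "left_module B ?W" using Q(1) by (simp add: fd_modules_def)
  obtain z i where z: "z \<in> Ob C" "i \<in> module_homs B (V z) ?W" "bij_betw i (carrier (V z)) (carrier ?W)"
    using realize[OF Q(1)] by blast
  let ?j = "\<lambda>w \<in> carrier ?W. inv_into (carrier (V z)) i w"
  have j: "?j \<in> module_homs B ?W (V z)" by (rule module_hom_inv[OF z(2,3) V_left[OF z(1)] lW])
  have cW: "carrier ?W = ?r ` carrier (V x)" by (simp add: quot_mod_def)
  have r: "(\<lambda>v \<in> carrier (V x). ?r v) \<in> module_homs B (V x) ?W"
    using Q(2,3) cW x by (auto simp: module_homs_def)
  have h: "(\<lambda>v \<in> carrier (V x). ?j ((\<lambda>v \<in> carrier (V x). ?r v) v)) \<in> module_homs B (V x) (V z)" (is "?h \<in> _")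
    by (rule module_hom_comp[OF r j V_left[OF x]])
  have jb: "bij_betw ?j (carrier ?W) (carrier (V z))"
    using bij_betw_inv_into[OF z(3)] by (simp add: bij_betw_def inj_on_def cong: image_cong)
  obtain q where q: "q \<in> Hom C x z" "U q = ?h" using full[OF x z(1) h] by blast
  have Uq: "U q v = ?j (?r v)" if "v \<in> carrier (V x)" for v using q(2) that by simp
  show thesis
  proof (rule that[of q])
    show "q \<in> Arr C" "Dom C q = x" using q by (simp_all add: Hom_iff)
    have "U q ` carrier (V x) = ?j ` (?r ` carrier (V x))" using Uq by (auto simp: image_image)
    also have "\<dots> = carrier (V z)" using jb cW by (simp add: bij_betw_def)
    finally show "U q ` carrier (V x) = carrier (V (Cod C q))" using q by (simp add: Hom_iff)
    show "\<forall>v \<in> carrier (V x). U q v = \<zero>\<^bsub>V (Cod C q)\<^esub> \<longleftrightarrow> v \<in> N"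
    proof
    fix v assume v: "v \<in> carrier (V x)"
    have z0: "U q \<zero>\<^bsub>V x\<^esub> = \<zero>\<^bsub>V z\<^esub>" using U_at_zero[of q] HomD[OF q(1)] by metis
    interpret W: left_module B ?W by (rule lW)
    have r0: "?r \<zero>\<^bsub>V x\<^esub> = \<zero>\<^bsub>?W\<^esub>" by (simp add: quot_mod_def)
    have "U q v = \<zero>\<^bsub>V z\<^esub> \<longleftrightarrow> ?j (?r v) = ?j (?r \<zero>\<^bsub>V x\<^esub>)" using Uq v z0 Uq[of "\<zero>\<^bsub>V x\<^esub>"] x by simp
    also have "\<dots> \<longleftrightarrow> ?r v = ?r \<zero>\<^bsub>V x\<^esub>"
      using inj_on_eq_iff[of ?j "carrier ?W" "?r v" "?r \<zero>\<^bsub>V x\<^esub>"] jb cW v x by (simp add: bij_betw_def)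
    also have "\<dots> \<longleftrightarrow> v \<in> N" unfolding r0 by (rule Q(4)[OF v])
    finally show "U q v = \<zero>\<^bsub>V (Cod C q)\<^esub> \<longleftrightarrow> v \<in> N" using q(1) by (simp add: Hom_iff)
    qed
  qed
qed

lemma mono_if_inj:
  assumes "k \<in> Arr C" "inj_on (U k) (carrier (V (Dom C k)))"
  shows "is_epi (op_cat C) k"
  unfolding is_epi_def op_cat_simps
proof (intro conjI ballI impI)
  fix z g h assume gh: "z \<in> Ob C" "g \<in> Hom C z (Dom C k)" "h \<in> Hom C z (Dom C k)" "k \<bullet> g = k \<bullet> h"
  show "g = h"
  proof (rule faithful)
    fix v assume v: "v \<in> carrier (V (Dom C g))"
    have "U k (U g v) = U (k \<bullet> g) v" "U k (U h v) = U (k \<bullet> h) v"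
      using U_comp[of g k v] U_comp[of h k v] gh(1-3) assms(1) v by (simp_all add: Hom_iff)
    then have "U k (U g v) = U k (U h v)" using gh(4) by simp
    then show "U g v = U h v"
      by (rule inj_onD[OF assms(2)]) (use gh(2,3) v U_in[of g v] U_in[of h v] in \<open>simp_all add: Hom_iff\<close>)
  qed (use gh(1-3) in \<open>simp_all add: Hom_iff\<close>)
qed (rule assms(1))

lemma epi_if_surj:
  assumes "q \<in> Arr C" "U q ` carrier (V (Dom C q)) = carrier (V (Cod C q))"
  shows "is_epi C q"
  unfolding is_epi_def
proof (intro conjI ballI impI)
  fix z g h assume gh: "z \<in> Ob C" "g \<in> Hom C (Cod C q) z" "h \<in> Hom C (Cod C q) z" "g \<bullet> q = h \<bullet> q"
  show "g = h"
  proof (rule faithful)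
    fix v assume "v \<in> carrier (V (Dom C g))"
    then have "v \<in> U q ` carrier (V (Dom C q))" using gh(2) assms(2) by (simp add: Hom_iff)
    then obtain u where u: "u \<in> carrier (V (Dom C q))" "v = U q u" by blast
    have "U g (U q u) = U (g \<bullet> q) u" "U h (U q u) = U (h \<bullet> q) u"
      using U_comp[of q g u] U_comp[of q h u] gh(1-3) assms(1) u by (simp_all add: Hom_iff)
    then show "U g v = U h v" using gh(4) u(2) by simp
  qed (use gh(1-3) in \<open>simp_all add: Hom_iff\<close>)
qed (rule assms(1))

lemma zero_iff:
  assumes "f \<in> Arr C"
  shows "f = HZero C (Dom C f) (Cod C f) \<longleftrightarrow> (\<forall>v \<in> carrier (V (Dom C f)). U f v = \<zero>\<^bsub>V (Cod C f)\<^esub>)"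
proof
  assume "f = HZero C (Dom C f) (Cod C f)"
  then show "\<forall>v \<in> carrier (V (Dom C f)). U f v = \<zero>\<^bsub>V (Cod C f)\<^esub>"
    using U_zero[of "Dom C f" "Cod C f"] assms by (metis dom_Ob cod_Ob)
next
  assume "\<forall>v \<in> carrier (V (Dom C f)). U f v = \<zero>\<^bsub>V (Cod C f)\<^esub>"
  then show "f = HZero C (Dom C f) (Cod C f)"
    by (intro faithful) (use assms U_zero in \<open>simp_all\<close>)
qed

lemma lsub_ker:
  assumes "f \<in> Arr C" shows "lsub B (V (Dom C f)) {v \<in> carrier (V (Dom C f)). U f v = \<zero>\<^bsub>V (Cod C f)\<^esub>}"
proof -
  interpret Y: left_module B "V (Cod C f)" by (rule V_left) (simp add: assms)
  show ?thesis unfolding lsub_def using assms U_hom_add[of f] U_hom_act[of f] by auto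
qed

lemma lsub_image:
  assumes "f \<in> Arr C" shows "lsub B (V (Cod C f)) (U f ` carrier (V (Dom C f)))"
  unfolding lsub_def
proof (intro conjI ballI)
  show "U f ` carrier (V (Dom C f)) \<subseteq> carrier (V (Cod C f))" using assms by auto
  show "\<zero>\<^bsub>V (Cod C f)\<^esub> \<in> U f ` carrier (V (Dom C f))"
    using assms by (intro image_eqI[of _ _ "\<zero>\<^bsub>V (Dom C f)\<^esub>"]) simp_all
  fix u assume "u \<in> U f ` carrier (V (Dom C f))"
  then obtain u' where u: "u = U f u'" "u' \<in> carrier (V (Dom C f))" by blast
  { fix b assume b: "b \<in> carrier B"
    then show "b \<odot>\<^bsub>V (Cod C f)\<^esub> u \<in> U f ` carrier (V (Dom C f))"
      using u assms by (intro image_eqI[of _ _ "b \<odot>\<^bsub>V (Dom C f)\<^esub> u'"]) (simp_all add: U_hom_act) }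
  fix v assume "v \<in> U f ` carrier (V (Dom C f))"
  then obtain v' where v: "v = U f v'" "v' \<in> carrier (V (Dom C f))" by blast
  then show "u \<oplus>\<^bsub>V (Cod C f)\<^esub> v \<in> U f ` carrier (V (Dom C f))"
    using u assms by (intro image_eqI[of _ _ "u' \<oplus>\<^bsub>V (Dom C f)\<^esub> v'"]) (simp_all add: U_hom_add)
qed

text \<open>Pointwise exactness gives the categorical universal properties. A map killed by q takes
  its values in the image of k and is lifted by inverting k there; a map killing k is constant on
  the fibres of q and descends. The lift is a homomorphism because k is injective, the descended map
  because of its constancy on fibres.\<close>

lemma short_exact_if:
  assumes k: "k \<in> Arr C" "inj_on (U k) (carrier (V (Dom C k)))"
    and q: "q \<in> Arr C" "U q ` carrier (V (Dom C q)) = carrier (V (Cod C q))"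
    and kq: "Dom C q = Cod C k"
      "U k ` carrier (V (Dom C k)) = {v \<in> carrier (V (Dom C q)). U q v = \<zero>\<^bsub>V (Cod C q)\<^esub>}"
  shows "short_exact C k q"
proof -
  have kq0: "U q (U k v) = \<zero>\<^bsub>V (Cod C q)\<^esub>" if "v \<in> carrier (V (Dom C k))" for v
    using kq(2) that by blast
  have qk: "q \<bullet> k = HZero C (Dom C k) (Cod C q)"
    using zero_iff[of "q \<bullet> k"] U_comp[of k q] kq0 k(1) q(1) kq(1) by simp
  have ker: "is_kernel C q k"
  proof (rule is_kernelI)
    fix h assume h: "h \<in> Arr C" "Cod C h = Dom C q" "q \<bullet> h = HZero C (Dom C h) (Cod C q)"
    let ?j = "inv_into (carrier (V (Dom C k))) (U k)"
    have Uh: "U h v \<in> U k ` carrier (V (Dom C k))" if "v \<in> carrier (V (Dom C h))" for v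
    proof -
      have "U q (U h v) = U (q \<bullet> h) v" using U_comp[of h q v] h(1,2) q(1) that by simp
      also have "\<dots> = \<zero>\<^bsub>V (Cod C q)\<^esub>" unfolding h(3) by (rule U_zero) (use h(1) q(1) that in simp_all)
      finally show ?thesis unfolding kq(2) using U_in[OF h(1) that] h(2) by simp
    qed
    have j: "?j (U h v) \<in> carrier (V (Dom C k))" "U k (?j (U h v)) = U h v" if "v \<in> carrier (V (Dom C h))" for v
      using inv_into_into[OF Uh[OF that]] f_inv_into_f[OF Uh[OF that]] by simp_all
    have inj: "a = b" if "a \<in> carrier (V (Dom C k))" "b \<in> carrier (V (Dom C k))" "U k a = U k b" for a b
      using inj_onD[OF k(2) that(3,1,2)] .
    have O: "Dom C k \<in> Ob C" "Dom C h \<in> Ob C" using k(1) h(1) by simp_all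
    have hk: "Cod C h = Cod C k" using h(2) kq(1) by simp
    have "?j (U h (u \<oplus>\<^bsub>V (Dom C h)\<^esub> v)) = ?j (U h u) \<oplus>\<^bsub>V (Dom C k)\<^esub> ?j (U h v)"
      if uv: "u \<in> carrier (V (Dom C h))" "v \<in> carrier (V (Dom C h))" for u v
      by (rule inj) (use j[OF uv(1)] j[OF uv(2)] j[of "u \<oplus>\<^bsub>V (Dom C h)\<^esub> v"] uv O hk
          U_hom_add[OF h(1) uv] U_hom_add[OF k(1) j(1)[OF uv(1)] j(1)[OF uv(2)]] in simp_all)
    moreover have "?j (U h (b \<odot>\<^bsub>V (Dom C h)\<^esub> v)) = b \<odot>\<^bsub>V (Dom C k)\<^esub> ?j (U h v)"
      if bv: "b \<in> carrier B" "v \<in> carrier (V (Dom C h))" for b v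
      by (rule inj) (use j[OF bv(2)] j[of "b \<odot>\<^bsub>V (Dom C h)\<^esub> v"] bv O hk
          U_hom_act[OF h(1) bv] U_hom_act[OF k(1) bv(1) j(1)[OF bv(2)]] in simp_all)
    ultimately have "(\<lambda>v \<in> carrier (V (Dom C h)). ?j (U h v)) \<in> module_homs B (V (Dom C h)) (V (Dom C k))"
      using j(1) O by (auto simp: module_homs_def)
    then obtain u where u: "u \<in> Hom C (Dom C h) (Dom C k)" "U u = (\<lambda>v \<in> carrier (V (Dom C h)). ?j (U h v))"
      using full[OF O(2,1)] by blast
    have "k \<bullet> u = h"
    proof (rule faithful)
      fix v assume "v \<in> carrier (V (Dom C (k \<bullet> u)))"
      then have v: "v \<in> carrier (V (Dom C h))" using u(1) k(1) by (simp add: Hom_iff)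
      have "U (k \<bullet> u) v = U k (U u v)" using U_comp[of u k v] u(1) k(1) v by (simp add: Hom_iff)
      then show "U (k \<bullet> u) v = U h v" using u(2) v j(2) by simp
    qed (use u(1) k(1) h(1,2) kq(1) in \<open>simp_all add: Hom_iff\<close>)
    then show "\<exists>u. u \<in> Hom C (Dom C h) (Dom C k) \<and> k \<bullet> u = h" using u(1) by blast
  qed (use q k kq qk mono_if_inj in simp_all)
  have coker: "is_cokernel C k q"
  proof (rule is_cokernelI)
    fix h assume h: "h \<in> Arr C" "Dom C h = Cod C k" "h \<bullet> k = HZero C (Dom C k) (Cod C h)"
    \<comment> \<open>A mere set-theoretic section of q; by \<open>heq\<close> the choice does not
      affect the values of h.\<close>
    let ?s = "inv_into (carrier (V (Dom C q))) (U q)"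
    have s: "?s w \<in> carrier (V (Dom C q))" "U q (?s w) = w" if "w \<in> carrier (V (Cod C q))" for w
      using inv_into_into[of w "U q" "carrier (V (Dom C q))"] f_inv_into_f[of w "U q" "carrier (V (Dom C q))"]
        that q(2) by simp_all
    have dom: "Dom C q = Dom C h" using h(2) kq(1) by simp
    have h0: "U h v = \<zero>\<^bsub>V (Cod C h)\<^esub>" if "v \<in> carrier (V (Dom C q))" "U q v = \<zero>\<^bsub>V (Cod C q)\<^esub>" for v
    proof -
      have "v \<in> U k ` carrier (V (Dom C k))" unfolding kq(2) using that by simp
      then obtain t where t: "t \<in> carrier (V (Dom C k))" "v = U k t" by blast
      have "U h v = U (h \<bullet> k) t" using U_comp[of k h t] h(1,2) k(1) t by simp
      also have "\<dots> = \<zero>\<^bsub>V (Cod C h)\<^esub>" unfolding h(3) by (rule U_zero) (use h(1) k(1) t in simp_all)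
      finally show ?thesis .
    qed
    have heq: "U h u = U h v" if uv: "u \<in> carrier (V (Dom C q))" "v \<in> carrier (V (Dom C q))" "U q u = U q v" for u v
    proof -
      obtain w where w: "w \<in> carrier (V (Dom C q))" "U q w = \<zero>\<^bsub>V (Cod C q)\<^esub>" "u = v \<oplus>\<^bsub>V (Dom C q)\<^esub> w"
        using U_eq_iff_sub[OF q(1) uv] by blast
      have "U h u = U h v \<oplus>\<^bsub>V (Cod C h)\<^esub> U h w"
        unfolding w(3) using U_hom_add[OF h(1), of v w] uv(2) w(1) dom by simp
      then show ?thesis using h0[OF w(1,2)] U_in[OF h(1), of v] uv(2) dom h(1) by simp
    qed
    have O: "Cod C q \<in> Ob C" "Cod C h \<in> Ob C" "Dom C h \<in> Ob C" using q(1) h(1) by simp_all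
    have "U h (?s (u \<oplus>\<^bsub>V (Cod C q)\<^esub> v)) = U h (?s u) \<oplus>\<^bsub>V (Cod C h)\<^esub> U h (?s v)"
      if uv: "u \<in> carrier (V (Cod C q))" "v \<in> carrier (V (Cod C q))" for u v
    proof -
      have "U h (?s (u \<oplus>\<^bsub>V (Cod C q)\<^esub> v)) = U h (?s u \<oplus>\<^bsub>V (Dom C h)\<^esub> ?s v)"
        by (rule heq) (use s uv O dom U_hom_add[OF q(1) s(1)[OF uv(1)] s(1)[OF uv(2)]] in simp_all)
      then show ?thesis using U_hom_add[OF h(1), of "?s u" "?s v"] s uv dom by simp
    qed
    moreover have "U h (?s (b \<odot>\<^bsub>V (Cod C q)\<^esub> v)) = b \<odot>\<^bsub>V (Cod C h)\<^esub> U h (?s v)"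
      if bv: "b \<in> carrier B" "v \<in> carrier (V (Cod C q))" for b v
    proof -
      have "U h (?s (b \<odot>\<^bsub>V (Cod C q)\<^esub> v)) = U h (b \<odot>\<^bsub>V (Dom C h)\<^esub> ?s v)"
        by (rule heq) (use s bv O dom U_hom_act[OF q(1) bv(1) s(1)[OF bv(2)]] in simp_all)
      then show ?thesis using U_hom_act[OF h(1) bv(1), of "?s v"] s bv dom by simp
    qed
    moreover have "U h (?s v) \<in> carrier (V (Cod C h))" if "v \<in> carrier (V (Cod C q))" for v
      using U_in[OF h(1), of "?s v"] s(1)[OF that] dom by simp
    ultimately have "(\<lambda>w \<in> carrier (V (Cod C q)). U h (?s w)) \<in> module_homs B (V (Cod C q)) (V (Cod C h))"
      using O by (auto simp: module_homs_def)
    then obtain u where u: "u \<in> Hom C (Cod C q) (Cod C h)" "U u = (\<lambda>w \<in> carrier (V (Cod C q)). U h (?s w))"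
      using full[OF O(1,2)] by blast
    have "u \<bullet> q = h"
    proof (rule faithful)
      fix v assume "v \<in> carrier (V (Dom C (u \<bullet> q)))"
      then have v: "v \<in> carrier (V (Dom C q))" using u(1) q(1) by (simp add: Hom_iff)
      have "U (u \<bullet> q) v = U u (U q v)" using U_comp[of q u v] u(1) q(1) v by (simp add: Hom_iff)
      also have "\<dots> = U h (?s (U q v))" using u(2) U_in[OF q(1) v] by simp
      also have "\<dots> = U h v" by (rule heq) (use s[OF U_in[OF q(1) v]] v in simp_all)
      finally show "U (u \<bullet> q) v = U h v" .
    qed (use u(1) q(1) h(1,2) kq(1) in \<open>simp_all add: Hom_iff\<close>)
    then show "\<exists>u. u \<in> Hom C (Cod C q) (Cod C h) \<and> u \<bullet> q = h" using u(1) by blast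
  qed (use q k kq qk epi_if_surj in simp_all)
  show ?thesis using ker coker by (simp add: short_exact_def)
qed

text \<open>Take q to be the quotient by the kernel of f, i the injection that f induces on it, and
  c the quotient by the image of i.\<close>

lemma image_factorization:
  assumes f: "f \<in> Arr C"
  shows "\<exists>k q i c. short_exact C k q \<and> short_exact C i c \<and> Dom C i = Cod C q \<and> i \<bullet> q = f"
proof -
  let ?N = "{v \<in> carrier (V (Dom C f)). U f v = \<zero>\<^bsub>V (Cod C f)\<^esub>}"
  obtain k where k: "k \<in> Arr C" "Cod C k = Dom C f" "inj_on (U k) (carrier (V (Dom C k)))"
    "U k ` carrier (V (Dom C k)) = ?N"
    by (rule sub_ob[OF dom_Ob[OF f] lsub_ker[OF f]])
  obtain q where q: "q \<in> Arr C" "Dom C q = Dom C f" "U q ` carrier (V (Dom C f)) = carrier (V (Cod C q))"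
    and qN: "\<forall>v \<in> carrier (V (Dom C f)). U q v = \<zero>\<^bsub>V (Cod C q)\<^esub> \<longleftrightarrow> v \<in> ?N"
    by (rule quot_ob[OF dom_Ob[OF f] lsub_ker[OF f]])
  have kq: "short_exact C k q"
    by (rule short_exact_if) (use k q qN in auto)
  have "f \<bullet> k = HZero C (Dom C k) (Cod C f)"
    using zero_iff[of "f \<bullet> k"] U_comp[of k f] k(4) k(1,2) f by auto
  then obtain i where i: "i \<in> Arr C" "Dom C i = Cod C q" "Cod C i = Cod C f" "i \<bullet> q = f"
    using is_cokernelD(6)[of k q f] kq f k(1,2) by (auto simp: short_exact_def Hom_iff)
  have Ui: "U i (U q v) = U f v" if "v \<in> carrier (V (Dom C f))" for v
    using U_comp[of q i v] i q that by simp
  have "inj_on (U i) (carrier (V (Dom C i)))"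
  proof (rule U_inj[OF i(1)])
    fix w assume w: "w \<in> carrier (V (Dom C i))" "U i w = \<zero>\<^bsub>V (Cod C i)\<^esub>"
    then have "w \<in> U q ` carrier (V (Dom C f))" using q(3) i(2) by simp
    then obtain v where v: "v \<in> carrier (V (Dom C f))" "w = U q v" by blast
    then have "U f v = \<zero>\<^bsub>V (Cod C f)\<^esub>" using Ui w(2) i(3) by simp
    then show "w = \<zero>\<^bsub>V (Dom C i)\<^esub>" using bspec[OF qN v(1)] v i(2) by simp
  qed
  moreover obtain c where c: "c \<in> Arr C" "Dom C c = Cod C i" "U c ` carrier (V (Cod C i)) = carrier (V (Cod C c))"
    and cN: "\<forall>v \<in> carrier (V (Cod C i)). U c v = \<zero>\<^bsub>V (Cod C c)\<^esub> \<longleftrightarrow> v \<in> U i ` carrier (V (Dom C i))"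
    by (rule quot_ob[OF cod_Ob[OF i(1)] lsub_image[OF i(1)]])
  ultimately have "short_exact C i c"
    by (intro short_exact_if) (use i(1) c cN U_in[OF i(1)] in auto)
  then show ?thesis using kq i(2,4) by (intro exI[of _ k] exI[of _ q] exI[of _ i] exI[of _ c]) simp
qed

lemma realize_iso:
  assumes "W \<in> fd_modules K B"
  obtains x i j where "x \<in> Ob C" "i \<in> module_homs B (V x) W" "j \<in> module_homs B W (V x)"
    "\<forall>v \<in> carrier (V x). j (i v) = v" "\<forall>w \<in> carrier W. i (j w) = w"
proof -
  have lW: "left_module B W" using assms by (simp add: fd_modules_def)
  obtain x i where x: "x \<in> Ob C" "i \<in> module_homs B (V x) W" "bij_betw i (carrier (V x)) (carrier W)"
    using realize[OF assms] by blast
  have iW: "i v \<in> carrier W" if "v \<in> carrier (V x)" for v using x(2) that by (auto simp: module_homs_def)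
  show thesis
    by (rule that[OF x(1,2) module_hom_inv[OF x(2,3) V_left[OF x(1)] lW]])
      (use x(3) iW in \<open>auto simp: bij_betw_inv_into_left bij_betw_inv_into_right\<close>)
qed

text \<open>P realizes the regular module and e corresponds to the unit of B, so evaluation at e
  identifies Hom(P, y) with the carrier of V y.\<close>

lemma reg_ob:
  obtains P e where "P \<in> Ob C" "e \<in> carrier (V P)"
    "\<forall>y \<in> Ob C. \<forall>w \<in> carrier (V y). \<exists>u \<in> Hom C P y. U u e = w"
    "\<forall>y \<in> Ob C. \<forall>f \<in> Hom C P y. \<forall>g \<in> Hom C P y. U f e = U g e \<longrightarrow> f = g"
proof -
  have rs [simp]: "carrier (reg_mod B) = carrier B" "(\<oplus>\<^bsub>reg_mod B\<^esub>) = (\<oplus>\<^bsub>B\<^esub>)" "\<zero>\<^bsub>reg_mod B\<^esub> = \<zero>\<^bsub>B\<^esub>"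
     "(\<odot>\<^bsub>reg_mod B\<^esub>) = (\<otimes>\<^bsub>B\<^esub>)" by (simp_all add: reg_mod_def)
  obtain P i j where P: "P \<in> Ob C" and i: "i \<in> module_homs B (V P) (reg_mod B)"
    and j: "j \<in> module_homs B (reg_mod B) (V P)"
    and ji: "\<forall>v \<in> carrier (V P). j (i v) = v" and ij: "\<forall>w \<in> carrier (reg_mod B). i (j w) = w"
    by (rule realize_iso[OF reg_mod])
  have j1: "j \<one>\<^bsub>B\<^esub> \<in> carrier (V P)" using j B.one_closed unfolding module_homs_def by auto
  have gen: "v = i v \<odot>\<^bsub>V P\<^esub> j \<one>\<^bsub>B\<^esub>" "i v \<in> carrier B" if v: "v \<in> carrier (V P)" for v
  proof -
    show iv: "i v \<in> carrier B" using i v unfolding module_homs_def by auto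
    have "\<forall>b\<in>carrier B. \<forall>w\<in>carrier B. j (b \<otimes>\<^bsub>B\<^esub> w) = b \<odot>\<^bsub>V P\<^esub> j w"
      using j by (simp add: module_homs_def)
    then have "j (i v \<otimes>\<^bsub>B\<^esub> \<one>\<^bsub>B\<^esub>) = i v \<odot>\<^bsub>V P\<^esub> j \<one>\<^bsub>B\<^esub>" using iv B.one_closed by blast
    then show "v = i v \<odot>\<^bsub>V P\<^esub> j \<one>\<^bsub>B\<^esub>" using iv ji v by simp
  qed
  show thesis
  proof (rule that[OF P j1]; intro ballI impI)
    fix y w assume y: "y \<in> Ob C" and w: "w \<in> carrier (V y)"
    interpret Y: left_module B "V y" by (rule V_left[OF y])
    interpret X: left_module B "V P" by (rule V_left[OF P])
    have ih: "i (u \<oplus>\<^bsub>V P\<^esub> v) = i u \<oplus>\<^bsub>B\<^esub> i v" "b \<in> carrier B \<Longrightarrow> i (b \<odot>\<^bsub>V P\<^esub> v) = b \<otimes>\<^bsub>B\<^esub> i v"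
      if "u \<in> carrier (V P)" "v \<in> carrier (V P)" for u v b
      using i that unfolding module_homs_def by auto
    have "(\<lambda>v \<in> carrier (V P). i v \<odot>\<^bsub>V y\<^esub> w) \<in> module_homs B (V P) (V y)"
      using gen(2) w by (auto simp: module_homs_def ih X.act_closed Y.act_closed Y.act_l_distr Y.act_assoc)
    then obtain u where u: "u \<in> Hom C P y" "U u = (\<lambda>v \<in> carrier (V P). i v \<odot>\<^bsub>V y\<^esub> w)" using full[OF P y] by blast
    then have "U u (j \<one>\<^bsub>B\<^esub>) = w" using j1 ij w Y.act_one by simp
    then show "\<exists>u\<in>Hom C P y. U u (j \<one>\<^bsub>B\<^esub>) = w" using u(1) by blast
  next
    fix y f g assume fg': "y \<in> Ob C" "f \<in> Hom C P y" "g \<in> Hom C P y" and fg6: "U f (j \<one>\<^bsub>B\<^esub>) = U g (j \<one>\<^bsub>B\<^esub>)"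
    then have fg: "f \<in> Arr C" "g \<in> Arr C" "Dom C f = P" "Dom C g = P" "Cod C f = Cod C g"
      by (simp_all add: Hom_iff)
    show "f = g"
    proof (rule faithful)
      fix v assume "v \<in> carrier (V (Dom C f))"
      then have v: "v \<in> carrier (V P)" using fg by simp
      have "U f (i v \<odot>\<^bsub>V P\<^esub> j \<one>\<^bsub>B\<^esub>) = U g (i v \<odot>\<^bsub>V P\<^esub> j \<one>\<^bsub>B\<^esub>)"
        using U_hom_act[of f "i v" "j \<one>\<^bsub>B\<^esub>"] U_hom_act[of g "i v" "j \<one>\<^bsub>B\<^esub>"] fg fg6 gen(2)[OF v] j1 by simp
      then show "U f v = U g v" using gen(1)[OF v] by simp
    qed (use fg in simp_all)
  qed
qed

text \<open>Arrows from P are elements, by evaluation at e. An arrow vanishing on all of them is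
  zero on every element, so P is a generator. For projectivity it remains to see that an epimorphism
  is surjective: the quotient by its image is killed by it, hence zero.\<close>

lemma ex_proj_gen: "\<exists>P. proj_gen C P"
proof -
  obtain P e where P: "P \<in> Ob C" "e \<in> carrier (V P)"
    and ex0: "\<forall>y \<in> Ob C. \<forall>w \<in> carrier (V y). \<exists>u \<in> Hom C P y. U u e = w"
    and un: "\<forall>y \<in> Ob C. \<forall>f \<in> Hom C P y. \<forall>g \<in> Hom C P y. U f e = U g e \<longrightarrow> f = g"
    by (rule reg_ob)
  have ex: "\<exists>u \<in> Hom C P y. U u e = w" if "y \<in> Ob C" "w \<in> carrier (V y)" for y w
    using ex0 that by blast
  have "faithful_ob C P" unfolding faithful_ob_def
  proof (intro conjI ballI impI)
    fix g assume g: "g \<in> Arr C" "\<forall>u\<in>Hom C P (Dom C g). g \<bullet> u = HZero C P (Cod C g)"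
    have "U g v = \<zero>\<^bsub>V (Cod C g)\<^esub>" if v: "v \<in> carrier (V (Dom C g))" for v
    proof -
      obtain u where u: "u \<in> Hom C P (Dom C g)" "U u e = v" using ex[OF dom_Ob[OF g(1)] v] by blast
      have "U g v = U (g \<bullet> u) e" using U_comp[of u g e] u g(1) P(2) by (simp add: Hom_iff)
      also have "g \<bullet> u = HZero C P (Cod C g)" using g(2) u(1) by blast
      also have "U \<dots> e = \<zero>\<^bsub>V (Cod C g)\<^esub>" by (rule U_zero) (use P g(1) in simp_all)
      finally show ?thesis .
    qed
    then show "g = HZero C (Dom C g) (Cod C g)" using zero_iff[OF g(1)] by blast
  qed (rule P(1))
  moreover have "projective C P" unfolding projective_def
  proof (intro conjI allI impI ballI)
    fix p f assume p: "is_epi C p" and f: "f \<in> Hom C P (Cod C p)"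
    have pA: "p \<in> Arr C" using p by (simp add: is_epi_def)
    obtain q where q: "q \<in> Arr C" "Dom C q = Cod C p" "U q ` carrier (V (Cod C p)) = carrier (V (Cod C q))"
      and qN: "\<forall>v \<in> carrier (V (Cod C p)). U q v = \<zero>\<^bsub>V (Cod C q)\<^esub> \<longleftrightarrow> v \<in> U p ` carrier (V (Dom C p))"
      by (rule quot_ob[OF cod_Ob[OF pA] lsub_image[OF pA]])
    have "q \<bullet> p = HZero C (Dom C p) (Cod C q)"
      using zero_iff[of "q \<bullet> p"] U_comp[of p q] q(1,2) pA qN U_in[OF pA] by simp
    then have "q = HZero C (Cod C p) (Cod C q)" using epi_zeroD[OF p q(1,2)] by simp
    then have q0: "U q v = \<zero>\<^bsub>V (Cod C q)\<^esub>" if "v \<in> carrier (V (Cod C p))" for v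
      using zero_iff[OF q(1)] q(2) that by simp
    have fe: "U f e \<in> carrier (V (Cod C p))" using U_in[of f e] HomD[OF f] P(2) by metis
    then have "U f e \<in> U p ` carrier (V (Dom C p))" using qN q0 by blast
    then obtain w where w: "w \<in> carrier (V (Dom C p))" "U f e = U p w" by blast
    obtain u where u: "u \<in> Hom C P (Dom C p)" "U u e = w" using ex[OF dom_Ob[OF pA] w(1)] by blast
    have "U (p \<bullet> u) e = U f e" using U_comp[of u p e] u pA P(2) w(2) by (simp add: Hom_iff)
    moreover have "p \<bullet> u \<in> Hom C P (Cod C p)" using u(1) pA by (simp add: Hom_iff)
    ultimately have "p \<bullet> u = f" using un f cod_Ob[OF pA] by blast
    then show "\<exists>g\<in>Hom C P (Dom C p). p \<bullet> g = f" using u(1) by blast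
  qed (rule P(1))
  ultimately show ?thesis unfolding proj_gen_def by blast
qed

text \<open>The zero submodule of the regular module, realized as an object.\<close>

lemma zero_object: "\<exists>z \<in> Ob C. Id C z = HZero C z z"
proof -
  obtain P e where P: "P \<in> Ob C" and "e \<in> carrier (V P)" by (rule reg_ob)
  interpret X: left_module B "V P" by (rule V_left[OF P])
  have "lsub B (V P) {\<zero>\<^bsub>V P\<^esub>}" using P by (simp add: lsub_def)
  from sub_ob[OF P this] obtain k where k: "k \<in> Arr C" "Cod C k = P" "inj_on (U k) (carrier (V (Dom C k)))"
    "U k ` carrier (V (Dom C k)) = {\<zero>\<^bsub>V P\<^esub>}" by blast
  have z: "v = \<zero>\<^bsub>V (Dom C k)\<^esub>" if v: "v \<in> carrier (V (Dom C k))" for v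
  proof (rule inj_onD[OF k(3) _ v])
    have "U k v = \<zero>\<^bsub>V P\<^esub>" using k(4) v by blast
    then show "U k v = U k \<zero>\<^bsub>V (Dom C k)\<^esub>" using k(1,2) by simp
  qed (use k(1) in simp)
  have "Id C (Dom C k) = HZero C (Dom C k) (Dom C k)"
    using zero_iff[of "Id C (Dom C k)"] k(1) z by (simp add: U_id)
  then show ?thesis using k(1) by (intro bexI[of _ "Dom C k"]) simp_all
qed

lemma biproducts:
  assumes x: "x \<in> Ob C" and y: "y \<in> Ob C"
  shows "\<exists>z i j p q. is_biprod C x y z i j p q"
proof -
  let ?W = "prod_mod (V x) (V y)"
  note W = prod_mod[OF V_fd[OF x] V_fd[OF y]]
  interpret X: left_module B "V x" by (rule V_left[OF x])
  interpret Y: left_module B "V y" by (rule V_left[OF y])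
  have lW: "left_module B ?W" using W by (simp add: fd_modules_def)
  obtain z \<alpha> \<beta> where z: "z \<in> Ob C" and a: "\<alpha> \<in> module_homs B (V z) ?W" and b: "\<beta> \<in> module_homs B ?W (V z)"
    and ba: "\<forall>v \<in> carrier (V z). \<beta> (\<alpha> v) = v" and ab: "\<forall>w \<in> carrier ?W. \<alpha> (\<beta> w) = w"
    by (rule realize_iso[OF W])
  have i: "(\<lambda>v \<in> carrier (V x). enc v \<zero>\<^bsub>V y\<^esub>) \<in> module_homs B (V x) ?W"
    using x y by (auto simp: module_homs_def)
  have j: "(\<lambda>v \<in> carrier (V y). enc \<zero>\<^bsub>V x\<^esub> v) \<in> module_homs B (V y) ?W"
    using x y by (auto simp: module_homs_def)
  have p: "(\<lambda>w \<in> carrier ?W. dec1 w) \<in> module_homs B ?W (V x)"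
    using x y by (auto simp: module_homs_def)
  have q: "(\<lambda>w \<in> carrier ?W. dec2 w) \<in> module_homs B ?W (V y)"
    using x y by (auto simp: module_homs_def)
  obtain i' where i': "i' \<in> Hom C x z" "U i' = (\<lambda>v \<in> carrier (V x). \<beta> ((\<lambda>v \<in> carrier (V x). enc v \<zero>\<^bsub>V y\<^esub>) v))"
    using full[OF x z module_hom_comp[OF i b V_left[OF x]]] by blast
  obtain j' where j': "j' \<in> Hom C y z" "U j' = (\<lambda>v \<in> carrier (V y). \<beta> ((\<lambda>v \<in> carrier (V y). enc \<zero>\<^bsub>V x\<^esub> v) v))"
    using full[OF y z module_hom_comp[OF j b V_left[OF y]]] by blast
  obtain p' where p': "p' \<in> Hom C z x" "U p' = (\<lambda>v \<in> carrier (V z). (\<lambda>w \<in> carrier ?W. dec1 w) (\<alpha> v))"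
    using full[OF z x module_hom_comp[OF a p V_left[OF z]]] by blast
  obtain q' where q': "q' \<in> Hom C z y" "U q' = (\<lambda>v \<in> carrier (V z). (\<lambda>w \<in> carrier ?W. dec2 w) (\<alpha> v))"
    using full[OF z y module_hom_comp[OF a q V_left[OF z]]] by blast
  have bin: "\<beta> w \<in> carrier (V z)" if "w \<in> carrier ?W" for w using b that by (auto simp: module_homs_def)
  have ain: "\<alpha> v \<in> carrier ?W" if "v \<in> carrier (V z)" for v using a that by (auto simp: module_homs_def)
  note t = i'(1)[unfolded Hom_iff] j'(1)[unfolded Hom_iff] p'(1)[unfolded Hom_iff] q'(1)[unfolded Hom_iff]
  have Ui: "U i' v = \<beta> (enc v \<zero>\<^bsub>V y\<^esub>)" if "v \<in> carrier (V x)" for v using that i' by simp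
  have Uj: "U j' v = \<beta> (enc \<zero>\<^bsub>V x\<^esub> v)" if "v \<in> carrier (V y)" for v using that j' by simp
  have Up: "U p' v = dec1 (\<alpha> v)" if "v \<in> carrier (V z)" for v using that p' ain by simp
  have Uq: "U q' v = dec2 (\<alpha> v)" if "v \<in> carrier (V z)" for v using that q' ain by simp
  have ei: "enc v \<zero>\<^bsub>V y\<^esub> \<in> carrier ?W" if "v \<in> carrier (V x)" for v using that y by auto
  have ej: "enc \<zero>\<^bsub>V x\<^esub> v \<in> carrier ?W" if "v \<in> carrier (V y)" for v using that x by auto
  have pi: "p' \<bullet> i' = Id C x"
  proof (rule faithful)
    fix v assume "v \<in> carrier (V (Dom C (p' \<bullet> i')))"
    then have v: "v \<in> carrier (V x)" using t by simp
    show "U (p' \<bullet> i') v = U (Id C x) v"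
      using U_comp[of i' p' v] t v Ui Up[OF bin[OF ei[OF v]]] bspec[OF ab ei[OF v]] by (simp add: U_id x)
  qed (use t x in simp_all)
  have qj: "q' \<bullet> j' = Id C y"
  proof (rule faithful)
    fix v assume "v \<in> carrier (V (Dom C (q' \<bullet> j')))"
    then have v: "v \<in> carrier (V y)" using t by simp
    show "U (q' \<bullet> j') v = U (Id C y) v"
      using U_comp[of j' q' v] t v Uj Uq[OF bin[OF ej[OF v]]] bspec[OF ab ej[OF v]] by (simp add: U_id y)
  qed (use t y in simp_all)
  have "HAdd C (i' \<bullet> p') (j' \<bullet> q') = Id C z"
  proof (rule faithful)
    fix v assume "v \<in> carrier (V (Dom C (HAdd C (i' \<bullet> p') (j' \<bullet> q'))))"
    then have v: "v \<in> carrier (V z)" using t by simp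
    obtain c d where cd: "\<alpha> v = enc c d" "c \<in> carrier (V x)" "d \<in> carrier (V y)" using ain[OF v] by auto
    have "U (HAdd C (i' \<bullet> p') (j' \<bullet> q')) v = U (i' \<bullet> p') v \<oplus>\<^bsub>V z\<^esub> U (j' \<bullet> q') v"
      using U_add[of "i' \<bullet> p'" "j' \<bullet> q'" v] t v by simp
    also have "U (i' \<bullet> p') v = \<beta> (enc c \<zero>\<^bsub>V y\<^esub>)" using U_comp[of p' i' v] t v Up Ui[OF cd(2)] cd(1) by simp
    also have "U (j' \<bullet> q') v = \<beta> (enc \<zero>\<^bsub>V x\<^esub> d)" using U_comp[of q' j' v] t v Uq Uj[OF cd(3)] cd(1) by simp
    also have "\<beta> (enc c \<zero>\<^bsub>V y\<^esub>) \<oplus>\<^bsub>V z\<^esub> \<beta> (enc \<zero>\<^bsub>V x\<^esub> d) = \<beta> (enc c \<zero>\<^bsub>V y\<^esub> \<oplus>\<^bsub>?W\<^esub> enc \<zero>\<^bsub>V x\<^esub> d)"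
    proof -
      have "\<forall>u\<in>carrier ?W. \<forall>v\<in>carrier ?W. \<beta> (u \<oplus>\<^bsub>?W\<^esub> v) = \<beta> u \<oplus>\<^bsub>V z\<^esub> \<beta> v"
        using b unfolding module_homs_def by (elim CollectE conjE)
      then show ?thesis using ei[OF cd(2)] ej[OF cd(3)] by metis
    qed
    also have "enc c \<zero>\<^bsub>V y\<^esub> \<oplus>\<^bsub>?W\<^esub> enc \<zero>\<^bsub>V x\<^esub> d = \<alpha> v" using cd x y by simp
    finally show "U (HAdd C (i' \<bullet> p') (j' \<bullet> q')) v = U (Id C z) v" using ba v z by (simp add: U_id)
  qed (use t z in simp_all)
  then have "is_biprod C x y z i' j' p' q'" unfolding is_biprod_def using i'(1) j'(1) p'(1) q'(1) pi qj by blast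
  then show ?thesis by blast
qed

end

context module_like
begin

text \<open>Induction on a finite set S of vectors that detects zero arrows in N; generators of V x
  form such a set. Evaluation at one vector s maps N onto a subspace of the noetherian space V y,
  and the arrows of N vanishing at s are covered by induction. Generators of that kernel together
  with lifts of generators of the image generate N.\<close>

lemma hom_noetherian:
  assumes x: "x \<in> Ob C" and y: "y \<in> Ob C"
  shows "noetherian_space K (hom_space C x y)"
proof -
  let ?H = "hom_space C x y"
  note mH = hom_space_module[OF x y] and mY = underlying_module[OF V_left[OF y]]
  have nY: "noetherian_space K (underlying_space B (V y))"
    by (rule finite_dimensional_noetherian[OF field V_fin[OF y]])
  interpret X: left_module B "V x" by (rule V_left[OF x])
  interpret Y: left_module B "V y" by (rule V_left[OF y])
  have *: "fin_gen K ?H N"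
    if "finite S" "S \<subseteq> carrier (V x)" "submodule N K ?H" "\<forall>f\<in>N. (\<forall>s\<in>S. U f s = \<zero>\<^bsub>V y\<^esub>) \<longrightarrow> f = HZero C x y" for S N
    using that
  proof (induction S arbitrary: N rule: finite_induct)
    case empty
    note Nd = empty(2)[unfolded submodule_iff[OF mH], simplified]
    have "N \<subseteq> {HZero C x y}" using empty(3) by auto
    then show ?case unfolding fin_gen_def submodule_iff[OF mH] by (intro exI[of _ "{}"]) auto
  next
    case (insert s S)
    have s: "s \<in> carrier (V x)" using insert.prems(1) by simp
    note Nd = insert.prems(2)[unfolded submodule_iff[OF mH], simplified]
    have Us: "U (HAdd C f g) s = U f s \<oplus>\<^bsub>V y\<^esub> U g s" "U f s \<in> carrier (V y)"
      "c \<in> carrier K \<Longrightarrow> U (HSmult C c f) s = (c \<odot>\<^bsub>B\<^esub> \<one>\<^bsub>B\<^esub>) \<odot>\<^bsub>V y\<^esub> U f s"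
      if "f \<in> Hom C x y" "g \<in> Hom C x y" for f g c
      using that s U_add[of f g s] U_smult[of f c s] U_in[of f s] unfolding Hom_iff by auto
    have ev: "submodule ((\<lambda>f. U f s) ` N') K (underlying_space B (V y))" if N': "submodule N' K ?H" for N'
      unfolding submodule_iff[OF mY]
    proof (intro conjI subsetI ballI)
      note Nd' = N'[unfolded submodule_iff[OF mH], simplified]
      show "w \<in> carrier (underlying_space B (V y))" if "w \<in> (\<lambda>f. U f s) ` N'" for w using that Nd' Us(2) by auto
      show "\<zero>\<^bsub>underlying_space B (V y)\<^esub> \<in> (\<lambda>f. U f s) ` N'"
        using Nd' U_zero[OF x y s] by (auto intro!: image_eqI[of _ _ "HZero C x y"])
      fix u assume "u \<in> (\<lambda>f. U f s) ` N'"
      then obtain f where f: "u = U f s" "f \<in> N'" "f \<in> Hom C x y" using Nd' by auto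
      { fix v assume "v \<in> (\<lambda>f. U f s) ` N'"
        then obtain g where g: "v = U g s" "g \<in> N'" "g \<in> Hom C x y" using Nd' by auto
        have "HAdd C f g \<in> N'" using Nd' f g by blast
        then show "u \<oplus>\<^bsub>underlying_space B (V y)\<^esub> v \<in> (\<lambda>f. U f s) ` N'"
          using Us(1)[OF f(3) g(3)] f(1) g(1) by (auto intro!: image_eqI[of _ _ "HAdd C f g"]) }
      fix c assume c: "c \<in> carrier K"
      have "HSmult C c f \<in> N'" using Nd' f c by blast
      then show "c \<odot>\<^bsub>underlying_space B (V y)\<^esub> u \<in> (\<lambda>f. U f s) ` N'"
        using Us(3)[OF f(3) f(3) c] f(1) by (auto intro!: image_eqI[of _ _ "HSmult C c f"])
    qed
    let ?N0 = "{f \<in> N. U f s = \<zero>\<^bsub>V y\<^esub>}"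
    have "submodule ?N0 K ?H"
      unfolding submodule_iff[OF mH] hom_space_simps
    proof (intro conjI ballI)
      show "?N0 \<subseteq> Hom C x y" using Nd by auto
      show "HZero C x y \<in> ?N0" using Nd U_zero[OF x y s] by simp
      fix f assume f: "f \<in> ?N0"
      then have f': "f \<in> Hom C x y" using Nd by auto
      { fix g assume g: "g \<in> ?N0"
        then have g': "g \<in> Hom C x y" using Nd by auto
        show "HAdd C f g \<in> ?N0" using f g Nd Us(1)[OF f' g'] by simp }
      fix c assume c: "c \<in> carrier K"
      show "HSmult C c f \<in> ?N0" using f Nd Us(3)[OF f' f' c] c by simp
    qed
    then have "fin_gen K ?H ?N0"
      by (rule insert.IH[rotated]) (use insert.prems in auto)
    then obtain T0 where T0: "finite T0" "T0 \<subseteq> ?N0" "\<forall>W. submodule W K ?H \<and> T0 \<subseteq> W \<longrightarrow> ?N0 \<subseteq> W"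
      unfolding fin_gen_def by (elim exE conjE) (rule that)
    have "fin_gen K (underlying_space B (V y)) ((\<lambda>f. U f s) ` N)"
      using nY ev[OF insert.prems(2)] by (simp add: noetherian_space_def)
    then obtain T' where T': "finite T'" "T' \<subseteq> (\<lambda>f. U f s) ` N"
      "\<forall>W. submodule W K (underlying_space B (V y)) \<and> T' \<subseteq> W \<longrightarrow> (\<lambda>f. U f s) ` N \<subseteq> W"
      unfolding fin_gen_def by (elim exE conjE) (rule that)
    obtain T1 where T1: "T1 \<subseteq> N" "finite T1" "T' = (\<lambda>f. U f s) ` T1"
      using finite_subset_image[OF T'(1,2)] by blast
    have "N \<subseteq> W" if W: "submodule W K ?H" "T0 \<union> T1 \<subseteq> W" for W
    proof
      note Wd = W(1)[unfolded submodule_iff[OF mH], simplified]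
      fix f assume f: "f \<in> N"
      have "(\<lambda>f. U f s) ` N \<subseteq> (\<lambda>f. U f s) ` (N \<inter> W)"
        using T'(3) ev[OF submodule_Int[OF mH insert.prems(2) W(1)]] T1(1,3) W(2) by blast
      \<comment> \<open>An arrow already known to lie in W with the same value at s, so that f - g
        belongs to the kernel part.\<close>
      then obtain g where g: "g \<in> N" "g \<in> W" "U f s = U g s" using f by blast
      have fg: "f \<in> Hom C x y" "g \<in> Hom C x y" using f g Nd by auto
      have n1: "\<ominus>\<^bsub>K\<^esub> \<one>\<^bsub>K\<^esub> \<in> carrier K" by simp
      have gm: "HSmult C (\<ominus>\<^bsub>K\<^esub> \<one>\<^bsub>K\<^esub>) g \<in> N" using g(1) Nd n1 by blast
      then have "hsub f g \<in> N" unfolding hsub_def using f Nd by blast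
      moreover have "U (hsub f g) s = \<zero>\<^bsub>V y\<^esub>"
      proof -
        have "U (hsub g g) s = U (hsub f g) s"
          unfolding hsub_def using Us(1)[OF fg(1), of "HSmult C (\<ominus>\<^bsub>K\<^esub> \<one>\<^bsub>K\<^esub>) g"] Us(1)[OF fg(2), of "HSmult C (\<ominus>\<^bsub>K\<^esub> \<one>\<^bsub>K\<^esub>) g"]
            gm Nd g(3) by auto
        moreover have "hsub g g = HZero C x y" using hsub_facts(1)[of g g] fg(2) by (simp add: Hom_iff)
        ultimately show ?thesis using U_zero[OF x y s] by simp
      qed
      ultimately have "hsub f g \<in> W" using T0(3) W by blast
      then have "HAdd C (hsub f g) g \<in> W" using g(2) Wd by blast
      then show "f \<in> W" using hsub_facts(3)[of f g] fg by (simp add: Hom_iff)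
    qed
    then show ?case unfolding fin_gen_def using T0(1,2) T1(1,2) by (intro exI[of _ "T0 \<union> T1"]) auto
  qed
  obtain S where S: "finite S" "S \<subseteq> carrier (V x)"
    "\<forall>W. submodule W K (underlying_space B (V x)) \<and> S \<subseteq> W \<longrightarrow> W = carrier (V x)"
    using V_fin[OF x] unfolding finite_dimensional_def by (elim exE conjE) (rule that, simp_all)
  have "f = HZero C x y" if f: "f \<in> Hom C x y" "\<forall>s\<in>S. U f s = \<zero>\<^bsub>V y\<^esub>" for f
  proof -
    have d: "f \<in> Arr C" "Dom C f = x" "Cod C f = y" using HomD[OF f(1)] .
    have "S \<subseteq> {v \<in> carrier (V x). U f v = \<zero>\<^bsub>V y\<^esub>}" using S(2) f(2) by blast
    then have "{v \<in> carrier (V x). U f v = \<zero>\<^bsub>V y\<^esub>} = carrier (V x)"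
      using S(3) lsub_submodule[OF V_left[OF x] lsub_ker[OF d(1), unfolded d(2,3)]] by blast
    then show ?thesis using zero_iff[OF d(1)] d(2,3) by blast
  qed
  then have "fin_gen K ?H N" if "submodule N K ?H" for N
    using *[OF S(1,2) that] that unfolding submodule_iff[OF mH] by auto
  then show ?thesis using mH by (simp add: noetherian_space_def)
qed

lemma fin_ab: "fin_ab K C"
  by (intro fin_ab.intro linear_category_axioms fin_ab_axioms.intro zero_object biproducts
      image_factorization hom_noetherian)

end

section \<open>The category of finite-dimensional modules, and transport along an
  equivalence\<close>

lemma fd_module_cat_simps [simp]:
  "Ob (fd_module_cat K B) = fd_modules K B"
  "Dom (fd_module_cat K B) (M1, f, M2) = M1" "Cod (fd_module_cat K B) (M1, f, M2) = M2"
  "Id (fd_module_cat K B) M1 = (M1, \<lambda>v \<in> carrier M1. v, M1)"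
  "(M2', g, M3) \<bullet>\<^bsub>fd_module_cat K B\<^esub> (M1, f, M2) = (M1, \<lambda>v \<in> carrier M1. g (f v), M3)"
  "HAdd (fd_module_cat K B) (M1, f, M2) (M1', f', M2') = (M1, \<lambda>v \<in> carrier M1. f v \<oplus>\<^bsub>M2\<^esub> f' v, M2)"
  "HSmult (fd_module_cat K B) c (M1, f, M2) = (M1, \<lambda>v \<in> carrier M1. c \<odot>\<^bsub>underlying_space B M2\<^esub> f v, M2)"
  by (simp_all add: fd_module_cat_def)

lemma Arr_fd_module_cat:
  "h \<in> Arr (fd_module_cat K B) \<longleftrightarrow>
    (\<exists>M1 f M2. h = (M1, f, M2) \<and> M1 \<in> fd_modules K B \<and> M2 \<in> fd_modules K B \<and> f \<in> module_homs B M1 M2)"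
  by (auto simp: fd_module_cat_def)

lemma Hom_fd_module_cat:
  "h \<in> Hom (fd_module_cat K B) M1 M2 \<longleftrightarrow>
    (\<exists>f. h = (M1, f, M2) \<and> M1 \<in> fd_modules K B \<and> M2 \<in> fd_modules K B \<and> f \<in> module_homs B M1 M2)"
  unfolding Hom_iff Arr_fd_module_cat by auto

text \<open>The restrictions to carriers in \<open>Id\<close> and \<open>Comp\<close> are absorbed
  because homomorphisms are extensional functions.\<close>

lemma category_fd_module_cat: "category (fd_module_cat K B)"
proof
  fix f assume "f \<in> Arr (fd_module_cat K B)"
  then show "Dom (fd_module_cat K B) f \<in> Ob (fd_module_cat K B)" "Cod (fd_module_cat K B) f \<in> Ob (fd_module_cat K B)"
    by (auto simp: Arr_fd_module_cat)
next
  fix M1 assume "M1 \<in> Ob (fd_module_cat K B)"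
  then interpret M1: left_module B M1 by (simp add: fd_modules_def)
  show "Id (fd_module_cat K B) M1 \<in> Hom (fd_module_cat K B) M1 M1"
    using \<open>M1 \<in> _\<close> M1.act_closed by (auto simp: Hom_fd_module_cat module_homs_def)
next
  fix f M1 M2 g M3 assume "f \<in> Hom (fd_module_cat K B) M1 M2" "g \<in> Hom (fd_module_cat K B) M2 M3"
  then obtain f' g' where h: "f = (M1, f', M2)" "g = (M2, g', M3)" "M1 \<in> fd_modules K B" "M3 \<in> fd_modules K B"
     "f' \<in> module_homs B M1 M2" "g' \<in> module_homs B M2 M3" unfolding Hom_fd_module_cat by blast
  interpret M1: left_module B M1 using h by (simp add: fd_modules_def)
  have c: "f' v \<in> carrier M2" if "v \<in> carrier M1" for v using h that by (auto simp: module_homs_def)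
  have "(\<lambda>v \<in> carrier M1. g' (f' v)) \<in> module_homs B M1 M3"
    using h(5,6) c M1.act_closed by (auto simp: module_homs_def)
  then show "g \<bullet>\<^bsub>fd_module_cat K B\<^esub> f \<in> Hom (fd_module_cat K B) M1 M3"
    using h by (auto simp: Hom_fd_module_cat)
next
  fix f M1 M2 assume "f \<in> Hom (fd_module_cat K B) M1 M2"
  then obtain f' where h: "f = (M1, f', M2)" "f' \<in> carrier M1 \<rightarrow>\<^sub>E carrier M2"
    unfolding Hom_fd_module_cat module_homs_def by blast
  then have e: "(\<lambda>v \<in> carrier M1. f' v) = f'" "f' v \<in> carrier M2" if "v \<in> carrier M1" for v
    using that by (auto simp: PiE_def extensional_restrict)
  have "(\<lambda>v \<in> carrier M1. f' v) = f'" using h by (auto simp: PiE_def extensional_restrict)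
  moreover have "(\<lambda>v \<in> carrier M1. (\<lambda>v \<in> carrier M2. v) (f' v)) = (\<lambda>v \<in> carrier M1. f' v)"
    using h(2) by (intro restrict_ext) auto
  moreover have "(\<lambda>v \<in> carrier M1. f' ((\<lambda>v \<in> carrier M1. v) v)) = (\<lambda>v \<in> carrier M1. f' v)"
    by (intro restrict_ext) auto
  ultimately show "Id (fd_module_cat K B) M2 \<bullet>\<^bsub>fd_module_cat K B\<^esub> f = f" "f \<bullet>\<^bsub>fd_module_cat K B\<^esub> Id (fd_module_cat K B) M1 = f"
    using h(1) by simp_all
next
  fix f W M1 g M2 h M3
  assume "f \<in> Hom (fd_module_cat K B) W M1" "g \<in> Hom (fd_module_cat K B) M1 M2" "h \<in> Hom (fd_module_cat K B) M2 M3"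
  then obtain f' g' h' where e: "f = (W, f', M1)" "g = (M1, g', M2)" "h = (M2, h', M3)" "f' \<in> carrier W \<rightarrow>\<^sub>E carrier M1"
    unfolding Hom_fd_module_cat module_homs_def by blast
  have "(\<lambda>v \<in> carrier W. (\<lambda>v \<in> carrier M1. h' (g' v)) (f' v)) = (\<lambda>v \<in> carrier W. h' ((\<lambda>v \<in> carrier W. g' (f' v)) v))"
    using e(4) by (intro restrict_ext) auto
  then show "(h \<bullet>\<^bsub>fd_module_cat K B\<^esub> g) \<bullet>\<^bsub>fd_module_cat K B\<^esub> f = h \<bullet>\<^bsub>fd_module_cat K B\<^esub> g \<bullet>\<^bsub>fd_module_cat K B\<^esub> f"
    using e by simp
qed

lemma nat_isoD:
  assumes "nat_iso C D F G \<eta>"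
  shows "x \<in> Ob C \<Longrightarrow> \<eta> x \<in> Hom D (omap F x) (omap G x)" "x \<in> Ob C \<Longrightarrow> is_iso D (\<eta> x)"
    "\<lbrakk>category C; f \<in> Arr C\<rbrakk> \<Longrightarrow> \<eta> (Cod C f) \<bullet>\<^bsub>D\<^esub> amap F f = amap G f \<bullet>\<^bsub>D\<^esub> \<eta> (Dom C f)"
proof -
  show "x \<in> Ob C \<Longrightarrow> \<eta> x \<in> Hom D (omap F x) (omap G x)" "x \<in> Ob C \<Longrightarrow> is_iso D (\<eta> x)"
    using assms unfolding nat_iso_def by blast+
  have *: "\<forall>x\<in>Ob C. \<forall>y\<in>Ob C. \<forall>f\<in>Hom C x y. \<eta> y \<bullet>\<^bsub>D\<^esub> amap F f = amap G f \<bullet>\<^bsub>D\<^esub> \<eta> x"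
    using assms unfolding nat_iso_def by (rule conjunct2)
  assume C: "category C" and f: "f \<in> Arr C"
  have "f \<in> Hom C (Dom C f) (Cod C f)" "Dom C f \<in> Ob C" "Cod C f \<in> Ob C"
    using f category.dom_Ob[OF C f] category.cod_Ob[OF C f] by (simp_all add: Hom_iff)
  then show "\<eta> (Cod C f) \<bullet>\<^bsub>D\<^esub> amap F f = amap G f \<bullet>\<^bsub>D\<^esub> \<eta> (Dom C f)" using * by blast
qed

text \<open>An equivalence F with modules makes C \<open>module_like\<close>: V is F on objects and
  U the underlying map of F on arrows. Faithfulness, fullness and the realization of modules are
  extracted from the two natural isomorphisms.\<close>

theorem finite_linear_category_fin_ab:
  fixes K :: "'k ring" and C :: "('o, 'm, 'k, 'z) lincat_scheme"
  assumes "finite_linear_category K C"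
  shows "fin_ab K C" "\<exists>P. proj_gen C P"
proof -
  from assms have lC: "linear_category K C" by (simp add: finite_linear_category_def)
  from assms obtain B :: "('k, nat \<Rightarrow> 'k) module" where B: "fd_algebra K B"
    and eq: "linearly_equivalent K C (fd_module_cat K B :: ((nat \<Rightarrow> 'k, nat \<Rightarrow> 'k) module, (nat \<Rightarrow> 'k, nat \<Rightarrow> 'k) module \<times> ((nat \<Rightarrow> 'k) \<Rightarrow> (nat \<Rightarrow> 'k)) \<times> (nat \<Rightarrow> 'k, nat \<Rightarrow> 'k) module, 'k) lincat)"
    unfolding finite_linear_category_def by blast
  interpret linear_category K C by (rule lC)
  interpret fd_alg K B by (intro fd_alg.intro K.field_axioms B)
  let ?D = "fd_module_cat K B :: ((nat \<Rightarrow> 'k, nat \<Rightarrow> 'k) module, (nat \<Rightarrow> 'k, nat \<Rightarrow> 'k) module \<times> ((nat \<Rightarrow> 'k) \<Rightarrow> (nat \<Rightarrow> 'k)) \<times> (nat \<Rightarrow> 'k, nat \<Rightarrow> 'k) module, 'k) lincat"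
  interpret D: category ?D by (rule category_fd_module_cat)
  obtain F G \<eta> \<epsilon> where F: "linear_functor K C ?D F" and G: "linear_functor K ?D C G"
    and eta: "nat_iso C C id_ftor (comp_ftor G F) \<eta>" and eps: "nat_iso ?D ?D (comp_ftor F G) id_ftor \<epsilon>"
    using eq unfolding linearly_equivalent_def by (elim exE conjE) (rule that)
  have fF: "is_functor C ?D F" and fG: "is_functor ?D C G" using F G by (simp_all add: linear_functor_def)
  note Fs = is_functorD[OF fF] and Gs = is_functorD[OF fG]
  note CA = category_axioms and DA = D.category_axioms
  have eta_n: "\<eta> (Cod C f) \<bullet>\<^bsub>C\<^esub> f = amap G (amap F f) \<bullet>\<^bsub>C\<^esub> \<eta> (Dom C f)" if "f \<in> Arr C" for f
    using nat_isoD(3)[OF eta CA that] by (simp add: id_ftor_def comp_ftor_def)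
  have eta_i: "is_iso C (\<eta> x)" "\<eta> x \<in> Arr C" "Dom C (\<eta> x) = x" "Cod C (\<eta> x) = omap G (omap F x)" if "x \<in> Ob C" for x
    using nat_isoD(1,2)[OF eta that] by (simp_all add: id_ftor_def comp_ftor_def Hom_iff)
  have eps_n: "\<epsilon> (Cod ?D f) \<bullet>\<^bsub>?D\<^esub> amap F (amap G f) = f \<bullet>\<^bsub>?D\<^esub> \<epsilon> (Dom ?D f)" if "f \<in> Arr ?D" for f
    using nat_isoD(3)[OF eps DA that] by (simp add: id_ftor_def comp_ftor_def)
  have eps_i: "is_iso ?D (\<epsilon> x)" "\<epsilon> x \<in> Hom ?D (omap F (omap G x)) x" if "x \<in> Ob ?D" for x
    using nat_isoD(1,2)[OF eps that] by (simp_all add: id_ftor_def comp_ftor_def)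
  define V where "V = omap F"
  define U where "U f = fst (snd (amap F f))" for f
  have FU: "amap F f = (V (Dom C f), U f, V (Cod C f))" and U: "U f \<in> module_homs B (V (Dom C f)) (V (Cod C f))"
    if "f \<in> Arr C" for f
  proof -
    have "amap F f \<in> Hom ?D (V (Dom C f)) (V (Cod C f))" using Fs(2-4)[OF CA that] by (simp add: Hom_iff V_def)
    then obtain h where "amap F f = (V (Dom C f), h, V (Cod C f))" "h \<in> module_homs B (V (Dom C f)) (V (Cod C f))"
      unfolding Hom_fd_module_cat by blast
    then show "amap F f = (V (Dom C f), U f, V (Cod C f))" "U f \<in> module_homs B (V (Dom C f)) (V (Cod C f))"
      by (simp_all add: U_def)
  qed
  have VO: "V x \<in> fd_modules K B" if "x \<in> Ob C" for x using Fs(1)[OF that] by (simp add: V_def)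
  have lin: "linear_map K (hom_space C x y) (hom_space ?D (V x) (V y)) (amap F)" if "x \<in> Ob C" "y \<in> Ob C" for x y
    using F that by (simp add: linear_functor_def V_def)
  have Usm: "U (HSmult C c f) v = (c \<odot>\<^bsub>B\<^esub> \<one>\<^bsub>B\<^esub>) \<odot>\<^bsub>V (Cod C f)\<^esub> U f v"
    if "f \<in> Arr C" "c \<in> carrier K" "v \<in> carrier (V (Dom C f))" for f c v
  proof -
    have "amap F (HSmult C c f) = HSmult ?D c (amap F f)"
      using lin[of "Dom C f" "Cod C f"] that(1,2) by (simp add: linear_map_def Hom_iff)
    then show ?thesis using FU[OF that(1)] FU[of "HSmult C c f"] that by simp
  qed
  have "module_like K B C V U"
  proof (intro module_like.intro fd_alg_axioms lC module_like_axioms.intro VO U Usm)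
    show "U (Id C x) v = v" if "x \<in> Ob C" "v \<in> carrier (V x)" for x v
      using Fs(5)[OF that(1)] that by (simp add: U_def V_def)
    show "U (g \<bullet>\<^bsub>C\<^esub> f) v = U g (U f v)"
      if "f \<in> Arr C" "g \<in> Arr C" "Dom C g = Cod C f" "v \<in> carrier (V (Dom C f))" for f g v
      using Fs(6)[OF CA that(1-3)] FU[OF that(1)] FU[OF that(2)] FU[of "g \<bullet>\<^bsub>C\<^esub> f"] that by simp
    show "U (HZero C x y) v = \<zero>\<^bsub>V y\<^esub>" if xy: "x \<in> Ob C" "y \<in> Ob C" "v \<in> carrier (V x)" for x y v
    proof -
      interpret H: module K "hom_space C x y" by (rule hom_space_module[OF xy(1,2)])
      interpret Y: left_module B "V y" using VO[OF xy(2)] by (simp add: fd_modules_def)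
      interpret Bm: module K B by (rule B_module)
      \<comment> \<open>Linearity of F speaks of sums and scalar multiples only; preservation of
        zero is read off from multiplication by the zero scalar.\<close>
      have "HSmult C \<zero>\<^bsub>K\<^esub> (HZero C x y) = HZero C x y"
        using H.smult_l_null[of "HZero C x y"] H.zero_closed by simp
      then have "U (HZero C x y) v = (\<zero>\<^bsub>K\<^esub> \<odot>\<^bsub>B\<^esub> \<one>\<^bsub>B\<^esub>) \<odot>\<^bsub>V y\<^esub> U (HZero C x y) v"
        using Usm[of "HZero C x y" "\<zero>\<^bsub>K\<^esub>" v] xy by simp
      moreover have "U (HZero C x y) v \<in> carrier (V y)"
        using U[of "HZero C x y"] xy by (auto simp: module_homs_def)
      ultimately show ?thesis by simp
    qed
    show "U (HAdd C f g) v = U f v \<oplus>\<^bsub>V (Cod C f)\<^esub> U g v"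
      if "f \<in> Arr C" "g \<in> Arr C" "Dom C f = Dom C g" "Cod C f = Cod C g" "v \<in> carrier (V (Dom C f))" for f g v
    proof -
      have "amap F (HAdd C f g) = HAdd ?D (amap F f) (amap F g)"
        using lin[of "Dom C f" "Cod C f"] that(1-4) by (simp add: linear_map_def Hom_iff)
      then show ?thesis using FU[OF that(1)] FU[OF that(2)] FU[of "HAdd C f g"] that by simp
    qed
    show "f = g" if f: "f \<in> Arr C" and g: "g \<in> Arr C" and p: "Dom C f = Dom C g" "Cod C f = Cod C g"
      and e: "\<And>v. v \<in> carrier (V (Dom C f)) \<Longrightarrow> U f v = U g v" for f g
    proof -
      have "U f = U g"
        by (rule PiE_ext[of _ "carrier (V (Dom C f))" "\<lambda>_. carrier (V (Cod C f))"])
          (use U[OF f] U[OF g] p e in \<open>simp_all add: module_homs_def\<close>)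
      then have "amap F f = amap F g" using FU[OF f] FU[OF g] p by simp
      then have "\<eta> (Cod C f) \<bullet>\<^bsub>C\<^esub> f = \<eta> (Cod C f) \<bullet>\<^bsub>C\<^esub> g" using eta_n[OF f] eta_n[OF g] p by simp
      then show "f = g" by (rule iso_cancel_left[OF eta_i(1), rotated -1]) (use f g p eta_i(3) in simp_all)
    qed
    show "\<exists>f\<in>Hom C x y. U f = h" if x: "x \<in> Ob C" and y: "y \<in> Ob C" and h: "h \<in> module_homs B (V x) (V y)" for x y h
    proof -
      let ?H = "(V x, h, V y)"
      have H: "?H \<in> Arr ?D" using VO x y h by (auto simp: Arr_fd_module_cat)
      note GH = Gs(2-4)[OF DA H, simplified]
      \<comment> \<open>Naturality of \<eta> forces this choice: it yields G (F f) = G H for the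
        given homomorphism H. Then F f = H because \<epsilon> makes G faithful.\<close>
      define f where "f = inv_arr C (\<eta> y) \<bullet>\<^bsub>C\<^esub> amap G ?H \<bullet>\<^bsub>C\<^esub> \<eta> x"
      note iy = inv_arr[OF eta_i(1)[OF y]] and ey = eta_i[OF y] and ex = eta_i[OF x]
      have f: "f \<in> Arr C" "Dom C f = x" "Cod C f = y"
        using GH iy(1-3) ey(2-4) ex(2-4) by (simp_all add: f_def V_def)
      have "amap G (amap F f) \<bullet>\<^bsub>C\<^esub> \<eta> x = amap G ?H \<bullet>\<^bsub>C\<^esub> \<eta> x"
        using eta_n[OF f(1)] inv_arr_comp_cancel(2)[OF ey(1), of "amap G ?H \<bullet>\<^bsub>C\<^esub> \<eta> x"] GH ex(2-4) ey(4) f(2,3)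
        by (simp add: f_def V_def)
      then have GF: "amap G (amap F f) = amap G ?H"
        by (rule iso_cancel_right[OF ex(1), rotated -1])
          (use GH ex(2-4) f Fs(2-4)[OF CA f(1)] Gs(2-4)[OF DA Fs(2)[OF CA f(1)]] in \<open>simp_all add: V_def\<close>)
      have Ff: "amap F f \<in> Arr ?D" "Dom ?D (amap F f) = V x" "Cod ?D (amap F f) = V y"
        using Fs(2-4)[OF CA f(1)] f by (simp_all add: V_def)
      have "amap F f \<bullet>\<^bsub>?D\<^esub> \<epsilon> (V x) = ?H \<bullet>\<^bsub>?D\<^esub> \<epsilon> (V x)"
        using eps_n[OF Ff(1)] eps_n[OF H] GF Ff by simp
      then have "amap F f = ?H"
        by (rule D.iso_cancel_right[OF eps_i(1), rotated -1])
          (use H Ff eps_i(2)[of "V x"] VO[OF x] in \<open>simp_all add: Hom_iff\<close>)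
      then have "U f = h" by (simp add: U_def)
      then show ?thesis using f by (auto simp: Hom_iff)
    qed
    show "\<exists>x\<in>Ob C. \<exists>i\<in>module_homs B (V x) W. bij_betw i (carrier (V x)) (carrier W)" if W: "W \<in> fd_modules K B" for W
    proof -
      have WO: "W \<in> Ob ?D" using W by simp
      obtain i where i: "\<epsilon> W = (V (omap G W), i, W)" "i \<in> module_homs B (V (omap G W)) W"
        using eps_i(2)[OF WO] unfolding Hom_fd_module_cat V_def by blast
      obtain g where g: "g \<in> Hom ?D W (V (omap G W))" "g \<bullet>\<^bsub>?D\<^esub> \<epsilon> W = Id ?D (V (omap G W))" "\<epsilon> W \<bullet>\<^bsub>?D\<^esub> g = Id ?D W"
        using eps_i(1)[OF WO] i(1) unfolding is_iso_def by auto
      obtain j where j: "g = (W, j, V (omap G W))" "j \<in> module_homs B W (V (omap G W))"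
        using g(1) unfolding Hom_fd_module_cat by blast
      have fe: "a v = b v" if "(\<lambda>v \<in> N. a v) = (\<lambda>v \<in> N. b v)" "v \<in> N" for a b :: "(nat \<Rightarrow> 'k) \<Rightarrow> nat \<Rightarrow> 'k" and N v
        using fun_cong[OF that(1), of v] that(2) by simp
      have ji: "j (i v) = v" if "v \<in> carrier (V (omap G W))" for v
        using g(2) i(1) j(1) fe[OF _ that, of "\<lambda>v. j (i v)" "\<lambda>v. v"] by simp
      have ij: "i (j v) = v" if "v \<in> carrier W" for v
        using g(3) i(1) j(1) fe[OF _ that, of "\<lambda>v. i (j v)" "\<lambda>v. v"] by simp
      have "bij_betw i (carrier (V (omap G W))) (carrier W)"
        by (rule bij_betw_byWitness[of _ j]) (use ji ij i(2) j(2) in \<open>auto simp: module_homs_def\<close>)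
      then show ?thesis using i(2) Gs(1)[OF WO] by blast
    qed
  qed
  then interpret module_like K B C V U .
  show "fin_ab K C" by (rule fin_ab)
  show "\<exists>P. proj_gen C P" by (rule ex_proj_gen)
qed

section \<open>Monoidal categories acting on linear categories\<close>

text \<open>Composites are kept nested to the right, so an equation for g f does not match inside a
  longer composite; this supplies the extended form.\<close>

lemma (in category) comp_extend:
  "\<lbrakk>g \<bullet> f = h; f \<in> Arr C; g \<in> Arr C; k \<in> Arr C; Dom C g = Cod C f; Dom C f = Cod C k\<rbrakk> \<Longrightarrow> g \<bullet> f \<bullet> k = h \<bullet> k"
  by (metis comp_assoc')

lemma prod_cat_simps [simp]:
  "Ob (prod_cat C D) = Ob C \<times> Ob D" "Arr (prod_cat C D) = Arr C \<times> Arr D"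
  "Dom (prod_cat C D) (f, g) = (Dom C f, Dom D g)" "Cod (prod_cat C D) (f, g) = (Cod C f, Cod D g)"
  "Id (prod_cat C D) (x, y) = (Id C x, Id D y)"
  "(f', g') \<bullet>\<^bsub>prod_cat C D\<^esub> (f, g) = (f' \<bullet>\<^bsub>C\<^esub> f, g' \<bullet>\<^bsub>D\<^esub> g)"
  by (simp_all add: prod_cat_def)

lemma category_prod_cat:
  assumes "category C" "category D" shows "category (prod_cat C D)"
proof -
  interpret C: category C by fact
  interpret D: category D by fact
  show ?thesis by (rule category.intro) (auto simp: Hom_iff)
qed

lemma is_iso_prod_cat:
  assumes "category C" "category D"
  shows "is_iso C f \<Longrightarrow> is_iso D g \<Longrightarrow> is_iso (prod_cat C D) (f, g)"
proof -
  interpret C: category C by fact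
  interpret D: category D by fact
  assume f: "is_iso C f" and g: "is_iso D g"
  show ?thesis
    by (rule category.is_isoI[OF category_prod_cat[OF assms], of _ "(Dom C f, Dom D g)" "(Cod C f, Cod D g)"
          "(inv_arr C f, inv_arr D g)"])
      (use C.inv_arr[OF f] D.inv_arr[OF g] C.is_iso_arr[OF f] D.is_iso_arr[OF g] in \<open>simp_all add: Hom_iff\<close>)
qed

lemma bilinear_functorD:
  assumes "category C" "category D" "bilinear_functor K C D E F"
  shows "\<lbrakk>x \<in> Ob C; y \<in> Ob D\<rbrakk> \<Longrightarrow> omap F (x, y) \<in> Ob E"
    and "\<lbrakk>f \<in> Arr C; g \<in> Arr D\<rbrakk> \<Longrightarrow> amap F (f, g) \<in> Arr E"
    and "\<lbrakk>f \<in> Arr C; g \<in> Arr D\<rbrakk> \<Longrightarrow> Dom E (amap F (f, g)) = omap F (Dom C f, Dom D g)"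
    and "\<lbrakk>f \<in> Arr C; g \<in> Arr D\<rbrakk> \<Longrightarrow> Cod E (amap F (f, g)) = omap F (Cod C f, Cod D g)"
    and "\<lbrakk>x \<in> Ob C; y \<in> Ob D\<rbrakk> \<Longrightarrow> amap F (Id C x, Id D y) = Id E (omap F (x, y))"
    and "\<lbrakk>f \<in> Arr C; f' \<in> Arr C; g \<in> Arr D; g' \<in> Arr D; Dom C f' = Cod C f; Dom D g' = Cod D g\<rbrakk>
      \<Longrightarrow> amap F (f' \<bullet>\<^bsub>C\<^esub> f, g' \<bullet>\<^bsub>D\<^esub> g) = amap F (f', g') \<bullet>\<^bsub>E\<^esub> amap F (f, g)"
proof -
  have F: "is_functor (prod_cat C D) E F" using assms(3) by (simp add: bilinear_functor_def)
  note c = category_prod_cat[OF assms(1,2)]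
  note Fs = is_functorD[OF F]
  show "\<lbrakk>x \<in> Ob C; y \<in> Ob D\<rbrakk> \<Longrightarrow> omap F (x, y) \<in> Ob E" using Fs(1)[of "(x, y)"] by simp
  show "\<lbrakk>x \<in> Ob C; y \<in> Ob D\<rbrakk> \<Longrightarrow> amap F (Id C x, Id D y) = Id E (omap F (x, y))" using Fs(5)[of "(x, y)"] by simp
  show "\<lbrakk>f \<in> Arr C; g \<in> Arr D\<rbrakk> \<Longrightarrow> amap F (f, g) \<in> Arr E"
    "\<lbrakk>f \<in> Arr C; g \<in> Arr D\<rbrakk> \<Longrightarrow> Dom E (amap F (f, g)) = omap F (Dom C f, Dom D g)"
    "\<lbrakk>f \<in> Arr C; g \<in> Arr D\<rbrakk> \<Longrightarrow> Cod E (amap F (f, g)) = omap F (Cod C f, Cod D g)"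
    using Fs(2-4)[OF c, of "(f, g)"] by simp_all
  show "\<lbrakk>f \<in> Arr C; f' \<in> Arr C; g \<in> Arr D; g' \<in> Arr D; Dom C f' = Cod C f; Dom D g' = Cod D g\<rbrakk>
      \<Longrightarrow> amap F (f' \<bullet>\<^bsub>C\<^esub> f, g' \<bullet>\<^bsub>D\<^esub> g) = amap F (f', g') \<bullet>\<^bsub>E\<^esub> amap F (f, g)"
    using Fs(6)[OF c, of "(f, g)" "(f', g')"] by simp
qed

lemma is_functor_iso:
  assumes "category C" "category D" "is_functor C D F" "is_iso C f"
  shows "is_iso D (amap F f)" "inv_arr D (amap F f) = amap F (inv_arr C f)"
proof -
  interpret C: category C by fact
  interpret D: category D by fact
  note i = C.inv_arr[OF assms(4)] C.is_iso_arr[OF assms(4)]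
  note Fs = is_functorD[OF assms(3)]
  have 1: "amap F (inv_arr C f) \<bullet>\<^bsub>D\<^esub> amap F f = Id D (omap F (Dom C f))"
    "amap F f \<bullet>\<^bsub>D\<^esub> amap F (inv_arr C f) = Id D (omap F (Cod C f))"
    using i Fs(5)[of "Dom C f"] Fs(5)[of "Cod C f"]
      Fs(6)[OF assms(1), of f "inv_arr C f"] Fs(6)[OF assms(1), of "inv_arr C f" f] by simp_all
  have 2: "amap F f \<in> Hom D (omap F (Dom C f)) (omap F (Cod C f))"
    "amap F (inv_arr C f) \<in> Hom D (omap F (Cod C f)) (omap F (Dom C f))"
    using i Fs(2-4)[OF assms(1)] by (simp_all add: Hom_iff)
  show "is_iso D (amap F f)" by (rule D.is_isoI[OF 2 1])
  show "inv_arr D (amap F f) = amap F (inv_arr C f)" by (rule D.inv_arr_eqI[OF 2 1])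
qed

context monoidal_linear_category
begin

lemmas cat_A = category_axioms

lemma tensor_simps [simp]:
  "\<lbrakk>a \<in> Ob A; b \<in> Ob A\<rbrakk> \<Longrightarrow> a \<boxtimes> b \<in> Ob A"
  "\<lbrakk>f \<in> Arr A; g \<in> Arr A\<rbrakk> \<Longrightarrow> f \<boxdot> g \<in> Arr A"
  "\<lbrakk>f \<in> Arr A; g \<in> Arr A\<rbrakk> \<Longrightarrow> Dom A (f \<boxdot> g) = Dom A f \<boxtimes> Dom A g"
  "\<lbrakk>f \<in> Arr A; g \<in> Arr A\<rbrakk> \<Longrightarrow> Cod A (f \<boxdot> g) = Cod A f \<boxtimes> Cod A g"
  "\<lbrakk>a \<in> Ob A; b \<in> Ob A\<rbrakk> \<Longrightarrow> Id A a \<boxdot> Id A b = Id A (a \<boxtimes> b)"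
  using bilinear_functorD[OF cat_A cat_A tensor_bilinear] by auto

lemma tensor_comp:
  "\<lbrakk>f \<in> Arr A; f' \<in> Arr A; g \<in> Arr A; g' \<in> Arr A; Dom A f' = Cod A f; Dom A g' = Cod A g\<rbrakk>
    \<Longrightarrow> (f' \<bullet> f) \<boxdot> (g' \<bullet> g) = (f' \<boxdot> g') \<bullet> (f \<boxdot> g)"
  by (rule bilinear_functorD(6)[OF cat_A cat_A tensor_bilinear])

lemma unit_Ob [simp]: "Unit A \<in> Ob A" by (rule unit_in_Ob)

lemma assoc_simps [simp]:
  assumes "a \<in> Ob A" "b \<in> Ob A" "c \<in> Ob A"
  shows "Assoc A a b c \<in> Arr A" "Dom A (Assoc A a b c) = (a \<boxtimes> b) \<boxtimes> c" "Cod A (Assoc A a b c) = a \<boxtimes> (b \<boxtimes> c)"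
    "is_iso A (Assoc A a b c)"
  using nat_isoD(1,2)[OF assoc_nat_iso, of "((a, b), c)"] assms by (simp_all add: Hom_iff)

lemma assoc_nat:
  assumes "f \<in> Arr A" "g \<in> Arr A" "h \<in> Arr A"
  shows "Assoc A (Cod A f) (Cod A g) (Cod A h) \<bullet> ((f \<boxdot> g) \<boxdot> h)
    = (f \<boxdot> (g \<boxdot> h)) \<bullet> Assoc A (Dom A f) (Dom A g) (Dom A h)"
  using nat_isoD(3)[OF assoc_nat_iso category_prod_cat[OF category_prod_cat[OF cat_A cat_A] cat_A], of "((f, g), h)"]
    assms by simp

lemma lunit_simps [simp]:
  assumes "a \<in> Ob A"
  shows "LUnit A a \<in> Arr A" "Dom A (LUnit A a) = Unit A \<boxtimes> a" "Cod A (LUnit A a) = a" "is_iso A (LUnit A a)"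
  using nat_isoD(1,2)[OF lunit_nat_iso, of a] assms by (simp_all add: Hom_iff id_ftor_def)

lemma runit_simps [simp]:
  assumes "a \<in> Ob A"
  shows "RUnit A a \<in> Arr A" "Dom A (RUnit A a) = a \<boxtimes> Unit A" "Cod A (RUnit A a) = a" "is_iso A (RUnit A a)"
  using nat_isoD(1,2)[OF runit_nat_iso, of a] assms by (simp_all add: Hom_iff id_ftor_def)

lemma lunit_nat: "f \<in> Arr A \<Longrightarrow> LUnit A (Cod A f) \<bullet> (Id A (Unit A) \<boxdot> f) = f \<bullet> LUnit A (Dom A f)"
  using nat_isoD(3)[OF lunit_nat_iso cat_A] by (simp add: id_ftor_def)

lemma runit_nat: "f \<in> Arr A \<Longrightarrow> RUnit A (Cod A f) \<bullet> (f \<boxdot> Id A (Unit A)) = f \<bullet> RUnit A (Dom A f)"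
  using nat_isoD(3)[OF runit_nat_iso cat_A] by (simp add: id_ftor_def)

lemma inv_simps [simp]:
  assumes "is_iso A f"
  shows "inv_arr A f \<in> Arr A" "Dom A (inv_arr A f) = Cod A f" "Cod A (inv_arr A f) = Dom A f"
    "inv_arr A f \<bullet> f = Id A (Dom A f)" "f \<bullet> inv_arr A f = Id A (Cod A f)" "is_iso A (inv_arr A f)"
    "inv_arr A (inv_arr A f) = f"
  using inv_arr[OF assms] is_iso_inv_arr[OF assms] by auto

lemma tensor_iso:
  assumes "is_iso A f" "is_iso A g"
  shows "is_iso A (f \<boxdot> g)" "inv_arr A (f \<boxdot> g) = inv_arr A f \<boxdot> inv_arr A g"
proof -
  note p = category_prod_cat[OF cat_A cat_A] and F = tensor_bilinear[unfolded bilinear_functor_def, THEN conjunct1]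
    and i = is_iso_prod_cat[OF cat_A cat_A assms]
  have "inv_arr (prod_cat A A) (f, g) = (inv_arr A f, inv_arr A g)"
    by (rule category.inv_arr_eqI[OF p, of _ "(Dom A f, Dom A g)" "(Cod A f, Cod A g)"])
      (use assms is_iso_arr in \<open>simp_all add: Hom_iff\<close>)
  then show "is_iso A (f \<boxdot> g)" "inv_arr A (f \<boxdot> g) = inv_arr A f \<boxdot> inv_arr A g"
    using is_functor_iso[OF p cat_A F i] by simp_all
qed

end

text \<open>Module categories stripped of finiteness and exactness, so that the results on dual
  objects also apply to \<open>A\<close> acting on itself and to the reversed tensor
  product.\<close>

locale lin_action = A: monoidal_linear_category K A + M: linear_category K M
  for K :: "('k, 'y) ring_scheme" and A :: "('oa, 'ma, 'k, 'z) moncat_scheme"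
    and M :: "('oa, 'ma, 'o, 'm, 'k, 'w) modcat_scheme" (structure) +
  assumes act_bilinear: "bilinear_functor K A M M (Act M)"
    and massoc_nat_iso: "nat_iso (prod_cat (prod_cat A A) M) M
       \<lparr>omap = (\<lambda>((a, b), m). (a \<boxtimes>\<^bsub>A\<^esub> b) \<rhd> m), amap = (\<lambda>((f, g), h). (f \<boxdot>\<^bsub>A\<^esub> g) \<unrhd> h)\<rparr>
       \<lparr>omap = (\<lambda>((a, b), m). a \<rhd> (b \<rhd> m)), amap = (\<lambda>((f, g), h). f \<unrhd> (g \<unrhd> h))\<rparr>
       (\<lambda>((a, b), m). MAssoc M a b m)"
    and munit_nat_iso: "nat_iso M M
       \<lparr>omap = (\<lambda>m. Unit A \<rhd> m), amap = (\<lambda>f. Id A (Unit A) \<unrhd> f)\<rparr> id_ftor (MUnit M)"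
    and mpentagon: "\<lbrakk>a \<in> Ob A; b \<in> Ob A; c \<in> Ob A; m \<in> Ob M\<rbrakk> \<Longrightarrow>
        MAssoc M a b (c \<rhd> m) \<bullet> MAssoc M (a \<boxtimes>\<^bsub>A\<^esub> b) c m =
        (Id A a \<unrhd> MAssoc M b c m) \<bullet> MAssoc M a (b \<boxtimes>\<^bsub>A\<^esub> c) m \<bullet> (Assoc A a b c \<unrhd> Id M m)"
    and mtriangle: "\<lbrakk>a \<in> Ob A; m \<in> Ob M\<rbrakk> \<Longrightarrow>
        (Id A a \<unrhd> MUnit M m) \<bullet> MAssoc M a (Unit A) m = RUnit A a \<unrhd> Id M m"
begin

lemma act_simps [simp]:
  "\<lbrakk>a \<in> Ob A; m \<in> Ob M\<rbrakk> \<Longrightarrow> a \<rhd> m \<in> Ob M"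
  "\<lbrakk>f \<in> Arr A; g \<in> Arr M\<rbrakk> \<Longrightarrow> f \<unrhd> g \<in> Arr M"
  "\<lbrakk>f \<in> Arr A; g \<in> Arr M\<rbrakk> \<Longrightarrow> Dom M (f \<unrhd> g) = Dom A f \<rhd> Dom M g"
  "\<lbrakk>f \<in> Arr A; g \<in> Arr M\<rbrakk> \<Longrightarrow> Cod M (f \<unrhd> g) = Cod A f \<rhd> Cod M g"
  "\<lbrakk>a \<in> Ob A; m \<in> Ob M\<rbrakk> \<Longrightarrow> Id A a \<unrhd> Id M m = Id M (a \<rhd> m)"
  using bilinear_functorD[OF A.category_axioms M.category_axioms act_bilinear] by auto

lemma act_comp:
  "\<lbrakk>f \<in> Arr A; f' \<in> Arr A; g \<in> Arr M; g' \<in> Arr M; Dom A f' = Cod A f; Dom M g' = Cod M g\<rbrakk>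
    \<Longrightarrow> (f' \<unrhd> g') \<bullet> (f \<unrhd> g) = (f' \<bullet>\<^bsub>A\<^esub> f) \<unrhd> (g' \<bullet> g)"
  by (rule bilinear_functorD(6)[OF A.category_axioms M.category_axioms act_bilinear, symmetric])

lemma whisker_left:
  "\<lbrakk>a \<in> Ob A; f \<in> Arr M; g \<in> Arr M; Dom M g = Cod M f\<rbrakk> \<Longrightarrow> Id A a \<unrhd> (g \<bullet> f) = (Id A a \<unrhd> g) \<bullet> (Id A a \<unrhd> f)"
  by (subst act_comp) simp_all

lemma whisker_right:
  "\<lbrakk>m \<in> Ob M; f \<in> Arr A; g \<in> Arr A; Dom A g = Cod A f\<rbrakk> \<Longrightarrow> (g \<bullet>\<^bsub>A\<^esub> f) \<unrhd> Id M m = (g \<unrhd> Id M m) \<bullet> (f \<unrhd> Id M m)"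
  by (subst act_comp) simp_all

lemma act_exchange:
  "\<lbrakk>f \<in> Arr A; g \<in> Arr M; Dom A f = a; Dom M g = m; Cod A f = a'; Cod M g = m'\<rbrakk>
    \<Longrightarrow> (f \<unrhd> Id M m') \<bullet> (Id A a \<unrhd> g) = (Id A a' \<unrhd> g) \<bullet> (f \<unrhd> Id M m)"
  by (auto simp: act_comp)

lemma act_iso:
  assumes "is_iso A f" "is_iso M g"
  shows "is_iso M (f \<unrhd> g)" "inv_arr M (f \<unrhd> g) = inv_arr A f \<unrhd> inv_arr M g"
proof -
  note p = category_prod_cat[OF A.category_axioms M.category_axioms]
    and F = act_bilinear[unfolded bilinear_functor_def, THEN conjunct1]
    and i = is_iso_prod_cat[OF A.category_axioms M.category_axioms assms]
  have "inv_arr (prod_cat A M) (f, g) = (inv_arr A f, inv_arr M g)"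
    by (rule category.inv_arr_eqI[OF p, of _ "(Dom A f, Dom M g)" "(Cod A f, Cod M g)"])
      (use M.inv_arr[OF assms(2)] assms A.is_iso_arr M.is_iso_arr in \<open>simp_all add: Hom_iff\<close>)
  then show "is_iso M (f \<unrhd> g)" "inv_arr M (f \<unrhd> g) = inv_arr A f \<unrhd> inv_arr M g"
    using is_functor_iso[OF p M.category_axioms F i] by simp_all
qed

lemma minv_simps [simp]:
  assumes "is_iso M f"
  shows "inv_arr M f \<in> Arr M" "Dom M (inv_arr M f) = Cod M f" "Cod M (inv_arr M f) = Dom M f"
    "inv_arr M f \<bullet> f = Id M (Dom M f)" "f \<bullet> inv_arr M f = Id M (Cod M f)" "is_iso M (inv_arr M f)"
    "inv_arr M (inv_arr M f) = f"
  using M.inv_arr[OF assms] M.is_iso_inv_arr[OF assms] by auto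

lemma massoc_simps [simp]:
  assumes "a \<in> Ob A" "b \<in> Ob A" "m \<in> Ob M"
  shows "MAssoc M a b m \<in> Arr M" "Dom M (MAssoc M a b m) = (a \<boxtimes>\<^bsub>A\<^esub> b) \<rhd> m" "Cod M (MAssoc M a b m) = a \<rhd> (b \<rhd> m)"
    "is_iso M (MAssoc M a b m)"
  using nat_isoD(1,2)[OF massoc_nat_iso, of "((a, b), m)"] assms by (simp_all add: Hom_iff)

lemma massoc_nat:
  assumes "f \<in> Arr A" "g \<in> Arr A" "h \<in> Arr M" "Dom A f = a" "Dom A g = b" "Dom M h = m"
    "Cod A f = a'" "Cod A g = b'" "Cod M h = m'"
  shows "MAssoc M a' b' m' \<bullet> ((f \<boxdot>\<^bsub>A\<^esub> g) \<unrhd> h) = (f \<unrhd> (g \<unrhd> h)) \<bullet> MAssoc M a b m"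
  using nat_isoD(3)[OF massoc_nat_iso
      category_prod_cat[OF category_prod_cat[OF A.category_axioms A.category_axioms] M.category_axioms], of "((f, g), h)"]
    assms by simp

lemma munit_simps [simp]:
  assumes "m \<in> Ob M"
  shows "MUnit M m \<in> Arr M" "Dom M (MUnit M m) = Unit A \<rhd> m" "Cod M (MUnit M m) = m" "is_iso M (MUnit M m)"
  using nat_isoD(1,2)[OF munit_nat_iso, of m] assms by (simp_all add: Hom_iff id_ftor_def)

lemma munit_nat:
  "\<lbrakk>f \<in> Arr M; Dom M f = m; Cod M f = m'\<rbrakk> \<Longrightarrow> MUnit M m' \<bullet> (Id A (Unit A) \<unrhd> f) = f \<bullet> MUnit M m"
  using nat_isoD(3)[OF munit_nat_iso M.category_axioms] by (auto simp: id_ftor_def)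

text \<open>Acting with the unit is naturally isomorphic to the identity functor, hence
  faithful.\<close>

lemma unit_act_cancel:
  assumes "f \<in> Arr M" "g \<in> Arr M" "Dom M f = Dom M g" "Cod M f = Cod M g" "Id A (Unit A) \<unrhd> f = Id A (Unit A) \<unrhd> g"
  shows "f = g"
proof -
  have "f \<bullet> MUnit M (Dom M f) = g \<bullet> MUnit M (Dom M f)"
    using munit_nat[OF assms(1) refl refl] munit_nat[OF assms(2) refl refl] assms(3-5) by simp
  then show ?thesis by (rule M.iso_cancel_right[rotated -1, of _ "MUnit M (Dom M f)"]) (use assms in simp_all)
qed

text \<open>The left unit constraint is determined by the right one, as in Kelly's reduction of the
  coherence axioms: compare both sides after acting with the unit.\<close>

lemma munit_massoc:
  assumes x: "x \<in> Ob A" and m: "m \<in> Ob M"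
  shows "MUnit M (x \<rhd> m) \<bullet> MAssoc M (Unit A) x m = LUnit A x \<unrhd> Id M m"
proof (rule unit_act_cancel)
  let ?I = "Unit A"
  \<comment> \<open>Two of the three factors of one side of the pentagon. Composing with this
    isomorphism lets pentagon and triangle apply; it is cancelled at the end.\<close>
  let ?W = "MAssoc M ?I (?I \<boxtimes>\<^bsub>A\<^esub> x) m \<bullet> (Assoc A ?I ?I x \<unrhd> Id M m)"
  have W: "is_iso M ?W"
    using x m by (intro M.is_iso_comp(1)) (simp_all add: act_iso M.is_iso_id)
  have "(Id A ?I \<unrhd> (MUnit M (x \<rhd> m) \<bullet> MAssoc M ?I x m)) \<bullet> ?W
      = (Id A ?I \<unrhd> MUnit M (x \<rhd> m)) \<bullet> (Id A ?I \<unrhd> MAssoc M ?I x m) \<bullet> ?W"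
    using x m by (simp add: whisker_left)
  also have "\<dots> = (Id A ?I \<unrhd> MUnit M (x \<rhd> m)) \<bullet> MAssoc M ?I ?I (x \<rhd> m) \<bullet> MAssoc M (?I \<boxtimes>\<^bsub>A\<^esub> ?I) x m"
    using x m by (simp add: mpentagon)
  also have "\<dots> = (RUnit A ?I \<unrhd> Id M (x \<rhd> m)) \<bullet> MAssoc M (?I \<boxtimes>\<^bsub>A\<^esub> ?I) x m"
    using x m by (simp add: M.comp_extend[OF mtriangle])
  also have "\<dots> = (RUnit A ?I \<unrhd> (Id A x \<unrhd> Id M m)) \<bullet> MAssoc M (?I \<boxtimes>\<^bsub>A\<^esub> ?I) x m" using x m by simp
  also have "\<dots> = MAssoc M ?I x m \<bullet> ((RUnit A ?I \<boxdot>\<^bsub>A\<^esub> Id A x) \<unrhd> Id M m)"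
    by (rule massoc_nat[symmetric]) (use x m in simp_all)
  also have "RUnit A ?I \<boxdot>\<^bsub>A\<^esub> Id A x = (Id A ?I \<boxdot>\<^bsub>A\<^esub> LUnit A x) \<bullet>\<^bsub>A\<^esub> Assoc A ?I ?I x" using x A.triangle by simp
  also have "MAssoc M ?I x m \<bullet> (((Id A ?I \<boxdot>\<^bsub>A\<^esub> LUnit A x) \<bullet>\<^bsub>A\<^esub> Assoc A ?I ?I x) \<unrhd> Id M m)
      = (MAssoc M ?I x m \<bullet> ((Id A ?I \<boxdot>\<^bsub>A\<^esub> LUnit A x) \<unrhd> Id M m)) \<bullet> (Assoc A ?I ?I x \<unrhd> Id M m)"
    using x m by (simp add: whisker_right)
  also have "MAssoc M ?I x m \<bullet> ((Id A ?I \<boxdot>\<^bsub>A\<^esub> LUnit A x) \<unrhd> Id M m)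
      = (Id A ?I \<unrhd> (LUnit A x \<unrhd> Id M m)) \<bullet> MAssoc M ?I (?I \<boxtimes>\<^bsub>A\<^esub> x) m"
    by (rule massoc_nat) (use x m in simp_all)
  finally have "(Id A ?I \<unrhd> (MUnit M (x \<rhd> m) \<bullet> MAssoc M ?I x m)) \<bullet> ?W
      = (Id A ?I \<unrhd> (LUnit A x \<unrhd> Id M m)) \<bullet> ?W" using x m by simp
  then show "Id A ?I \<unrhd> (MUnit M (x \<rhd> m) \<bullet> MAssoc M ?I x m) = Id A ?I \<unrhd> (LUnit A x \<unrhd> Id M m)"
    by (rule M.iso_cancel_right[OF W, rotated -1]) (use x m in simp_all)
qed (use x m in simp_all)

abbreviation "MAI a b m \<equiv> inv_arr M (MAssoc M a b m)"

lemma mai_nat: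
  assumes "f \<in> Arr A" "g \<in> Arr A" "h \<in> Arr M" "Dom A f = a" "Dom A g = b" "Dom M h = m"
    "Cod A f = a'" "Cod A g = b'" "Cod M h = m'"
  shows "MAI a' b' m' \<bullet> (f \<unrhd> (g \<unrhd> h)) = ((f \<boxdot>\<^bsub>A\<^esub> g) \<unrhd> h) \<bullet> MAI a b m"
proof -
  have O: "a \<in> Ob A" "b \<in> Ob A" "m \<in> Ob M" "a' \<in> Ob A" "b' \<in> Ob A" "m' \<in> Ob M" using assms by auto
  have "MAI a' b' m' \<bullet> ((f \<unrhd> (g \<unrhd> h)) \<bullet> MAssoc M a b m) \<bullet> MAI a b m
      = MAI a' b' m' \<bullet> (MAssoc M a' b' m' \<bullet> ((f \<boxdot>\<^bsub>A\<^esub> g) \<unrhd> h)) \<bullet> MAI a b m"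
    using massoc_nat[OF assms] by simp
  then show ?thesis using O assms by (simp add: M.inv_arr_comp_cancel)
qed

lemma munitI_nat:
  assumes "f \<in> Arr M" "Dom M f = m" "Cod M f = m'"
  shows "inv_arr M (MUnit M m') \<bullet> f = (Id A (Unit A) \<unrhd> f) \<bullet> inv_arr M (MUnit M m)"
proof -
  have O: "m \<in> Ob M" "m' \<in> Ob M" using assms by auto
  have "inv_arr M (MUnit M m') \<bullet> (f \<bullet> MUnit M m) \<bullet> inv_arr M (MUnit M m)
      = inv_arr M (MUnit M m') \<bullet> (MUnit M m' \<bullet> (Id A (Unit A) \<unrhd> f)) \<bullet> inv_arr M (MUnit M m)"
    using munit_nat[OF assms] by simp
  then show ?thesis using O assms by (simp add: M.inv_arr_comp_cancel)
qed

text \<open>The pentagon solved for a composite with one inverted constraint, as it arises in a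
  triangle identity below; \<open>mpentagon_inv2\<close> serves the other triangle identity.\<close>

lemma mpentagon_inv1:
  assumes "a \<in> Ob A" "b \<in> Ob A" "c \<in> Ob A" "m \<in> Ob M"
  shows "(Id A a \<unrhd> MAI b c m) \<bullet> MAssoc M a b (c \<rhd> m)
    = MAssoc M a (b \<boxtimes>\<^bsub>A\<^esub> c) m \<bullet> (Assoc A a b c \<unrhd> Id M m) \<bullet> MAI (a \<boxtimes>\<^bsub>A\<^esub> b) c m"
proof -
  have i: "is_iso M (Id A a \<unrhd> MAssoc M b c m)" "inv_arr M (Id A a \<unrhd> MAssoc M b c m) = Id A a \<unrhd> MAI b c m"
    using assms by (simp_all add: act_iso A.is_iso_id A.inv_arr_id)
  have "(Id A a \<unrhd> MAI b c m) \<bullet> (MAssoc M a b (c \<rhd> m) \<bullet> MAssoc M (a \<boxtimes>\<^bsub>A\<^esub> b) c m) \<bullet> MAI (a \<boxtimes>\<^bsub>A\<^esub> b) c m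
     = (Id A a \<unrhd> MAI b c m) \<bullet> ((Id A a \<unrhd> MAssoc M b c m) \<bullet> MAssoc M a (b \<boxtimes>\<^bsub>A\<^esub> c) m \<bullet> (Assoc A a b c \<unrhd> Id M m)) \<bullet> MAI (a \<boxtimes>\<^bsub>A\<^esub> b) c m"
    using mpentagon assms by simp
  then show ?thesis using assms M.inv_arr_comp_cancel(1)[OF i(1)] unfolding i(2) by simp
qed

lemma mpentagon_inv2:
  assumes "a \<in> Ob A" "b \<in> Ob A" "c \<in> Ob A" "m \<in> Ob M"
  shows "MAI a b (c \<rhd> m) \<bullet> (Id A a \<unrhd> MAssoc M b c m)
    = MAssoc M (a \<boxtimes>\<^bsub>A\<^esub> b) c m \<bullet> (inv_arr A (Assoc A a b c) \<unrhd> Id M m) \<bullet> MAI a (b \<boxtimes>\<^bsub>A\<^esub> c) m"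
proof -
  let ?j = "inv_arr A (Assoc A a b c) \<unrhd> Id M m"
  have j: "(Assoc A a b c \<unrhd> Id M m) \<bullet> ?j = Id M ((a \<boxtimes>\<^bsub>A\<^esub> (b \<boxtimes>\<^bsub>A\<^esub> c)) \<rhd> m)"
    using assms by (simp add: act_comp)
  have "MAI a b (c \<rhd> m) \<bullet> (Id A a \<unrhd> MAssoc M b c m)
     = MAI a b (c \<rhd> m) \<bullet> ((Id A a \<unrhd> MAssoc M b c m) \<bullet> MAssoc M a (b \<boxtimes>\<^bsub>A\<^esub> c) m \<bullet> (Assoc A a b c \<unrhd> Id M m))
         \<bullet> ?j \<bullet> MAI a (b \<boxtimes>\<^bsub>A\<^esub> c) m"
    using assms by (simp add: M.comp_extend[OF j])
  also have "\<dots> = MAI a b (c \<rhd> m) \<bullet> (MAssoc M a b (c \<rhd> m) \<bullet> MAssoc M (a \<boxtimes>\<^bsub>A\<^esub> b) c m) \<bullet> ?j \<bullet> MAI a (b \<boxtimes>\<^bsub>A\<^esub> c) m"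
    using mpentagon assms by simp
  finally show ?thesis using assms by (simp add: M.inv_arr_comp_cancel)
qed

lemma mai_munitI:
  assumes "x \<in> Ob A" "m \<in> Ob M"
  shows "MAI (Unit A) x m \<bullet> inv_arr M (MUnit M (x \<rhd> m)) = inv_arr A (LUnit A x) \<unrhd> Id M m"
  using M.is_iso_comp(2)[of "MAssoc M (Unit A) x m" "MUnit M (x \<rhd> m)"] munit_massoc[OF assms]
    act_iso(2)[of "LUnit A x" "Id M m"] assms by (simp add: M.is_iso_id M.inv_arr_id)

lemma mai_act_munitI:
  assumes "a \<in> Ob A" "m \<in> Ob M"
  shows "MAI a (Unit A) m \<bullet> (Id A a \<unrhd> inv_arr M (MUnit M m)) = inv_arr A (RUnit A a) \<unrhd> Id M m"
  using M.is_iso_comp(2)[of "MAssoc M a (Unit A) m" "Id A a \<unrhd> MUnit M m"] mtriangle[OF assms]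
    act_iso[of "Id A a" "MUnit M m"] act_iso(2)[of "RUnit A a" "Id M m"] assms
  by (simp add: M.is_iso_id M.inv_arr_id A.is_iso_id A.inv_arr_id)

subsection \<open>The adjunction between the actions of dual objects\<close>

text \<open>For b a right dual of a, the action of b is left adjoint to the action of a; this is the
  counit b.(a.z) -> z, and \<open>counit_unit\<close> is the unit.\<close>

definition counit :: "'oa \<Rightarrow> 'oa \<Rightarrow> 'ma \<Rightarrow> 'o \<Rightarrow> 'm" where
  "counit a b ev z = MUnit M z \<bullet> (ev \<unrhd> Id M z) \<bullet> MAI b a z"

definition counit_unit :: "'oa \<Rightarrow> 'oa \<Rightarrow> 'ma \<Rightarrow> 'o \<Rightarrow> 'm" where
  "counit_unit a b coev y = MAssoc M a b y \<bullet> (coev \<unrhd> Id M y) \<bullet> inv_arr M (MUnit M y)"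

end

lemma (in monoidal_linear_category) right_dualD:
  assumes "is_right_dual A a b ev coev"
  shows "a \<in> Ob A" "b \<in> Ob A" "ev \<in> Arr A" "Dom A ev = b \<boxtimes> a" "Cod A ev = Unit A"
    "coev \<in> Arr A" "Dom A coev = Unit A" "Cod A coev = a \<boxtimes> b"
    "RUnit A a \<bullet> (Id A a \<boxdot> ev) \<bullet> Assoc A a b a \<bullet> (coev \<boxdot> Id A a) \<bullet> inv_arr A (LUnit A a) = Id A a"
    "LUnit A b \<bullet> (ev \<boxdot> Id A b) \<bullet> inv_arr A (Assoc A b a b) \<bullet> (Id A b \<boxdot> coev) \<bullet> inv_arr A (RUnit A b) = Id A b"
  using assms by (simp_all add: is_right_dual_def Hom_iff)

context lin_action
begin

lemma counit_arr:
  assumes "is_right_dual A a b ev coev" "z \<in> Ob M"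
  shows "counit a b ev z \<in> Arr M" "Dom M (counit a b ev z) = b \<rhd> (a \<rhd> z)" "Cod M (counit a b ev z) = z"
    "counit_unit a b coev z \<in> Arr M" "Dom M (counit_unit a b coev z) = z" "Cod M (counit_unit a b coev z) = a \<rhd> (b \<rhd> z)"
  using A.right_dualD(1-8)[OF assms(1)] assms(2) by (simp_all add: counit_def counit_unit_def)

lemma counit_nat:
  assumes d: "is_right_dual A a b ev coev" and g: "g \<in> Arr M" "Dom M g = z" "Cod M g = z'"
  shows "counit a b ev z' \<bullet> (Id A b \<unrhd> (Id A a \<unrhd> g)) = g \<bullet> counit a b ev z"
proof -
  note D = A.right_dualD(1-8)[OF d]
  have O: "z \<in> Ob M" "z' \<in> Ob M" using g by auto
  have "counit a b ev z' \<bullet> (Id A b \<unrhd> (Id A a \<unrhd> g))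
      = MUnit M z' \<bullet> (ev \<unrhd> Id M z') \<bullet> (MAI b a z' \<bullet> (Id A b \<unrhd> (Id A a \<unrhd> g)))"
    using D g O by (simp add: counit_def)
  also have "MAI b a z' \<bullet> (Id A b \<unrhd> (Id A a \<unrhd> g)) = (Id A (b \<boxtimes>\<^bsub>A\<^esub> a) \<unrhd> g) \<bullet> MAI b a z"
    using D g O by (subst mai_nat[of _ _ _ b a z]) simp_all
  also have "MUnit M z' \<bullet> (ev \<unrhd> Id M z') \<bullet> (Id A (b \<boxtimes>\<^bsub>A\<^esub> a) \<unrhd> g) \<bullet> MAI b a z
      = MUnit M z' \<bullet> (Id A (Unit A) \<unrhd> g) \<bullet> (ev \<unrhd> Id M z) \<bullet> MAI b a z"
    using D g O by (simp add: M.comp_extend[OF act_exchange])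
  also have "\<dots> = g \<bullet> counit a b ev z"
    using D g O by (simp add: counit_def M.comp_extend[OF munit_nat[OF g]])
  finally show ?thesis .
qed

lemma counit_unit_nat:
  assumes d: "is_right_dual A a b ev coev" and g: "g \<in> Arr M" "Dom M g = z" "Cod M g = z'"
  shows "(Id A a \<unrhd> (Id A b \<unrhd> g)) \<bullet> counit_unit a b coev z = counit_unit a b coev z' \<bullet> g"
proof -
  note D = A.right_dualD(1-8)[OF d]
  have O: "z \<in> Ob M" "z' \<in> Ob M" using g by auto
  have "counit_unit a b coev z' \<bullet> g
      = MAssoc M a b z' \<bullet> (coev \<unrhd> Id M z') \<bullet> (inv_arr M (MUnit M z') \<bullet> g)"
    using D g O by (simp add: counit_unit_def)
  also have "\<dots> = MAssoc M a b z' \<bullet> (coev \<unrhd> Id M z') \<bullet> (Id A (Unit A) \<unrhd> g) \<bullet> inv_arr M (MUnit M z)"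
    using munitI_nat[OF g] by simp
  also have "\<dots> = MAssoc M a b z' \<bullet> (Id A (a \<boxtimes>\<^bsub>A\<^esub> b) \<unrhd> g) \<bullet> (coev \<unrhd> Id M z) \<bullet> inv_arr M (MUnit M z)"
    using D g O by (simp add: M.comp_extend[OF act_exchange])
  also have "\<dots> = (MAssoc M a b z' \<bullet> ((Id A a \<boxdot>\<^bsub>A\<^esub> Id A b) \<unrhd> g)) \<bullet> (coev \<unrhd> Id M z) \<bullet> inv_arr M (MUnit M z)"
    using D g O by simp
  also have "MAssoc M a b z' \<bullet> ((Id A a \<boxdot>\<^bsub>A\<^esub> Id A b) \<unrhd> g) = (Id A a \<unrhd> (Id A b \<unrhd> g)) \<bullet> MAssoc M a b z"
    by (rule massoc_nat) (use D g in simp_all)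
  finally show ?thesis using D g O by (simp add: counit_unit_def)
qed

text \<open>Naturality and the pentagon gather all constraints at the two ends; what remains is the
  first snake identity acting on m.\<close>

lemma counit_triangle1:
  assumes d: "is_right_dual A a b ev coev" and m: "m \<in> Ob M"
  shows "(Id A a \<unrhd> counit a b ev m) \<bullet> counit_unit a b coev (a \<rhd> m) = Id M (a \<rhd> m)"
proof -
  note D = A.right_dualD[OF d]
  note T = D(1-8) m
  let ?lu = "inv_arr M (MUnit M (a \<rhd> m))"
  have 1: "MAI (a \<boxtimes>\<^bsub>A\<^esub> b) a m \<bullet> (coev \<unrhd> Id M (a \<rhd> m)) = ((coev \<boxdot>\<^bsub>A\<^esub> Id A a) \<unrhd> Id M m) \<bullet> MAI (Unit A) a m"
    using mai_nat[of coev "Id A a" "Id M m" "Unit A" a m "a \<boxtimes>\<^bsub>A\<^esub> b" a m] T by simp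
  have 2: "(Id A a \<unrhd> (ev \<unrhd> Id M m)) \<bullet> MAssoc M a (b \<boxtimes>\<^bsub>A\<^esub> a) m = MAssoc M a (Unit A) m \<bullet> ((Id A a \<boxdot>\<^bsub>A\<^esub> ev) \<unrhd> Id M m)"
    by (rule massoc_nat[symmetric]) (use T in simp_all)
  have "(Id A a \<unrhd> counit a b ev m) \<bullet> counit_unit a b coev (a \<rhd> m)
     = (Id A a \<unrhd> MUnit M m) \<bullet> (Id A a \<unrhd> (ev \<unrhd> Id M m)) \<bullet> ((Id A a \<unrhd> MAI b a m) \<bullet> MAssoc M a b (a \<rhd> m))
        \<bullet> (coev \<unrhd> Id M (a \<rhd> m)) \<bullet> ?lu"
    using T by (simp add: counit_def counit_unit_def whisker_left)
  also have "\<dots> = (Id A a \<unrhd> MUnit M m) \<bullet> ((Id A a \<unrhd> (ev \<unrhd> Id M m)) \<bullet> MAssoc M a (b \<boxtimes>\<^bsub>A\<^esub> a) m) \<bullet> (Assoc A a b a \<unrhd> Id M m)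
        \<bullet> (MAI (a \<boxtimes>\<^bsub>A\<^esub> b) a m \<bullet> (coev \<unrhd> Id M (a \<rhd> m))) \<bullet> ?lu"
    using T by (simp add: mpentagon_inv1)
  also have "\<dots> = ((Id A a \<unrhd> MUnit M m) \<bullet> MAssoc M a (Unit A) m) \<bullet> ((Id A a \<boxdot>\<^bsub>A\<^esub> ev) \<unrhd> Id M m) \<bullet> (Assoc A a b a \<unrhd> Id M m)
        \<bullet> ((coev \<boxdot>\<^bsub>A\<^esub> Id A a) \<unrhd> Id M m) \<bullet> (MAI (Unit A) a m \<bullet> ?lu)"
    unfolding 1 2 using T by simp
  also have "\<dots> = (RUnit A a \<unrhd> Id M m) \<bullet> ((Id A a \<boxdot>\<^bsub>A\<^esub> ev) \<unrhd> Id M m) \<bullet> (Assoc A a b a \<unrhd> Id M m)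
        \<bullet> ((coev \<boxdot>\<^bsub>A\<^esub> Id A a) \<unrhd> Id M m) \<bullet> (inv_arr A (LUnit A a) \<unrhd> Id M m)"
    using T by (simp only: mtriangle mai_munitI)
  also have "\<dots> = (RUnit A a \<bullet>\<^bsub>A\<^esub> (Id A a \<boxdot>\<^bsub>A\<^esub> ev) \<bullet>\<^bsub>A\<^esub> Assoc A a b a \<bullet>\<^bsub>A\<^esub> (coev \<boxdot>\<^bsub>A\<^esub> Id A a) \<bullet>\<^bsub>A\<^esub> inv_arr A (LUnit A a)) \<unrhd> Id M m"
    using T by (simp add: whisker_right)
  also have "\<dots> = Id M (a \<rhd> m)" unfolding D(9) using T by simp
  finally show ?thesis .
qed

text \<open>The same regrouping, ending in the second snake identity acting on m.\<close>

lemma counit_triangle2: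
  assumes d: "is_right_dual A a b ev coev" and m: "m \<in> Ob M"
  shows "counit a b ev (b \<rhd> m) \<bullet> (Id A b \<unrhd> counit_unit a b coev m) = Id M (b \<rhd> m)"
proof -
  note D = A.right_dualD[OF d]
  note T = D(1-8) m
  have 1: "(ev \<unrhd> Id M (b \<rhd> m)) \<bullet> MAssoc M (b \<boxtimes>\<^bsub>A\<^esub> a) b m = MAssoc M (Unit A) b m \<bullet> ((ev \<boxdot>\<^bsub>A\<^esub> Id A b) \<unrhd> Id M m)"
    using massoc_nat[of ev "Id A b" "Id M m" "b \<boxtimes>\<^bsub>A\<^esub> a" b m "Unit A" b m] T by simp
  have 2: "MAI b (a \<boxtimes>\<^bsub>A\<^esub> b) m \<bullet> (Id A b \<unrhd> (coev \<unrhd> Id M m)) = ((Id A b \<boxdot>\<^bsub>A\<^esub> coev) \<unrhd> Id M m) \<bullet> MAI b (Unit A) m"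
    by (rule mai_nat) (use T in simp_all)
  have "counit a b ev (b \<rhd> m) \<bullet> (Id A b \<unrhd> counit_unit a b coev m)
     = MUnit M (b \<rhd> m) \<bullet> (ev \<unrhd> Id M (b \<rhd> m)) \<bullet> (MAI b a (b \<rhd> m) \<bullet> (Id A b \<unrhd> MAssoc M a b m))
        \<bullet> (Id A b \<unrhd> (coev \<unrhd> Id M m)) \<bullet> (Id A b \<unrhd> inv_arr M (MUnit M m))"
    using T by (simp add: counit_def counit_unit_def whisker_left)
  also have "\<dots> = MUnit M (b \<rhd> m) \<bullet> ((ev \<unrhd> Id M (b \<rhd> m)) \<bullet> MAssoc M (b \<boxtimes>\<^bsub>A\<^esub> a) b m) \<bullet> (inv_arr A (Assoc A b a b) \<unrhd> Id M m)
        \<bullet> (MAI b (a \<boxtimes>\<^bsub>A\<^esub> b) m \<bullet> (Id A b \<unrhd> (coev \<unrhd> Id M m))) \<bullet> (Id A b \<unrhd> inv_arr M (MUnit M m))"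
    using T by (simp add: mpentagon_inv2)
  also have "\<dots> = (MUnit M (b \<rhd> m) \<bullet> MAssoc M (Unit A) b m) \<bullet> ((ev \<boxdot>\<^bsub>A\<^esub> Id A b) \<unrhd> Id M m) \<bullet> (inv_arr A (Assoc A b a b) \<unrhd> Id M m)
        \<bullet> ((Id A b \<boxdot>\<^bsub>A\<^esub> coev) \<unrhd> Id M m) \<bullet> (MAI b (Unit A) m \<bullet> (Id A b \<unrhd> inv_arr M (MUnit M m)))"
    unfolding 1 2 using T by simp
  also have "\<dots> = (LUnit A b \<unrhd> Id M m) \<bullet> ((ev \<boxdot>\<^bsub>A\<^esub> Id A b) \<unrhd> Id M m) \<bullet> (inv_arr A (Assoc A b a b) \<unrhd> Id M m)
        \<bullet> ((Id A b \<boxdot>\<^bsub>A\<^esub> coev) \<unrhd> Id M m) \<bullet> (inv_arr A (RUnit A b) \<unrhd> Id M m)"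
    using T by (simp only: munit_massoc mai_act_munitI)
  also have "\<dots> = (LUnit A b \<bullet>\<^bsub>A\<^esub> (ev \<boxdot>\<^bsub>A\<^esub> Id A b) \<bullet>\<^bsub>A\<^esub> inv_arr A (Assoc A b a b) \<bullet>\<^bsub>A\<^esub> (Id A b \<boxdot>\<^bsub>A\<^esub> coev) \<bullet>\<^bsub>A\<^esub> inv_arr A (RUnit A b)) \<unrhd> Id M m"
    using T by (simp add: whisker_right)
  also have "\<dots> = Id M (b \<rhd> m)" unfolding D(10) using T by simp
  finally show ?thesis .
qed

text \<open>The adjunction bijection Hom(y, a.z) -> Hom(b.y, z).\<close>

definition mate :: "'oa \<Rightarrow> 'oa \<Rightarrow> 'ma \<Rightarrow> 'o \<Rightarrow> 'm \<Rightarrow> 'm" where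
  "mate a b ev z w = counit a b ev z \<bullet> (Id A b \<unrhd> w)"

lemma mate_in_Hom:
  assumes "is_right_dual A a b ev coev" "w \<in> Arr M" "Cod M w = a \<rhd> z" "z \<in> Ob M"
  shows "mate a b ev z w \<in> Arr M" "Dom M (mate a b ev z w) = b \<rhd> Dom M w" "Cod M (mate a b ev z w) = z"
  using A.right_dualD(1-8)[OF assms(1)] counit_arr[OF assms(1,4)] assms(2-4) by (simp_all add: mate_def)

text \<open>Naturality of unit and counit moves the given arrow outside, leaving a triangle
  identity.\<close>

lemma mate_inverse:
  assumes d: "is_right_dual A a b ev coev"
  shows "\<lbrakk>w \<in> Arr M; Cod M w = a \<rhd> z; z \<in> Ob M\<rbrakk>
      \<Longrightarrow> (Id A a \<unrhd> mate a b ev z w) \<bullet> counit_unit a b coev (Dom M w) = w"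
    and "\<lbrakk>g \<in> Arr M; Dom M g = b \<rhd> y; y \<in> Ob M\<rbrakk>
      \<Longrightarrow> mate a b ev (Cod M g) ((Id A a \<unrhd> g) \<bullet> counit_unit a b coev y) = g"
proof -
  note D = A.right_dualD(1-8)[OF d]
  { assume w: "w \<in> Arr M" "Cod M w = a \<rhd> z" "z \<in> Ob M"
    have "(Id A a \<unrhd> mate a b ev z w) \<bullet> counit_unit a b coev (Dom M w)
       = (Id A a \<unrhd> counit a b ev z) \<bullet> ((Id A a \<unrhd> (Id A b \<unrhd> w)) \<bullet> counit_unit a b coev (Dom M w))"
      using D w counit_arr[OF d] by (simp add: mate_def whisker_left)
    also have "\<dots> = ((Id A a \<unrhd> counit a b ev z) \<bullet> counit_unit a b coev (a \<rhd> z)) \<bullet> w"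
      using counit_unit_nat[OF d w(1) refl w(2)] D w counit_arr[OF d] by simp
    also have "\<dots> = w" using counit_triangle1[OF d w(3)] w by simp
    finally show "(Id A a \<unrhd> mate a b ev z w) \<bullet> counit_unit a b coev (Dom M w) = w" . }
  { assume g: "g \<in> Arr M" "Dom M g = b \<rhd> y" "y \<in> Ob M"
    let ?z = "Cod M g"
    have "mate a b ev ?z ((Id A a \<unrhd> g) \<bullet> counit_unit a b coev y)
      = (counit a b ev ?z \<bullet> (Id A b \<unrhd> (Id A a \<unrhd> g))) \<bullet> (Id A b \<unrhd> counit_unit a b coev y)"
      using D g counit_arr[OF d] by (simp add: mate_def whisker_left)
    also have "\<dots> = g \<bullet> (counit a b ev (b \<rhd> y) \<bullet> (Id A b \<unrhd> counit_unit a b coev y))"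
      using counit_nat[OF d g(1,2) refl] D g counit_arr[OF d] by simp
    also have "\<dots> = g" using counit_triangle2[OF d g(3)] g by simp
    finally show "mate a b ev ?z ((Id A a \<unrhd> g) \<bullet> counit_unit a b coev y) = g" . }
qed

lemma mate_inj:
  assumes d: "is_right_dual A a b ev coev" and "w \<in> Arr M" "w' \<in> Arr M" "Dom M w = Dom M w'"
    "Cod M w = a \<rhd> z" "Cod M w' = a \<rhd> z" "z \<in> Ob M" "mate a b ev z w = mate a b ev z w'"
  shows "w = w'"
  using mate_inverse(1)[OF d, of w z] mate_inverse(1)[OF d, of w' z] assms by metis

lemma mate_surj:
  assumes d: "is_right_dual A a b ev coev" and "g \<in> Arr M" "Dom M g = b \<rhd> y" "y \<in> Ob M"
  obtains w where "w \<in> Arr M" "Dom M w = y" "Cod M w = a \<rhd> Cod M g" "mate a b ev (Cod M g) w = g"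
  using mate_inverse(2)[OF assms]
  by (rule that[rotated -1]) (use A.right_dualD(1-8)[OF d] counit_arr[OF d] assms in simp_all)

lemma mate_comp:
  assumes d: "is_right_dual A a b ev coev" and w: "w \<in> Arr M" "Cod M w = a \<rhd> z" "z \<in> Ob M"
  shows "\<lbrakk>f \<in> Arr M; Cod M f = Dom M w\<rbrakk> \<Longrightarrow> mate a b ev z (w \<bullet> f) = mate a b ev z w \<bullet> (Id A b \<unrhd> f)"
    and "\<lbrakk>g \<in> Arr M; Dom M g = z\<rbrakk> \<Longrightarrow> mate a b ev (Cod M g) ((Id A a \<unrhd> g) \<bullet> w) = g \<bullet> mate a b ev z w"
proof -
  note D = A.right_dualD(1-8)[OF d]
  show "\<lbrakk>f \<in> Arr M; Cod M f = Dom M w\<rbrakk> \<Longrightarrow> mate a b ev z (w \<bullet> f) = mate a b ev z w \<bullet> (Id A b \<unrhd> f)"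
    using D w counit_arr[OF d] by (simp add: mate_def whisker_left)
  assume g: "g \<in> Arr M" "Dom M g = z"
  have "mate a b ev (Cod M g) ((Id A a \<unrhd> g) \<bullet> w) = (counit a b ev (Cod M g) \<bullet> (Id A b \<unrhd> (Id A a \<unrhd> g))) \<bullet> (Id A b \<unrhd> w)"
    using D w g counit_arr[OF d] by (simp add: mate_def whisker_left)
  also have "\<dots> = g \<bullet> mate a b ev z w"
    using counit_nat[OF d g refl] D w g counit_arr[OF d] by (simp add: mate_def)
  finally show "mate a b ev (Cod M g) ((Id A a \<unrhd> g) \<bullet> w) = g \<bullet> mate a b ev z w" .
qed

end

section \<open>The regular action, the reversed tensor product, and duals\<close>

definition regular :: "('o, 'm, 'k, 'z) moncat_scheme \<Rightarrow> ('o, 'm, 'o, 'm, 'k) modcat" where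
  "regular A = \<lparr>Ob = Ob A, Arr = Arr A, Dom = Dom A, Cod = Cod A, Id = Id A, Comp = Comp A,
     HZero = HZero A, HAdd = HAdd A, HSmult = HSmult A, Act = Tensor A, MAssoc = Assoc A, MUnit = LUnit A\<rparr>"

text \<open>Reversing the tensor product exchanges left and right duals
  (\<open>is_right_dual_rev\<close>), so facts on one kind transfer to the other. Reversal turns the
  bracketing around, hence the inverse associator.\<close>

definition rev :: "('o, 'm, 'k, 'z) moncat_scheme \<Rightarrow> ('o, 'm, 'k) moncat" where
  "rev A = \<lparr>Ob = Ob A, Arr = Arr A, Dom = Dom A, Cod = Cod A, Id = Id A, Comp = Comp A,
     HZero = HZero A, HAdd = HAdd A, HSmult = HSmult A,
     Tensor = \<lparr>omap = (\<lambda>(a, b). b \<boxtimes>\<^bsub>A\<^esub> a), amap = (\<lambda>(f, g). g \<boxdot>\<^bsub>A\<^esub> f)\<rparr>, Unit = Unit A,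
     Assoc = (\<lambda>a b c. inv_arr A (Assoc A c b a)), LUnit = RUnit A, RUnit = LUnit A\<rparr>"

lemma regular_simps [simp]:
  "Ob (regular A) = Ob A" "Arr (regular A) = Arr A" "Dom (regular A) = Dom A" "Cod (regular A) = Cod A"
  "Id (regular A) = Id A" "Comp (regular A) = Comp A" "HZero (regular A) = HZero A" "HAdd (regular A) = HAdd A"
  "HSmult (regular A) = HSmult A" "Act (regular A) = Tensor A" "MAssoc (regular A) = Assoc A"
  "MUnit (regular A) = LUnit A" "Hom (regular A) = Hom A" "hom_space (regular A) = hom_space A"
  "is_iso (regular A) = is_iso A" "inv_arr (regular A) = inv_arr A"
  "prod_cat (regular A) D = prod_cat A D" "prod_cat D (regular A) = prod_cat D A"
  by (auto simp: regular_def Hom_def hom_space_def is_iso_def inv_arr_def prod_cat_def fun_eq_iff)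

lemma rev_simps [simp]:
  "Ob (rev A) = Ob A" "Arr (rev A) = Arr A" "Dom (rev A) = Dom A" "Cod (rev A) = Cod A"
  "Id (rev A) = Id A" "Comp (rev A) = Comp A" "HZero (rev A) = HZero A" "HAdd (rev A) = HAdd A"
  "HSmult (rev A) = HSmult A" "Unit (rev A) = Unit A" "LUnit (rev A) = RUnit A" "RUnit (rev A) = LUnit A"
  "Assoc (rev A) a b c = inv_arr A (Assoc A c b a)" "a \<boxtimes>\<^bsub>rev A\<^esub> b = b \<boxtimes>\<^bsub>A\<^esub> a" "f \<boxdot>\<^bsub>rev A\<^esub> g = g \<boxdot>\<^bsub>A\<^esub> f"
  "Hom (rev A) = Hom A" "hom_space (rev A) = hom_space A" "is_iso (rev A) = is_iso A" "inv_arr (rev A) = inv_arr A"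
  "prod_cat (rev A) D = prod_cat A D" "prod_cat D (rev A) = prod_cat D A"
  by (auto simp: rev_def Hom_def hom_space_def is_iso_def inv_arr_def prod_cat_def fun_eq_iff)

lemma functor_regular [simp]:
  "is_functor C (regular A) F = is_functor C A F" "is_functor (regular A) E G = is_functor A E G"
  "linear_functor K D (regular A) F' = linear_functor K D A F'" "linear_functor K (regular A) D F' = linear_functor K A D F'"
  "nat_iso C (regular A) F H n = nat_iso C A F H n" "nat_iso (regular A) E G I n' = nat_iso A E G I n'"
  "is_epi (regular A) f = is_epi A f" "projective (regular A) p = projective A p"
  by (simp_all add: is_functor_def linear_functor_def nat_iso_def is_epi_def projective_def)

lemma functor_rev [simp]:
  "is_functor C (rev A) F = is_functor C A F" "is_functor (rev A) E G = is_functor A E G"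
  "linear_functor K D (rev A) F' = linear_functor K D A F'" "linear_functor K (rev A) D F' = linear_functor K A D F'"
  "nat_iso C (rev A) F H n = nat_iso C A F H n" "nat_iso (rev A) E G I n' = nat_iso A E G I n'"
  "is_epi (rev A) f = is_epi A f"
  by (simp_all add: is_functor_def linear_functor_def nat_iso_def is_epi_def)

lemma (in linear_category) linear_category_cong:
  assumes "Ob D = Ob C" "Arr D = Arr C" "Dom D = Dom C" "Cod D = Cod C" "Id D = Id C" "Comp D = Comp C"
    "HZero D = HZero C" "HAdd D = HAdd C" "HSmult D = HSmult C"
  shows "linear_category K D"
proof -
  have h: "Hom D = Hom C" "hom_space D = hom_space C"
    using assms by (auto simp: Hom_def hom_space_def fun_eq_iff)
  show ?thesis
    by (intro linear_category.intro category.intro linear_category_axioms.intro K.field_axioms)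
      (auto simp: assms h dom_in_Ob cod_in_Ob id_in_Hom comp_in_Hom id_comp comp_id comp_assoc hom_space_module
        comp_linear_left comp_linear_right)
qed

lemma (in monoidal_linear_category) lin_action_regular: "lin_action K A (regular A)"
proof (intro lin_action.intro lin_action_axioms.intro monoidal_linear_category_axioms)
  show "linear_category K (regular A)" by (rule linear_category_cong) simp_all
  show "bilinear_functor K A (regular A) (regular A) (Act (regular A))"
    using tensor_bilinear by (simp add: bilinear_functor_def)
qed (use assoc_nat_iso lunit_nat_iso pentagon triangle in simp_all)

context monoidal_linear_category
begin

interpretation R: lin_action K A "regular A" by (rule lin_action_regular)

lemma lunit_tensor:
  "\<lbrakk>x \<in> Ob A; y \<in> Ob A\<rbrakk> \<Longrightarrow> LUnit A (x \<boxtimes> y) \<bullet> Assoc A (Unit A) x y = LUnit A x \<boxdot> Id A y"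
  using R.munit_massoc[of x y] by simp

text \<open>By the triangle axiom and \<open>lunit_tensor\<close> the two constraints agree after
  tensoring with the unit on the right, and naturality of the right unit constraint cancels that
  factor.\<close>

lemma lunit_unit: "LUnit A (Unit A) = RUnit A (Unit A)"
proof -
  let ?I = "Unit A"
  have "LUnit A ?I \<bullet> (Id A ?I \<boxdot> LUnit A ?I) = LUnit A ?I \<bullet> LUnit A (?I \<boxtimes> ?I)"
    using lunit_nat[of "LUnit A ?I"] by simp
  then have "Id A ?I \<boxdot> LUnit A ?I = LUnit A (?I \<boxtimes> ?I)"
    by (rule iso_cancel_left[of "LUnit A ?I", rotated -1]) simp_all
  then have "LUnit A ?I \<boxdot> Id A ?I = RUnit A ?I \<boxdot> Id A ?I"
    using lunit_tensor[of ?I ?I] triangle[of ?I ?I] by simp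
  then have "LUnit A ?I \<bullet> RUnit A (?I \<boxtimes> ?I) = RUnit A ?I \<bullet> RUnit A (?I \<boxtimes> ?I)"
    using runit_nat[of "LUnit A ?I"] runit_nat[of "RUnit A ?I"] by simp
  then show ?thesis by (rule iso_cancel_right[of "RUnit A (?I \<boxtimes> ?I)", rotated -1]) simp_all
qed

text \<open>The pentagon for the inverse associators is the inverse of the pentagon for the objects
  in reverse order.\<close>

lemma monoidal_rev: "monoidal_linear_category K (rev A)"
proof (intro monoidal_linear_category.intro monoidal_linear_category_axioms.intro)
  show "linear_category K (rev A)" by (rule linear_category_cong) simp_all
  have "is_functor (prod_cat A A) A (Tensor (rev A))"
    unfolding is_functor_def by (auto simp: Hom_iff tensor_comp)
  then show "bilinear_functor K (rev A) (rev A) (rev A) (Tensor (rev A))"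
    using tensor_bilinear by (simp add: bilinear_functor_def)
  show "nat_iso (prod_cat (prod_cat (rev A) (rev A)) (rev A)) (rev A)
      \<lparr>omap = (\<lambda>((a, b), c). (a \<boxtimes>\<^bsub>rev A\<^esub> b) \<boxtimes>\<^bsub>rev A\<^esub> c), amap = (\<lambda>((f, g), h). (f \<boxdot>\<^bsub>rev A\<^esub> g) \<boxdot>\<^bsub>rev A\<^esub> h)\<rparr>
      \<lparr>omap = (\<lambda>((a, b), c). a \<boxtimes>\<^bsub>rev A\<^esub> (b \<boxtimes>\<^bsub>rev A\<^esub> c)), amap = (\<lambda>((f, g), h). f \<boxdot>\<^bsub>rev A\<^esub> (g \<boxdot>\<^bsub>rev A\<^esub> h))\<rparr>
      (\<lambda>((a, b), c). Assoc (rev A) a b c)"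
    unfolding nat_iso_def using R.mai_nat by (auto simp: Hom_iff)
  show "nat_iso (rev A) (rev A)
      \<lparr>omap = (\<lambda>a. Unit (rev A) \<boxtimes>\<^bsub>rev A\<^esub> a), amap = (\<lambda>f. Id (rev A) (Unit (rev A)) \<boxdot>\<^bsub>rev A\<^esub> f)\<rparr> id_ftor (LUnit (rev A))"
    using runit_nat_iso by simp
  show "nat_iso (rev A) (rev A)
      \<lparr>omap = (\<lambda>a. a \<boxtimes>\<^bsub>rev A\<^esub> Unit (rev A)), amap = (\<lambda>f. f \<boxdot>\<^bsub>rev A\<^esub> Id (rev A) (Unit (rev A)))\<rparr> id_ftor (RUnit (rev A))"
    using lunit_nat_iso by simp
  fix a b c d assume "a \<in> Ob (rev A)" "b \<in> Ob (rev A)" "c \<in> Ob (rev A)" "d \<in> Ob (rev A)"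
  then have O: "a \<in> Ob A" "b \<in> Ob A" "c \<in> Ob A" "d \<in> Ob A" by simp_all
  have "inv_arr A (Assoc A d c (b \<boxtimes> a) \<bullet> Assoc A (d \<boxtimes> c) b a)
      = inv_arr A ((Id A d \<boxdot> Assoc A c b a) \<bullet> Assoc A d (c \<boxtimes> b) a \<bullet> (Assoc A d c b \<boxdot> Id A a))"
    using pentagon[of d c b a] O by simp
  then show "Assoc (rev A) a b (c \<boxtimes>\<^bsub>rev A\<^esub> d) \<bullet>\<^bsub>rev A\<^esub> Assoc (rev A) (a \<boxtimes>\<^bsub>rev A\<^esub> b) c d
     = (Id (rev A) a \<boxdot>\<^bsub>rev A\<^esub> Assoc (rev A) b c d) \<bullet>\<^bsub>rev A\<^esub> Assoc (rev A) a (b \<boxtimes>\<^bsub>rev A\<^esub> c) d \<bullet>\<^bsub>rev A\<^esub> (Assoc (rev A) a b c \<boxdot>\<^bsub>rev A\<^esub> Id (rev A) d)"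
    using O by (simp add: is_iso_comp tensor_iso is_iso_id inv_arr_id)
next
  fix a b assume "a \<in> Ob (rev A)" "b \<in> Ob (rev A)"
  then have O: "a \<in> Ob A" "b \<in> Ob A" by simp_all
  show "(Id (rev A) a \<boxdot>\<^bsub>rev A\<^esub> LUnit (rev A) b) \<bullet>\<^bsub>rev A\<^esub> Assoc (rev A) a (Unit (rev A)) b = RUnit (rev A) a \<boxdot>\<^bsub>rev A\<^esub> Id (rev A) b"
    using triangle[OF O(2,1)] O by (simp flip: triangle)
qed (simp add: unit_in_Ob)

lemma is_right_dual_rev: "is_right_dual A c d ev coev \<Longrightarrow> is_right_dual (rev A) d c ev coev"
  by (auto simp: is_right_dual_def)

interpretation V: monoidal_linear_category K "rev A" by (rule monoidal_rev)
interpretation W: lin_action K "rev A" "regular (rev A)" by (rule V.lin_action_regular)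

text \<open>The mirror image of \<open>lunit_tensor\<close>, read off in the reversed
  category.\<close>

lemma runit_tensor:
  "\<lbrakk>x \<in> Ob A; y \<in> Ob A\<rbrakk> \<Longrightarrow> RUnit A (y \<boxtimes> x) \<bullet> inv_arr A (Assoc A y x (Unit A)) = Id A y \<boxdot> RUnit A x"
  using W.munit_massoc[of x y] by simp

subsection \<open>Pairings with a left dual\<close>

text \<open>Identifies the evaluation pairing Hom(x, e) -> Hom(c \<otimes> x, 1) with the mate
  bijection at the unit object, up to the right unit constraint of e. The mate ends in the left unit
  constraint of 1 and the pairing leads to the right one, so \<open>lunit_unit\<close> is essential.
  Bijectivity of the pairing follows.\<close>

lemma pairing_mate:
  assumes d: "is_right_dual A e c ev coev" and g: "g \<in> Arr A" "Cod A g = e"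
  shows "ev \<bullet> (Id A c \<boxdot> g) = R.mate e c ev (Unit A) (inv_arr A (RUnit A e) \<bullet> g)"
proof -
  note D = right_dualD(1-8)[OF d]
  have "ev \<bullet> (Id A c \<boxdot> RUnit A e) = (ev \<bullet> RUnit A (c \<boxtimes> e)) \<bullet> inv_arr A (Assoc A c e (Unit A))"
    using runit_tensor[of e c] D by simp
  also have "\<dots> = (RUnit A (Unit A) \<bullet> (ev \<boxdot> Id A (Unit A))) \<bullet> inv_arr A (Assoc A c e (Unit A))"
    using runit_nat[of ev] D by simp
  also have "\<dots> = R.counit e c ev (Unit A)" using D by (simp add: R.counit_def lunit_unit)
  finally have 1: "R.counit e c ev (Unit A) = ev \<bullet> (Id A c \<boxdot> RUnit A e)" by simp
  have "R.mate e c ev (Unit A) (inv_arr A (RUnit A e) \<bullet> g) = ev \<bullet> ((Id A c \<boxdot> RUnit A e) \<bullet> (Id A c \<boxdot> (inv_arr A (RUnit A e) \<bullet> g)))"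
    using D g by (simp add: R.mate_def 1)
  also have "(Id A c \<boxdot> RUnit A e) \<bullet> (Id A c \<boxdot> (inv_arr A (RUnit A e) \<bullet> g)) = Id A c \<boxdot> g"
    using D g by (simp add: inv_arr_comp_cancel flip: tensor_comp)
  finally show ?thesis by simp
qed

lemma pairing_inj:
  assumes d: "is_right_dual A e c ev coev" and g: "g \<in> Arr A" "Cod A g = e" and g': "g' \<in> Arr A" "Cod A g' = e"
    and "Dom A g = Dom A g'" "ev \<bullet> (Id A c \<boxdot> g) = ev \<bullet> (Id A c \<boxdot> g')"
  shows "g = g'"
proof -
  note D = right_dualD(1-8)[OF d]
  have "inv_arr A (RUnit A e) \<bullet> g = inv_arr A (RUnit A e) \<bullet> g'"
    by (rule R.mate_inj[OF d, of _ _ "Unit A", simplified])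
      (use assms D pairing_mate[OF d g] pairing_mate[OF d g'] in simp_all)
  then show ?thesis by (rule iso_cancel_left[rotated -1, of "inv_arr A (RUnit A e)"]) (use g g' D in simp_all)
qed

text \<open>The preimage is spelled out, not just shown to exist, so that the formula defining the
  left transpose can be recognised as an instance.\<close>

lemma pairing_surj:
  assumes d: "is_right_dual A e c ev coev" and h: "h \<in> Arr A" "Dom A h = c \<boxtimes> x" "Cod A h = Unit A" and x: "x \<in> Ob A"
  defines "g \<equiv> RUnit A e \<bullet> (Id A e \<boxdot> h) \<bullet> Assoc A e c x \<bullet> (coev \<boxdot> Id A x) \<bullet> inv_arr A (LUnit A x)"
  shows "g \<in> Arr A" "Dom A g = x" "Cod A g = e" "ev \<bullet> (Id A c \<boxdot> g) = h"
proof -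
  note D = right_dualD(1-8)[OF d]
  show g: "g \<in> Arr A" "Dom A g = x" "Cod A g = e" using D h x by (simp_all add: g_def)
  have "inv_arr A (RUnit A e) \<bullet> g = (Id A e \<boxdot> h) \<bullet> R.counit_unit e c coev x"
    using D h x by (simp add: g_def R.counit_unit_def inv_arr_comp_cancel)
  then show "ev \<bullet> (Id A c \<boxdot> g) = h"
    using pairing_mate[OF d g(1,3)] R.mate_inverse(2)[OF d, of h x] h x by simp
qed

text \<open>The familiar adjointness of a transpose with respect to the evaluation pairing. As the
  pairing is injective it determines the transpose, and later arguments use the dual functor on
  arrows only through it.\<close>

lemma left_dual_ftor_pairing:
  assumes D: "left_duality A D" and f: "f \<in> Arr A" "Dom A f = a" "Cod A f = b"
  shows "amap (left_dual_ftor A D) f \<in> Arr A" "Dom A (amap (left_dual_ftor A D) f) = Dual D b"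
    "Cod A (amap (left_dual_ftor A D) f) = Dual D a"
    "Ev D a \<bullet> (Id A a \<boxdot> amap (left_dual_ftor A D) f) = Ev D b \<bullet> (f \<boxdot> Id A (Dual D b))"
proof -
  have O: "a \<in> Ob A" "b \<in> Ob A" using f by auto
  have da: "is_right_dual A (Dual D a) a (Ev D a) (Coev D a)" and db: "is_right_dual A (Dual D b) b (Ev D b) (Coev D b)"
    using D O by (simp_all add: left_duality_def is_left_dual_def)
  note Da = right_dualD(1-8)[OF da] and Db = right_dualD(1-8)[OF db]
  let ?h = "Ev D b \<bullet> (f \<boxdot> Id A (Dual D b))"
  have h: "?h \<in> Arr A" "Dom A ?h = a \<boxtimes> Dual D b" "Cod A ?h = Unit A" using f Da Db by simp_all
  have "(Id A (Dual D a) \<boxdot> ?h) \<bullet> Assoc A (Dual D a) a (Dual D b)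
     = (Id A (Dual D a) \<boxdot> Ev D b) \<bullet> ((Id A (Dual D a) \<boxdot> (f \<boxdot> Id A (Dual D b))) \<bullet> Assoc A (Dual D a) a (Dual D b))"
    using R.whisker_left[of "Dual D a" "f \<boxdot> Id A (Dual D b)" "Ev D b"] f Da Db by simp
  also have "\<dots> = (Id A (Dual D a) \<boxdot> Ev D b) \<bullet> Assoc A (Dual D a) b (Dual D b) \<bullet> ((Id A (Dual D a) \<boxdot> f) \<boxdot> Id A (Dual D b))"
    using assoc_nat[of "Id A (Dual D a)" f "Id A (Dual D b)"] f Da Db by simp
  finally have e: "(Id A (Dual D a) \<boxdot> ?h) \<bullet> Assoc A (Dual D a) a (Dual D b)
     = (Id A (Dual D a) \<boxdot> Ev D b) \<bullet> Assoc A (Dual D a) b (Dual D b) \<bullet> ((Id A (Dual D a) \<boxdot> f) \<boxdot> Id A (Dual D b))" .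
  have am: "amap (left_dual_ftor A D) f
     = RUnit A (Dual D a) \<bullet> (Id A (Dual D a) \<boxdot> ?h) \<bullet> Assoc A (Dual D a) a (Dual D b) \<bullet> (Coev D a \<boxdot> Id A (Dual D b)) \<bullet> inv_arr A (LUnit A (Dual D b))"
    using f Da Db h comp_extend[OF e, of "(Coev D a \<boxdot> Id A (Dual D b)) \<bullet> inv_arr A (LUnit A (Dual D b))"]
    by (simp add: left_dual_ftor_def Let_def)
  show "amap (left_dual_ftor A D) f \<in> Arr A" "Dom A (amap (left_dual_ftor A D) f) = Dual D b"
    "Cod A (amap (left_dual_ftor A D) f) = Dual D a"
    "Ev D a \<bullet> (Id A a \<boxdot> amap (left_dual_ftor A D) f) = ?h"
    unfolding am using pairing_surj[OF da h] Db by simp_all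
qed

end

lemma (in monoidal_linear_category) right_duality_rev: "right_duality A D \<Longrightarrow> left_duality (rev A) D"
  unfolding right_duality_def left_duality_def is_left_dual_def using is_right_dual_rev by auto

text \<open>The composite defining the right transpose reads, symbol by symbol, as the left
  transpose for the reversed tensor product.\<close>

lemma right_dual_ftor_rev: "right_dual_ftor A D = left_dual_ftor (rev A) D"
  by (simp add: right_dual_ftor_def left_dual_ftor_def Let_def)

context monoidal_linear_category
begin

interpretation V: monoidal_linear_category K "rev A" by (rule monoidal_rev)
interpretation W: lin_action K "rev A" "regular (rev A)" by (rule V.lin_action_regular)

lemma rpairing_inj:
  assumes d: "is_right_dual A c e ev coev" and g: "g \<in> Arr A" "Cod A g = e" and g': "g' \<in> Arr A" "Cod A g' = e"
    and "Dom A g = Dom A g'" "ev \<bullet> (g \<boxdot> Id A c) = ev \<bullet> (g' \<boxdot> Id A c)"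
  shows "g = g'"
  by (rule V.pairing_inj[OF is_right_dual_rev[OF d]]) (use assms in simp_all)

lemma rpairing_surj:
  assumes d: "is_right_dual A c e ev coev" and h: "h \<in> Arr A" "Dom A h = x \<boxtimes> c" "Cod A h = Unit A" and x: "x \<in> Ob A"
  obtains g where "g \<in> Arr A" "Dom A g = x" "Cod A g = e" "ev \<bullet> (g \<boxdot> Id A c) = h"
  using V.pairing_surj[OF is_right_dual_rev[OF d], of h x] h x that by simp

lemma right_dual_ftor_pairing:
  assumes D: "right_duality A D" and f: "f \<in> Arr A" "Dom A f = a" "Cod A f = b"
  shows "amap (right_dual_ftor A D) f \<in> Arr A" "Dom A (amap (right_dual_ftor A D) f) = Dual D b"
    "Cod A (amap (right_dual_ftor A D) f) = Dual D a"
    "Ev D a \<bullet> (amap (right_dual_ftor A D) f \<boxdot> Id A a) = Ev D b \<bullet> (Id A (Dual D b) \<boxdot> f)"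
  using V.left_dual_ftor_pairing[OF right_duality_rev[OF D], of f a b] f by (simp_all add: right_dual_ftor_rev)

text \<open>The bijection Hom(y, z \<otimes> x) -> Hom(y \<otimes> b, z) for x a right dual of b,
  that is, \<open>mate\<close> for the regular action of \<open>rev A\<close> (see
  \<open>rmate_W\<close>), written out in \<open>A\<close>.\<close>

definition rmate :: "'o \<Rightarrow> 'o \<Rightarrow> 'm \<Rightarrow> 'o \<Rightarrow> 'm \<Rightarrow> 'm" where
  "rmate b x ev z w = RUnit A z \<bullet> (Id A z \<boxdot> ev) \<bullet> Assoc A z x b \<bullet> (w \<boxdot> Id A b)"

lemma rmate_W:
  assumes d: "is_right_dual A b x ev coev" and w: "w \<in> Arr A" "Cod A w = z \<boxtimes> x" "z \<in> Ob A"
  shows "W.mate x b ev z w = rmate b x ev z w"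
  using right_dualD(1-8)[OF d] w by (simp add: rmate_def W.mate_def W.counit_def)

lemma rmate_inj:
  assumes d: "is_right_dual A b x ev coev" and "w \<in> Arr A" "w' \<in> Arr A" "Dom A w = Dom A w'"
    "Cod A w = z \<boxtimes> x" "Cod A w' = z \<boxtimes> x" "z \<in> Ob A" "rmate b x ev z w = rmate b x ev z w'"
  shows "w = w'"
  by (rule W.mate_inj[OF is_right_dual_rev[OF d], of w w' z]) (use assms rmate_W[OF d] in simp_all)

lemma rmate_surj:
  assumes d: "is_right_dual A b x ev coev" and g: "g \<in> Arr A" "Dom A g = y \<boxtimes> b" "y \<in> Ob A"
  obtains w where "w \<in> Arr A" "Dom A w = y" "Cod A w = Cod A g \<boxtimes> x" "rmate b x ev (Cod A g) w = g"
proof -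
  obtain w where w: "w \<in> Arr A" "Dom A w = y" "Cod A w = Cod A g \<boxtimes> x" "W.mate x b ev (Cod A g) w = g"
    using W.mate_surj[OF is_right_dual_rev[OF d], of g y] g by auto
  then show thesis using that[of w] rmate_W[OF d w(1,3)] g by simp
qed

end

section \<open>Exactness of acting with an object that has a dual\<close>

context lin_action
begin

lemma act_zero [simp]: "\<lbrakk>a \<in> Ob A; m \<in> Ob M; n \<in> Ob M\<rbrakk> \<Longrightarrow> Id A a \<unrhd> HZero M m n = HZero M (a \<rhd> m) (a \<rhd> n)"
proof -
  assume O: "a \<in> Ob A" "m \<in> Ob M" "n \<in> Ob M"
  have "linear_functor K M M \<lparr>omap = (\<lambda>y. a \<rhd> y), amap = (\<lambda>g. Id A a \<unrhd> g)\<rparr>"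
    using act_bilinear O unfolding bilinear_functor_def by blast
  from linear_functorD(8)[OF M.linear_category_axioms M.linear_category_axioms this O(2,3)] show ?thesis by simp
qed

lemma act_left_linear: "m \<in> Ob M \<Longrightarrow> linear_functor K A M \<lparr>omap = (\<lambda>a. a \<rhd> m), amap = (\<lambda>f. f \<unrhd> Id M m)\<rparr>"
  using act_bilinear unfolding bilinear_functor_def by blast

lemma mate_zero:
  assumes "is_right_dual A a b ev coev" "y \<in> Ob M" "z \<in> Ob M"
  shows "mate a b ev z (HZero M y (a \<rhd> z)) = HZero M (b \<rhd> y) z"
  using A.right_dualD(1-8)[OF assms(1)] counit_arr[OF assms(1,3)] assms(2,3) by (simp add: mate_def)

text \<open>The action of b is a left adjoint: an arrow killing b.e is the mate of one killing e.
  Cokernels are treated in the same way. In a rigid category every object has a left dual and so can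
  play the role of b.\<close>

lemma act_epi:
  assumes d: "is_right_dual A a b ev coev" and e: "is_epi M e"
  shows "is_epi M (Id A b \<unrhd> e)"
  unfolding M.is_epi_iff
proof (intro conjI ballI impI)
  note D = A.right_dualD(1-8)[OF d]
  have eA: "e \<in> Arr M" using e by (simp add: is_epi_def)
  then show "Id A b \<unrhd> e \<in> Arr M" using D by simp
  fix g assume g: "g \<in> Arr M" "Dom M g = Cod M (Id A b \<unrhd> e)"
    "g \<bullet> (Id A b \<unrhd> e) = HZero M (Dom M (Id A b \<unrhd> e)) (Cod M g)"
  obtain w where w: "w \<in> Arr M" "Dom M w = Cod M e" "Cod M w = a \<rhd> Cod M g" "mate a b ev (Cod M g) w = g"
    by (rule mate_surj[OF d g(1), of "Cod M e"]) (use g eA D in simp_all)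
  have "mate a b ev (Cod M g) (w \<bullet> e) = mate a b ev (Cod M g) (HZero M (Dom M e) (a \<rhd> Cod M g))"
    using mate_comp(1)[OF d w(1,3) _ eA] w g eA D mate_zero[OF d, of "Dom M e" "Cod M g"] by simp
  then have "w \<bullet> e = HZero M (Dom M e) (a \<rhd> Cod M g)"
    by (rule mate_inj[OF d, rotated -1]) (use w g eA D in simp_all)
  then have "w = HZero M (Cod M e) (a \<rhd> Cod M g)"
    using M.epi_zeroD[OF e w(1)] w by simp
  then show "g = HZero M (Cod M (Id A b \<unrhd> e)) (Cod M g)"
    using w(4) mate_zero[OF d, of "Cod M e" "Cod M g"] g eA D by simp
qed

lemma act_cokernel:
  assumes d: "is_right_dual A a b ev coev" and q: "is_cokernel M f q"
  shows "is_cokernel M (Id A b \<unrhd> f) (Id A b \<unrhd> q)"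
proof (rule M.is_cokernelI)
  note D = A.right_dualD(1-8)[OF d] and Q = M.is_cokernelD[OF q]
  show "Id A b \<unrhd> f \<in> Arr M" "Dom M (Id A b \<unrhd> q) = Cod M (Id A b \<unrhd> f)" using D Q(1-3) by simp_all
  show "(Id A b \<unrhd> q) \<bullet> (Id A b \<unrhd> f) = HZero M (Dom M (Id A b \<unrhd> f)) (Cod M (Id A b \<unrhd> q))"
    using whisker_left[OF D(2) Q(1,2,3)] D Q(1-4) by simp
  show "is_epi M (Id A b \<unrhd> q)" by (rule act_epi[OF d Q(5)])
  fix h assume h: "h \<in> Arr M" "Dom M h = Cod M (Id A b \<unrhd> f)" "h \<bullet> (Id A b \<unrhd> f) = HZero M (Dom M (Id A b \<unrhd> f)) (Cod M h)"
  obtain w where w: "w \<in> Arr M" "Dom M w = Cod M f" "Cod M w = a \<rhd> Cod M h" "mate a b ev (Cod M h) w = h"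
    by (rule mate_surj[OF d h(1), of "Cod M f"]) (use h Q(1) D in simp_all)
  have "mate a b ev (Cod M h) (w \<bullet> f) = mate a b ev (Cod M h) (HZero M (Dom M f) (a \<rhd> Cod M h))"
    using mate_comp(1)[OF d w(1,3) _ Q(1)] w h Q(1) D mate_zero[OF d, of "Dom M f" "Cod M h"] by simp
  then have "w \<bullet> f = HZero M (Dom M f) (a \<rhd> Cod M h)"
    by (rule mate_inj[OF d, rotated -1]) (use w h Q(1) D in simp_all)
  then obtain u where u: "u \<in> Arr M" "Dom M u = Cod M q" "Cod M u = a \<rhd> Cod M h" "u \<bullet> q = w"
    using Q(6)[OF w(1,2)] w(3) by (auto simp: Hom_iff)
  have "mate a b ev (Cod M h) u \<bullet> (Id A b \<unrhd> q) = h"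
    using mate_comp(1)[OF d u(1,3) _ Q(2)] u w(4) h by simp
  then show "\<exists>u. u \<in> Hom M (Cod M (Id A b \<unrhd> q)) (Cod M h) \<and> u \<bullet> (Id A b \<unrhd> q) = h"
    using mate_in_Hom[OF d u(1,3)] h(1) u(2) Q(2) D
    by (intro exI[of _ "mate a b ev (Cod M h) u"]) (simp add: Hom_iff)
qed

text \<open>The action of a is a right adjoint; the dual argument, with naturality of mates in the
  target. Kernels follow in the same way.\<close>

lemma act_mono:
  assumes d: "is_right_dual A a b ev coev" and e: "is_epi (op_cat M) e"
  shows "is_epi (op_cat M) (Id A a \<unrhd> e)"
  unfolding M.is_mono_iff
proof (intro conjI ballI impI)
  note D = A.right_dualD(1-8)[OF d]
  have eA: "e \<in> Arr M" using e by (simp add: is_epi_def)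
  then show "Id A a \<unrhd> e \<in> Arr M" using D by simp
  fix g assume g: "g \<in> Arr M" "Cod M g = Dom M (Id A a \<unrhd> e)"
    "(Id A a \<unrhd> e) \<bullet> g = HZero M (Dom M g) (Cod M (Id A a \<unrhd> e))"
  have "e \<bullet> mate a b ev (Dom M e) g = HZero M (b \<rhd> Dom M g) (Cod M e)"
    using mate_comp(2)[OF d g(1) _ _ eA refl] g eA D mate_zero[OF d, of "Dom M g" "Cod M e"] by simp
  then have "mate a b ev (Dom M e) g = HZero M (b \<rhd> Dom M g) (Dom M e)"
    using e[unfolded M.is_mono_iff, THEN conjunct2, THEN bspec, of "mate a b ev (Dom M e) g"]
      mate_in_Hom[OF d g(1), of "Dom M e"] g eA D by simp
  then have "mate a b ev (Dom M e) g = mate a b ev (Dom M e) (HZero M (Dom M g) (a \<rhd> Dom M e))"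
    using mate_zero[OF d, of "Dom M g" "Dom M e"] g eA by simp
  then have "g = HZero M (Dom M g) (a \<rhd> Dom M e)"
    by (rule mate_inj[OF d, rotated -1]) (use g eA D in simp_all)
  then show "g = HZero M (Dom M g) (Dom M (Id A a \<unrhd> e))" using eA D by simp
qed

lemma act_kernel:
  assumes d: "is_right_dual A a b ev coev" and k: "is_kernel M f k"
  shows "is_kernel M (Id A a \<unrhd> f) (Id A a \<unrhd> k)"
proof (rule M.is_kernelI)
  note D = A.right_dualD(1-8)[OF d] and Q = M.is_kernelD[OF k]
  show "Id A a \<unrhd> f \<in> Arr M" "Cod M (Id A a \<unrhd> k) = Dom M (Id A a \<unrhd> f)" using D Q(1-3) by simp_all
  show "(Id A a \<unrhd> f) \<bullet> (Id A a \<unrhd> k) = HZero M (Dom M (Id A a \<unrhd> k)) (Cod M (Id A a \<unrhd> f))"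
    using whisker_left[OF D(1) Q(2,1)] D Q(1-4) by simp
  show "is_epi (op_cat M) (Id A a \<unrhd> k)" by (rule act_mono[OF d Q(5)])
  fix h assume h: "h \<in> Arr M" "Cod M h = Dom M (Id A a \<unrhd> f)" "(Id A a \<unrhd> f) \<bullet> h = HZero M (Dom M h) (Cod M (Id A a \<unrhd> f))"
  let ?g = "mate a b ev (Dom M f) h"
  have g: "?g \<in> Arr M" "Dom M ?g = b \<rhd> Dom M h" "Cod M ?g = Dom M f"
    using mate_in_Hom[OF d h(1), of "Dom M f"] h D Q(1) by simp_all
  have "f \<bullet> ?g = HZero M (Dom M ?g) (Cod M f)"
    using mate_comp(2)[OF d h(1) _ _ Q(1) refl] h Q(1) D g mate_zero[OF d, of "Dom M h" "Cod M f"] by simp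
  then obtain u where u: "u \<in> Arr M" "Dom M u = b \<rhd> Dom M h" "Cod M u = Dom M k" "k \<bullet> u = ?g"
    using Q(6)[OF g(1,3)] g(2) by (auto simp: Hom_iff)
  obtain w where w: "w \<in> Arr M" "Dom M w = Dom M h" "Cod M w = a \<rhd> Cod M u" "mate a b ev (Cod M u) w = u"
    by (rule mate_surj[OF d u(1,2)]) (use h in simp_all)
  have "mate a b ev (Cod M k) ((Id A a \<unrhd> k) \<bullet> w) = k \<bullet> mate a b ev (Cod M u) w"
    by (rule mate_comp(2)[OF d w(1)]) (use w(3) u(1,3) Q(2) in simp_all)
  then have "mate a b ev (Dom M f) ((Id A a \<unrhd> k) \<bullet> w) = ?g" unfolding w(4) u(4) Q(3) .
  then have "(Id A a \<unrhd> k) \<bullet> w = h"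
    by (rule mate_inj[OF d, rotated -1]) (use w(1-3) u(1-3) h(1,2) Q(1-3) D in simp_all)
  then show "\<exists>u. u \<in> Hom M (Dom M h) (Dom M (Id A a \<unrhd> k)) \<and> (Id A a \<unrhd> k) \<bullet> u = h"
    using w(1-3) u(3) Q(2) D by (intro exI[of _ w]) (simp add: Hom_iff)
qed

end

section \<open>Inner Homs\<close>

context lin_action
begin

lemma act_right_linear: "a \<in> Ob A \<Longrightarrow> linear_functor K M M \<lparr>omap = (\<lambda>m. a \<rhd> m), amap = (\<lambda>f. Id A a \<unrhd> f)\<rparr>"
  using act_bilinear unfolding bilinear_functor_def by blast

lemma act_add:
  "\<lbrakk>m \<in> Ob M; f \<in> Arr A; f' \<in> Arr A; Dom A f = Dom A f'; Cod A f = Cod A f'\<rbrakk>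
    \<Longrightarrow> HAdd A f f' \<unrhd> Id M m = HAdd M (f \<unrhd> Id M m) (f' \<unrhd> Id M m)"
  "\<lbrakk>m \<in> Ob M; f \<in> Arr A; c \<in> carrier K\<rbrakk> \<Longrightarrow> HSmult A c f \<unrhd> Id M m = HSmult M c (f \<unrhd> Id M m)"
  "\<lbrakk>a \<in> Ob A; g \<in> Arr M; g' \<in> Arr M; Dom M g = Dom M g'; Cod M g = Cod M g'\<rbrakk>
    \<Longrightarrow> Id A a \<unrhd> HAdd M g g' = HAdd M (Id A a \<unrhd> g) (Id A a \<unrhd> g')"
  "\<lbrakk>a \<in> Ob A; g \<in> Arr M; c \<in> carrier K\<rbrakk> \<Longrightarrow> Id A a \<unrhd> HSmult M c g = HSmult M c (Id A a \<unrhd> g)"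
  "\<lbrakk>m \<in> Ob M; a \<in> Ob A; b \<in> Ob A\<rbrakk> \<Longrightarrow> HZero A a b \<unrhd> Id M m = HZero M (a \<rhd> m) (b \<rhd> m)"
  using linear_functorD(8-10)[OF A.linear_category_axioms M.linear_category_axioms act_left_linear, of m]
    linear_functorD(9,10)[OF M.linear_category_axioms M.linear_category_axioms act_right_linear, of a] by auto

end

section \<open>Construction of inner Homs for a finite module category\<close>

locale finite_action = lin_action K A M
  for K :: "('k, 'y) ring_scheme" and A :: "('oa, 'ma, 'k, 'z) moncat_scheme"
    and M :: "('oa, 'ma, 'o, 'm, 'k, 'w) modcat_scheme" (structure) +
  assumes rigid: "rigid A"
    and A_fin: "fin_ab K A" and M_fin: "fin_ab K M"
    and A_gen: "\<exists>P. proj_gen A P" and M_gen: "\<exists>P. proj_gen M P"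
    and act_exact: "m \<in> Ob M \<Longrightarrow> exact_functor A M \<lparr>omap = (\<lambda>a. a \<rhd> m), amap = (\<lambda>f. f \<unrhd> Id M m)\<rparr>"
begin

text \<open>The pair (r, e) is terminal among all arrows a.m -> n with varying a: an inner Hom
  together with its evaluation.\<close>

definition universal_ev :: "'o \<Rightarrow> 'o \<Rightarrow> 'oa \<Rightarrow> 'm \<Rightarrow> bool" where
  "universal_ev m n r e \<longleftrightarrow> r \<in> Ob A \<and> e \<in> Hom M (r \<rhd> m) n \<and>
     (\<forall>a \<in> Ob A. \<forall>x \<in> Hom M (a \<rhd> m) n. \<exists>!u. u \<in> Hom A a r \<and> e \<bullet> (u \<unrhd> Id M m) = x)"

text \<open>\<open>right_adjoint_ob\<close> for the functor sending a to a.m, which is exact by the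
  definition of a module category.\<close>

lemma ex_universal_ev:
  assumes m: "m \<in> Ob M" and n: "n \<in> Ob M"
  shows "\<exists>r e. universal_ev m n r e"
proof -
  obtain P where P: "proj_gen A P" using A_gen by blast
  interpret F: fin_cat K A P by (intro fin_cat.intro A_fin fin_cat_axioms.intro P)
  have rex: "is_cokernel M (amap \<lparr>omap = (\<lambda>a. a \<rhd> m), amap = (\<lambda>f. f \<unrhd> Id M m)\<rparr> k)
      (amap \<lparr>omap = (\<lambda>a. a \<rhd> m), amap = (\<lambda>f. f \<unrhd> Id M m)\<rparr> q)" if "short_exact A k q" for k q
    using act_exact[OF m] that unfolding exact_functor_def short_exact_def by blast
  from F.right_adjoint_ob[OF M.linear_category_axioms act_left_linear[OF m] n _ rex]
    fin_ab.hom_noetherian[OF M_fin _ n]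
  show ?thesis unfolding universal_ev_def by simp
qed

definition "ih_ev m n = (SOME re. universal_ev m n (fst re) (snd re))"
definition "ih m n = fst (ih_ev m n)"
definition "ev m n = snd (ih_ev m n)"

lemma universal_ev:
  assumes "m \<in> Ob M" "n \<in> Ob M" shows "universal_ev m n (ih m n) (ev m n)"
proof -
  obtain r e where "universal_ev m n r e" using ex_universal_ev[OF assms] by blast
  then have "\<exists>re. universal_ev m n (fst re) (snd re)" by (intro exI[of _ "(r, e)"]) simp
  from someI_ex[OF this] show ?thesis unfolding ih_def ev_def ih_ev_def .
qed

lemma ih_simps [simp]:
  assumes "m \<in> Ob M" "n \<in> Ob M"
  shows "ih m n \<in> Ob A" "ev m n \<in> Arr M" "Dom M (ev m n) = ih m n \<rhd> m" "Cod M (ev m n) = n"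
  using universal_ev[OF assms] unfolding universal_ev_def Hom_iff by blast+

lemma ih_ex1:
  assumes "m \<in> Ob M" "n \<in> Ob M" "a \<in> Ob A" "x \<in> Hom M (a \<rhd> m) n"
  shows "\<exists>!u. u \<in> Hom A a (ih m n) \<and> ev m n \<bullet> (u \<unrhd> Id M m) = x"
  using universal_ev[OF assms(1,2)] assms(3,4) unfolding universal_ev_def by blast

lemma ih_eqI:
  assumes "m \<in> Ob M" "n \<in> Ob M" "u \<in> Arr A" "u' \<in> Arr A" "Dom A u = Dom A u'" "Cod A u = ih m n" "Cod A u' = ih m n"
    "ev m n \<bullet> (u \<unrhd> Id M m) = ev m n \<bullet> (u' \<unrhd> Id M m)"
  shows "u = u'"
proof -
  have "\<exists>!v. v \<in> Hom A (Dom A u') (ih m n) \<and> ev m n \<bullet> (v \<unrhd> Id M m) = ev m n \<bullet> (u' \<unrhd> Id M m)"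
    by (rule ih_ex1) (use assms in \<open>simp_all add: Hom_iff\<close>)
  moreover have "u \<in> Hom A (Dom A u') (ih m n) \<and> ev m n \<bullet> (u \<unrhd> Id M m) = ev m n \<bullet> (u' \<unrhd> Id M m)"
    "u' \<in> Hom A (Dom A u') (ih m n) \<and> ev m n \<bullet> (u' \<unrhd> Id M m) = ev m n \<bullet> (u' \<unrhd> Id M m)"
    using assms by (simp_all add: Hom_iff)
  ultimately show ?thesis by blast
qed

text \<open>The only choice that makes evaluation natural in the second and dinatural in the first
  argument.\<close>

definition "ihm g h = (THE u. u \<in> Hom A (ih (Cod M g) (Dom M h)) (ih (Dom M g) (Cod M h)) \<and>
   ev (Dom M g) (Cod M h) \<bullet> (u \<unrhd> Id M (Dom M g)) = h \<bullet> ev (Cod M g) (Dom M h) \<bullet> (Id A (ih (Cod M g) (Dom M h)) \<unrhd> g))"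

lemma ihm:
  assumes "g \<in> Arr M" "h \<in> Arr M"
  shows "ihm g h \<in> Arr A" "Dom A (ihm g h) = ih (Cod M g) (Dom M h)" "Cod A (ihm g h) = ih (Dom M g) (Cod M h)"
    "ev (Dom M g) (Cod M h) \<bullet> (ihm g h \<unrhd> Id M (Dom M g)) = h \<bullet> ev (Cod M g) (Dom M h) \<bullet> (Id A (ih (Cod M g) (Dom M h)) \<unrhd> g)"
proof -
  have "\<exists>!u. u \<in> Hom A (ih (Cod M g) (Dom M h)) (ih (Dom M g) (Cod M h)) \<and>
   ev (Dom M g) (Cod M h) \<bullet> (u \<unrhd> Id M (Dom M g)) = h \<bullet> ev (Cod M g) (Dom M h) \<bullet> (Id A (ih (Cod M g) (Dom M h)) \<unrhd> g)"
    by (rule ih_ex1) (use assms in \<open>simp_all add: Hom_iff\<close>)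
  from theI'[OF this, folded ihm_def]
  show "ihm g h \<in> Arr A" "Dom A (ihm g h) = ih (Cod M g) (Dom M h)" "Cod A (ihm g h) = ih (Dom M g) (Cod M h)"
    "ev (Dom M g) (Cod M h) \<bullet> (ihm g h \<unrhd> Id M (Dom M g)) = h \<bullet> ev (Cod M g) (Dom M h) \<bullet> (Id A (ih (Cod M g) (Dom M h)) \<unrhd> g)"
    unfolding Hom_iff by blast+
qed

lemma ihm_eqI:
  assumes "g \<in> Arr M" "h \<in> Arr M" "u \<in> Arr A" "Dom A u = ih (Cod M g) (Dom M h)" "Cod A u = ih (Dom M g) (Cod M h)"
    "ev (Dom M g) (Cod M h) \<bullet> (u \<unrhd> Id M (Dom M g)) = h \<bullet> ev (Cod M g) (Dom M h) \<bullet> (Id A (ih (Cod M g) (Dom M h)) \<unrhd> g)"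
  shows "ihm g h = u"
  by (rule ih_eqI[of "Dom M g" "Cod M h"]) (use assms ihm[OF assms(1,2)] in simp_all)

lemma ihm_id: "\<lbrakk>m \<in> Ob M; n \<in> Ob M\<rbrakk> \<Longrightarrow> ihm (Id M m) (Id M n) = Id A (ih m n)"
  by (rule ihm_eqI) simp_all

lemma ihm_comp:
  assumes g: "g \<in> Arr M" "g' \<in> Arr M" "Dom M g = Cod M g'" and h: "h \<in> Arr M" "h' \<in> Arr M" "Dom M h' = Cod M h"
  shows "ihm (g \<bullet> g') (h' \<bullet> h) = ihm g' h' \<bullet>\<^bsub>A\<^esub> ihm g h"
proof (rule ihm_eqI)
  note G = g h ihm(1-3)[OF g(1) h(1)] ihm(1-3)[OF g(2) h(2)]
  show "g \<bullet> g' \<in> Arr M" "h' \<bullet> h \<in> Arr M" "ihm g' h' \<bullet>\<^bsub>A\<^esub> ihm g h \<in> Arr A"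
    "Dom A (ihm g' h' \<bullet>\<^bsub>A\<^esub> ihm g h) = ih (Cod M (g \<bullet> g')) (Dom M (h' \<bullet> h))"
    "Cod A (ihm g' h' \<bullet>\<^bsub>A\<^esub> ihm g h) = ih (Dom M (g \<bullet> g')) (Cod M (h' \<bullet> h))"
    using G by simp_all
  let ?I = "ih (Cod M g) (Dom M h)"
  have "ev (Dom M g') (Cod M h') \<bullet> ((ihm g' h' \<bullet>\<^bsub>A\<^esub> ihm g h) \<unrhd> Id M (Dom M g'))
     = (ev (Dom M g') (Cod M h') \<bullet> (ihm g' h' \<unrhd> Id M (Dom M g'))) \<bullet> (ihm g h \<unrhd> Id M (Dom M g'))"
    using G whisker_right[of "Dom M g'" "ihm g h" "ihm g' h'"] by simp
  also have "\<dots> = h' \<bullet> ev (Cod M g') (Dom M h') \<bullet> ((Id A (ih (Cod M g') (Dom M h')) \<unrhd> g') \<bullet> (ihm g h \<unrhd> Id M (Dom M g')))"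
    unfolding ihm(4)[OF g(2) h(2)] using G by simp
  also have "(Id A (ih (Cod M g') (Dom M h')) \<unrhd> g') \<bullet> (ihm g h \<unrhd> Id M (Dom M g')) = (ihm g h \<unrhd> Id M (Dom M g)) \<bullet> (Id A ?I \<unrhd> g')"
    using G by (simp add: act_comp)
  also have "h' \<bullet> ev (Cod M g') (Dom M h') \<bullet> (ihm g h \<unrhd> Id M (Dom M g)) \<bullet> (Id A ?I \<unrhd> g')
     = h' \<bullet> (ev (Dom M g) (Cod M h) \<bullet> (ihm g h \<unrhd> Id M (Dom M g))) \<bullet> (Id A ?I \<unrhd> g')"
    using G by simp
  also have "\<dots> = (h' \<bullet> h) \<bullet> ev (Cod M g) (Dom M h) \<bullet> ((Id A ?I \<unrhd> g) \<bullet> (Id A ?I \<unrhd> g'))"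
    unfolding ihm(4)[OF g(1) h(1)] using G by simp
  also have "(Id A ?I \<unrhd> g) \<bullet> (Id A ?I \<unrhd> g') = Id A ?I \<unrhd> (g \<bullet> g')" using G whisker_left[of ?I g' g] by simp
  finally show "ev (Dom M (g \<bullet> g')) (Cod M (h' \<bullet> h)) \<bullet> ((ihm g' h' \<bullet>\<^bsub>A\<^esub> ihm g h) \<unrhd> Id M (Dom M (g \<bullet> g')))
     = (h' \<bullet> h) \<bullet> ev (Cod M (g \<bullet> g')) (Dom M (h' \<bullet> h)) \<bullet> (Id A (ih (Cod M (g \<bullet> g')) (Dom M (h' \<bullet> h))) \<unrhd> (g \<bullet> g'))"
    using G by simp
qed

definition "inner_Hom = \<lparr>IHom = \<lparr>omap = (\<lambda>(m, n). ih m n), amap = (\<lambda>(g, h). ihm g h)\<rparr>,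
   IAdj = (\<lambda>a m n u. ev m n \<bullet> (u \<unrhd> Id M m))\<rparr>"

lemma is_inner_hom_inner_Hom: "is_inner_hom K A M inner_Hom"
  unfolding is_inner_hom_def
proof (intro conjI ballI)
  have F: "is_functor (prod_cat (op_cat M) M) A (IHom inner_Hom)"
    unfolding is_functor_def by (auto simp: inner_Hom_def ihm_id Hom_iff ihm ihm_comp)
  have 1: "ihm (Id M m) (HAdd M h h') = HAdd A (ihm (Id M m) h) (ihm (Id M m) h')"
    if "m \<in> Ob M" "h \<in> Arr M" "h' \<in> Arr M" "Dom M h = Dom M h'" "Cod M h = Cod M h'" for m h h'
    by (rule ihm_eqI) (use that ihm[of "Id M m" h] ihm[of "Id M m" h'] in
        \<open>simp_all add: act_add M.comp_add_left M.comp_add_right\<close>)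
  have 2: "ihm (Id M m) (HSmult M c h) = HSmult A c (ihm (Id M m) h)"
    if "m \<in> Ob M" "h \<in> Arr M" "c \<in> carrier K" for m h c
    by (rule ihm_eqI) (use that ihm[of "Id M m" h] in \<open>simp_all add: act_add M.comp_smult_left M.comp_smult_right\<close>)
  have 3: "ihm (HAdd M h h') (Id M m) = HAdd A (ihm h (Id M m)) (ihm h' (Id M m))"
    if "m \<in> Ob M" "h \<in> Arr M" "h' \<in> Arr M" "Dom M h = Dom M h'" "Cod M h = Cod M h'" for m h h'
    by (rule ihm_eqI) (use that ihm[of h "Id M m"] ihm[of h' "Id M m"] in
        \<open>simp_all add: act_add M.comp_add_left M.comp_add_right\<close>)
  have 4: "ihm (HSmult M c h) (Id M m) = HSmult A c (ihm h (Id M m))"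
    if "m \<in> Ob M" "h \<in> Arr M" "c \<in> carrier K" for m h c
    by (rule ihm_eqI) (use that ihm[of h "Id M m"] in \<open>simp_all add: act_add M.comp_smult_left M.comp_smult_right\<close>)
  have 5: "linear_functor K M A \<lparr>omap = (\<lambda>n. ih m n), amap = (\<lambda>h. ihm (Id M m) h)\<rparr>" if "m \<in> Ob M" for m
    using that ihm_comp[of "Id M m" "Id M m"]
    by (auto simp: linear_functor_def is_functor_def linear_map_def Hom_iff ihm ihm_id 1 2)
  have 6: "linear_functor K (op_cat M) A \<lparr>omap = (\<lambda>m. ih m n), amap = (\<lambda>g. ihm g (Id M n))\<rparr>" if "n \<in> Ob M" for n
    using that ihm_comp[of _ _ "Id M n" "Id M n"]
    by (auto simp: linear_functor_def is_functor_def linear_map_def Hom_iff ihm ihm_id 3 4)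
  show "bilinear_functor K (op_cat M) M A (IHom inner_Hom)"
    unfolding bilinear_functor_def using F 5 6 by (simp add: inner_Hom_def)
next
  fix a m n assume O: "a \<in> Ob A" "m \<in> Ob M" "n \<in> Ob M"
  show "linear_map K (hom_space A a (omap (IHom inner_Hom) (m, n))) (hom_space M (a \<rhd> m) n) (IAdj inner_Hom a m n)"
    using O by (auto simp: linear_map_def Hom_iff inner_Hom_def act_add M.comp_add_right M.comp_smult_right)
  show "bij_betw (IAdj inner_Hom a m n) (Hom A a (omap (IHom inner_Hom) (m, n))) (Hom M (a \<rhd> m) n)"
  proof (rule bij_betw_imageI)
    show "inj_on (IAdj inner_Hom a m n) (Hom A a (omap (IHom inner_Hom) (m, n)))"
    proof (rule inj_onI)
      fix u v assume "u \<in> Hom A a (omap (IHom inner_Hom) (m, n))" "v \<in> Hom A a (omap (IHom inner_Hom) (m, n))"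
        "IAdj inner_Hom a m n u = IAdj inner_Hom a m n v"
      then show "u = v" by (intro ih_eqI[of m n]) (use O in \<open>simp_all add: Hom_iff inner_Hom_def\<close>)
    qed
    show "IAdj inner_Hom a m n ` Hom A a (omap (IHom inner_Hom) (m, n)) = Hom M (a \<rhd> m) n"
    proof (intro equalityI subsetI)
      fix x assume "x \<in> Hom M (a \<rhd> m) n"
      from ih_ex1[OF O(2,3,1) this] obtain u where "u \<in> Hom A a (ih m n)" "ev m n \<bullet> (u \<unrhd> Id M m) = x" by blast
      then show "x \<in> IAdj inner_Hom a m n ` Hom A a (omap (IHom inner_Hom) (m, n))"
        by (intro image_eqI[of _ _ u]) (simp_all add: inner_Hom_def)
    next
      fix x assume "x \<in> IAdj inner_Hom a m n ` Hom A a (omap (IHom inner_Hom) (m, n))"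
      then show "x \<in> Hom M (a \<rhd> m) n" using O by (auto simp: Hom_iff inner_Hom_def)
    qed
  qed
next
  fix a a' m m' n n' f g h u
  assume O: "a \<in> Ob A" "a' \<in> Ob A" "m \<in> Ob M" "m' \<in> Ob M" "n \<in> Ob M" "n' \<in> Ob M"
    and "f \<in> Hom A a' a" "g \<in> Hom M m' m" "h \<in> Hom M n n'" "u \<in> Hom A a (omap (IHom inner_Hom) (m, n))"
  then have G: "f \<in> Arr A" "Dom A f = a'" "Cod A f = a" "g \<in> Arr M" "Dom M g = m'" "Cod M g = m" "h \<in> Arr M" "Dom M h = n"
    "Cod M h = n'" "u \<in> Arr A" "Dom A u = a" "Cod A u = ih m n" by (simp_all add: Hom_iff inner_Hom_def)
  note I = ihm[OF G(4,7), unfolded G(5,6,8,9)]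
  have "ev m' n' \<bullet> ((ihm g h \<bullet>\<^bsub>A\<^esub> u \<bullet>\<^bsub>A\<^esub> f) \<unrhd> Id M m') = (ev m' n' \<bullet> (ihm g h \<unrhd> Id M m')) \<bullet> ((u \<bullet>\<^bsub>A\<^esub> f) \<unrhd> Id M m')"
    using G O I(1-3) by (simp add: whisker_right)
  also have "\<dots> = h \<bullet> ev m n \<bullet> ((Id A (ih m n) \<unrhd> g) \<bullet> ((u \<bullet>\<^bsub>A\<^esub> f) \<unrhd> Id M m'))"
    unfolding I(4) using G O by simp
  also have "(Id A (ih m n) \<unrhd> g) \<bullet> ((u \<bullet>\<^bsub>A\<^esub> f) \<unrhd> Id M m') = (u \<unrhd> Id M m) \<bullet> (f \<unrhd> g)"
    using G O by (simp add: act_comp)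
  finally show "IAdj inner_Hom a' m' n' (amap (IHom inner_Hom) (g, h) \<bullet>\<^bsub>A\<^esub> u \<bullet>\<^bsub>A\<^esub> f) = h \<bullet> IAdj inner_Hom a m n u \<bullet> (f \<unrhd> g)"
    using G O by (simp add: inner_Hom_def)
qed

end

text \<open>Here the inner Hom is prescribed, as it is when a Serre functor is given together with
  one. Evaluation is recovered as the arrow adjoint to the identity.\<close>

locale inner_action = lin_action K A M
  for K :: "('k, 'y) ring_scheme" and A :: "('oa, 'ma, 'k, 'z) moncat_scheme"
    and M :: "('oa, 'ma, 'o, 'm, 'k, 'w) modcat_scheme" (structure) +
  fixes H :: "('oa, 'ma, 'o, 'm) inner_hom"
  assumes inner_hom: "is_inner_hom K A M H"
begin

abbreviation "ih m n \<equiv> omap (IHom H) (m, n)"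
abbreviation "ihm g h \<equiv> amap (IHom H) (g, h)"

definition "ev m n = IAdj H (ih m n) m n (Id A (ih m n))"

lemma bilinear_H: "bilinear_functor K (op_cat M) M A (IHom H)"
  using inner_hom unfolding is_inner_hom_def by (elim conjE)

lemma cat_op: "category (op_cat M)"
  using M.linear_category_op by (simp add: linear_category_def)

lemma ih_simps [simp]:
  "\<lbrakk>m \<in> Ob M; n \<in> Ob M\<rbrakk> \<Longrightarrow> ih m n \<in> Ob A"
  "\<lbrakk>g \<in> Arr M; h \<in> Arr M\<rbrakk> \<Longrightarrow> ihm g h \<in> Arr A"
  "\<lbrakk>g \<in> Arr M; h \<in> Arr M\<rbrakk> \<Longrightarrow> Dom A (ihm g h) = ih (Cod M g) (Dom M h)"
  "\<lbrakk>g \<in> Arr M; h \<in> Arr M\<rbrakk> \<Longrightarrow> Cod A (ihm g h) = ih (Dom M g) (Cod M h)"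
  "\<lbrakk>m \<in> Ob M; n \<in> Ob M\<rbrakk> \<Longrightarrow> ihm (Id M m) (Id M n) = Id A (ih m n)"
  using bilinear_functorD(1-5)[OF cat_op M.category_axioms bilinear_H] by simp_all

lemma ihm_comp:
  "\<lbrakk>g \<in> Arr M; g' \<in> Arr M; h \<in> Arr M; h' \<in> Arr M; Dom M g = Cod M g'; Dom M h' = Cod M h\<rbrakk>
    \<Longrightarrow> ihm g' h' \<bullet>\<^bsub>A\<^esub> ihm g h = ihm (g \<bullet> g') (h' \<bullet> h)"
  using bilinear_functorD(6)[OF cat_op M.category_axioms bilinear_H, of g g' h h'] by simp

lemma IAdj_nat:
  assumes "f \<in> Arr A" "g \<in> Arr M" "h \<in> Arr M" "u \<in> Arr A" "Dom A u = Cod A f" "Cod A u = ih (Cod M g) (Dom M h)"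
  shows "IAdj H (Dom A f) (Dom M g) (Cod M h) (ihm g h \<bullet>\<^bsub>A\<^esub> u \<bullet>\<^bsub>A\<^esub> f)
    = h \<bullet> IAdj H (Cod A f) (Cod M g) (Dom M h) u \<bullet> (f \<unrhd> g)"
proof -
  have *: "\<forall>a\<in>Ob A. \<forall>a'\<in>Ob A. \<forall>m\<in>Ob M. \<forall>m'\<in>Ob M. \<forall>n\<in>Ob M. \<forall>n'\<in>Ob M.
        \<forall>f\<in>Hom A a' a. \<forall>g\<in>Hom M m' m. \<forall>h\<in>Hom M n n'. \<forall>u\<in>Hom A a (ih m n).
          IAdj H a' m' n' (ihm g h \<bullet>\<^bsub>A\<^esub> u \<bullet>\<^bsub>A\<^esub> f) = h \<bullet> IAdj H a m n u \<bullet> (f \<unrhd> g)"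
    using inner_hom unfolding is_inner_hom_def by (elim conjE)
  have "f \<in> Hom A (Dom A f) (Cod A f)" "g \<in> Hom M (Dom M g) (Cod M g)" "h \<in> Hom M (Dom M h) (Cod M h)"
    "u \<in> Hom A (Cod A f) (ih (Cod M g) (Dom M h))"
    using assms by (simp_all add: Hom_iff)
  with * A.dom_Ob[OF assms(1)] A.cod_Ob[OF assms(1)] M.dom_Ob[OF assms(2)] M.cod_Ob[OF assms(2)]
    M.dom_Ob[OF assms(3)] M.cod_Ob[OF assms(3)]
  show ?thesis by blast
qed

lemma IAdj_bij:
  "\<lbrakk>a \<in> Ob A; m \<in> Ob M; n \<in> Ob M\<rbrakk> \<Longrightarrow> bij_betw (IAdj H a m n) (Hom A a (ih m n)) (Hom M (a \<rhd> m) n)"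
  using inner_hom unfolding is_inner_hom_def by blast

lemma ev_simps [simp]:
  assumes "m \<in> Ob M" "n \<in> Ob M"
  shows "ev m n \<in> Arr M" "Dom M (ev m n) = ih m n \<rhd> m" "Cod M (ev m n) = n"
proof -
  have "Id A (ih m n) \<in> Hom A (ih m n) (ih m n)" using assms by (simp add: Hom_iff)
  then have "ev m n \<in> Hom M (ih m n \<rhd> m) n"
    using bij_betwE[OF IAdj_bij[of "ih m n" m n]] assms unfolding ev_def by simp
  then show "ev m n \<in> Arr M" "Dom M (ev m n) = ih m n \<rhd> m" "Cod M (ev m n) = n" by (simp_all add: Hom_iff)
qed

text \<open>Yoneda: by naturality the adjunction is determined by its value \<open>ev\<close> at the
  identity.\<close>

lemma IAdj_ev:
  assumes "u \<in> Arr A" "Cod A u = ih m n" "m \<in> Ob M" "n \<in> Ob M"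
  shows "IAdj H (Dom A u) m n u = ev m n \<bullet> (u \<unrhd> Id M m)"
  using IAdj_nat[of u "Id M m" "Id M n" "Id A (ih m n)"] assms by (simp flip: ev_def)

lemma ev_inj:
  assumes "m \<in> Ob M" "n \<in> Ob M" "u \<in> Arr A" "u' \<in> Arr A" "Dom A u = Dom A u'" "Cod A u = ih m n" "Cod A u' = ih m n"
    "ev m n \<bullet> (u \<unrhd> Id M m) = ev m n \<bullet> (u' \<unrhd> Id M m)"
  shows "u = u'"
proof (rule inj_onD[OF bij_betw_imp_inj_on[OF IAdj_bij]])
  show "IAdj H (Dom A u) m n u = IAdj H (Dom A u) m n u'"
    using IAdj_ev[of u m n] IAdj_ev[of u' m n] assms by simp
qed (use assms in \<open>simp_all add: Hom_iff\<close>)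

lemma ev_surj:
  assumes "m \<in> Ob M" "n \<in> Ob M" "a \<in> Ob A" "x \<in> Arr M" "Dom M x = a \<rhd> m" "Cod M x = n"
  obtains u where "u \<in> Arr A" "Dom A u = a" "Cod A u = ih m n" "ev m n \<bullet> (u \<unrhd> Id M m) = x"
proof -
  have "x \<in> Hom M (a \<rhd> m) n" using assms by (simp add: Hom_iff)
  then have "x \<in> IAdj H a m n ` Hom A a (ih m n)"
    by (simp only: bij_betw_imp_surj_on[OF IAdj_bij[OF assms(3,1,2)]])
  then obtain u where u: "u \<in> Hom A a (ih m n)" "IAdj H a m n u = x" by (elim imageE) (rule that, simp_all)
  have t: "u \<in> Arr A" "Dom A u = a" "Cod A u = ih m n" using HomD[OF u(1)] .
  show thesis by (rule that[OF t]) (use IAdj_ev[OF t(1,3) assms(1,2)] t(2) u(2) in simp)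
qed

lemma ev_nat:
  assumes "g \<in> Arr M" "h \<in> Arr M" "Dom M g = m'" "Cod M g = m" "Dom M h = n" "Cod M h = n'"
  shows "ev m' n' \<bullet> (ihm g h \<unrhd> Id M m') = h \<bullet> ev m n \<bullet> (Id A (ih m n) \<unrhd> g)"
proof -
  have O: "m \<in> Ob M" "m' \<in> Ob M" "n \<in> Ob M" "n' \<in> Ob M" using assms by auto
  show ?thesis
    using IAdj_nat[of "Id A (ih m n)" g h "Id A (ih m n)"] IAdj_ev[of "ihm g h" m' n'] assms O
    by (simp flip: ev_def)
qed

lemma ihm_linear:
  "m \<in> Ob M \<Longrightarrow> linear_functor K M A \<lparr>omap = (\<lambda>n. ih m n), amap = (\<lambda>h. ihm (Id M m) h)\<rparr>"
  "n \<in> Ob M \<Longrightarrow> linear_functor K (op_cat M) A \<lparr>omap = (\<lambda>m. ih m n), amap = (\<lambda>g. ihm g (Id M n))\<rparr>"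
  using bilinear_H unfolding bilinear_functor_def by auto

text \<open>Under evaluation, composing with IHom(m, h) becomes composing with h. The companion
  \<open>ihm_nat_ev'\<close> treats the first argument, where g turns into its translate a.g on the
  other side.\<close>

lemma ihm_nat_ev:
  assumes "h \<in> Arr M" "m \<in> Ob M" "v \<in> Arr A" "Cod A v = ih m (Dom M h)"
  shows "ev m (Cod M h) \<bullet> ((ihm (Id M m) h \<bullet>\<^bsub>A\<^esub> v) \<unrhd> Id M m) = h \<bullet> ev m (Dom M h) \<bullet> (v \<unrhd> Id M m)"
proof -
  have "ev m (Cod M h) \<bullet> ((ihm (Id M m) h \<bullet>\<^bsub>A\<^esub> v) \<unrhd> Id M m)
     = (ev m (Cod M h) \<bullet> (ihm (Id M m) h \<unrhd> Id M m)) \<bullet> (v \<unrhd> Id M m)"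
    using assms by (simp add: whisker_right)
  also have "ev m (Cod M h) \<bullet> (ihm (Id M m) h \<unrhd> Id M m) = h \<bullet> ev m (Dom M h)"
    using ev_nat[of "Id M m" h m m "Dom M h" "Cod M h"] assms by simp
  finally show ?thesis using assms by simp
qed

lemma ihm_nat_ev':
  assumes "g \<in> Arr M" "n \<in> Ob M" "v \<in> Arr A" "Cod A v = ih (Cod M g) n"
  shows "ev (Dom M g) n \<bullet> ((ihm g (Id M n) \<bullet>\<^bsub>A\<^esub> v) \<unrhd> Id M (Dom M g)) = ev (Cod M g) n \<bullet> (v \<unrhd> Id M (Cod M g)) \<bullet> (Id A (Dom A v) \<unrhd> g)"
proof -
  have "ev (Dom M g) n \<bullet> ((ihm g (Id M n) \<bullet>\<^bsub>A\<^esub> v) \<unrhd> Id M (Dom M g))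
     = (ev (Dom M g) n \<bullet> (ihm g (Id M n) \<unrhd> Id M (Dom M g))) \<bullet> (v \<unrhd> Id M (Dom M g))"
    using assms by (simp add: whisker_right)
  also have "ev (Dom M g) n \<bullet> (ihm g (Id M n) \<unrhd> Id M (Dom M g)) = ev (Cod M g) n \<bullet> (Id A (ih (Cod M g) n) \<unrhd> g)"
    using ev_nat[of g "Id M n" "Dom M g" "Cod M g" n n] assms by simp
  also have "(ev (Cod M g) n \<bullet> (Id A (ih (Cod M g) n) \<unrhd> g)) \<bullet> (v \<unrhd> Id M (Dom M g))
     = ev (Cod M g) n \<bullet> (v \<unrhd> Id M (Cod M g)) \<bullet> (Id A (Dom A v) \<unrhd> g)"
    using assms by (simp add: act_comp)
  finally show ?thesis .
qed

end

context lin_action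
begin

interpretation R: lin_action K A "regular A" by (rule A.lin_action_regular)

text \<open>Mates are compatible with acting on m: up to associativity, the counit at z.m is the
  counit of \<open>A\<close> at z, acting on m.\<close>

lemma mate_act:
  assumes d: "is_right_dual A a b e c" and v: "v \<in> Arr A" "Dom A v = x" "Cod A v = a \<boxtimes>\<^bsub>A\<^esub> z" and z: "z \<in> Ob A" and m: "m \<in> Ob M"
  shows "mate a b e (z \<rhd> m) (MAssoc M a z m \<bullet> (v \<unrhd> Id M m)) \<bullet> MAssoc M b x m = R.mate a b e z v \<unrhd> Id M m"
proof -
  note D = A.right_dualD(1-8)[OF d]
  have x: "x \<in> Ob A" using v by auto
  note T = D v z m x
  have 1: "(Id A b \<unrhd> (v \<unrhd> Id M m)) \<bullet> MAssoc M b x m = MAssoc M b (a \<boxtimes>\<^bsub>A\<^esub> z) m \<bullet> ((Id A b \<boxdot>\<^bsub>A\<^esub> v) \<unrhd> Id M m)"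
    by (rule massoc_nat[symmetric]) (use T in simp_all)
  have 2: "(e \<unrhd> Id M (z \<rhd> m)) \<bullet> MAssoc M (b \<boxtimes>\<^bsub>A\<^esub> a) z m = MAssoc M (Unit A) z m \<bullet> ((e \<boxdot>\<^bsub>A\<^esub> Id A z) \<unrhd> Id M m)"
    using massoc_nat[of e "Id A z" "Id M m" "b \<boxtimes>\<^bsub>A\<^esub> a" z m "Unit A" z m] T by simp
  have "mate a b e (z \<rhd> m) (MAssoc M a z m \<bullet> (v \<unrhd> Id M m)) \<bullet> MAssoc M b x m
     = MUnit M (z \<rhd> m) \<bullet> (e \<unrhd> Id M (z \<rhd> m)) \<bullet> (MAI b a (z \<rhd> m) \<bullet> (Id A b \<unrhd> MAssoc M a z m))
        \<bullet> ((Id A b \<unrhd> (v \<unrhd> Id M m)) \<bullet> MAssoc M b x m)"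
    using T by (simp add: mate_def counit_def whisker_left)
  also have "\<dots> = MUnit M (z \<rhd> m) \<bullet> ((e \<unrhd> Id M (z \<rhd> m)) \<bullet> MAssoc M (b \<boxtimes>\<^bsub>A\<^esub> a) z m) \<bullet> (inv_arr A (Assoc A b a z) \<unrhd> Id M m)
        \<bullet> ((Id A b \<boxdot>\<^bsub>A\<^esub> v) \<unrhd> Id M m)"
    unfolding 1 using T by (simp add: mpentagon_inv2 M.inv_arr_comp_cancel)
  also have "\<dots> = (MUnit M (z \<rhd> m) \<bullet> MAssoc M (Unit A) z m) \<bullet> ((e \<boxdot>\<^bsub>A\<^esub> Id A z) \<unrhd> Id M m) \<bullet> (inv_arr A (Assoc A b a z) \<unrhd> Id M m)
        \<bullet> ((Id A b \<boxdot>\<^bsub>A\<^esub> v) \<unrhd> Id M m)"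
    unfolding 2 using T by simp
  also have "\<dots> = (LUnit A z \<unrhd> Id M m) \<bullet> ((e \<boxdot>\<^bsub>A\<^esub> Id A z) \<unrhd> Id M m) \<bullet> (inv_arr A (Assoc A b a z) \<unrhd> Id M m)
        \<bullet> ((Id A b \<boxdot>\<^bsub>A\<^esub> v) \<unrhd> Id M m)"
    using T by (simp only: munit_massoc)
  also have "\<dots> = R.mate a b e z v \<unrhd> Id M m"
    using T by (simp add: R.mate_def R.counit_def whisker_right)
  finally show ?thesis .
qed

text \<open>The counterpart for duals tensored on the right. The dual pair now stands between z and
  m, so the counit on m is applied underneath the action of z.\<close>

lemma rmate_act:
  assumes d: "is_right_dual A b x e c" and v: "v \<in> Arr A" "Dom A v = y" "Cod A v = z \<boxtimes>\<^bsub>A\<^esub> x" and z: "z \<in> Ob A" and m: "m \<in> Ob M"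
  shows "(Id A z \<unrhd> counit b x e m) \<bullet> MAssoc M z x (b \<rhd> m) \<bullet> (v \<unrhd> Id M (b \<rhd> m)) \<bullet> MAssoc M y b m
    = A.rmate b x e z v \<unrhd> Id M m"
proof -
  note D = A.right_dualD(1-8)[OF d]
  have y: "y \<in> Ob A" using v by auto
  note T = D v z m y
  have 1: "(v \<unrhd> Id M (b \<rhd> m)) \<bullet> MAssoc M y b m = MAssoc M (z \<boxtimes>\<^bsub>A\<^esub> x) b m \<bullet> ((v \<boxdot>\<^bsub>A\<^esub> Id A b) \<unrhd> Id M m)"
    using massoc_nat[of v "Id A b" "Id M m" y b m "z \<boxtimes>\<^bsub>A\<^esub> x" b m] T by simp
  have 2: "(Id A z \<unrhd> (e \<unrhd> Id M m)) \<bullet> MAssoc M z (x \<boxtimes>\<^bsub>A\<^esub> b) m = MAssoc M z (Unit A) m \<bullet> ((Id A z \<boxdot>\<^bsub>A\<^esub> e) \<unrhd> Id M m)"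
    by (rule massoc_nat[symmetric]) (use T in simp_all)
  have "(Id A z \<unrhd> counit b x e m) \<bullet> MAssoc M z x (b \<rhd> m) \<bullet> (v \<unrhd> Id M (b \<rhd> m)) \<bullet> MAssoc M y b m
    = (Id A z \<unrhd> MUnit M m) \<bullet> (Id A z \<unrhd> (e \<unrhd> Id M m)) \<bullet> ((Id A z \<unrhd> MAI x b m) \<bullet> MAssoc M z x (b \<rhd> m))
       \<bullet> ((v \<unrhd> Id M (b \<rhd> m)) \<bullet> MAssoc M y b m)"
    using T by (simp add: counit_def whisker_left)
  also have "\<dots> = (Id A z \<unrhd> MUnit M m) \<bullet> ((Id A z \<unrhd> (e \<unrhd> Id M m)) \<bullet> MAssoc M z (x \<boxtimes>\<^bsub>A\<^esub> b) m) \<bullet> (Assoc A z x b \<unrhd> Id M m)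
       \<bullet> ((v \<boxdot>\<^bsub>A\<^esub> Id A b) \<unrhd> Id M m)"
    unfolding 1 using T by (simp add: mpentagon_inv1 M.inv_arr_comp_cancel)
  also have "\<dots> = ((Id A z \<unrhd> MUnit M m) \<bullet> MAssoc M z (Unit A) m) \<bullet> ((Id A z \<boxdot>\<^bsub>A\<^esub> e) \<unrhd> Id M m) \<bullet> (Assoc A z x b \<unrhd> Id M m)
       \<bullet> ((v \<boxdot>\<^bsub>A\<^esub> Id A b) \<unrhd> Id M m)"
    unfolding 2 using T by simp
  also have "\<dots> = (RUnit A z \<unrhd> Id M m) \<bullet> ((Id A z \<boxdot>\<^bsub>A\<^esub> e) \<unrhd> Id M m) \<bullet> (Assoc A z x b \<unrhd> Id M m) \<bullet> ((v \<boxdot>\<^bsub>A\<^esub> Id A b) \<unrhd> Id M m)"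
    using T by (simp only: mtriangle)
  also have "\<dots> = A.rmate b x e z v \<unrhd> Id M m"
    using T by (simp add: A.rmate_def whisker_right)
  finally show ?thesis .
qed

end

context inner_action
begin

interpretation R: lin_action K A "regular A" by (rule A.lin_action_regular)

subsection \<open>The isomorphism \<open>a \<otimes> IHom(m, n) \<rightarrow> IHom(m, a.n)\<close>\<close>

definition "theta a m n = (SOME u. u \<in> Arr A \<and> Dom A u = a \<boxtimes>\<^bsub>A\<^esub> ih m n \<and> Cod A u = ih m (a \<rhd> n) \<and>
   ev m (a \<rhd> n) \<bullet> (u \<unrhd> Id M m) = (Id A a \<unrhd> ev m n) \<bullet> MAssoc M a (ih m n) m)"

lemma theta:
  assumes "a \<in> Ob A" "m \<in> Ob M" "n \<in> Ob M"
  shows "theta a m n \<in> Arr A" "Dom A (theta a m n) = a \<boxtimes>\<^bsub>A\<^esub> ih m n" "Cod A (theta a m n) = ih m (a \<rhd> n)"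
    "ev m (a \<rhd> n) \<bullet> (theta a m n \<unrhd> Id M m) = (Id A a \<unrhd> ev m n) \<bullet> MAssoc M a (ih m n) m"
proof -
  have "\<exists>u. u \<in> Arr A \<and> Dom A u = a \<boxtimes>\<^bsub>A\<^esub> ih m n \<and> Cod A u = ih m (a \<rhd> n) \<and>
   ev m (a \<rhd> n) \<bullet> (u \<unrhd> Id M m) = (Id A a \<unrhd> ev m n) \<bullet> MAssoc M a (ih m n) m"
    by (rule ev_surj[of m "a \<rhd> n" "a \<boxtimes>\<^bsub>A\<^esub> ih m n" "(Id A a \<unrhd> ev m n) \<bullet> MAssoc M a (ih m n) m"]) (use assms in \<open>simp_all, blast\<close>)
  from someI_ex[OF this, folded theta_def]
  show "theta a m n \<in> Arr A" "Dom A (theta a m n) = a \<boxtimes>\<^bsub>A\<^esub> ih m n" "Cod A (theta a m n) = ih m (a \<rhd> n)"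
    "ev m (a \<rhd> n) \<bullet> (theta a m n \<unrhd> Id M m) = (Id A a \<unrhd> ev m n) \<bullet> MAssoc M a (ih m n) m"
    by blast+
qed

text \<open>After evaluation both sides become the action of f on the composite of h, evaluation and
  the translate of g, up to associativity.\<close>

lemma theta_nat:
  assumes f: "f \<in> Arr A" "Dom A f = a" "Cod A f = a'" and g: "g \<in> Arr M" "Dom M g = m'" "Cod M g = m"
    and h: "h \<in> Arr M" "Dom M h = n" "Cod M h = n'"
  shows "theta a' m' n' \<bullet>\<^bsub>A\<^esub> (f \<boxdot>\<^bsub>A\<^esub> ihm g h) = ihm g (f \<unrhd> h) \<bullet>\<^bsub>A\<^esub> theta a m n"
proof (rule ev_inj)
  have O: "a \<in> Ob A" "a' \<in> Ob A" "m \<in> Ob M" "m' \<in> Ob M" "n \<in> Ob M" "n' \<in> Ob M" using f g h by auto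
  note t = theta[OF O(1,3,5)] and t' = theta[OF O(2,4,6)]
  note T = O f g h t(1-3) t'(1-3)
  let ?I = "ih m n"
  show "m' \<in> Ob M" "a' \<rhd> n' \<in> Ob M" "theta a' m' n' \<bullet>\<^bsub>A\<^esub> (f \<boxdot>\<^bsub>A\<^esub> ihm g h) \<in> Arr A" "ihm g (f \<unrhd> h) \<bullet>\<^bsub>A\<^esub> theta a m n \<in> Arr A"
    "Dom A (theta a' m' n' \<bullet>\<^bsub>A\<^esub> (f \<boxdot>\<^bsub>A\<^esub> ihm g h)) = Dom A (ihm g (f \<unrhd> h) \<bullet>\<^bsub>A\<^esub> theta a m n)"
    "Cod A (theta a' m' n' \<bullet>\<^bsub>A\<^esub> (f \<boxdot>\<^bsub>A\<^esub> ihm g h)) = ih m' (a' \<rhd> n')" "Cod A (ihm g (f \<unrhd> h) \<bullet>\<^bsub>A\<^esub> theta a m n) = ih m' (a' \<rhd> n')"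
    using T by simp_all
  have 1: "MAssoc M a' (ih m' n') m' \<bullet> ((f \<boxdot>\<^bsub>A\<^esub> ihm g h) \<unrhd> Id M m') = (f \<unrhd> (ihm g h \<unrhd> Id M m')) \<bullet> MAssoc M a ?I m'"
    by (rule massoc_nat) (use T in simp_all)
  have 2: "MAssoc M a ?I m \<bullet> ((Id A a \<boxdot>\<^bsub>A\<^esub> Id A ?I) \<unrhd> g) = (Id A a \<unrhd> (Id A ?I \<unrhd> g)) \<bullet> MAssoc M a ?I m'"
    by (rule massoc_nat) (use T in simp_all)
  have "ev m' (a' \<rhd> n') \<bullet> ((theta a' m' n' \<bullet>\<^bsub>A\<^esub> (f \<boxdot>\<^bsub>A\<^esub> ihm g h)) \<unrhd> Id M m')
     = (ev m' (a' \<rhd> n') \<bullet> (theta a' m' n' \<unrhd> Id M m')) \<bullet> ((f \<boxdot>\<^bsub>A\<^esub> ihm g h) \<unrhd> Id M m')"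
    using T by (simp add: whisker_right)
  also have "\<dots> = (Id A a' \<unrhd> ev m' n') \<bullet> (MAssoc M a' (ih m' n') m' \<bullet> ((f \<boxdot>\<^bsub>A\<^esub> ihm g h) \<unrhd> Id M m'))"
    unfolding t'(4) using T by simp
  also have "\<dots> = ((Id A a' \<unrhd> ev m' n') \<bullet> (f \<unrhd> (ihm g h \<unrhd> Id M m'))) \<bullet> MAssoc M a ?I m'"
    unfolding 1 using T by simp
  also have "(Id A a' \<unrhd> ev m' n') \<bullet> (f \<unrhd> (ihm g h \<unrhd> Id M m')) = f \<unrhd> (h \<bullet> ev m n \<bullet> (Id A ?I \<unrhd> g))"
    using T ev_nat[OF g(1) h(1) g(2,3) h(2,3)] by (simp add: act_comp)
  finally have L: "ev m' (a' \<rhd> n') \<bullet> ((theta a' m' n' \<bullet>\<^bsub>A\<^esub> (f \<boxdot>\<^bsub>A\<^esub> ihm g h)) \<unrhd> Id M m')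
     = (f \<unrhd> (h \<bullet> ev m n \<bullet> (Id A ?I \<unrhd> g))) \<bullet> MAssoc M a ?I m'" .
  have "ev m' (a' \<rhd> n') \<bullet> ((ihm g (f \<unrhd> h) \<bullet>\<^bsub>A\<^esub> theta a m n) \<unrhd> Id M m')
     = (ev m' (a' \<rhd> n') \<bullet> (ihm g (f \<unrhd> h) \<unrhd> Id M m')) \<bullet> (theta a m n \<unrhd> Id M m')"
    using T by (simp add: whisker_right)
  also have "ev m' (a' \<rhd> n') \<bullet> (ihm g (f \<unrhd> h) \<unrhd> Id M m') = (f \<unrhd> h) \<bullet> ev m (a \<rhd> n) \<bullet> (Id A (ih m (a \<rhd> n)) \<unrhd> g)"
    by (rule ev_nat) (use T in simp_all)
  also have "((f \<unrhd> h) \<bullet> ev m (a \<rhd> n) \<bullet> (Id A (ih m (a \<rhd> n)) \<unrhd> g)) \<bullet> (theta a m n \<unrhd> Id M m')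
     = (f \<unrhd> h) \<bullet> ev m (a \<rhd> n) \<bullet> ((Id A (ih m (a \<rhd> n)) \<unrhd> g) \<bullet> (theta a m n \<unrhd> Id M m'))" using T by simp
  also have "(Id A (ih m (a \<rhd> n)) \<unrhd> g) \<bullet> (theta a m n \<unrhd> Id M m') = (theta a m n \<unrhd> Id M m) \<bullet> (Id A (a \<boxtimes>\<^bsub>A\<^esub> ?I) \<unrhd> g)"
    using T by (simp add: act_comp)
  also have "(f \<unrhd> h) \<bullet> ev m (a \<rhd> n) \<bullet> (theta a m n \<unrhd> Id M m) \<bullet> (Id A (a \<boxtimes>\<^bsub>A\<^esub> ?I) \<unrhd> g)
     = (f \<unrhd> h) \<bullet> (ev m (a \<rhd> n) \<bullet> (theta a m n \<unrhd> Id M m)) \<bullet> (Id A (a \<boxtimes>\<^bsub>A\<^esub> ?I) \<unrhd> g)" using T by simp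
  also have "\<dots> = ((f \<unrhd> h) \<bullet> (Id A a \<unrhd> ev m n)) \<bullet> (MAssoc M a ?I m \<bullet> ((Id A a \<boxdot>\<^bsub>A\<^esub> Id A ?I) \<unrhd> g))"
    unfolding t(4) using T by simp
  also have "\<dots> = ((f \<unrhd> h) \<bullet> (Id A a \<unrhd> ev m n) \<bullet> (Id A a \<unrhd> (Id A ?I \<unrhd> g))) \<bullet> MAssoc M a ?I m'"
    unfolding 2 using T by simp
  also have "(f \<unrhd> h) \<bullet> (Id A a \<unrhd> ev m n) \<bullet> (Id A a \<unrhd> (Id A ?I \<unrhd> g)) = f \<unrhd> (h \<bullet> ev m n \<bullet> (Id A ?I \<unrhd> g))"
    using T by (simp add: act_comp)
  finally show "ev m' (a' \<rhd> n') \<bullet> ((theta a' m' n' \<bullet>\<^bsub>A\<^esub> (f \<boxdot>\<^bsub>A\<^esub> ihm g h)) \<unrhd> Id M m')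
     = ev m' (a' \<rhd> n') \<bullet> ((ihm g (f \<unrhd> h) \<bullet>\<^bsub>A\<^esub> theta a m n) \<unrhd> Id M m')" using L by simp
qed

text \<open>Seen through evaluation and mates on M, composing with \<open>theta\<close> turns into
  the mate bijection inside \<open>A\<close> followed by evaluation. Thus \<open>theta\<close>
  induces a bijection on every Hom(x, -), because all the other maps involved are
  bijections.\<close>

lemma theta_mate:
  assumes d: "is_right_dual A a b e c" and m: "m \<in> Ob M" "n \<in> Ob M" and v: "v \<in> Arr A" "Dom A v = x" "Cod A v = a \<boxtimes>\<^bsub>A\<^esub> ih m n"
  shows "mate a b e n (ev m (a \<rhd> n) \<bullet> ((theta a m n \<bullet>\<^bsub>A\<^esub> v) \<unrhd> Id M m)) \<bullet> MAssoc M b x m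
    = ev m n \<bullet> (R.mate a b e (ih m n) v \<unrhd> Id M m)"
proof -
  note D = A.right_dualD(1-8)[OF d]
  have x: "x \<in> Ob A" using v by auto
  note t = theta[OF D(1) m]
  note T = D m v x t(1-3)
  let ?w = "MAssoc M a (ih m n) m \<bullet> (v \<unrhd> Id M m)"
  have w: "?w \<in> Arr M" "Dom M ?w = x \<rhd> m" "Cod M ?w = a \<rhd> (ih m n \<rhd> m)" using T by simp_all
  have "ev m (a \<rhd> n) \<bullet> ((theta a m n \<bullet>\<^bsub>A\<^esub> v) \<unrhd> Id M m) = (ev m (a \<rhd> n) \<bullet> (theta a m n \<unrhd> Id M m)) \<bullet> (v \<unrhd> Id M m)"
    using T by (simp add: whisker_right)
  also have "\<dots> = (Id A a \<unrhd> ev m n) \<bullet> ?w" unfolding t(4) using T by simp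
  finally have e: "ev m (a \<rhd> n) \<bullet> ((theta a m n \<bullet>\<^bsub>A\<^esub> v) \<unrhd> Id M m) = (Id A a \<unrhd> ev m n) \<bullet> ?w" .
  have "mate a b e n ((Id A a \<unrhd> ev m n) \<bullet> ?w) = ev m n \<bullet> mate a b e (ih m n \<rhd> m) ?w"
    using mate_comp(2)[OF d w(1,3), of "ev m n"] T by simp
  then have "mate a b e n (ev m (a \<rhd> n) \<bullet> ((theta a m n \<bullet>\<^bsub>A\<^esub> v) \<unrhd> Id M m)) \<bullet> MAssoc M b x m
     = ev m n \<bullet> (mate a b e (ih m n \<rhd> m) ?w \<bullet> MAssoc M b x m)"
    unfolding e using mate_in_Hom[OF d w(1,3)] w(2) T by simp
  also have "mate a b e (ih m n \<rhd> m) ?w \<bullet> MAssoc M b x m = R.mate a b e (ih m n) v \<unrhd> Id M m"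
    by (rule mate_act[OF d v]) (use T in simp_all)
  finally show ?thesis .
qed

text \<open>The piece of the Yoneda lemma that is needed: a monomorphism with a right inverse is
  invertible.\<close>

lemma iso_of_bijective:
  assumes t: "t \<in> Arr A"
    and inj: "\<And>v v'. \<lbrakk>v \<in> Arr A; v' \<in> Arr A; Dom A v = Dom A v'; Cod A v = Dom A t; Cod A v' = Dom A t; t \<bullet>\<^bsub>A\<^esub> v = t \<bullet>\<^bsub>A\<^esub> v'\<rbrakk> \<Longrightarrow> v = v'"
    and s: "s \<in> Arr A" "Dom A s = Cod A t" "Cod A s = Dom A t" "t \<bullet>\<^bsub>A\<^esub> s = Id A (Cod A t)"
  shows "is_iso A t"
proof -
  have "t \<bullet>\<^bsub>A\<^esub> (s \<bullet>\<^bsub>A\<^esub> t) = (t \<bullet>\<^bsub>A\<^esub> s) \<bullet>\<^bsub>A\<^esub> t" using t s(1-3) by simp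
  also have "\<dots> = t \<bullet>\<^bsub>A\<^esub> Id A (Dom A t)" unfolding s(4) using t by simp
  finally have "s \<bullet>\<^bsub>A\<^esub> t = Id A (Dom A t)" by (rule inj[rotated -1]) (use t s(1-3) in simp_all)
  then show ?thesis using t s by (intro A.is_isoI[of t "Dom A t" "Cod A t" s]) (simp_all add: Hom_iff)
qed

text \<open>For b a right dual of a: Hom(x, a \<otimes> IHom(m, n)) = Hom(b \<otimes> x, IHom(m, n))
  = Hom(b.(x.m), n) = Hom(x.m, a.n) = Hom(x, IHom(m, a.n)), and by \<open>theta_mate\<close> the
  composite is induced by \<open>theta\<close>.\<close>

lemma theta_iso:
  assumes d: "is_right_dual A a b e c" and m: "m \<in> Ob M" "n \<in> Ob M"
  shows "is_iso A (theta a m n)"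
proof -
  note D = A.right_dualD(1-8)[OF d]
  note t = theta[OF D(1) m]
  let ?I = "ih m n" and ?x = "ih m (a \<rhd> n)"
  note T = D m t(1-3)
  have Rm: "R.mate a b e ?I v \<in> Arr A" "Dom A (R.mate a b e ?I v) = b \<boxtimes>\<^bsub>A\<^esub> Dom A v" "Cod A (R.mate a b e ?I v) = ?I"
    if "v \<in> Arr A" "Cod A v = a \<boxtimes>\<^bsub>A\<^esub> ?I" for v
    using R.mate_in_Hom[OF d, of v ?I] that T by simp_all
  have inj: "v = v'" if "v \<in> Arr A" "v' \<in> Arr A" "Dom A v = Dom A v'" "Cod A v = Dom A (theta a m n)" "Cod A v' = Dom A (theta a m n)"
    "theta a m n \<bullet>\<^bsub>A\<^esub> v = theta a m n \<bullet>\<^bsub>A\<^esub> v'" for v v'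
  proof -
    have C: "Cod A v = a \<boxtimes>\<^bsub>A\<^esub> ?I" "Cod A v' = a \<boxtimes>\<^bsub>A\<^esub> ?I" using that T by simp_all
    have "ev m n \<bullet> (R.mate a b e ?I v \<unrhd> Id M m) = ev m n \<bullet> (R.mate a b e ?I v' \<unrhd> Id M m)"
      using theta_mate[OF d m that(1) refl C(1)] theta_mate[OF d m that(2) refl C(2)] that(3,6) by simp
    then have "R.mate a b e ?I v = R.mate a b e ?I v'"
      by (rule ev_inj[OF m, rotated -1]) (use Rm[OF that(1) C(1)] Rm[OF that(2) C(2)] that(3) in simp_all)
    then show ?thesis by (rule R.mate_inj[OF d, rotated -1]) (use that C T in simp_all)
  qed
  have w: "ev m (a \<rhd> n) \<in> Arr M" "Cod M (ev m (a \<rhd> n)) = a \<rhd> n" "Dom M (ev m (a \<rhd> n)) = ?x \<rhd> m" using T by simp_all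
  \<comment> \<open>The inverse v is found by running the chain of bijections backwards from the
    identity of IHom(m, a.n), whose evaluation is \<open>ev m (a \<rhd> n)\<close>.\<close>
  let ?g = "mate a b e n (ev m (a \<rhd> n))"
  have g: "?g \<in> Arr M" "Dom M ?g = b \<rhd> (?x \<rhd> m)" "Cod M ?g = n" using mate_in_Hom[OF d w(1,2)] w(3) T by simp_all
  obtain r where r: "r \<in> Arr A" "Dom A r = b \<boxtimes>\<^bsub>A\<^esub> ?x" "Cod A r = ?I" "ev m n \<bullet> (r \<unrhd> Id M m) = ?g \<bullet> MAssoc M b ?x m"
    by (rule ev_surj[OF m, of "b \<boxtimes>\<^bsub>A\<^esub> ?x" "?g \<bullet> MAssoc M b ?x m"]) (use g T in simp_all)
  obtain v where v: "v \<in> Arr A" "Dom A v = ?x" "Cod A v = a \<boxtimes>\<^bsub>A\<^esub> ?I" "R.mate a b e ?I v = r"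
    using R.mate_surj[OF d, of r ?x] r(1-3) T by auto
  have "mate a b e n (ev m (a \<rhd> n) \<bullet> ((theta a m n \<bullet>\<^bsub>A\<^esub> v) \<unrhd> Id M m)) \<bullet> MAssoc M b ?x m = ?g \<bullet> MAssoc M b ?x m"
    using theta_mate[OF d m v(1-3)] r(4) v(4) by simp
  then have "mate a b e n (ev m (a \<rhd> n) \<bullet> ((theta a m n \<bullet>\<^bsub>A\<^esub> v) \<unrhd> Id M m)) = ?g"
    by (rule M.iso_cancel_right[rotated -1, of _ "MAssoc M b ?x m"])
      (use g T v(1-3) mate_in_Hom[OF d, of "ev m (a \<rhd> n) \<bullet> ((theta a m n \<bullet>\<^bsub>A\<^esub> v) \<unrhd> Id M m)" n] in simp_all)
  then have "ev m (a \<rhd> n) \<bullet> ((theta a m n \<bullet>\<^bsub>A\<^esub> v) \<unrhd> Id M m) = ev m (a \<rhd> n)"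
    by (rule mate_inj[OF d, rotated -1]) (use v(1-3) T in simp_all)
  then have "ev m (a \<rhd> n) \<bullet> ((theta a m n \<bullet>\<^bsub>A\<^esub> v) \<unrhd> Id M m) = ev m (a \<rhd> n) \<bullet> (Id A ?x \<unrhd> Id M m)" using T by simp
  then have "theta a m n \<bullet>\<^bsub>A\<^esub> v = Id A ?x"
    by (rule ev_inj[rotated -1]) (use v(1-3) T in simp_all)
  show ?thesis
  proof (rule iso_of_bijective[of "theta a m n" v], goal_cases)
    case (2 u u') then show ?case by (rule inj)
  qed (use v(1-3) T \<open>theta a m n \<bullet>\<^bsub>A\<^esub> v = _\<close> in simp_all)
qed

subsection \<open>The morphism \<open>IHom(x.s, n) \<otimes> x \<rightarrow> IHom(s, n)\<close>\<close>

text \<open>The transpose of evaluation at x.s. It is not invertible in general; combined with the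
  counit of a dual pair it yields the isomorphism \<open>lam\<close>.\<close>

definition "kappa x s n = (SOME u. u \<in> Arr A \<and> Dom A u = ih (x \<rhd> s) n \<boxtimes>\<^bsub>A\<^esub> x \<and> Cod A u = ih s n \<and>
   ev s n \<bullet> (u \<unrhd> Id M s) = ev (x \<rhd> s) n \<bullet> MAssoc M (ih (x \<rhd> s) n) x s)"

lemma kappa:
  assumes "x \<in> Ob A" "s \<in> Ob M" "n \<in> Ob M"
  shows "kappa x s n \<in> Arr A" "Dom A (kappa x s n) = ih (x \<rhd> s) n \<boxtimes>\<^bsub>A\<^esub> x" "Cod A (kappa x s n) = ih s n"
    "ev s n \<bullet> (kappa x s n \<unrhd> Id M s) = ev (x \<rhd> s) n \<bullet> MAssoc M (ih (x \<rhd> s) n) x s"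
proof -
  have "\<exists>u. u \<in> Arr A \<and> Dom A u = ih (x \<rhd> s) n \<boxtimes>\<^bsub>A\<^esub> x \<and> Cod A u = ih s n \<and>
   ev s n \<bullet> (u \<unrhd> Id M s) = ev (x \<rhd> s) n \<bullet> MAssoc M (ih (x \<rhd> s) n) x s"
    by (rule ev_surj[of s n "ih (x \<rhd> s) n \<boxtimes>\<^bsub>A\<^esub> x" "ev (x \<rhd> s) n \<bullet> MAssoc M (ih (x \<rhd> s) n) x s"]) (use assms in \<open>simp_all, blast\<close>)
  from someI_ex[OF this, folded kappa_def]
  show "kappa x s n \<in> Arr A" "Dom A (kappa x s n) = ih (x \<rhd> s) n \<boxtimes>\<^bsub>A\<^esub> x" "Cod A (kappa x s n) = ih s n"
    "ev s n \<bullet> (kappa x s n \<unrhd> Id M s) = ev (x \<rhd> s) n \<bullet> MAssoc M (ih (x \<rhd> s) n) x s"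
    by blast+
qed

text \<open>The computation shared by \<open>kappa_nat\<close>, \<open>kappa_dinat\<close> and
  \<open>lam_rmate\<close>.\<close>

lemma kappa_whisker:
  assumes x: "x \<in> Ob A" and s: "s \<in> Ob M" "n \<in> Ob M" and f: "f \<in> Arr A" "Dom A f = y \<boxtimes>\<^bsub>A\<^esub> z" "Cod A f = ih (x \<rhd> s) n \<boxtimes>\<^bsub>A\<^esub> x"
    and p: "p \<in> Arr A" "Dom A p = y" "Cod A p = ih (x \<rhd> s) n" and q: "q \<in> Arr A" "Dom A q = z" "Cod A q = x" and fpq: "f = p \<boxdot>\<^bsub>A\<^esub> q"
  shows "ev s n \<bullet> ((kappa x s n \<bullet>\<^bsub>A\<^esub> f) \<unrhd> Id M s) = (ev (x \<rhd> s) n \<bullet> (p \<unrhd> (q \<unrhd> Id M s))) \<bullet> MAssoc M y z s"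
proof -
  have O: "y \<in> Ob A" "z \<in> Ob A" using p q by auto
  note k = kappa[OF x s]
  note T = x s p q O k(1-3)
  have "ev s n \<bullet> ((kappa x s n \<bullet>\<^bsub>A\<^esub> f) \<unrhd> Id M s) = (ev s n \<bullet> (kappa x s n \<unrhd> Id M s)) \<bullet> ((p \<boxdot>\<^bsub>A\<^esub> q) \<unrhd> Id M s)"
    unfolding fpq using T by (simp add: whisker_right)
  also have "\<dots> = ev (x \<rhd> s) n \<bullet> (MAssoc M (ih (x \<rhd> s) n) x s \<bullet> ((p \<boxdot>\<^bsub>A\<^esub> q) \<unrhd> Id M s))" unfolding k(4) using T by simp
  also have "MAssoc M (ih (x \<rhd> s) n) x s \<bullet> ((p \<boxdot>\<^bsub>A\<^esub> q) \<unrhd> Id M s) = (p \<unrhd> (q \<unrhd> Id M s)) \<bullet> MAssoc M y z s"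
    by (rule massoc_nat) (use T in simp_all)
  finally show ?thesis using T by simp
qed

lemma kappa_nat:
  assumes x: "x \<in> Ob A" and w: "w \<in> Arr M" "Dom M w = s" "Cod M w = s'" and h: "h \<in> Arr M" "Dom M h = n" "Cod M h = n'"
  shows "kappa x s n' \<bullet>\<^bsub>A\<^esub> (ihm (Id A x \<unrhd> w) h \<boxdot>\<^bsub>A\<^esub> Id A x) = ihm w h \<bullet>\<^bsub>A\<^esub> kappa x s' n"
proof (rule ev_inj)
  have O: "s \<in> Ob M" "s' \<in> Ob M" "n \<in> Ob M" "n' \<in> Ob M" using w h by auto
  note k = kappa[OF x O(1,4)] and k' = kappa[OF x O(2,3)]
  note T = x O w h k(1-3) k'(1-3)
  let ?J = "ih (x \<rhd> s') n"
  show "s \<in> Ob M" "n' \<in> Ob M" "kappa x s n' \<bullet>\<^bsub>A\<^esub> (ihm (Id A x \<unrhd> w) h \<boxdot>\<^bsub>A\<^esub> Id A x) \<in> Arr A" "ihm w h \<bullet>\<^bsub>A\<^esub> kappa x s' n \<in> Arr A"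
    "Dom A (kappa x s n' \<bullet>\<^bsub>A\<^esub> (ihm (Id A x \<unrhd> w) h \<boxdot>\<^bsub>A\<^esub> Id A x)) = Dom A (ihm w h \<bullet>\<^bsub>A\<^esub> kappa x s' n)"
    "Cod A (kappa x s n' \<bullet>\<^bsub>A\<^esub> (ihm (Id A x \<unrhd> w) h \<boxdot>\<^bsub>A\<^esub> Id A x)) = ih s n'" "Cod A (ihm w h \<bullet>\<^bsub>A\<^esub> kappa x s' n) = ih s n'"
    using T by simp_all
  have "ev s n' \<bullet> ((kappa x s n' \<bullet>\<^bsub>A\<^esub> (ihm (Id A x \<unrhd> w) h \<boxdot>\<^bsub>A\<^esub> Id A x)) \<unrhd> Id M s)
     = (ev (x \<rhd> s) n' \<bullet> (ihm (Id A x \<unrhd> w) h \<unrhd> (Id A x \<unrhd> Id M s))) \<bullet> MAssoc M ?J x s"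
    by (rule kappa_whisker[where y = ?J and z = x]) (use T in simp_all)
  also have "ev (x \<rhd> s) n' \<bullet> (ihm (Id A x \<unrhd> w) h \<unrhd> (Id A x \<unrhd> Id M s)) = h \<bullet> ev (x \<rhd> s') n \<bullet> (Id A ?J \<unrhd> (Id A x \<unrhd> w))"
    using ev_nat[of "Id A x \<unrhd> w" h "x \<rhd> s" "x \<rhd> s'" n n'] T by simp
  finally have L: "ev s n' \<bullet> ((kappa x s n' \<bullet>\<^bsub>A\<^esub> (ihm (Id A x \<unrhd> w) h \<boxdot>\<^bsub>A\<^esub> Id A x)) \<unrhd> Id M s)
     = (h \<bullet> ev (x \<rhd> s') n \<bullet> (Id A ?J \<unrhd> (Id A x \<unrhd> w))) \<bullet> MAssoc M ?J x s" .
  have 1: "MAssoc M ?J x s' \<bullet> ((Id A ?J \<boxdot>\<^bsub>A\<^esub> Id A x) \<unrhd> w) = (Id A ?J \<unrhd> (Id A x \<unrhd> w)) \<bullet> MAssoc M ?J x s"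
    by (rule massoc_nat) (use T in simp_all)
  have "ev s n' \<bullet> ((ihm w h \<bullet>\<^bsub>A\<^esub> kappa x s' n) \<unrhd> Id M s) = (ev s n' \<bullet> (ihm w h \<unrhd> Id M s)) \<bullet> (kappa x s' n \<unrhd> Id M s)"
    using T by (simp add: whisker_right)
  also have "ev s n' \<bullet> (ihm w h \<unrhd> Id M s) = h \<bullet> ev s' n \<bullet> (Id A (ih s' n) \<unrhd> w)" by (rule ev_nat) (use T in simp_all)
  also have "(h \<bullet> ev s' n \<bullet> (Id A (ih s' n) \<unrhd> w)) \<bullet> (kappa x s' n \<unrhd> Id M s)
     = h \<bullet> ev s' n \<bullet> ((Id A (ih s' n) \<unrhd> w) \<bullet> (kappa x s' n \<unrhd> Id M s))" using T by simp
  also have "(Id A (ih s' n) \<unrhd> w) \<bullet> (kappa x s' n \<unrhd> Id M s) = (kappa x s' n \<unrhd> Id M s') \<bullet> (Id A (?J \<boxtimes>\<^bsub>A\<^esub> x) \<unrhd> w)"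
    using T by (simp add: act_comp)
  also have "h \<bullet> ev s' n \<bullet> (kappa x s' n \<unrhd> Id M s') \<bullet> (Id A (?J \<boxtimes>\<^bsub>A\<^esub> x) \<unrhd> w)
     = h \<bullet> (ev s' n \<bullet> (kappa x s' n \<unrhd> Id M s')) \<bullet> (Id A (?J \<boxtimes>\<^bsub>A\<^esub> x) \<unrhd> w)" using T by simp
  also have "\<dots> = h \<bullet> ev (x \<rhd> s') n \<bullet> (MAssoc M ?J x s' \<bullet> ((Id A ?J \<boxdot>\<^bsub>A\<^esub> Id A x) \<unrhd> w))"
    unfolding k'(4) using T by simp
  finally show "ev s n' \<bullet> ((kappa x s n' \<bullet>\<^bsub>A\<^esub> (ihm (Id A x \<unrhd> w) h \<boxdot>\<^bsub>A\<^esub> Id A x)) \<unrhd> Id M s)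
     = ev s n' \<bullet> ((ihm w h \<bullet>\<^bsub>A\<^esub> kappa x s' n) \<unrhd> Id M s)" unfolding L 1 using T by simp
qed

text \<open>The object x occurs both in the first argument of \<open>IHom\<close> and as a tensor
  factor, with opposite variance, so an arrow f can only be moved from one place to the
  other.\<close>

lemma kappa_dinat:
  assumes f: "f \<in> Arr A" "Dom A f = x" "Cod A f = x'" and s: "s \<in> Ob M" "n \<in> Ob M"
  shows "kappa x s n \<bullet>\<^bsub>A\<^esub> (ihm (f \<unrhd> Id M s) (Id M n) \<boxdot>\<^bsub>A\<^esub> Id A x) = kappa x' s n \<bullet>\<^bsub>A\<^esub> (Id A (ih (x' \<rhd> s) n) \<boxdot>\<^bsub>A\<^esub> f)"
proof (rule ev_inj)
  have O: "x \<in> Ob A" "x' \<in> Ob A" using f by auto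
  note T = O f s kappa(1-3)[OF O(1) s] kappa(1-3)[OF O(2) s]
  let ?J = "ih (x' \<rhd> s) n"
  show "s \<in> Ob M" "n \<in> Ob M" "kappa x s n \<bullet>\<^bsub>A\<^esub> (ihm (f \<unrhd> Id M s) (Id M n) \<boxdot>\<^bsub>A\<^esub> Id A x) \<in> Arr A" "kappa x' s n \<bullet>\<^bsub>A\<^esub> (Id A ?J \<boxdot>\<^bsub>A\<^esub> f) \<in> Arr A"
    "Dom A (kappa x s n \<bullet>\<^bsub>A\<^esub> (ihm (f \<unrhd> Id M s) (Id M n) \<boxdot>\<^bsub>A\<^esub> Id A x)) = Dom A (kappa x' s n \<bullet>\<^bsub>A\<^esub> (Id A ?J \<boxdot>\<^bsub>A\<^esub> f))"
    "Cod A (kappa x s n \<bullet>\<^bsub>A\<^esub> (ihm (f \<unrhd> Id M s) (Id M n) \<boxdot>\<^bsub>A\<^esub> Id A x)) = ih s n" "Cod A (kappa x' s n \<bullet>\<^bsub>A\<^esub> (Id A ?J \<boxdot>\<^bsub>A\<^esub> f)) = ih s n"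
    using T by simp_all
  have "ev s n \<bullet> ((kappa x s n \<bullet>\<^bsub>A\<^esub> (ihm (f \<unrhd> Id M s) (Id M n) \<boxdot>\<^bsub>A\<^esub> Id A x)) \<unrhd> Id M s)
     = (ev (x \<rhd> s) n \<bullet> (ihm (f \<unrhd> Id M s) (Id M n) \<unrhd> (Id A x \<unrhd> Id M s))) \<bullet> MAssoc M ?J x s"
    by (rule kappa_whisker[where y = ?J and z = x]) (use T in simp_all)
  also have "ev (x \<rhd> s) n \<bullet> (ihm (f \<unrhd> Id M s) (Id M n) \<unrhd> (Id A x \<unrhd> Id M s)) = ev (x' \<rhd> s) n \<bullet> (Id A ?J \<unrhd> (f \<unrhd> Id M s))"
    using ev_nat[of "f \<unrhd> Id M s" "Id M n" "x \<rhd> s" "x' \<rhd> s" n n] T by simp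
  also have "(ev (x' \<rhd> s) n \<bullet> (Id A ?J \<unrhd> (f \<unrhd> Id M s))) \<bullet> MAssoc M ?J x s
     = ev s n \<bullet> ((kappa x' s n \<bullet>\<^bsub>A\<^esub> (Id A ?J \<boxdot>\<^bsub>A\<^esub> f)) \<unrhd> Id M s)"
    by (rule kappa_whisker[where y = ?J and z = x, symmetric]) (use T in simp_all)
  finally show "ev s n \<bullet> ((kappa x s n \<bullet>\<^bsub>A\<^esub> (ihm (f \<unrhd> Id M s) (Id M n) \<boxdot>\<^bsub>A\<^esub> Id A x)) \<unrhd> Id M s)
     = ev s n \<bullet> ((kappa x' s n \<bullet>\<^bsub>A\<^esub> (Id A ?J \<boxdot>\<^bsub>A\<^esub> f)) \<unrhd> Id M s)" .
qed

text \<open>The canonical arrow IHom(m, n) \<otimes> x -> IHom(b.m, n) for x a right dual of b: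
  restrict along the counit x.(b.m) -> m, then apply \<open>kappa\<close>.\<close>

definition "lam b x e m n = kappa x (b \<rhd> m) n \<bullet>\<^bsub>A\<^esub> (ihm (counit b x e m) (Id M n) \<boxdot>\<^bsub>A\<^esub> Id A x)"

lemma lam_rmate:
  assumes d: "is_right_dual A b x e c" and m: "m \<in> Ob M" "n \<in> Ob M"
    and v: "v \<in> Arr A" "Dom A v = y" "Cod A v = ih m n \<boxtimes>\<^bsub>A\<^esub> x"
  shows "(ev (b \<rhd> m) n \<bullet> ((lam b x e m n \<bullet>\<^bsub>A\<^esub> v) \<unrhd> Id M (b \<rhd> m))) \<bullet> MAssoc M y b m
    = ev m n \<bullet> (A.rmate b x e (ih m n) v \<unrhd> Id M m)"
proof -
  note D = A.right_dualD(1-8)[OF d]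
  have y: "y \<in> Ob A" using v by auto
  have O: "b \<rhd> m \<in> Ob M" using D m by simp
  let ?cu = "counit b x e m" and ?I = "ih m n"
  note cu = counit_arr(1-3)[OF d m(1)]
  note T = D m v y O cu kappa(1-3)[OF D(2) O m(2)]
  have l: "lam b x e m n \<in> Arr A" "Dom A (lam b x e m n) = ?I \<boxtimes>\<^bsub>A\<^esub> x" "Cod A (lam b x e m n) = ih (b \<rhd> m) n"
    using T by (simp_all add: lam_def)
  have "ev (b \<rhd> m) n \<bullet> (lam b x e m n \<unrhd> Id M (b \<rhd> m))
     = (ev (x \<rhd> (b \<rhd> m)) n \<bullet> (ihm ?cu (Id M n) \<unrhd> (Id A x \<unrhd> Id M (b \<rhd> m)))) \<bullet> MAssoc M ?I x (b \<rhd> m)"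
    unfolding lam_def by (rule kappa_whisker[where y = ?I and z = x]) (use T in simp_all)
  also have "ev (x \<rhd> (b \<rhd> m)) n \<bullet> (ihm ?cu (Id M n) \<unrhd> (Id A x \<unrhd> Id M (b \<rhd> m))) = ev m n \<bullet> (Id A ?I \<unrhd> ?cu)"
    using ev_nat[of ?cu "Id M n" "x \<rhd> (b \<rhd> m)" m n n] T by simp
  finally have e: "ev (b \<rhd> m) n \<bullet> (lam b x e m n \<unrhd> Id M (b \<rhd> m)) = (ev m n \<bullet> (Id A ?I \<unrhd> ?cu)) \<bullet> MAssoc M ?I x (b \<rhd> m)" .
  have "(ev (b \<rhd> m) n \<bullet> ((lam b x e m n \<bullet>\<^bsub>A\<^esub> v) \<unrhd> Id M (b \<rhd> m))) \<bullet> MAssoc M y b m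
     = (ev (b \<rhd> m) n \<bullet> (lam b x e m n \<unrhd> Id M (b \<rhd> m))) \<bullet> (v \<unrhd> Id M (b \<rhd> m)) \<bullet> MAssoc M y b m"
    using T l by (simp add: whisker_right)
  also have "\<dots> = ev m n \<bullet> ((Id A ?I \<unrhd> ?cu) \<bullet> MAssoc M ?I x (b \<rhd> m) \<bullet> (v \<unrhd> Id M (b \<rhd> m)) \<bullet> MAssoc M y b m)"
    unfolding e using T by simp
  also have "(Id A ?I \<unrhd> ?cu) \<bullet> MAssoc M ?I x (b \<rhd> m) \<bullet> (v \<unrhd> Id M (b \<rhd> m)) \<bullet> MAssoc M y b m = A.rmate b x e ?I v \<unrhd> Id M m"
    by (rule rmate_act[OF d v]) (use T in simp_all)
  finally show ?thesis .
qed

text \<open>Hom(y, IHom(m, n) \<otimes> x) = Hom(y \<otimes> b, IHom(m, n)) = Hom(y.(b.m), n) =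
  Hom(y, IHom(b.m, n)), and by \<open>lam_rmate\<close> the composite is induced by
  \<open>lam\<close>. The inverse again comes from the identity.\<close>

lemma lam_iso:
  assumes d: "is_right_dual A b x e c" and m: "m \<in> Ob M" "n \<in> Ob M"
  shows "lam b x e m n \<in> Arr A" "Dom A (lam b x e m n) = ih m n \<boxtimes>\<^bsub>A\<^esub> x" "Cod A (lam b x e m n) = ih (b \<rhd> m) n"
    "is_iso A (lam b x e m n)"
proof -
  note D = A.right_dualD(1-8)[OF d]
  have O: "b \<rhd> m \<in> Ob M" using D m by simp
  note cu = counit_arr(1-3)[OF d m(1)]
  let ?I = "ih m n" and ?y = "ih (b \<rhd> m) n"
  show l: "lam b x e m n \<in> Arr A" "Dom A (lam b x e m n) = ?I \<boxtimes>\<^bsub>A\<^esub> x" "Cod A (lam b x e m n) = ?y"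
    using D m O cu kappa(1-3)[OF D(2) O m(2)] by (simp_all add: lam_def)
  note T = D m O l
  have Rm: "A.rmate b x e ?I v \<in> Arr A" "Dom A (A.rmate b x e ?I v) = Dom A v \<boxtimes>\<^bsub>A\<^esub> b" "Cod A (A.rmate b x e ?I v) = ?I"
    if "v \<in> Arr A" "Cod A v = ?I \<boxtimes>\<^bsub>A\<^esub> x" for v
    using that T by (simp_all add: A.rmate_def)
  have inj: "v = v'" if "v \<in> Arr A" "v' \<in> Arr A" "Dom A v = Dom A v'" "Cod A v = Dom A (lam b x e m n)" "Cod A v' = Dom A (lam b x e m n)"
    "lam b x e m n \<bullet>\<^bsub>A\<^esub> v = lam b x e m n \<bullet>\<^bsub>A\<^esub> v'" for v v'
  proof -
    have C: "Cod A v = ?I \<boxtimes>\<^bsub>A\<^esub> x" "Cod A v' = ?I \<boxtimes>\<^bsub>A\<^esub> x" using that T by simp_all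
    have "ev m n \<bullet> (A.rmate b x e ?I v \<unrhd> Id M m) = ev m n \<bullet> (A.rmate b x e ?I v' \<unrhd> Id M m)"
      using lam_rmate[OF d m that(1) refl C(1)] lam_rmate[OF d m that(2) refl C(2)] that(3,6) by simp
    then have "A.rmate b x e ?I v = A.rmate b x e ?I v'"
      by (rule ev_inj[OF m, rotated -1]) (use Rm[OF that(1) C(1)] Rm[OF that(2) C(2)] that(3) in simp_all)
    then show ?thesis by (rule A.rmate_inj[OF d, rotated -1]) (use that C T in simp_all)
  qed
  obtain r where r: "r \<in> Arr A" "Dom A r = ?y \<boxtimes>\<^bsub>A\<^esub> b" "Cod A r = ?I" "ev m n \<bullet> (r \<unrhd> Id M m) = ev (b \<rhd> m) n \<bullet> MAssoc M ?y b m"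
    by (rule ev_surj[OF m, of "?y \<boxtimes>\<^bsub>A\<^esub> b" "ev (b \<rhd> m) n \<bullet> MAssoc M ?y b m"]) (use T in simp_all)
  have yO: "?y \<in> Ob A" using T by simp
  obtain v where v: "v \<in> Arr A" "Dom A v = ?y" "Cod A v = Cod A r \<boxtimes>\<^bsub>A\<^esub> x" "A.rmate b x e (Cod A r) v = r"
    by (rule A.rmate_surj[OF d r(1,2) yO])
  have v3: "Cod A v = ?I \<boxtimes>\<^bsub>A\<^esub> x" using v(3) r(3) by simp
  have "(ev (b \<rhd> m) n \<bullet> ((lam b x e m n \<bullet>\<^bsub>A\<^esub> v) \<unrhd> Id M (b \<rhd> m))) \<bullet> MAssoc M ?y b m = ev (b \<rhd> m) n \<bullet> MAssoc M ?y b m"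
    using lam_rmate[OF d m v(1,2) v3] r(3,4) v(4) by simp
  then have "ev (b \<rhd> m) n \<bullet> ((lam b x e m n \<bullet>\<^bsub>A\<^esub> v) \<unrhd> Id M (b \<rhd> m)) = ev (b \<rhd> m) n"
    by (rule M.iso_cancel_right[rotated -1, of _ "MAssoc M ?y b m"]) (use T v(1,2) v3 in simp_all)
  then have "ev (b \<rhd> m) n \<bullet> ((lam b x e m n \<bullet>\<^bsub>A\<^esub> v) \<unrhd> Id M (b \<rhd> m)) = ev (b \<rhd> m) n \<bullet> (Id A ?y \<unrhd> Id M (b \<rhd> m))" using T by simp
  then have "lam b x e m n \<bullet>\<^bsub>A\<^esub> v = Id A ?y"
    by (rule ev_inj[rotated -1]) (use v(1,2) v3 T in simp_all)
  show "is_iso A (lam b x e m n)"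
  proof (rule iso_of_bijective[of "lam b x e m n" v], goal_cases)
    case (2 u u') then show ?case by (rule inj)
  qed (use v(1,2) v3 T \<open>lam b x e m n \<bullet>\<^bsub>A\<^esub> v = _\<close> in simp_all)
qed

end

section \<open>Exactness of the inner Hom\<close>

text \<open>The epimorphism q is the cokernel of some k', which factors through the kernel k; an
  arrow that kills k therefore kills k'.\<close>

lemma (in fin_ab) kernel_epi_cokernel:
  assumes k: "is_kernel C q k" and q: "is_epi C q"
  shows "is_cokernel C k q"
proof -
  note Kd = is_kernelD[OF k]
  obtain k' where k': "short_exact C k' q" by (rule epi_short_exact[OF q])
  then have kk: "is_kernel C q k'" and ck: "is_cokernel C k' q" by (simp_all add: short_exact_def)
  note K' = is_kernelD[OF kk] and C' = is_cokernelD[OF ck]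
  obtain u where u: "u \<in> Arr C" "Dom C u = Dom C k'" "Cod C u = Dom C k" "k \<bullet> u = k'"
    using Kd(6)[OF K'(2,3,4)] by (auto simp: Hom_iff)
  show ?thesis
  proof (rule is_cokernelI)
    show "k \<in> Arr C" "Dom C q = Cod C k" "q \<bullet> k = HZero C (Dom C k) (Cod C q)" "is_epi C q"
      using Kd(1-4) q by simp_all
    fix h assume h: "h \<in> Arr C" "Dom C h = Cod C k" "h \<bullet> k = HZero C (Dom C k) (Cod C h)"
    have "h \<bullet> k' = (h \<bullet> k) \<bullet> u" using u(4)[symmetric] u(1-3) h(1,2) Kd(2) by simp
    also have "\<dots> = HZero C (Dom C k') (Cod C h)" unfolding h(3) using u(1-3) h(1) by simp
    finally show "\<exists>u. u \<in> Hom C (Cod C q) (Cod C h) \<and> u \<bullet> q = h"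
      using C'(6)[OF h(1)] h(2) Kd(3) K'(3) by simp
  qed
qed

context fin_cat
begin

text \<open>An arrow killing f then kills every arrow from the generator P into the target of f, so
  it vanishes.\<close>

lemma epi_test:
  assumes f: "f \<in> Arr C" and lift: "\<forall>u \<in> Hom C P (Cod C f). \<exists>v \<in> Hom C P (Dom C f). f \<bullet> v = u"
  shows "is_epi C f"
  unfolding is_epi_iff
proof (intro conjI ballI impI)
  fix g assume g: "g \<in> Arr C" "Dom C g = Cod C f" "g \<bullet> f = HZero C (Dom C f) (Cod C g)"
  have "g \<bullet> u = HZero C P (Cod C g)" if u: "u \<in> Hom C P (Dom C g)" for u
  proof -
    obtain v where v: "v \<in> Hom C P (Dom C f)" "f \<bullet> v = u" using lift u g(2) by auto
    have "g \<bullet> f \<bullet> v = (g \<bullet> f) \<bullet> v" using v(1) f g(1,2) by (simp add: Hom_iff)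
    also have "\<dots> = HZero C P (Cod C g)" unfolding g(3) using v(1) f g(1) by (simp add: Hom_iff)
    finally show ?thesis unfolding v(2) .
  qed
  then show "g = HZero C (Cod C f) (Cod C g)"
    using faithful_obD[OF proj_gen[unfolded proj_gen_def, THEN conjunct2] g(1)] g(2) by simp
qed (rule f)

text \<open>An arrow into a finite sum vanishes when its components do. Needed to test against
  projective objects, which are summands of such sums.\<close>

lemma sum_of_zero_test:
  assumes "sum_of C P p" and g: "g \<in> Arr C" and z: "\<forall>u \<in> Hom C (Cod C g) P. u \<bullet> g = HZero C (Dom C g) P"
  shows "\<forall>v \<in> Hom C (Cod C g) p. v \<bullet> g = HZero C (Dom C g) p"
  using assms(1)
proof induction
  case (zero s)
  show ?case
  proof
    fix v assume v: "v \<in> Hom C (Cod C g) s"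
    have "v \<bullet> g = Id C s \<bullet> v \<bullet> g" using v g by (simp add: Hom_iff)
    also have "\<dots> = HZero C (Dom C g) s" unfolding zero(2) using v g by (auto simp: Hom_iff)
    finally show "v \<bullet> g = HZero C (Dom C g) s" .
  qed
next
  case (plus x s i j a b)
  note B = biprodD[OF plus(2)]
  show ?case
  proof
    fix v assume v: "v \<in> Hom C (Cod C g) s"
    have 1: "a \<bullet> v \<bullet> g = HZero C (Dom C g) x"
      using plus.IH[THEN bspec, of "a \<bullet> v"] v B(10-12) g by (simp add: Hom_iff)
    have 2: "b \<bullet> v \<bullet> g = HZero C (Dom C g) P"
      using z[THEN bspec, of "b \<bullet> v"] v B(13-15) g by (simp add: Hom_iff)
    have "v \<bullet> g = HAdd C (i \<bullet> a) (j \<bullet> b) \<bullet> v \<bullet> g" unfolding B(18) using v g by (simp add: Hom_iff)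
    also have "\<dots> = HAdd C (i \<bullet> (a \<bullet> v \<bullet> g)) (j \<bullet> (b \<bullet> v \<bullet> g))"
      using v g B(1-15) by (simp add: Hom_iff comp_add_left)
    also have "\<dots> = HZero C (Dom C g) s" unfolding 1 2 using v g B(1-15) by simp
    finally show "v \<bullet> g = HZero C (Dom C g) s" .
  qed
qed

end

locale exact_action = inner_action K A M H + F: finite_action K A M
  for K :: "('k, 'y) ring_scheme" and A :: "('oa, 'ma, 'k, 'z) moncat_scheme"
    and M :: "('oa, 'ma, 'o, 'm, 'k, 'w) modcat_scheme" (structure) and H :: "('oa, 'ma, 'o, 'm) inner_hom" +
  assumes exact: "exact_module_category A M"
begin

interpretation R: lin_action K A "regular A" by (rule A.lin_action_regular)

definition "PA = (SOME P. proj_gen A P)"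
definition "PM = (SOME P. proj_gen M P)"

lemma PA: "proj_gen A PA" and PM: "proj_gen M PM"
  unfolding PA_def PM_def using someI_ex[OF F.A_gen] someI_ex[OF F.M_gen] by auto

sublocale FA: fin_cat K A PA by (intro fin_cat.intro F.A_fin fin_cat_axioms.intro PA)
sublocale FM: fin_cat K M PM by (intro fin_cat.intro F.M_fin fin_cat_axioms.intro PM)

lemma act_projective: "projective A p \<Longrightarrow> m \<in> Ob M \<Longrightarrow> projective M (p \<rhd> m)"
  using exact unfolding exact_module_category_def by blast

lemma left_dual_ex: "c \<in> Ob A \<Longrightarrow> \<exists>d e f. is_right_dual A d c e f"
  and right_dual_ex: "c \<in> Ob A \<Longrightarrow> \<exists>d e f. is_right_dual A c d e f"
  using F.rigid unfolding rigid_def is_left_dual_def by blast+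

lemma ihm_zero:
  "\<lbrakk>m \<in> Ob M; x \<in> Ob M; y \<in> Ob M\<rbrakk> \<Longrightarrow> ihm (Id M m) (HZero M x y) = HZero A (ih m x) (ih m y)"
  "\<lbrakk>n \<in> Ob M; x \<in> Ob M; y \<in> Ob M\<rbrakk> \<Longrightarrow> ihm (HZero M x y) (Id M n) = HZero A (ih y n) (ih x n)"
  using linear_functorD(8)[OF M.linear_category_axioms A.linear_category_axioms ihm_linear(1), of m x y]
    linear_functorD(8)[OF M.linear_category_op A.linear_category_axioms ihm_linear(2), of n y x] by simp_all

lemma ev_zero_iff:
  assumes "m \<in> Ob M" "n \<in> Ob M" "u \<in> Arr A" "Cod A u = ih m n"
  shows "ev m n \<bullet> (u \<unrhd> Id M m) = HZero M (Dom A u \<rhd> m) n \<longleftrightarrow> u = HZero A (Dom A u) (ih m n)"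
proof -
  have z: "ev m n \<bullet> (HZero A (Dom A u) (ih m n) \<unrhd> Id M m) = HZero M (Dom A u \<rhd> m) n"
    using assms by (simp add: act_add)
  show ?thesis
  proof
    assume "ev m n \<bullet> (u \<unrhd> Id M m) = HZero M (Dom A u \<rhd> m) n"
    then show "u = HZero A (Dom A u) (ih m n)"
      by (intro ev_inj[OF assms(1,2)]) (use assms z in simp_all)
  next
    assume "u = HZero A (Dom A u) (ih m n)"
    then show "ev m n \<bullet> (u \<unrhd> Id M m) = HZero M (Dom A u \<rhd> m) n" using z by metis
  qed
qed

text \<open>Tested on arrows from \<open>PA\<close>: they correspond to arrows from PA.m, which lift
  along e because that object is projective.\<close>

lemma ihm_epi:
  assumes m: "m \<in> Ob M" and e: "is_epi M e"
  shows "is_epi A (ihm (Id M m) e)"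
proof (rule FA.epi_test)
  have eA: "e \<in> Arr M" using e by (simp add: is_epi_def)
  then show "ihm (Id M m) e \<in> Arr A" using m by simp
  show "\<forall>u\<in>Hom A PA (Cod A (ihm (Id M m) e)). \<exists>v\<in>Hom A PA (Dom A (ihm (Id M m) e)). ihm (Id M m) e \<bullet>\<^bsub>A\<^esub> v = u"
  proof
    fix u assume "u \<in> Hom A PA (Cod A (ihm (Id M m) e))"
    then have u: "u \<in> Arr A" "Dom A u = PA" "Cod A u = ih m (Cod M e)" using m eA by (simp_all add: Hom_iff)
    obtain w where w: "w \<in> Arr M" "Dom M w = PA \<rhd> m" "Cod M w = Dom M e" "e \<bullet> w = ev m (Cod M e) \<bullet> (u \<unrhd> Id M m)"
      by (rule M.projective_lift[OF act_projective[OF FA.P_projective m] e, of "ev m (Cod M e) \<bullet> (u \<unrhd> Id M m)"])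
        (use u m eA in simp_all)
    obtain v where v: "v \<in> Arr A" "Dom A v = PA" "Cod A v = ih m (Dom M e)" "ev m (Dom M e) \<bullet> (v \<unrhd> Id M m) = w"
      by (rule ev_surj[of m "Dom M e" PA w]) (use w m eA in simp_all)
    have "ihm (Id M m) e \<bullet>\<^bsub>A\<^esub> v = u"
      by (rule ev_inj[of m "Cod M e"]) (use ihm_nat_ev[OF eA m v(1,3)] v(1-3) u w(4) m eA in \<open>simp_all add: v(4)\<close>)
    then show "\<exists>v\<in>Hom A PA (Dom A (ihm (Id M m) e)). ihm (Id M m) e \<bullet>\<^bsub>A\<^esub> v = u"
      using v(1-3) m eA by (intro bexI[of _ v]) (simp_all add: Hom_iff)
  qed
qed

text \<open>IHom(m, -) is a right adjoint, so it preserves kernels; every step is transported along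
  evaluation.\<close>

lemma ihm_kernel:
  assumes m: "m \<in> Ob M" and k: "is_kernel M q k"
  shows "is_kernel A (ihm (Id M m) q) (ihm (Id M m) k)"
proof (rule A.is_kernelI)
  note Kd = M.is_kernelD[OF k]
  show "ihm (Id M m) q \<in> Arr A" "Cod A (ihm (Id M m) k) = Dom A (ihm (Id M m) q)" using Kd(1-3) m by simp_all
  show "ihm (Id M m) q \<bullet>\<^bsub>A\<^esub> ihm (Id M m) k = HZero A (Dom A (ihm (Id M m) k)) (Cod A (ihm (Id M m) q))"
    using ihm_comp[of "Id M m" "Id M m" k q] Kd(1-4) m by (simp add: ihm_zero)
  show "is_epi (op_cat A) (ihm (Id M m) k)"
    unfolding A.is_mono_iff
  proof (intro conjI ballI impI)
    show "ihm (Id M m) k \<in> Arr A" using Kd(2) m by simp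
    fix g assume g: "g \<in> Arr A" "Cod A g = Dom A (ihm (Id M m) k)" "ihm (Id M m) k \<bullet>\<^bsub>A\<^esub> g = HZero A (Dom A g) (Cod A (ihm (Id M m) k))"
    let ?g = "ev m (Dom M k) \<bullet> (g \<unrhd> Id M m)"
    have g2: "Cod A g = ih m (Dom M k)" using g(2) Kd(2) m by simp
    have "k \<bullet> ?g = ev m (Cod M k) \<bullet> (HZero A (Dom A g) (ih m (Cod M k)) \<unrhd> Id M m)"
      using ihm_nat_ev[OF Kd(2) m g(1) g2] g(3) Kd(2) m by simp
    also have "\<dots> = HZero M (Dom M ?g) (Cod M k)" using g(1) g2 Kd(2) m by (simp add: act_add)
    finally have "?g = HZero M (Dom A g \<rhd> m) (Dom M k)"
      using Kd(5)[unfolded M.is_mono_iff, THEN conjunct2, THEN bspec, of ?g] g(1) g2 Kd(2) m by simp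
    then show "g = HZero A (Dom A g) (Dom A (ihm (Id M m) k))"
      using ev_zero_iff[OF m _ g(1) g2] Kd(2) m by simp
  qed
  fix h assume h: "h \<in> Arr A" "Cod A h = Dom A (ihm (Id M m) q)" "ihm (Id M m) q \<bullet>\<^bsub>A\<^esub> h = HZero A (Dom A h) (Cod A (ihm (Id M m) q))"
  let ?h = "ev m (Dom M q) \<bullet> (h \<unrhd> Id M m)"
  have h2: "Cod A h = ih m (Dom M q)" using h(2) Kd(1) m by simp
  have hA: "?h \<in> Arr M" "Dom M ?h = Dom A h \<rhd> m" "Cod M ?h = Dom M q" using h(1) h2 Kd(1) m by simp_all
  have "q \<bullet> ?h = ev m (Cod M q) \<bullet> (HZero A (Dom A h) (ih m (Cod M q)) \<unrhd> Id M m)"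
    using ihm_nat_ev[OF Kd(1) m h(1) h2] h(3) Kd(1) m by simp
  also have "\<dots> = HZero M (Dom M ?h) (Cod M q)" using h(1) h2 Kd(1) m by (simp add: act_add)
  finally obtain w where w: "w \<in> Arr M" "Dom M w = Dom A h \<rhd> m" "Cod M w = Dom M k" "k \<bullet> w = ?h"
    using Kd(6)[OF hA(1,3)] hA(2) by (auto simp: Hom_iff)
  obtain v where v: "v \<in> Arr A" "Dom A v = Dom A h" "Cod A v = ih m (Dom M k)" "ev m (Dom M k) \<bullet> (v \<unrhd> Id M m) = w"
    by (rule ev_surj[of m "Dom M k" "Dom A h" w]) (use w(1-3) h(1) m Kd(2) in simp_all)
  have "ihm (Id M m) k \<bullet>\<^bsub>A\<^esub> v = h"
    by (rule ev_inj[of m "Dom M q"])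
      (use ihm_nat_ev[OF Kd(2) m v(1,3)] v(1-3) h(1) h2 w(4) m Kd(1-3) in \<open>simp_all add: v(4)\<close>)
  then show "\<exists>u. u \<in> Hom A (Dom A h) (Dom A (ihm (Id M m) k)) \<and> ihm (Id M m) k \<bullet>\<^bsub>A\<^esub> u = h"
    using v(1-3) m Kd(2) by (intro exI[of _ v]) (simp add: Hom_iff)
qed

text \<open>\<open>right_adjoint_ob\<close> for the functor IHom(m, -) and the unit object. Right
  exactness is pieced together from preservation of kernels and of epimorphisms by
  \<open>kernel_epi_cokernel\<close>.\<close>

lemma right_Serre_ob:
  assumes m: "m \<in> Ob M"
  shows "\<exists>r e. r \<in> Ob M \<and> e \<in> Hom A (ih m r) (Unit A) \<and>
    (\<forall>x\<in>Ob M. \<forall>y\<in>Hom A (ih m x) (Unit A). \<exists>!u. u \<in> Hom M x r \<and> e \<bullet>\<^bsub>A\<^esub> ihm (Id M m) u = y)"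
proof -
  have "is_cokernel A (amap \<lparr>omap = (\<lambda>n. ih m n), amap = (\<lambda>h. ihm (Id M m) h)\<rparr> k)
      (amap \<lparr>omap = (\<lambda>n. ih m n), amap = (\<lambda>h. ihm (Id M m) h)\<rparr> q)" if "short_exact M k q" for k q
  proof -
    have 1: "is_kernel M q k" and 2: "is_cokernel M k q" using that by (simp_all add: short_exact_def)
    show ?thesis using FA.kernel_epi_cokernel[OF ihm_kernel[OF m 1] ihm_epi[OF m M.is_cokernelD(5)[OF 2]]] by simp
  qed
  from FM.right_adjoint_ob[OF A.linear_category_axioms ihm_linear(1)[OF m] A.unit_Ob FA.hom_noetherian[OF _ A.unit_Ob] this]
  show ?thesis by simp
qed

text \<open>Let c be the cokernel of i. The target of p.c is projective, so the epimorphism p.c has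
  a section s; then 1 - s (p.c) factors through the kernel p.i of p.c, and the factor r is the
  retraction. The left dual of p keeps p.c epi, the right dual keeps p.i a kernel.\<close>

lemma act_mono_split:
  assumes p: "projective A p" and i: "is_epi (op_cat M) i"
  obtains r where "r \<in> Arr M" "Dom M r = p \<rhd> Cod M i" "Cod M r = p \<rhd> Dom M i" "r \<bullet> (Id A p \<unrhd> i) = Id M (p \<rhd> Dom M i)"
proof -
  have pO: "p \<in> Ob A" using p by (simp add: projective_def)
  have iA: "i \<in> Arr M" using i by (simp add: is_epi_def)
  obtain c where c: "short_exact M i c" by (rule FM.mono_short_exact[OF i])
  have kc: "is_kernel M c i" and cc: "is_cokernel M i c" using c by (simp_all add: short_exact_def)
  note Cd = M.is_cokernelD[OF cc]
  obtain lp e f where lp: "is_right_dual A lp p e f" using left_dual_ex[OF pO] by blast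
  obtain rp e' f' where rp: "is_right_dual A p rp e' f'" using right_dual_ex[OF pO] by blast
  let ?i = "Id A p \<unrhd> i" and ?c = "Id A p \<unrhd> c" and ?y = "p \<rhd> Cod M i"
  have t: "?i \<in> Arr M" "Dom M ?i = p \<rhd> Dom M i" "Cod M ?i = ?y" "?c \<in> Arr M" "Dom M ?c = ?y" "Cod M ?c = p \<rhd> Cod M c"
    using pO Cd(1-3) iA by simp_all
  note Kp = M.is_kernelD[OF act_kernel[OF rp kc]]
  obtain s where s: "s \<in> Arr M" "Dom M s = p \<rhd> Cod M c" "Cod M s = ?y" "?c \<bullet> s = Id M (p \<rhd> Cod M c)"
    by (rule M.projective_lift[OF act_projective[OF p] act_epi[OF lp Cd(5)], of "Cod M c" "Id M (p \<rhd> Cod M c)"])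
      (use t pO Cd(2) in simp_all)
  let ?d = "M.hsub (Id M ?y) (s \<bullet> ?c)"
  have yO: "?y \<in> Ob M" using pO iA by simp
  have d: "?d \<in> Arr M" "Dom M ?d = ?y" "Cod M ?d = ?y" using t s(1-3) yO by simp_all
  have "?c \<bullet> s \<bullet> ?c = (?c \<bullet> s) \<bullet> ?c" using t s(1-3) by simp
  then have csc: "?c \<bullet> s \<bullet> ?c = ?c" unfolding s(4) using t by simp
  have "?c \<bullet> ?d = M.hsub (?c \<bullet> Id M ?y) (?c \<bullet> s \<bullet> ?c)"
    by (rule M.comp_hsub_right) (use t s(1-3) yO in simp_all)
  also have "\<dots> = HZero M (Dom M ?d) (Cod M ?c)"
    unfolding csc using M.hsub_facts(1)[of ?c ?c] t d by simp
  finally obtain r where r: "r \<in> Arr M" "Dom M r = ?y" "Cod M r = p \<rhd> Dom M i" "?i \<bullet> r = ?d"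
    using Kp(6)[OF d(1)] d(2,3) t by (auto simp: Hom_iff)
  have "?d \<bullet> ?i = M.hsub (Id M ?y \<bullet> ?i) ((s \<bullet> ?c) \<bullet> ?i)"
    by (rule M.comp_hsub_left) (use t s(1-3) yO in simp_all)
  also have "(s \<bullet> ?c) \<bullet> ?i = HZero M (Dom M ?i) ?y" using t s(1-3) Kp(4) pO iA Cd(2) by simp
  also have "M.hsub (Id M ?y \<bullet> ?i) (HZero M (Dom M ?i) ?y) = ?i"
    using M.hsub_facts(3)[of ?i "HZero M (Dom M ?i) ?y"] t yO pO iA by simp
  finally have di: "?d \<bullet> ?i = ?i" .
  have "?i \<bullet> (r \<bullet> ?i) = (?i \<bullet> r) \<bullet> ?i" using t r(1-3) by simp
  also have "\<dots> = ?i \<bullet> Id M (p \<rhd> Dom M i)" unfolding r(4) di using t by simp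
  finally have "r \<bullet> ?i = Id M (p \<rhd> Dom M i)"
    by (rule M.mono_cancel[OF Kp(5), rotated -1]) (use t r(1-3) pO iA in simp_all)
  then show thesis by (rule that[OF r(1-3)])
qed

text \<open>Arrows from \<open>PA\<close> to IHom(Dom i, n) are arrows from PA.(Dom i) to n, and
  these extend along PA.i by composing with the retraction of \<open>act_mono_split\<close>.\<close>

lemma ihm_mono_epi:
  assumes n: "n \<in> Ob M" and i: "is_epi (op_cat M) i"
  shows "is_epi A (ihm i (Id M n))"
proof (rule FA.epi_test)
  have iA: "i \<in> Arr M" using i by (simp add: is_epi_def)
  then show "ihm i (Id M n) \<in> Arr A" using n by simp
  obtain r where r: "r \<in> Arr M" "Dom M r = PA \<rhd> Cod M i" "Cod M r = PA \<rhd> Dom M i" "r \<bullet> (Id A PA \<unrhd> i) = Id M (PA \<rhd> Dom M i)"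
    by (rule act_mono_split[OF FA.P_projective i])
  show "\<forall>u\<in>Hom A PA (Cod A (ihm i (Id M n))). \<exists>v\<in>Hom A PA (Dom A (ihm i (Id M n))). ihm i (Id M n) \<bullet>\<^bsub>A\<^esub> v = u"
  proof
    fix u assume "u \<in> Hom A PA (Cod A (ihm i (Id M n)))"
    then have u: "u \<in> Arr A" "Dom A u = PA" "Cod A u = ih (Dom M i) n" using n iA by (simp_all add: Hom_iff)
    let ?u = "ev (Dom M i) n \<bullet> (u \<unrhd> Id M (Dom M i))"
    have uA: "?u \<in> Arr M" "Dom M ?u = PA \<rhd> Dom M i" "Cod M ?u = n" using u n iA by simp_all
    obtain v where v: "v \<in> Arr A" "Dom A v = PA" "Cod A v = ih (Cod M i) n"
      "ev (Cod M i) n \<bullet> (v \<unrhd> Id M (Cod M i)) = ?u \<bullet> r"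
      by (rule ev_surj[of "Cod M i" n PA "?u \<bullet> r"]) (use r(1-3) uA n iA in simp_all)
    have "ev (Dom M i) n \<bullet> ((ihm i (Id M n) \<bullet>\<^bsub>A\<^esub> v) \<unrhd> Id M (Dom M i))
       = (ev (Cod M i) n \<bullet> (v \<unrhd> Id M (Cod M i))) \<bullet> (Id A PA \<unrhd> i)"
      using ihm_nat_ev'[OF iA n v(1,3)] v(1-3) n iA by simp
    also have "\<dots> = ?u \<bullet> (r \<bullet> (Id A PA \<unrhd> i))" unfolding v(4) using r(1-3) uA n iA u by simp
    also have "\<dots> = ?u" unfolding r(4) using uA u n iA by simp
    finally have "ihm i (Id M n) \<bullet>\<^bsub>A\<^esub> v = u"
      by (intro ev_inj[of "Dom M i" n]) (use v(1-3) u n iA in simp_all)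
    then show "\<exists>v\<in>Hom A PA (Dom A (ihm i (Id M n))). ihm i (Id M n) \<bullet>\<^bsub>A\<^esub> v = u"
      using v(1-3) n iA by (intro bexI[of _ v]) (simp_all add: Hom_iff)
  qed
qed

text \<open>Acting with any object a preserves cokernels, since a has a left dual, and Hom(a,
  IHom(-, n)) = Hom(a.-, n) turns them into kernels.\<close>

lemma ihm_cokernel_kernel:
  assumes n: "n \<in> Ob M" and c: "is_cokernel M i c"
  shows "is_kernel A (ihm i (Id M n)) (ihm c (Id M n))"
proof (rule A.is_kernelI)
  note Cd = M.is_cokernelD[OF c]
  show "ihm i (Id M n) \<in> Arr A" "Cod A (ihm c (Id M n)) = Dom A (ihm i (Id M n))" using Cd(1-3) n by simp_all
  show "ihm i (Id M n) \<bullet>\<^bsub>A\<^esub> ihm c (Id M n) = HZero A (Dom A (ihm c (Id M n))) (Cod A (ihm i (Id M n)))"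
    using ihm_comp[of c i "Id M n" "Id M n"] Cd(1-4) n by (simp add: ihm_zero)
  have dual: "is_cokernel M (Id A a \<unrhd> i) (Id A a \<unrhd> c)" if "a \<in> Ob A" for a
    using left_dual_ex[OF that] act_cokernel[OF _ c] by blast
  show "is_epi (op_cat A) (ihm c (Id M n))"
    unfolding A.is_mono_iff
  proof (intro conjI ballI impI)
    show "ihm c (Id M n) \<in> Arr A" using Cd(2) n by simp
    fix g assume g: "g \<in> Arr A" "Cod A g = Dom A (ihm c (Id M n))" "ihm c (Id M n) \<bullet>\<^bsub>A\<^esub> g = HZero A (Dom A g) (Cod A (ihm c (Id M n)))"
    let ?g = "ev (Cod M c) n \<bullet> (g \<unrhd> Id M (Cod M c))"
    have g2: "Cod A g = ih (Cod M c) n" using g(2) Cd(2) n by simp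
    have gA: "?g \<in> Arr M" "Dom M ?g = Dom A g \<rhd> Cod M c" "Cod M ?g = n" using g(1) g2 Cd(2) n by simp_all
    have "?g \<bullet> (Id A (Dom A g) \<unrhd> c) = ev (Dom M c) n \<bullet> (HZero A (Dom A g) (ih (Dom M c) n) \<unrhd> Id M (Dom M c))"
      using ihm_nat_ev'[OF Cd(2) n g(1) g2] g(1) g2 g(3) Cd(2) n by simp
    also have "\<dots> = HZero M (Dom M (Id A (Dom A g) \<unrhd> c)) (Cod M ?g)" using g(1) g2 Cd(2) n by (simp add: act_add)
    finally have "?g = HZero M (Dom A g \<rhd> Cod M c) n"
      using M.epi_zeroD[OF M.is_cokernelD(5)[OF dual[of "Dom A g"]] gA(1)] gA g(1) Cd(2) by simp
    then show "g = HZero A (Dom A g) (Dom A (ihm c (Id M n)))"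
      using ev_zero_iff[OF _ n g(1) g2] Cd(2) n by simp
  qed
  fix h assume h: "h \<in> Arr A" "Cod A h = Dom A (ihm i (Id M n))" "ihm i (Id M n) \<bullet>\<^bsub>A\<^esub> h = HZero A (Dom A h) (Cod A (ihm i (Id M n)))"
  let ?h = "ev (Cod M i) n \<bullet> (h \<unrhd> Id M (Cod M i))"
  have h2: "Cod A h = ih (Cod M i) n" using h(2) Cd(1) n by simp
  have hA: "?h \<in> Arr M" "Dom M ?h = Dom A h \<rhd> Cod M i" "Cod M ?h = n" using h(1) h2 Cd(1) n by simp_all
  have aO: "Dom A h \<in> Ob A" using h(1) by simp
  note Da = M.is_cokernelD[OF dual[OF aO]]
  have "?h \<bullet> (Id A (Dom A h) \<unrhd> i) = ev (Dom M i) n \<bullet> (HZero A (Dom A h) (ih (Dom M i) n) \<unrhd> Id M (Dom M i))"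
    using ihm_nat_ev'[OF Cd(1) n h(1) h2] h(1) h2 h(3) Cd(1) n by simp
  also have "\<dots> = HZero M (Dom M (Id A (Dom A h) \<unrhd> i)) (Cod M ?h)" using h(1) h2 Cd(1) n by (simp add: act_add)
  finally obtain w where w: "w \<in> Arr M" "Dom M w = Dom A h \<rhd> Cod M c" "Cod M w = n" "w \<bullet> (Id A (Dom A h) \<unrhd> c) = ?h"
    using Da(6)[OF hA(1)] hA aO Cd(1,2) by (auto simp: Hom_iff)
  obtain v where v: "v \<in> Arr A" "Dom A v = Dom A h" "Cod A v = ih (Cod M c) n" "ev (Cod M c) n \<bullet> (v \<unrhd> Id M (Cod M c)) = w"
    by (rule ev_surj[of "Cod M c" n "Dom A h" w]) (use w(1-3) h(1) n Cd(2) in simp_all)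
  have "ev (Dom M c) n \<bullet> ((ihm c (Id M n) \<bullet>\<^bsub>A\<^esub> v) \<unrhd> Id M (Dom M c)) = (ev (Cod M c) n \<bullet> (v \<unrhd> Id M (Cod M c))) \<bullet> (Id A (Dom A h) \<unrhd> c)"
    using ihm_nat_ev'[OF Cd(2) n v(1,3)] v(1-3) n Cd(2) aO by simp
  then have "ev (Cod M i) n \<bullet> ((ihm c (Id M n) \<bullet>\<^bsub>A\<^esub> v) \<unrhd> Id M (Cod M i)) = ?h" unfolding v(4) w(4) Cd(3) .
  then have "ihm c (Id M n) \<bullet>\<^bsub>A\<^esub> v = h"
    by (intro ev_inj[of "Cod M i" n]) (use v(1-3) h(1) h2 n Cd(1-3) in simp_all)
  then show "\<exists>u. u \<in> Hom A (Dom A h) (Dom A (ihm c (Id M n))) \<and> ihm c (Id M n) \<bullet>\<^bsub>A\<^esub> u = h"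
    using v(1-3) n Cd(2) by (intro exI[of _ v]) (simp add: Hom_iff)
qed

subsection \<open>The projective generator of an exact module category is an injective cogenerator\<close>

lemma act_left_exact: "short_exact A k q \<Longrightarrow> m \<in> Ob M \<Longrightarrow> short_exact M (k \<unrhd> Id M m) (q \<unrhd> Id M m)"
  using F.act_exact[of m] unfolding exact_functor_def by auto

text \<open>An epimorphism is completed to a short exact sequence, which the action preserves by
  exactness in its first argument.\<close>

lemma act_left_epi:
  assumes "is_epi A e" "m \<in> Ob M" shows "is_epi M (e \<unrhd> Id M m)"
proof -
  obtain k where "short_exact A k e" by (rule FA.epi_short_exact[OF assms(1)])
  from act_left_exact[OF this assms(2)] have "is_cokernel M (k \<unrhd> Id M m) (e \<unrhd> Id M m)" by (simp add: short_exact_def)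
  then show ?thesis by (rule M.is_cokernelD(5))
qed

lemma act_left_mono:
  assumes "is_epi (op_cat A) e" "m \<in> Ob M" shows "is_epi (op_cat M) (e \<unrhd> Id M m)"
proof -
  obtain k where "short_exact A e k" by (rule FA.mono_short_exact[OF assms(1)])
  from act_left_exact[OF this assms(2)] have "is_kernel M (k \<unrhd> Id M m) (e \<unrhd> Id M m)" by (simp add: short_exact_def)
  then show ?thesis by (rule M.is_kernelD(5))
qed

lemma unit_cover:
  obtains p w where "projective A p" "w \<in> Arr A" "Dom A w = p" "Cod A w = Unit A" "is_epi A w"
proof -
  obtain p w where "sum_of A PA p" "w \<in> Hom A p (Unit A)" "is_epi A w" by (rule FA.projective_cover[OF A.unit_Ob])
  then show thesis using that[of p w] FA.sum_of_projective by (simp add: Hom_iff)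
qed

text \<open>For p projective with an epimorphism onto 1 and left dual lp, PM is a retract of
  p.(lp.PM). To extend an arrow into the latter along i, take mates twice: it becomes an arrow from
  p.(rp.(Dom i)) to PM, which extends because p.(rp.i) is a split monomorphism.\<close>

lemma PM_injective: "projective (op_cat M) PM"
  unfolding projective_def
proof (intro conjI allI impI ballI)
  show "PM \<in> Ob (op_cat M)" by simp
  fix i f assume i: "is_epi (op_cat M) i" and "f \<in> Hom (op_cat M) PM (Cod (op_cat M) i)"
  then have f: "f \<in> Arr M" "Dom M f = Dom M i" "Cod M f = PM" by (simp_all add: Hom_iff)
  have iA: "i \<in> Arr M" using i by (simp add: is_epi_def)
  obtain p w where p: "projective A p" and w: "w \<in> Arr A" "Dom A w = p" "Cod A w = Unit A" "is_epi A w" by (rule unit_cover)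
  have pO: "p \<in> Ob A" using p by (simp add: projective_def)
  obtain lp el cl where lp: "is_right_dual A lp p el cl" using left_dual_ex[OF pO] by blast
  obtain rp er cr where rp: "is_right_dual A p rp er cr" using right_dual_ex[OF pO] by blast
  note L = A.right_dualD(1-8)[OF lp] and Rd = A.right_dualD(1-8)[OF rp]
  \<comment> \<open>A right dual of rp ensures that acting with rp preserves monomorphisms.\<close>
  obtain rr e' c' where rr: "is_right_dual A rp rr e' c'" using right_dual_ex[OF Rd(2)] by blast
  have h: "w \<bullet>\<^bsub>A\<^esub> RUnit A p \<in> Arr A" "Dom A (w \<bullet>\<^bsub>A\<^esub> RUnit A p) = p \<boxtimes>\<^bsub>A\<^esub> Unit A" "Cod A (w \<bullet>\<^bsub>A\<^esub> RUnit A p) = Unit A" using w pO by simp_all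
  \<comment> \<open>The arrow that the pairing with el sends to w, up to the unit constraint. Thus
    an epimorphism factors as el after another arrow, which forces el : p \<otimes> lp -> 1 to be
    epi.\<close>
  obtain t where t: "t \<in> Arr A" "Dom A t = Unit A" "Cod A t = lp" "el \<bullet>\<^bsub>A\<^esub> (Id A p \<boxdot>\<^bsub>A\<^esub> t) = w \<bullet>\<^bsub>A\<^esub> RUnit A p"
    using A.pairing_surj[OF lp h A.unit_Ob] by blast
  have "is_epi A (w \<bullet>\<^bsub>A\<^esub> RUnit A p)"
    by (rule A.epi_comp[OF A.is_iso_epi w(4)]) (use w pO in simp_all)
  then have el: "is_epi A el" unfolding t(4)[symmetric] by (rule A.epi_of_comp) (use L t in simp_all)
  let ?z = "lp \<rhd> PM"
  let ?rho = "counit lp p el PM"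
  note rho = counit_arr(1-3)[OF lp FM.P_Ob]
  have zO: "?z \<in> Ob M" using L by simp
  have "is_epi M ?rho" unfolding counit_def
    by (intro M.epi_comp act_left_epi el M.is_iso_epi) (use L in simp_all)
  then obtain s where s: "s \<in> Arr M" "Dom M s = PM" "Cod M s = p \<rhd> ?z" "?rho \<bullet> s = Id M PM"
    by (rule M.projective_lift[OF FM.P_projective, of _ "Id M PM"]) (use rho in simp_all)
  let ?f1 = "mate p rp er ?z (s \<bullet> f)"
  have sf: "s \<bullet> f \<in> Arr M" "Dom M (s \<bullet> f) = Dom M i" "Cod M (s \<bullet> f) = p \<rhd> ?z" using s(1-3) f by simp_all
  have f1: "?f1 \<in> Arr M" "Dom M ?f1 = rp \<rhd> Dom M i" "Cod M ?f1 = ?z"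
    using mate_in_Hom[OF rp sf(1,3) zO] sf(2) by simp_all
  let ?f2 = "mate lp p el PM ?f1"
  have f2: "?f2 \<in> Arr M" "Dom M ?f2 = p \<rhd> (rp \<rhd> Dom M i)" "Cod M ?f2 = PM"
    using mate_in_Hom[OF lp f1(1,3) FM.P_Ob] f1(2) by simp_all
  let ?i1 = "Id A rp \<unrhd> i"
  have i1: "?i1 \<in> Arr M" "Dom M ?i1 = rp \<rhd> Dom M i" "Cod M ?i1 = rp \<rhd> Cod M i" using Rd iA by simp_all
  obtain r where r: "r \<in> Arr M" "Dom M r = p \<rhd> (rp \<rhd> Cod M i)" "Cod M r = p \<rhd> (rp \<rhd> Dom M i)"
    "r \<bullet> (Id A p \<unrhd> ?i1) = Id M (p \<rhd> (rp \<rhd> Dom M i))"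
    using act_mono_split[OF p act_mono[OF rr i]] i1(2,3) by metis
  have g2: "?f2 \<bullet> r \<in> Arr M" "Dom M (?f2 \<bullet> r) = p \<rhd> (rp \<rhd> Cod M i)" "Cod M (?f2 \<bullet> r) = PM" using f2 r(1-3) by simp_all
  have yO: "rp \<rhd> Cod M i \<in> Ob M" "Cod M i \<in> Ob M" using Rd iA by simp_all
  \<comment> \<open>The extension of the double mate is carried back through both bijections,
    yielding g with g i = s f.\<close>
  obtain g1 where g1: "g1 \<in> Arr M" "Dom M g1 = rp \<rhd> Cod M i" "Cod M g1 = lp \<rhd> Cod M (?f2 \<bullet> r)" "mate lp p el (Cod M (?f2 \<bullet> r)) g1 = ?f2 \<bullet> r"
    by (rule mate_surj[OF lp g2(1,2) yO(1)])
  have g1c: "Cod M g1 = ?z" and g1m: "mate lp p el PM g1 = ?f2 \<bullet> r" using g1(3,4) unfolding g2(3) by simp_all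
  obtain g where g: "g \<in> Arr M" "Dom M g = Cod M i" "Cod M g = p \<rhd> Cod M g1" "mate p rp er (Cod M g1) g = g1"
    by (rule mate_surj[OF rp g1(1,2) yO(2)])
  have gc: "Cod M g = p \<rhd> ?z" and gm: "mate p rp er ?z g = g1" using g(3,4) unfolding g1c by simp_all
  have "mate lp p el PM (g1 \<bullet> ?i1) = (?f2 \<bullet> r) \<bullet> (Id A p \<unrhd> ?i1)"
    using mate_comp(1)[OF lp g1(1) g1c FM.P_Ob i1(1)] i1(3) g1(2) unfolding g1m by simp
  also have "\<dots> = ?f2 \<bullet> (r \<bullet> (Id A p \<unrhd> ?i1))" using f2 r(1-3) i1 pO by simp
  also have "\<dots> = ?f2" unfolding r(4) using f2 by simp
  finally have "g1 \<bullet> ?i1 = ?f1"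
    by (rule mate_inj[OF lp, rotated -1]) (use g1(1,2) g1c i1 f1 in simp_all)
  moreover have "mate p rp er ?z (g \<bullet> i) = g1 \<bullet> ?i1"
    using mate_comp(1)[OF rp g(1) gc zO iA] g(2) unfolding gm by simp
  ultimately have "mate p rp er ?z (g \<bullet> i) = ?f1" by simp
  then have gi: "g \<bullet> i = s \<bullet> f"
    by (rule mate_inj[OF rp, rotated -1]) (use g(1,2) gc iA sf zO in simp_all)
  have "(?rho \<bullet> g) \<bullet> i = (?rho \<bullet> s) \<bullet> f" using gi g(1,2) gc iA rho s(1-3) f by simp
  then have "(?rho \<bullet> g) \<bullet> i = f" unfolding s(4) using f by simp
  then show "\<exists>g\<in>Hom (op_cat M) PM (Dom (op_cat M) i). i \<bullet>\<^bsub>op_cat M\<^esub> g = f"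
    using g(1,2) gc rho by (intro bexI[of _ "?rho \<bullet> g"]) (simp_all add: Hom_iff)
qed

text \<open>Suppose every arrow from the target y of g to PM kills g. The unit eta : y -> p.(rp.y)
  lands in a projective object, hence in a summand of a finite sum of copies of PM, so eta g = 0
  and, by mates, rp.g = 0. As 1 embeds in rp, the object 1.y embeds in rp.y, and g = 0
  follows.\<close>

lemma PM_cogenerator: "faithful_ob (op_cat M) PM"
  unfolding faithful_ob_def
proof (intro conjI ballI impI)
  show "PM \<in> Ob (op_cat M)" by simp
  fix g assume "g \<in> Arr (op_cat M)"
    and "\<forall>u\<in>Hom (op_cat M) PM (Dom (op_cat M) g). g \<bullet>\<^bsub>op_cat M\<^esub> u = HZero (op_cat M) PM (Cod (op_cat M) g)"
  then have g: "g \<in> Arr M" and gz: "\<forall>u\<in>Hom M (Cod M g) PM. u \<bullet> g = HZero M (Dom M g) PM" by simp_all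
  let ?y = "Cod M g"
  have yO: "?y \<in> Ob M" using g by simp
  obtain p w where p: "projective A p" and w: "w \<in> Arr A" "Dom A w = p" "Cod A w = Unit A" "is_epi A w" by (rule unit_cover)
  have pO: "p \<in> Ob A" using p by (simp add: projective_def)
  obtain rp er cr where rp: "is_right_dual A p rp er cr" using right_dual_ex[OF pO] by blast
  note Rd = A.right_dualD(1-8)[OF rp]
  obtain t where t: "t \<in> Arr A" "Dom A t = Unit A" "Cod A t = rp" "er \<bullet>\<^bsub>A\<^esub> (t \<boxdot>\<^bsub>A\<^esub> Id A p) = w \<bullet>\<^bsub>A\<^esub> LUnit A p"
    by (rule A.rpairing_surj[OF rp, of "w \<bullet>\<^bsub>A\<^esub> LUnit A p" "Unit A"]) (use w pO in simp_all)
  \<comment> \<open>Up to a unit constraint, u \<otimes> w is the arrow paired to t u. If t u = 0,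
    then (u \<otimes> 1) (x \<otimes> w) = 0; tensoring with x keeps w epi, so u \<otimes> 1 = 0 and
    u = 0.\<close>
  have tm: "is_epi (op_cat A) t"
    unfolding A.is_mono_iff
  proof (intro conjI ballI impI)
    fix u assume u: "u \<in> Arr A" "Cod A u = Dom A t" "t \<bullet>\<^bsub>A\<^esub> u = HZero A (Dom A u) (Cod A t)"
    let ?x = "Dom A u" and ?I = "Unit A"
    have xO: "?x \<in> Ob A" using u by simp
    have uI: "Cod A u = ?I" using u(2) t(2) by simp
    obtain lx ex cx where lx: "is_right_dual A lx ?x ex cx" using left_dual_ex[OF xO] by blast
    have we: "is_epi A (Id A ?x \<boxdot>\<^bsub>A\<^esub> w)" using R.act_epi[OF lx, of w] w(4) by simp
    have z: "HZero A ?x rp \<boxdot>\<^bsub>A\<^esub> Id A p = HZero A (?x \<boxtimes>\<^bsub>A\<^esub> p) (rp \<boxtimes>\<^bsub>A\<^esub> p)"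
      using R.act_add(5)[of p ?x rp] Rd xO by simp
    have "LUnit A ?I \<bullet>\<^bsub>A\<^esub> ((u \<boxdot>\<^bsub>A\<^esub> Id A ?I) \<bullet>\<^bsub>A\<^esub> (Id A ?x \<boxdot>\<^bsub>A\<^esub> w)) = (LUnit A ?I \<bullet>\<^bsub>A\<^esub> (Id A ?I \<boxdot>\<^bsub>A\<^esub> w)) \<bullet>\<^bsub>A\<^esub> (u \<boxdot>\<^bsub>A\<^esub> Id A p)"
      using R.act_exchange[of u w ?x p ?I ?I] w u(1) uI pO xO by simp
    also have "LUnit A ?I \<bullet>\<^bsub>A\<^esub> (Id A ?I \<boxdot>\<^bsub>A\<^esub> w) = er \<bullet>\<^bsub>A\<^esub> (t \<boxdot>\<^bsub>A\<^esub> Id A p)"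
      using A.lunit_nat[of w] w t(4) by simp
    also have "(er \<bullet>\<^bsub>A\<^esub> (t \<boxdot>\<^bsub>A\<^esub> Id A p)) \<bullet>\<^bsub>A\<^esub> (u \<boxdot>\<^bsub>A\<^esub> Id A p) = er \<bullet>\<^bsub>A\<^esub> ((t \<bullet>\<^bsub>A\<^esub> u) \<boxdot>\<^bsub>A\<^esub> Id A p)"
      using R.whisker_right[of p u t] Rd t(1-3) u(1) uI pO by simp
    also have "\<dots> = HZero A (?x \<boxtimes>\<^bsub>A\<^esub> p) ?I" unfolding u(3) t(3) z using Rd xO by simp
    finally have "LUnit A ?I \<bullet>\<^bsub>A\<^esub> ((u \<boxdot>\<^bsub>A\<^esub> Id A ?I) \<bullet>\<^bsub>A\<^esub> (Id A ?x \<boxdot>\<^bsub>A\<^esub> w)) = LUnit A ?I \<bullet>\<^bsub>A\<^esub> HZero A (?x \<boxtimes>\<^bsub>A\<^esub> p) (?I \<boxtimes>\<^bsub>A\<^esub> ?I)"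
      using xO pO by simp
    then have "(u \<boxdot>\<^bsub>A\<^esub> Id A ?I) \<bullet>\<^bsub>A\<^esub> (Id A ?x \<boxdot>\<^bsub>A\<^esub> w) = HZero A (?x \<boxtimes>\<^bsub>A\<^esub> p) (?I \<boxtimes>\<^bsub>A\<^esub> ?I)"
      by (rule A.iso_cancel_left[rotated -1, of "LUnit A ?I"]) (use u(1) uI w pO xO in simp_all)
    then have "u \<boxdot>\<^bsub>A\<^esub> Id A ?I = HZero A (?x \<boxtimes>\<^bsub>A\<^esub> ?I) (?I \<boxtimes>\<^bsub>A\<^esub> ?I)"
      using A.epi_zeroD[OF we, of "u \<boxdot>\<^bsub>A\<^esub> Id A ?I"] u(1) uI w xO by simp
    then have "u \<bullet>\<^bsub>A\<^esub> RUnit A ?x = HZero A ?x ?I \<bullet>\<^bsub>A\<^esub> RUnit A ?x"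
      using A.runit_nat[OF u(1)] uI xO by simp
    then have "u = HZero A ?x ?I"
      by (rule A.iso_cancel_right[rotated -1, of _ "RUnit A ?x"]) (use u(1) uI xO in simp_all)
    then show "u = HZero A (Dom A u) (Dom A t)" using t(2) by simp
  qed (rule t(1))
  let ?eta = "counit_unit p rp cr ?y"
  note eta = counit_arr(4-6)[OF rp yO]
  let ?q = "p \<rhd> (rp \<rhd> ?y)"
  have qP: "projective M ?q" by (rule act_projective[OF p]) (use Rd yO in simp)
  have qO: "?q \<in> Ob M" "rp \<rhd> ?y \<in> Ob M" using Rd yO by simp_all
  \<comment> \<open>The cover of the projective object p.(rp.y) splits, which exhibits it as a
    summand of a finite sum of copies of PM.\<close>
  obtain p1 w1 where p1: "sum_of M PM p1" "w1 \<in> Hom M p1 ?q" "is_epi M w1" by (rule FM.projective_cover[OF qO(1)])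
  have w1: "w1 \<in> Arr M" "Dom M w1 = p1" "Cod M w1 = ?q" using HomD[OF p1(2)] .
  obtain s where s: "s \<in> Arr M" "Dom M s = ?q" "Cod M s = Dom M w1" "w1 \<bullet> s = Id M ?q"
    by (rule M.projective_lift[OF qP p1(3), of "Id M ?q"]) (use w1 qO in simp_all)
  have "(s \<bullet> ?eta) \<bullet> g = HZero M (Dom M g) p1"
    using FM.sum_of_zero_test[OF p1(1) g gz, THEN bspec, of "s \<bullet> ?eta"] s(1-3) eta w1 by (simp add: Hom_iff)
  then have "w1 \<bullet> (s \<bullet> ?eta) \<bullet> g = w1 \<bullet> HZero M (Dom M g) p1" by simp
  moreover have "w1 \<bullet> (s \<bullet> ?eta) \<bullet> g = (w1 \<bullet> s) \<bullet> ?eta \<bullet> g" using s(1-3) w1 eta g by simp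
  ultimately have "(w1 \<bullet> s) \<bullet> ?eta \<bullet> g = HZero M (Dom M g) ?q" using w1 g by simp
  then have etag: "?eta \<bullet> g = HZero M (Dom M g) ?q" unfolding s(4) using eta g by simp
  \<comment> \<open>The mate of the unit is the identity, so the mate of eta g is rp.g.\<close>
  have "mate p rp er (rp \<rhd> ?y) ?eta = Id M (rp \<rhd> ?y)"
    using mate_inverse(2)[OF rp, of "Id M (rp \<rhd> ?y)" ?y] eta qO yO pO by simp
  then have "Id A rp \<unrhd> g = mate p rp er (rp \<rhd> ?y) (?eta \<bullet> g)"
    using mate_comp(1)[OF rp eta(1,3) qO(2) g] eta(2) g Rd by simp
  also have "\<dots> = HZero M (rp \<rhd> Dom M g) (rp \<rhd> ?y)"
    unfolding etag by (rule mate_zero[OF rp]) (use g qO in simp_all)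
  finally have rg: "Id A rp \<unrhd> g = HZero M (rp \<rhd> Dom M g) (rp \<rhd> ?y)" .
  have "(t \<unrhd> Id M ?y) \<bullet> (Id A (Unit A) \<unrhd> g) = (Id A rp \<unrhd> g) \<bullet> (t \<unrhd> Id M (Dom M g))"
    by (rule act_exchange) (use t g in simp_all)
  also have "\<dots> = HZero M (Unit A \<rhd> Dom M g) (rp \<rhd> ?y)" unfolding rg using t g Rd by simp
  finally have z: "Id A (Unit A) \<unrhd> g = HZero M (Unit A \<rhd> Dom M g) (Unit A \<rhd> ?y)"
    using act_left_mono[OF tm yO, unfolded M.is_mono_iff, THEN conjunct2, THEN bspec, of "Id A (Unit A) \<unrhd> g"] t g by simp
  have "g = HZero M (Dom M g) ?y" by (rule unit_act_cancel[OF g]) (use g z in simp_all)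
  then show "g = HZero (op_cat M) (Dom (op_cat M) g) (Cod (op_cat M) g)" by simp
qed

text \<open>\<open>right_adjoint_ob\<close> on the opposite of \<open>M\<close>, with PM as
  projective generator by the two preceding lemmas. A short exact sequence there is one of
  \<open>M\<close> read backwards.\<close>

lemma left_Serre_ob:
  assumes n: "n \<in> Ob M"
  shows "\<exists>r e. r \<in> Ob M \<and> e \<in> Hom A (ih r n) (Unit A) \<and>
    (\<forall>x\<in>Ob M. \<forall>y\<in>Hom A (ih x n) (Unit A). \<exists>!u. u \<in> Hom M r x \<and> e \<bullet>\<^bsub>A\<^esub> ihm u (Id M n) = y)"
proof -
  interpret O: fin_cat K "op_cat M" PM
    by (intro fin_cat.intro FM.fin_ab_op fin_cat_axioms.intro) (simp add: proj_gen_def PM_injective PM_cogenerator)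
  have "is_cokernel A (amap \<lparr>omap = (\<lambda>m. ih m n), amap = (\<lambda>g. ihm g (Id M n))\<rparr> k)
      (amap \<lparr>omap = (\<lambda>m. ih m n), amap = (\<lambda>g. ihm g (Id M n))\<rparr> q)" if "short_exact (op_cat M) k q" for k q
  proof -
    have 1: "is_kernel M k q" and 2: "is_cokernel M q k" using that by (simp_all add: short_exact_def)
    show ?thesis using FA.kernel_epi_cokernel[OF ihm_cokernel_kernel[OF n 2] ihm_mono_epi[OF n M.is_kernelD(5)[OF 1]]] by simp
  qed
  from O.right_adjoint_ob[OF A.linear_category_axioms ihm_linear(2)[OF n] A.unit_Ob FA.hom_noetherian[OF _ A.unit_Ob] this]
  show ?thesis by simp
qed

end

section \<open>Relative Serre functors of an exact module category\<close>

context exact_action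
begin

lemma ihm_add:
  "\<lbrakk>m \<in> Ob M; h \<in> Arr M; h' \<in> Arr M; Dom M h = Dom M h'; Cod M h = Cod M h'\<rbrakk>
    \<Longrightarrow> ihm (Id M m) (HAdd M h h') = HAdd A (ihm (Id M m) h) (ihm (Id M m) h')"
  "\<lbrakk>m \<in> Ob M; h \<in> Arr M; c \<in> carrier K\<rbrakk> \<Longrightarrow> ihm (Id M m) (HSmult M c h) = HSmult A c (ihm (Id M m) h)"
  "\<lbrakk>n \<in> Ob M; h \<in> Arr M; h' \<in> Arr M; Dom M h = Dom M h'; Cod M h = Cod M h'\<rbrakk>
    \<Longrightarrow> ihm (HAdd M h h') (Id M n) = HAdd A (ihm h (Id M n)) (ihm h' (Id M n))"
  "\<lbrakk>n \<in> Ob M; h \<in> Arr M; c \<in> carrier K\<rbrakk> \<Longrightarrow> ihm (HSmult M c h) (Id M n) = HSmult A c (ihm h (Id M n))"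
  using linear_functorD(9,10)[OF M.linear_category_axioms A.linear_category_axioms ihm_linear(1), of m]
    linear_functorD(9,10)[OF M.linear_category_op A.linear_category_axioms ihm_linear(2), of n] by simp_all

subsection \<open>The right relative Serre functor\<close>

text \<open>A representing object with its universal functional: \<open>tr m\<close> is a trace
  IHom(m, Sr m) -> 1 through which every functional on IHom(m, x) factors by a unique arrow x -> Sr
  m.\<close>

definition "right_rep m = (SOME re. fst re \<in> Ob M \<and> snd re \<in> Hom A (ih m (fst re)) (Unit A) \<and>
    (\<forall>x\<in>Ob M. \<forall>y\<in>Hom A (ih m x) (Unit A). \<exists>!u. u \<in> Hom M x (fst re) \<and> snd re \<bullet>\<^bsub>A\<^esub> ihm (Id M m) u = y))"
definition "Sr m = fst (right_rep m)"
definition "tr m = snd (right_rep m)"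

lemma right_rep:
  assumes "m \<in> Ob M"
  shows "Sr m \<in> Ob M \<and> tr m \<in> Hom A (ih m (Sr m)) (Unit A) \<and>
    (\<forall>x\<in>Ob M. \<forall>y\<in>Hom A (ih m x) (Unit A). \<exists>!u. u \<in> Hom M x (Sr m) \<and> tr m \<bullet>\<^bsub>A\<^esub> ihm (Id M m) u = y)"
proof -
  obtain r e where "r \<in> Ob M \<and> e \<in> Hom A (ih m r) (Unit A) \<and>
    (\<forall>x\<in>Ob M. \<forall>y\<in>Hom A (ih m x) (Unit A). \<exists>!u. u \<in> Hom M x r \<and> e \<bullet>\<^bsub>A\<^esub> ihm (Id M m) u = y)"
    using right_Serre_ob[OF assms] by blast
  then have "\<exists>re. fst re \<in> Ob M \<and> snd re \<in> Hom A (ih m (fst re)) (Unit A) \<and>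
    (\<forall>x\<in>Ob M. \<forall>y\<in>Hom A (ih m x) (Unit A). \<exists>!u. u \<in> Hom M x (fst re) \<and> snd re \<bullet>\<^bsub>A\<^esub> ihm (Id M m) u = y)"
    by (intro exI[of _ "(r, e)"]) simp
  from someI_ex[OF this] show ?thesis unfolding Sr_def tr_def right_rep_def .
qed

lemma Sr_simps [simp]:
  assumes "m \<in> Ob M"
  shows "Sr m \<in> Ob M" "tr m \<in> Arr A" "Dom A (tr m) = ih m (Sr m)" "Cod A (tr m) = Unit A"
  using right_rep[OF assms] unfolding Hom_iff by blast+

lemma tr_ex:
  assumes "m \<in> Ob M" "x \<in> Ob M" "y \<in> Arr A" "Dom A y = ih m x" "Cod A y = Unit A"
  shows "\<exists>u. u \<in> Hom M x (Sr m) \<and> tr m \<bullet>\<^bsub>A\<^esub> ihm (Id M m) u = y"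
proof -
  have "y \<in> Hom A (ih m x) (Unit A)" using assms by (simp add: Hom_iff)
  then show ?thesis using right_rep[OF assms(1)] assms(2) by blast
qed

lemma tr_inj:
  assumes "m \<in> Ob M" "u \<in> Arr M" "u' \<in> Arr M" "Dom M u = Dom M u'" "Cod M u = Sr m" "Cod M u' = Sr m"
    "tr m \<bullet>\<^bsub>A\<^esub> ihm (Id M m) u = tr m \<bullet>\<^bsub>A\<^esub> ihm (Id M m) u'"
  shows "u = u'"
proof -
  have "tr m \<bullet>\<^bsub>A\<^esub> ihm (Id M m) u' \<in> Hom A (ih m (Dom M u')) (Unit A)" using assms by (simp add: Hom_iff)
  moreover have "Dom M u' \<in> Ob M" using assms by simp
  ultimately have "\<exists>!v. v \<in> Hom M (Dom M u') (Sr m) \<and> tr m \<bullet>\<^bsub>A\<^esub> ihm (Id M m) v = tr m \<bullet>\<^bsub>A\<^esub> ihm (Id M m) u'"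
    using right_rep[OF assms(1)] by blast
  moreover have "u \<in> Hom M (Dom M u') (Sr m)" "u' \<in> Hom M (Dom M u') (Sr m)" using assms by (simp_all add: Hom_iff)
  ultimately show ?thesis using assms(7) by blast
qed

text \<open>Forced by the requirement that the traces \<open>tr\<close> be dinatural in m.\<close>

definition "Srm g = (SOME u. u \<in> Hom M (Sr (Dom M g)) (Sr (Cod M g)) \<and>
   tr (Cod M g) \<bullet>\<^bsub>A\<^esub> ihm (Id M (Cod M g)) u = tr (Dom M g) \<bullet>\<^bsub>A\<^esub> ihm g (Id M (Sr (Dom M g))))"

lemma Srm:
  assumes "g \<in> Arr M"
  shows "Srm g \<in> Arr M" "Dom M (Srm g) = Sr (Dom M g)" "Cod M (Srm g) = Sr (Cod M g)"
   "tr (Cod M g) \<bullet>\<^bsub>A\<^esub> ihm (Id M (Cod M g)) (Srm g) = tr (Dom M g) \<bullet>\<^bsub>A\<^esub> ihm g (Id M (Sr (Dom M g)))"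
proof -
  have "\<exists>u. u \<in> Hom M (Sr (Dom M g)) (Sr (Cod M g)) \<and>
   tr (Cod M g) \<bullet>\<^bsub>A\<^esub> ihm (Id M (Cod M g)) u = tr (Dom M g) \<bullet>\<^bsub>A\<^esub> ihm g (Id M (Sr (Dom M g)))"
    by (rule tr_ex) (use assms in simp_all)
  from someI_ex[OF this, folded Srm_def]
  show "Srm g \<in> Arr M" "Dom M (Srm g) = Sr (Dom M g)" "Cod M (Srm g) = Sr (Cod M g)"
   "tr (Cod M g) \<bullet>\<^bsub>A\<^esub> ihm (Id M (Cod M g)) (Srm g) = tr (Dom M g) \<bullet>\<^bsub>A\<^esub> ihm g (Id M (Sr (Dom M g)))"
    unfolding Hom_iff by blast+
qed

lemma Srm_eqI:
  assumes "g \<in> Arr M" "u \<in> Arr M" "Dom M u = Sr (Dom M g)" "Cod M u = Sr (Cod M g)"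
   "tr (Cod M g) \<bullet>\<^bsub>A\<^esub> ihm (Id M (Cod M g)) u = tr (Dom M g) \<bullet>\<^bsub>A\<^esub> ihm g (Id M (Sr (Dom M g)))"
  shows "Srm g = u"
  by (rule tr_inj[of "Cod M g"]) (use assms Srm[OF assms(1)] in simp_all)

lemma Srm_comp:
  assumes g: "g \<in> Arr M" "g' \<in> Arr M" "Dom M g' = Cod M g"
  shows "Srm (g' \<bullet> g) = Srm g' \<bullet> Srm g"
proof (rule Srm_eqI)
  let ?m = "Dom M g" and ?m' = "Cod M g" and ?n = "Cod M g'"
  note S = Srm[OF g(1)] and S' = Srm[OF g(2), unfolded g(3)]
  note T = g S(1-3) S'(1-3)
  show "g' \<bullet> g \<in> Arr M" "Srm g' \<bullet> Srm g \<in> Arr M" "Dom M (Srm g' \<bullet> Srm g) = Sr (Dom M (g' \<bullet> g))"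
    "Cod M (Srm g' \<bullet> Srm g) = Sr (Cod M (g' \<bullet> g))" using T by simp_all
  have "tr ?n \<bullet>\<^bsub>A\<^esub> ihm (Id M ?n) (Srm g' \<bullet> Srm g) = (tr ?n \<bullet>\<^bsub>A\<^esub> ihm (Id M ?n) (Srm g')) \<bullet>\<^bsub>A\<^esub> ihm (Id M ?n) (Srm g)"
    using T ihm_comp[of "Id M ?n" "Id M ?n" "Srm g" "Srm g'"] by simp
  also have "\<dots> = tr ?m' \<bullet>\<^bsub>A\<^esub> (ihm g' (Id M (Sr ?m')) \<bullet>\<^bsub>A\<^esub> ihm (Id M ?n) (Srm g))" unfolding S'(4) using T by simp
  also have "ihm g' (Id M (Sr ?m')) \<bullet>\<^bsub>A\<^esub> ihm (Id M ?n) (Srm g) = ihm (Id M ?m') (Srm g) \<bullet>\<^bsub>A\<^esub> ihm g' (Id M (Sr ?m))"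
    using T by (simp add: ihm_comp)
  also have "tr ?m' \<bullet>\<^bsub>A\<^esub> ihm (Id M ?m') (Srm g) \<bullet>\<^bsub>A\<^esub> ihm g' (Id M (Sr ?m)) = (tr ?m' \<bullet>\<^bsub>A\<^esub> ihm (Id M ?m') (Srm g)) \<bullet>\<^bsub>A\<^esub> ihm g' (Id M (Sr ?m))"
    using T by simp
  also have "\<dots> = tr ?m \<bullet>\<^bsub>A\<^esub> (ihm g (Id M (Sr ?m)) \<bullet>\<^bsub>A\<^esub> ihm g' (Id M (Sr ?m)))" unfolding S(4) using T by simp
  also have "ihm g (Id M (Sr ?m)) \<bullet>\<^bsub>A\<^esub> ihm g' (Id M (Sr ?m)) = ihm (g' \<bullet> g) (Id M (Sr ?m))" using T by (simp add: ihm_comp)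
  finally show "tr (Cod M (g' \<bullet> g)) \<bullet>\<^bsub>A\<^esub> ihm (Id M (Cod M (g' \<bullet> g))) (Srm g' \<bullet> Srm g)
     = tr (Dom M (g' \<bullet> g)) \<bullet>\<^bsub>A\<^esub> ihm (g' \<bullet> g) (Id M (Sr (Dom M (g' \<bullet> g))))" using T by simp
qed

lemma linear_functor_Sr: "linear_functor K M M \<lparr>omap = Sr, amap = Srm\<rparr>"
proof -
  have 1: "Srm (Id M m) = Id M (Sr m)" if "m \<in> Ob M" for m by (rule Srm_eqI) (use that in simp_all)
  have 2: "Srm (HAdd M g g') = HAdd M (Srm g) (Srm g')"
    if "g \<in> Arr M" "g' \<in> Arr M" "Dom M g = Dom M g'" "Cod M g = Cod M g'" for g g'
    by (rule Srm_eqI) (use that Srm[OF that(1)] Srm[OF that(2)] in \<open>simp_all add: ihm_add A.comp_add_right\<close>)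
  have 3: "Srm (HSmult M c g) = HSmult M c (Srm g)" if "g \<in> Arr M" "c \<in> carrier K" for g c
    by (rule Srm_eqI) (use that Srm[OF that(1)] in \<open>simp_all add: ihm_add A.comp_smult_right\<close>)
  show ?thesis
    by (auto simp: linear_functor_def is_functor_def linear_map_def Hom_iff Srm(1-3) 1 2 3 Srm_comp)
qed

text \<open>The bijection \<open>Hom(a, IHom(n, Sr m)) \<rightarrow> Hom(a \<otimes> IHom(m, n), 1)\<close>.\<close>

definition "betar m n u = tr m \<bullet>\<^bsub>A\<^esub> ihm (Id M m) (ev n (Sr m) \<bullet> (u \<unrhd> Id M n)) \<bullet>\<^bsub>A\<^esub> theta (Dom A u) m n"

lemma theta_iso': "\<lbrakk>a \<in> Ob A; m \<in> Ob M; n \<in> Ob M\<rbrakk> \<Longrightarrow> is_iso A (theta a m n)"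
  using right_dual_ex theta_iso by blast

lemma betar:
  assumes "m \<in> Ob M" "n \<in> Ob M" "u \<in> Arr A" "Cod A u = ih n (Sr m)"
  shows "betar m n u \<in> Arr A" "Dom A (betar m n u) = Dom A u \<boxtimes>\<^bsub>A\<^esub> ih m n" "Cod A (betar m n u) = Unit A"
  using assms theta[of "Dom A u" m n] by (simp_all add: betar_def)

text \<open>\<open>betar\<close> is a composite of bijections: evaluation, the universal property of
  the trace, and composition with the isomorphism \<open>theta\<close>.\<close>

lemma betar_inj:
  assumes m: "m \<in> Ob M" "n \<in> Ob M" and u: "u \<in> Arr A" "Cod A u = ih n (Sr m)" and u': "u' \<in> Arr A" "Cod A u' = ih n (Sr m)"
    and e: "Dom A u = Dom A u'" "betar m n u = betar m n u'"
  shows "u = u'"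
proof -
  have aO: "Dom A u' \<in> Ob A" using u' by simp
  note t = theta(1-3)[OF aO m]
  let ?w = "ev n (Sr m) \<bullet> (u \<unrhd> Id M n)" and ?w' = "ev n (Sr m) \<bullet> (u' \<unrhd> Id M n)"
  have "(tr m \<bullet>\<^bsub>A\<^esub> ihm (Id M m) ?w) \<bullet>\<^bsub>A\<^esub> theta (Dom A u') m n = (tr m \<bullet>\<^bsub>A\<^esub> ihm (Id M m) ?w') \<bullet>\<^bsub>A\<^esub> theta (Dom A u') m n"
    using e(2) e(1) m u u' t by (simp add: betar_def)
  then have "tr m \<bullet>\<^bsub>A\<^esub> ihm (Id M m) ?w = tr m \<bullet>\<^bsub>A\<^esub> ihm (Id M m) ?w'"
    by (rule A.iso_cancel_right[OF theta_iso'[OF aO m], rotated -1]) (use m u u' e(1) t in simp_all)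
  then have "?w = ?w'" by (rule tr_inj[OF m(1), rotated -1]) (use m u u' e(1) in simp_all)
  then show ?thesis by (rule ev_inj[rotated -1]) (use m u u' e(1) in simp_all)
qed

lemma betar_surj:
  assumes m: "m \<in> Ob M" "n \<in> Ob M" and a: "a \<in> Ob A" and y: "y \<in> Arr A" "Dom A y = a \<boxtimes>\<^bsub>A\<^esub> ih m n" "Cod A y = Unit A"
  shows "\<exists>u. u \<in> Hom A a (ih n (Sr m)) \<and> betar m n u = y"
proof -
  note t = theta(1-3)[OF a m] and ti = theta_iso'[OF a m]
  obtain w where w: "w \<in> Hom M (a \<rhd> n) (Sr m)" "tr m \<bullet>\<^bsub>A\<^esub> ihm (Id M m) w = y \<bullet>\<^bsub>A\<^esub> inv_arr A (theta a m n)"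
    using tr_ex[OF m(1), of "a \<rhd> n" "y \<bullet>\<^bsub>A\<^esub> inv_arr A (theta a m n)"] y t ti a m by auto
  note wd = HomD[OF w(1)]
  obtain u where u: "u \<in> Arr A" "Dom A u = a" "Cod A u = ih n (Sr m)" "ev n (Sr m) \<bullet> (u \<unrhd> Id M n) = w"
    by (rule ev_surj[of n "Sr m" a w]) (use wd m a in simp_all)
  have "betar m n u = (tr m \<bullet>\<^bsub>A\<^esub> ihm (Id M m) w) \<bullet>\<^bsub>A\<^esub> theta a m n"
    unfolding betar_def u(2,4) using wd m t by simp
  also have "\<dots> = y" unfolding w(2) using y t ti m a by simp
  finally show ?thesis using u(1-3) by (intro exI[of _ u]) (simp add: Hom_iff)
qed

text \<open>Naturality in a, from naturality of \<open>theta\<close> in its first argument.\<close>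

lemma betar_comp:
  assumes m: "m \<in> Ob M" "n \<in> Ob M" and u: "u \<in> Arr A" "Cod A u = ih n (Sr m)" and f: "f \<in> Arr A" "Cod A f = Dom A u"
  shows "betar m n (u \<bullet>\<^bsub>A\<^esub> f) = betar m n u \<bullet>\<^bsub>A\<^esub> (f \<boxdot>\<^bsub>A\<^esub> Id A (ih m n))"
proof -
  have O: "Dom A u \<in> Ob A" "Dom A f \<in> Ob A" using u f by auto
  note T = m u f O theta(1-3)[OF O(1) m] theta(1-3)[OF O(2) m]
  let ?u = "ev n (Sr m) \<bullet> (u \<unrhd> Id M n)"
  have uA: "?u \<in> Arr M" "Dom M ?u = Dom A u \<rhd> n" "Cod M ?u = Sr m" using T by simp_all
  have "ev n (Sr m) \<bullet> ((u \<bullet>\<^bsub>A\<^esub> f) \<unrhd> Id M n) = ?u \<bullet> (f \<unrhd> Id M n)" using T by (simp add: whisker_right)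
  then have "betar m n (u \<bullet>\<^bsub>A\<^esub> f) = tr m \<bullet>\<^bsub>A\<^esub> ihm (Id M m) (?u \<bullet> (f \<unrhd> Id M n)) \<bullet>\<^bsub>A\<^esub> theta (Dom A f) m n"
    using T by (simp add: betar_def)
  also have "ihm (Id M m) (?u \<bullet> (f \<unrhd> Id M n)) = ihm (Id M m) ?u \<bullet>\<^bsub>A\<^esub> ihm (Id M m) (f \<unrhd> Id M n)"
    using ihm_comp[of "Id M m" "Id M m" "f \<unrhd> Id M n" ?u] uA T by simp
  also have "tr m \<bullet>\<^bsub>A\<^esub> (ihm (Id M m) ?u \<bullet>\<^bsub>A\<^esub> ihm (Id M m) (f \<unrhd> Id M n)) \<bullet>\<^bsub>A\<^esub> theta (Dom A f) m n
     = tr m \<bullet>\<^bsub>A\<^esub> ihm (Id M m) ?u \<bullet>\<^bsub>A\<^esub> (ihm (Id M m) (f \<unrhd> Id M n) \<bullet>\<^bsub>A\<^esub> theta (Dom A f) m n)" using uA T by simp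
  also have "ihm (Id M m) (f \<unrhd> Id M n) \<bullet>\<^bsub>A\<^esub> theta (Dom A f) m n = theta (Dom A u) m n \<bullet>\<^bsub>A\<^esub> (f \<boxdot>\<^bsub>A\<^esub> ihm (Id M m) (Id M n))"
    by (rule theta_nat[symmetric]) (use T in simp_all)
  finally show ?thesis using uA T by (simp add: betar_def)
qed

text \<open>Naturality in m and n: \<open>Srm g\<close> is absorbed by its defining property with
  respect to the trace, and then g and h pass through \<open>theta\<close>.\<close>

lemma betar_nat:
  assumes g: "g \<in> Arr M" "Dom M g = m" "Cod M g = m'" and h: "h \<in> Arr M" "Dom M h = n'" "Cod M h = n"
    and u: "u \<in> Arr A" "Cod A u = ih n (Sr m)"
  shows "betar m' n' (ihm h (Srm g) \<bullet>\<^bsub>A\<^esub> u) = betar m n u \<bullet>\<^bsub>A\<^esub> (Id A (Dom A u) \<boxdot>\<^bsub>A\<^esub> ihm g h)"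
proof -
  have O: "m \<in> Ob M" "m' \<in> Ob M" "n \<in> Ob M" "n' \<in> Ob M" "Dom A u \<in> Ob A" using g h u by auto
  let ?a = "Dom A u"
  note S = Srm[OF g(1), unfolded g(2,3)]
  note T = O g h u S(1-3) theta(1-3)[OF O(5,1,3)] theta(1-3)[OF O(5,2,4)]
  let ?u = "ev n (Sr m) \<bullet> (u \<unrhd> Id M n)"
  have uA: "?u \<in> Arr M" "Dom M ?u = ?a \<rhd> n" "Cod M ?u = Sr m" using T by simp_all
  have "ev n' (Sr m') \<bullet> ((ihm h (Srm g) \<bullet>\<^bsub>A\<^esub> u) \<unrhd> Id M n') = (ev n' (Sr m') \<bullet> (ihm h (Srm g) \<unrhd> Id M n')) \<bullet> (u \<unrhd> Id M n')"
    using T by (simp add: whisker_right)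
  also have "ev n' (Sr m') \<bullet> (ihm h (Srm g) \<unrhd> Id M n') = Srm g \<bullet> ev n (Sr m) \<bullet> (Id A (ih n (Sr m)) \<unrhd> h)"
    by (rule ev_nat) (use T in simp_all)
  also have "(Srm g \<bullet> ev n (Sr m) \<bullet> (Id A (ih n (Sr m)) \<unrhd> h)) \<bullet> (u \<unrhd> Id M n') = Srm g \<bullet> ?u \<bullet> (Id A ?a \<unrhd> h)"
    using T by (simp add: act_comp)
  finally have hat: "ev n' (Sr m') \<bullet> ((ihm h (Srm g) \<bullet>\<^bsub>A\<^esub> u) \<unrhd> Id M n') = Srm g \<bullet> ?u \<bullet> (Id A ?a \<unrhd> h)" .
  have "betar m' n' (ihm h (Srm g) \<bullet>\<^bsub>A\<^esub> u) = tr m' \<bullet>\<^bsub>A\<^esub> ihm (Id M m') (Srm g \<bullet> ?u \<bullet> (Id A ?a \<unrhd> h)) \<bullet>\<^bsub>A\<^esub> theta ?a m' n'"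
    unfolding betar_def hat using T by simp
  also have "ihm (Id M m') (Srm g \<bullet> ?u \<bullet> (Id A ?a \<unrhd> h)) = ihm (Id M m') (Srm g) \<bullet>\<^bsub>A\<^esub> ihm (Id M m') (?u \<bullet> (Id A ?a \<unrhd> h))"
    using ihm_comp[of "Id M m'" "Id M m'" "?u \<bullet> (Id A ?a \<unrhd> h)" "Srm g"] uA T by simp
  also have "tr m' \<bullet>\<^bsub>A\<^esub> (ihm (Id M m') (Srm g) \<bullet>\<^bsub>A\<^esub> ihm (Id M m') (?u \<bullet> (Id A ?a \<unrhd> h))) \<bullet>\<^bsub>A\<^esub> theta ?a m' n'
     = (tr m' \<bullet>\<^bsub>A\<^esub> ihm (Id M m') (Srm g)) \<bullet>\<^bsub>A\<^esub> ihm (Id M m') (?u \<bullet> (Id A ?a \<unrhd> h)) \<bullet>\<^bsub>A\<^esub> theta ?a m' n'"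
    using uA T by simp
  also have "\<dots> = tr m \<bullet>\<^bsub>A\<^esub> (ihm g (Id M (Sr m)) \<bullet>\<^bsub>A\<^esub> ihm (Id M m') (?u \<bullet> (Id A ?a \<unrhd> h))) \<bullet>\<^bsub>A\<^esub> theta ?a m' n'"
    unfolding S(4) using uA T by simp
  also have "ihm g (Id M (Sr m)) \<bullet>\<^bsub>A\<^esub> ihm (Id M m') (?u \<bullet> (Id A ?a \<unrhd> h)) = ihm (Id M m) ?u \<bullet>\<^bsub>A\<^esub> ihm g (Id A ?a \<unrhd> h)"
    using ihm_comp[of "Id M m'" g "?u \<bullet> (Id A ?a \<unrhd> h)" "Id M (Sr m)"] ihm_comp[of g "Id M m" "Id A ?a \<unrhd> h" ?u] uA T
    by simp
  also have "tr m \<bullet>\<^bsub>A\<^esub> (ihm (Id M m) ?u \<bullet>\<^bsub>A\<^esub> ihm g (Id A ?a \<unrhd> h)) \<bullet>\<^bsub>A\<^esub> theta ?a m' n'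
     = tr m \<bullet>\<^bsub>A\<^esub> ihm (Id M m) ?u \<bullet>\<^bsub>A\<^esub> (ihm g (Id A ?a \<unrhd> h) \<bullet>\<^bsub>A\<^esub> theta ?a m' n')" using uA T by simp
  also have "ihm g (Id A ?a \<unrhd> h) \<bullet>\<^bsub>A\<^esub> theta ?a m' n' = theta ?a m n \<bullet>\<^bsub>A\<^esub> (Id A ?a \<boxdot>\<^bsub>A\<^esub> ihm g h)"
    by (rule theta_nat[symmetric]) (use T in simp_all)
  finally show ?thesis using uA T by (simp add: betar_def)
qed

text \<open>The dual of IHom(m, n), by evaluation, and IHom(n, Sr m), by \<open>betar\<close>,
  represent the same functor of a, namely Hom(a \<otimes> IHom(m, n), 1). The isomorphism \<phi> is
  the comparison arrow, the preimage of \<open>Ev\<close> under \<open>betar\<close>. Its naturality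
  is tested by the injective \<open>betar\<close>, where it reduces to the adjointness of the
  transpose.\<close>

theorem right_relative_Serre:
  assumes D: "right_duality A D"
  shows "\<exists>\<phi>. is_right_relative_Serre_functor K A M D H \<lparr>omap = Sr, amap = Srm\<rparr> \<phi>"
proof -
  define \<phi> where "\<phi> x = (SOME u. u \<in> Hom A (Dual D (ih (fst x) (snd x))) (ih (snd x) (Sr (fst x))) \<and>
    betar (fst x) (snd x) u = Ev D (ih (fst x) (snd x)))" for x
  have d: "is_right_dual A (ih m n) (Dual D (ih m n)) (Ev D (ih m n)) (Coev D (ih m n))" if "m \<in> Ob M" "n \<in> Ob M" for m n
    using D that unfolding right_duality_def by simp
  have \<phi>: "\<phi> (m, n) \<in> Arr A" "Dom A (\<phi> (m, n)) = Dual D (ih m n)" "Cod A (\<phi> (m, n)) = ih n (Sr m)"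
    "betar m n (\<phi> (m, n)) = Ev D (ih m n)" if mn: "m \<in> Ob M" "n \<in> Ob M" for m n
  proof -
    note E = A.right_dualD(1-8)[OF d[OF mn]]
    from someI_ex[OF betar_surj[OF mn E(2-5)]]
    have "\<phi> (m, n) \<in> Hom A (Dual D (ih m n)) (ih n (Sr m)) \<and> betar m n (\<phi> (m, n)) = Ev D (ih m n)"
      unfolding \<phi>_def by simp
    then show "\<phi> (m, n) \<in> Arr A" "Dom A (\<phi> (m, n)) = Dual D (ih m n)" "Cod A (\<phi> (m, n)) = ih n (Sr m)"
      "betar m n (\<phi> (m, n)) = Ev D (ih m n)" by (simp_all add: Hom_iff)
  qed
  have iso: "is_iso A (\<phi> (m, n))" if mn: "m \<in> Ob M" "n \<in> Ob M" for m n
  proof -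
    note E = A.right_dualD(1-8)[OF d[OF mn]] and P = \<phi>[OF mn]
    let ?J = "ih n (Sr m)" and ?I = "ih m n"
    have JO: "?J \<in> Ob A" using mn by simp
    have J: "Id A ?J \<in> Arr A" "Cod A (Id A ?J) = ?J" "Dom A (Id A ?J) = ?J" using JO by simp_all
    note B = betar[OF mn J(1,2), unfolded J(3)]
    \<comment> \<open>The comparison arrow in the other direction: it represents, through the
      evaluation pairing, the universal element \<open>betar\<close> of the identity.\<close>
    obtain p where p: "p \<in> Arr A" "Dom A p = ?J" "Cod A p = Dual D ?I" "Ev D ?I \<bullet>\<^bsub>A\<^esub> (p \<boxdot>\<^bsub>A\<^esub> Id A ?I) = betar m n (Id A ?J)"
      by (rule A.rpairing_surj[OF d[OF mn] B JO])
    have "betar m n (\<phi> (m, n) \<bullet>\<^bsub>A\<^esub> p) = betar m n (Id A ?J)"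
      using betar_comp[OF mn P(1,3) p(1)] p P by simp
    then have 1: "\<phi> (m, n) \<bullet>\<^bsub>A\<^esub> p = Id A ?J" by (rule betar_inj[OF mn, rotated -1]) (use p(1-3) P(1-3) J in simp_all)
    have "Ev D ?I \<bullet>\<^bsub>A\<^esub> ((p \<bullet>\<^bsub>A\<^esub> \<phi> (m, n)) \<boxdot>\<^bsub>A\<^esub> Id A ?I) = (Ev D ?I \<bullet>\<^bsub>A\<^esub> (p \<boxdot>\<^bsub>A\<^esub> Id A ?I)) \<bullet>\<^bsub>A\<^esub> (\<phi> (m, n) \<boxdot>\<^bsub>A\<^esub> Id A ?I)"
      using p(1-3) P(1-3) E A.tensor_comp[of "\<phi> (m, n)" p "Id A ?I" "Id A ?I"] by simp
    also have "\<dots> = betar m n (Id A ?J \<bullet>\<^bsub>A\<^esub> \<phi> (m, n))"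
      unfolding p(4) using betar_comp[OF mn J(1,2) P(1)] P(3) J(3) by simp
    also have "\<dots> = Ev D ?I \<bullet>\<^bsub>A\<^esub> (Id A (Dual D ?I) \<boxdot>\<^bsub>A\<^esub> Id A ?I)" using P E by simp
    finally have 2: "p \<bullet>\<^bsub>A\<^esub> \<phi> (m, n) = Id A (Dual D ?I)"
      by (rule A.rpairing_inj[OF d[OF mn], rotated -1]) (use p(1-3) P(1-3) E in simp_all)
    show ?thesis by (rule A.is_isoI[OF _ _ 2 1]) (use p P in \<open>simp_all add: Hom_iff\<close>)
  qed
  have nat: "\<phi> (m', n') \<bullet>\<^bsub>A\<^esub> amap (right_dual_ftor A D) (ihm g h) = ihm h (Srm g) \<bullet>\<^bsub>A\<^esub> \<phi> (m, n)"
    if g: "g \<in> Arr M" "Dom M g = m" "Cod M g = m'" and h: "h \<in> Arr M" "Dom M h = n'" "Cod M h = n" for g h m m' n n'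
  proof -
    have O: "m \<in> Ob M" "m' \<in> Ob M" "n \<in> Ob M" "n' \<in> Ob M" using g h by auto
    note E = A.right_dualD(1-8)[OF d[OF O(1,3)]] and E' = A.right_dualD(1-8)[OF d[OF O(2,4)]]
      and P = \<phi>[OF O(1,3)] and P' = \<phi>[OF O(2,4)] and S = Srm(1-3)[OF g(1), unfolded g(2,3)]
    have gh: "ihm g h \<in> Arr A" "Dom A (ihm g h) = ih m' n'" "Cod A (ihm g h) = ih m n" using g h by simp_all
    note R = A.right_dual_ftor_pairing[OF D gh]
    show ?thesis
    proof (rule betar_inj[OF O(2,4)])
      show "betar m' n' (\<phi> (m', n') \<bullet>\<^bsub>A\<^esub> amap (right_dual_ftor A D) (ihm g h)) = betar m' n' (ihm h (Srm g) \<bullet>\<^bsub>A\<^esub> \<phi> (m, n))"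
        using betar_comp[OF O(2,4) P'(1,3) R(1)] betar_nat[OF g h P(1,3)] P(2,4) P'(2,4) R(3,4) by simp
    qed (use P(1-3) P'(1-3) R(1-3) S g h O in simp_all)
  qed
  have "nat_iso (prod_cat M (op_cat M)) A (comp_ftor (right_dual_ftor A D) (IHom H))
       \<lparr>omap = (\<lambda>(m, n). ih n (omap \<lparr>omap = Sr, amap = Srm\<rparr> m)),
        amap = (\<lambda>(g, h). ihm h (amap \<lparr>omap = Sr, amap = Srm\<rparr> g))\<rparr> \<phi>"
    unfolding nat_iso_def
  proof (intro conjI ballI)
    fix x assume "x \<in> Ob (prod_cat M (op_cat M))"
    then obtain m n where x: "x = (m, n)" "m \<in> Ob M" "n \<in> Ob M" by (cases x) auto
    show "\<phi> x \<in> Hom A (omap (comp_ftor (right_dual_ftor A D) (IHom H)) x)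
       (omap \<lparr>omap = (\<lambda>(m, n). ih n (omap \<lparr>omap = Sr, amap = Srm\<rparr> m)),
        amap = (\<lambda>(g, h). ihm h (amap \<lparr>omap = Sr, amap = Srm\<rparr> g))\<rparr> x)"
      using \<phi>(1-3)[OF x(2,3)] x(1) by (simp add: Hom_iff comp_ftor_def right_dual_ftor_def)
    show "is_iso A (\<phi> x)" using iso[OF x(2,3)] x(1) by simp
  next
    fix x y f assume f: "f \<in> Hom (prod_cat M (op_cat M)) x y"
    obtain g h where gh: "f = (g, h)" by (cases f)
    have t: "g \<in> Arr M" "h \<in> Arr M" "x = (Dom M g, Cod M h)" "y = (Cod M g, Dom M h)"
      using f unfolding gh Hom_iff by auto
    show "\<phi> y \<bullet>\<^bsub>A\<^esub> amap (comp_ftor (right_dual_ftor A D) (IHom H)) f = amap \<lparr>omap = (\<lambda>(m, n). ih n (omap \<lparr>omap = Sr, amap = Srm\<rparr> m)),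
        amap = (\<lambda>(g, h). ihm h (amap \<lparr>omap = Sr, amap = Srm\<rparr> g))\<rparr> f \<bullet>\<^bsub>A\<^esub> \<phi> x"
      using nat[OF t(1) refl refl t(2) refl refl] unfolding t(3,4) gh by (simp add: comp_ftor_def)
  qed
  then show ?thesis unfolding is_right_relative_Serre_functor_def using linear_functor_Sr by blast
qed

subsection \<open>The left relative Serre functor\<close>

text \<open>The mirror image of \<open>right_rep\<close>: a universal functional among those on
  IHom(x, n) with x varying, factoring the others by arrows out of \<open>Sl n\<close>.\<close>

definition "left_rep n = (SOME re. fst re \<in> Ob M \<and> snd re \<in> Hom A (ih (fst re) n) (Unit A) \<and>
    (\<forall>x\<in>Ob M. \<forall>y\<in>Hom A (ih x n) (Unit A). \<exists>!u. u \<in> Hom M (fst re) x \<and> snd re \<bullet>\<^bsub>A\<^esub> ihm u (Id M n) = y))"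
definition "Sl n = fst (left_rep n)"
definition "trl n = snd (left_rep n)"

lemma left_rep:
  assumes "n \<in> Ob M"
  shows "Sl n \<in> Ob M \<and> trl n \<in> Hom A (ih (Sl n) n) (Unit A) \<and>
    (\<forall>x\<in>Ob M. \<forall>y\<in>Hom A (ih x n) (Unit A). \<exists>!u. u \<in> Hom M (Sl n) x \<and> trl n \<bullet>\<^bsub>A\<^esub> ihm u (Id M n) = y)"
proof -
  obtain r e where "r \<in> Ob M \<and> e \<in> Hom A (ih r n) (Unit A) \<and>
    (\<forall>x\<in>Ob M. \<forall>y\<in>Hom A (ih x n) (Unit A). \<exists>!u. u \<in> Hom M r x \<and> e \<bullet>\<^bsub>A\<^esub> ihm u (Id M n) = y)"
    using left_Serre_ob[OF assms] by blast
  then have "\<exists>re. fst re \<in> Ob M \<and> snd re \<in> Hom A (ih (fst re) n) (Unit A) \<and>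
    (\<forall>x\<in>Ob M. \<forall>y\<in>Hom A (ih x n) (Unit A). \<exists>!u. u \<in> Hom M (fst re) x \<and> snd re \<bullet>\<^bsub>A\<^esub> ihm u (Id M n) = y)"
    by (intro exI[of _ "(r, e)"]) simp
  from someI_ex[OF this] show ?thesis unfolding Sl_def trl_def left_rep_def .
qed

lemma Sl_simps [simp]:
  assumes "n \<in> Ob M"
  shows "Sl n \<in> Ob M" "trl n \<in> Arr A" "Dom A (trl n) = ih (Sl n) n" "Cod A (trl n) = Unit A"
  using left_rep[OF assms] unfolding Hom_iff by blast+

lemma trl_ex:
  assumes "n \<in> Ob M" "x \<in> Ob M" "y \<in> Arr A" "Dom A y = ih x n" "Cod A y = Unit A"
  shows "\<exists>u. u \<in> Hom M (Sl n) x \<and> trl n \<bullet>\<^bsub>A\<^esub> ihm u (Id M n) = y"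
proof -
  have "y \<in> Hom A (ih x n) (Unit A)" using assms by (simp add: Hom_iff)
  then show ?thesis using left_rep[OF assms(1)] assms(2) by blast
qed

lemma trl_inj:
  assumes "n \<in> Ob M" "u \<in> Arr M" "u' \<in> Arr M" "Cod M u = Cod M u'" "Dom M u = Sl n" "Dom M u' = Sl n"
    "trl n \<bullet>\<^bsub>A\<^esub> ihm u (Id M n) = trl n \<bullet>\<^bsub>A\<^esub> ihm u' (Id M n)"
  shows "u = u'"
proof -
  have "trl n \<bullet>\<^bsub>A\<^esub> ihm u' (Id M n) \<in> Hom A (ih (Cod M u') n) (Unit A)" using assms by (simp add: Hom_iff)
  moreover have "Cod M u' \<in> Ob M" using assms by simp
  ultimately have "\<exists>!v. v \<in> Hom M (Sl n) (Cod M u') \<and> trl n \<bullet>\<^bsub>A\<^esub> ihm v (Id M n) = trl n \<bullet>\<^bsub>A\<^esub> ihm u' (Id M n)"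
    using left_rep[OF assms(1)] by blast
  moreover have "u \<in> Hom M (Sl n) (Cod M u')" "u' \<in> Hom M (Sl n) (Cod M u')" using assms by (simp_all add: Hom_iff)
  ultimately show ?thesis using assms(7) by blast
qed

definition "Slm h = (SOME u. u \<in> Hom M (Sl (Dom M h)) (Sl (Cod M h)) \<and>
   trl (Dom M h) \<bullet>\<^bsub>A\<^esub> ihm u (Id M (Dom M h)) = trl (Cod M h) \<bullet>\<^bsub>A\<^esub> ihm (Id M (Sl (Cod M h))) h)"

lemma Slm:
  assumes "h \<in> Arr M"
  shows "Slm h \<in> Arr M" "Dom M (Slm h) = Sl (Dom M h)" "Cod M (Slm h) = Sl (Cod M h)"
   "trl (Dom M h) \<bullet>\<^bsub>A\<^esub> ihm (Slm h) (Id M (Dom M h)) = trl (Cod M h) \<bullet>\<^bsub>A\<^esub> ihm (Id M (Sl (Cod M h))) h"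
proof -
  have "\<exists>u. u \<in> Hom M (Sl (Dom M h)) (Sl (Cod M h)) \<and>
   trl (Dom M h) \<bullet>\<^bsub>A\<^esub> ihm u (Id M (Dom M h)) = trl (Cod M h) \<bullet>\<^bsub>A\<^esub> ihm (Id M (Sl (Cod M h))) h"
    by (rule trl_ex) (use assms in simp_all)
  from someI_ex[OF this, folded Slm_def]
  show "Slm h \<in> Arr M" "Dom M (Slm h) = Sl (Dom M h)" "Cod M (Slm h) = Sl (Cod M h)"
   "trl (Dom M h) \<bullet>\<^bsub>A\<^esub> ihm (Slm h) (Id M (Dom M h)) = trl (Cod M h) \<bullet>\<^bsub>A\<^esub> ihm (Id M (Sl (Cod M h))) h"
    unfolding Hom_iff by blast+
qed

lemma Slm_eqI:
  assumes "h \<in> Arr M" "u \<in> Arr M" "Dom M u = Sl (Dom M h)" "Cod M u = Sl (Cod M h)"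
   "trl (Dom M h) \<bullet>\<^bsub>A\<^esub> ihm u (Id M (Dom M h)) = trl (Cod M h) \<bullet>\<^bsub>A\<^esub> ihm (Id M (Sl (Cod M h))) h"
  shows "Slm h = u"
  by (rule trl_inj[of "Dom M h"]) (use assms Slm[OF assms(1)] in simp_all)

lemma Slm_comp:
  assumes h: "h \<in> Arr M" "h' \<in> Arr M" "Dom M h' = Cod M h"
  shows "Slm (h' \<bullet> h) = Slm h' \<bullet> Slm h"
proof (rule Slm_eqI)
  let ?l = "Dom M h" and ?m = "Cod M h" and ?n = "Cod M h'"
  note S = Slm[OF h(1)] and S' = Slm[OF h(2), unfolded h(3)]
  note T = h S(1-3) S'(1-3)
  show "h' \<bullet> h \<in> Arr M" "Slm h' \<bullet> Slm h \<in> Arr M" "Dom M (Slm h' \<bullet> Slm h) = Sl (Dom M (h' \<bullet> h))"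
    "Cod M (Slm h' \<bullet> Slm h) = Sl (Cod M (h' \<bullet> h))" using T by simp_all
  have "trl ?l \<bullet>\<^bsub>A\<^esub> ihm (Slm h' \<bullet> Slm h) (Id M ?l) = (trl ?l \<bullet>\<^bsub>A\<^esub> ihm (Slm h) (Id M ?l)) \<bullet>\<^bsub>A\<^esub> ihm (Slm h') (Id M ?l)"
    using T ihm_comp[of "Slm h'" "Slm h" "Id M ?l" "Id M ?l"] by simp
  also have "\<dots> = trl ?m \<bullet>\<^bsub>A\<^esub> (ihm (Id M (Sl ?m)) h \<bullet>\<^bsub>A\<^esub> ihm (Slm h') (Id M ?l))" unfolding S(4) using T by simp
  also have "ihm (Id M (Sl ?m)) h \<bullet>\<^bsub>A\<^esub> ihm (Slm h') (Id M ?l) = ihm (Slm h') (Id M ?m) \<bullet>\<^bsub>A\<^esub> ihm (Id M (Sl ?n)) h"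
    using T by (simp add: ihm_comp)
  also have "trl ?m \<bullet>\<^bsub>A\<^esub> ihm (Slm h') (Id M ?m) \<bullet>\<^bsub>A\<^esub> ihm (Id M (Sl ?n)) h = (trl ?m \<bullet>\<^bsub>A\<^esub> ihm (Slm h') (Id M ?m)) \<bullet>\<^bsub>A\<^esub> ihm (Id M (Sl ?n)) h"
    using T by simp
  also have "\<dots> = trl ?n \<bullet>\<^bsub>A\<^esub> (ihm (Id M (Sl ?n)) h' \<bullet>\<^bsub>A\<^esub> ihm (Id M (Sl ?n)) h)" unfolding S'(4) using T by simp
  also have "ihm (Id M (Sl ?n)) h' \<bullet>\<^bsub>A\<^esub> ihm (Id M (Sl ?n)) h = ihm (Id M (Sl ?n)) (h' \<bullet> h)" using T by (simp add: ihm_comp)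
  finally show "trl (Dom M (h' \<bullet> h)) \<bullet>\<^bsub>A\<^esub> ihm (Slm h' \<bullet> Slm h) (Id M (Dom M (h' \<bullet> h)))
     = trl (Cod M (h' \<bullet> h)) \<bullet>\<^bsub>A\<^esub> ihm (Id M (Sl (Cod M (h' \<bullet> h)))) (h' \<bullet> h)" using T by simp
qed

lemma linear_functor_Sl: "linear_functor K M M \<lparr>omap = Sl, amap = Slm\<rparr>"
proof -
  have 1: "Slm (Id M m) = Id M (Sl m)" if "m \<in> Ob M" for m by (rule Slm_eqI) (use that in simp_all)
  have 2: "Slm (HAdd M g g') = HAdd M (Slm g) (Slm g')"
    if "g \<in> Arr M" "g' \<in> Arr M" "Dom M g = Dom M g'" "Cod M g = Cod M g'" for g g'
    by (rule Slm_eqI) (use that Slm[OF that(1)] Slm[OF that(2)] in \<open>simp_all add: ihm_add A.comp_add_right\<close>)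
  have 3: "Slm (HSmult M c g) = HSmult M c (Slm g)" if "g \<in> Arr M" "c \<in> carrier K" for g c
    by (rule Slm_eqI) (use that Slm[OF that(1)] in \<open>simp_all add: ihm_add A.comp_smult_right\<close>)
  show ?thesis
    by (auto simp: linear_functor_def is_functor_def linear_map_def Hom_iff Slm(1-3) 1 2 3 Slm_comp)
qed

text \<open>The bijection \<open>Hom(x, IHom(Sl n, m)) \<rightarrow> Hom(IHom(m, n) \<otimes> x, 1)\<close>.\<close>

definition "betal m n u = trl n \<bullet>\<^bsub>A\<^esub> kappa (Dom A u) (Sl n) n \<bullet>\<^bsub>A\<^esub> (ihm (ev (Sl n) m \<bullet> (u \<unrhd> Id M (Sl n))) (Id M n) \<boxdot>\<^bsub>A\<^esub> Id A (Dom A u))"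

lemma betal:
  assumes "m \<in> Ob M" "n \<in> Ob M" "u \<in> Arr A" "Cod A u = ih (Sl n) m"
  shows "betal m n u \<in> Arr A" "Dom A (betal m n u) = ih m n \<boxtimes>\<^bsub>A\<^esub> Dom A u" "Cod A (betal m n u) = Unit A"
  using assms kappa(1-3)[of "Dom A u" "Sl n" n] by (simp_all add: betal_def)

text \<open>In terms of the mate \<open>w : Sl n \<rightarrow> b.m\<close> of \<open>u : x.(Sl n) \<rightarrow> m\<close>, where \<open>b\<close> is a left dual of \<open>x\<close>.\<close>

lemma betal_mate:
  assumes d: "is_right_dual A b x e c" and m: "m \<in> Ob M" "n \<in> Ob M" and u: "u \<in> Arr A" "Dom A u = x" "Cod A u = ih (Sl n) m"
    and w: "w \<in> Arr M" "Dom M w = Sl n" "Cod M w = b \<rhd> m" "mate b x e m w = ev (Sl n) m \<bullet> (u \<unrhd> Id M (Sl n))"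
  shows "betal m n u = (trl n \<bullet>\<^bsub>A\<^esub> ihm w (Id M n)) \<bullet>\<^bsub>A\<^esub> lam b x e m n"
proof -
  note D = A.right_dualD(1-8)[OF d]
  have O: "b \<rhd> m \<in> Ob M" "Sl n \<in> Ob M" using D m by simp_all
  let ?cu = "counit b x e m"
  note cu = counit_arr(1-3)[OF d m(1)]
  note T = D m u w(1-3) O cu kappa(1-3)[OF D(2) O(1) m(2)] kappa(1-3)[OF D(2) O(2) m(2)]
  have "betal m n u = trl n \<bullet>\<^bsub>A\<^esub> kappa x (Sl n) n \<bullet>\<^bsub>A\<^esub> (ihm (?cu \<bullet> (Id A x \<unrhd> w)) (Id M n) \<boxdot>\<^bsub>A\<^esub> Id A x)"
    unfolding betal_def u(2) w(4)[symmetric] mate_def ..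
  also have "ihm (?cu \<bullet> (Id A x \<unrhd> w)) (Id M n) = ihm (Id A x \<unrhd> w) (Id M n) \<bullet>\<^bsub>A\<^esub> ihm ?cu (Id M n)"
    using ihm_comp[of ?cu "Id A x \<unrhd> w" "Id M n" "Id M n"] T by simp
  also have "(ihm (Id A x \<unrhd> w) (Id M n) \<bullet>\<^bsub>A\<^esub> ihm ?cu (Id M n)) \<boxdot>\<^bsub>A\<^esub> Id A x
     = (ihm (Id A x \<unrhd> w) (Id M n) \<boxdot>\<^bsub>A\<^esub> Id A x) \<bullet>\<^bsub>A\<^esub> (ihm ?cu (Id M n) \<boxdot>\<^bsub>A\<^esub> Id A x)"
    using A.tensor_comp[of "ihm ?cu (Id M n)" "ihm (Id A x \<unrhd> w) (Id M n)" "Id A x" "Id A x"] T by simp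
  also have "trl n \<bullet>\<^bsub>A\<^esub> kappa x (Sl n) n \<bullet>\<^bsub>A\<^esub> (ihm (Id A x \<unrhd> w) (Id M n) \<boxdot>\<^bsub>A\<^esub> Id A x) \<bullet>\<^bsub>A\<^esub> (ihm ?cu (Id M n) \<boxdot>\<^bsub>A\<^esub> Id A x)
     = trl n \<bullet>\<^bsub>A\<^esub> (kappa x (Sl n) n \<bullet>\<^bsub>A\<^esub> (ihm (Id A x \<unrhd> w) (Id M n) \<boxdot>\<^bsub>A\<^esub> Id A x)) \<bullet>\<^bsub>A\<^esub> (ihm ?cu (Id M n) \<boxdot>\<^bsub>A\<^esub> Id A x)"
    using T by simp
  also have "kappa x (Sl n) n \<bullet>\<^bsub>A\<^esub> (ihm (Id A x \<unrhd> w) (Id M n) \<boxdot>\<^bsub>A\<^esub> Id A x) = ihm w (Id M n) \<bullet>\<^bsub>A\<^esub> kappa x (b \<rhd> m) n"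
    by (rule kappa_nat) (use T in simp_all)
  finally show ?thesis using T by (simp add: lam_def)
qed

text \<open>The definition of \<open>betal\<close> involves no chosen dual, which keeps naturality
  accessible. Bijectivity is seen after choosing a left dual b of x: \<open>betal_mate\<close> then
  presents it through the mate bijection, the universal property of \<open>trl\<close> and the
  isomorphism \<open>lam\<close>.\<close>

lemma betal_inj:
  assumes m: "m \<in> Ob M" "n \<in> Ob M" and u: "u \<in> Arr A" "Cod A u = ih (Sl n) m" and u': "u' \<in> Arr A" "Cod A u' = ih (Sl n) m"
    and e: "Dom A u = Dom A u'" "betal m n u = betal m n u'"
  shows "u = u'"
proof -
  let ?x = "Dom A u'"
  have xO: "?x \<in> Ob A" using u' by simp
  obtain b ee c where d: "is_right_dual A b ?x ee c" using left_dual_ex[OF xO] by blast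
  note D = A.right_dualD(1-8)[OF d] and L = lam_iso[OF d m]
  have sO: "Sl n \<in> Ob M" using m by simp
  let ?w = "ev (Sl n) m \<bullet> (u \<unrhd> Id M (Sl n))" and ?w' = "ev (Sl n) m \<bullet> (u' \<unrhd> Id M (Sl n))"
  have t: "?w \<in> Arr M" "Dom M ?w = ?x \<rhd> Sl n" "Cod M ?w = m" "?w' \<in> Arr M" "Dom M ?w' = ?x \<rhd> Sl n" "Cod M ?w' = m"
    using m u u' e(1) by simp_all
  obtain v where v: "v \<in> Arr M" "Dom M v = Sl n" "Cod M v = b \<rhd> Cod M ?w" "mate b ?x ee (Cod M ?w) v = ?w"
    by (rule mate_surj[OF d t(1,2) sO])
  obtain v' where v': "v' \<in> Arr M" "Dom M v' = Sl n" "Cod M v' = b \<rhd> Cod M ?w'" "mate b ?x ee (Cod M ?w') v' = ?w'"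
    by (rule mate_surj[OF d t(4,5) sO])
  note V = v[unfolded t(3)] and V' = v'[unfolded t(6)]
  have "(trl n \<bullet>\<^bsub>A\<^esub> ihm v (Id M n)) \<bullet>\<^bsub>A\<^esub> lam b ?x ee m n = (trl n \<bullet>\<^bsub>A\<^esub> ihm v' (Id M n)) \<bullet>\<^bsub>A\<^esub> lam b ?x ee m n"
    using betal_mate[OF d m u(1) e(1) u(2) V] betal_mate[OF d m u'(1) refl u'(2) V'] e(2) by simp
  then have "trl n \<bullet>\<^bsub>A\<^esub> ihm v (Id M n) = trl n \<bullet>\<^bsub>A\<^esub> ihm v' (Id M n)"
    by (rule A.iso_cancel_right[OF L(4), rotated -1]) (use V(1-3) V'(1-3) m L in simp_all)
  then have "v = v'" by (rule trl_inj[OF m(2), rotated -1]) (use V(1-3) V'(1-3) in simp_all)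
  then have "?w = ?w'" using V(4) V'(4) by simp
  then show ?thesis by (rule ev_inj[rotated -1]) (use m u u' e(1) in simp_all)
qed

lemma betal_surj:
  assumes m: "m \<in> Ob M" "n \<in> Ob M" and x: "x \<in> Ob A" and y: "y \<in> Arr A" "Dom A y = ih m n \<boxtimes>\<^bsub>A\<^esub> x" "Cod A y = Unit A"
  shows "\<exists>u. u \<in> Hom A x (ih (Sl n) m) \<and> betal m n u = y"
proof -
  obtain b ee c where d: "is_right_dual A b x ee c" using left_dual_ex[OF x] by blast
  note D = A.right_dualD(1-8)[OF d] and L = lam_iso[OF d m]
  have bO: "b \<rhd> m \<in> Ob M" using D m by simp
  obtain w where w: "w \<in> Hom M (Sl n) (b \<rhd> m)" "trl n \<bullet>\<^bsub>A\<^esub> ihm w (Id M n) = y \<bullet>\<^bsub>A\<^esub> inv_arr A (lam b x ee m n)"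
    using trl_ex[OF m(2) bO, of "y \<bullet>\<^bsub>A\<^esub> inv_arr A (lam b x ee m n)"] y L by auto
  note wd = HomD[OF w(1)]
  have mw: "mate b x ee m w \<in> Arr M" "Dom M (mate b x ee m w) = x \<rhd> Sl n" "Cod M (mate b x ee m w) = m"
    using mate_in_Hom[OF d wd(1,3) m(1)] wd(2) by simp_all
  obtain u where u: "u \<in> Arr A" "Dom A u = x" "Cod A u = ih (Sl n) m" "ev (Sl n) m \<bullet> (u \<unrhd> Id M (Sl n)) = mate b x ee m w"
    by (rule ev_surj[of "Sl n" m x "mate b x ee m w"]) (use mw m x in simp_all)
  have "betal m n u = (trl n \<bullet>\<^bsub>A\<^esub> ihm w (Id M n)) \<bullet>\<^bsub>A\<^esub> lam b x ee m n"
    by (rule betal_mate[OF d m u(1-3) wd u(4)[symmetric]])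
  also have "\<dots> = y" unfolding w(2) using y L m x by simp
  finally show ?thesis using u(1-3) by (intro exI[of _ u]) (simp add: Hom_iff)
qed

text \<open>Here x varies along f, so dinaturality of \<open>kappa\<close> in x is what moves f from
  the first argument of \<open>IHom\<close> to the tensor factor.\<close>

lemma betal_comp:
  assumes m: "m \<in> Ob M" "n \<in> Ob M" and u: "u \<in> Arr A" "Cod A u = ih (Sl n) m" and f: "f \<in> Arr A" "Cod A f = Dom A u"
  shows "betal m n (u \<bullet>\<^bsub>A\<^esub> f) = betal m n u \<bullet>\<^bsub>A\<^esub> (Id A (ih m n) \<boxdot>\<^bsub>A\<^esub> f)"
proof -
  let ?s = "Sl n" and ?x = "Dom A f" and ?x' = "Dom A u"
  have O: "?x' \<in> Ob A" "?x \<in> Ob A" "?s \<in> Ob M" using u f m by auto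
  note T = m u f O kappa(1-3)[OF O(1,3) m(2)] kappa(1-3)[OF O(2,3) m(2)]
  let ?u = "ev ?s m \<bullet> (u \<unrhd> Id M ?s)"
  have uA: "?u \<in> Arr M" "Dom M ?u = ?x' \<rhd> ?s" "Cod M ?u = m" using T by simp_all
  have "ev ?s m \<bullet> ((u \<bullet>\<^bsub>A\<^esub> f) \<unrhd> Id M ?s) = ?u \<bullet> (f \<unrhd> Id M ?s)" using T by (simp add: whisker_right)
  then have "betal m n (u \<bullet>\<^bsub>A\<^esub> f) = trl n \<bullet>\<^bsub>A\<^esub> kappa ?x ?s n \<bullet>\<^bsub>A\<^esub> (ihm (?u \<bullet> (f \<unrhd> Id M ?s)) (Id M n) \<boxdot>\<^bsub>A\<^esub> Id A ?x)"
    using T by (simp add: betal_def)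
  also have "ihm (?u \<bullet> (f \<unrhd> Id M ?s)) (Id M n) = ihm (f \<unrhd> Id M ?s) (Id M n) \<bullet>\<^bsub>A\<^esub> ihm ?u (Id M n)"
    using ihm_comp[of ?u "f \<unrhd> Id M ?s" "Id M n" "Id M n"] uA T by simp
  also have "(ihm (f \<unrhd> Id M ?s) (Id M n) \<bullet>\<^bsub>A\<^esub> ihm ?u (Id M n)) \<boxdot>\<^bsub>A\<^esub> Id A ?x
      = (ihm (f \<unrhd> Id M ?s) (Id M n) \<boxdot>\<^bsub>A\<^esub> Id A ?x) \<bullet>\<^bsub>A\<^esub> (ihm ?u (Id M n) \<boxdot>\<^bsub>A\<^esub> Id A ?x)"
    using A.tensor_comp[of "ihm ?u (Id M n)" "ihm (f \<unrhd> Id M ?s) (Id M n)" "Id A ?x" "Id A ?x"] uA T by simp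
  also have "trl n \<bullet>\<^bsub>A\<^esub> kappa ?x ?s n \<bullet>\<^bsub>A\<^esub> (ihm (f \<unrhd> Id M ?s) (Id M n) \<boxdot>\<^bsub>A\<^esub> Id A ?x) \<bullet>\<^bsub>A\<^esub> (ihm ?u (Id M n) \<boxdot>\<^bsub>A\<^esub> Id A ?x)
      = trl n \<bullet>\<^bsub>A\<^esub> (kappa ?x ?s n \<bullet>\<^bsub>A\<^esub> (ihm (f \<unrhd> Id M ?s) (Id M n) \<boxdot>\<^bsub>A\<^esub> Id A ?x)) \<bullet>\<^bsub>A\<^esub> (ihm ?u (Id M n) \<boxdot>\<^bsub>A\<^esub> Id A ?x)"
    using uA T by simp
  also have "kappa ?x ?s n \<bullet>\<^bsub>A\<^esub> (ihm (f \<unrhd> Id M ?s) (Id M n) \<boxdot>\<^bsub>A\<^esub> Id A ?x) = kappa ?x' ?s n \<bullet>\<^bsub>A\<^esub> (Id A (ih (?x' \<rhd> ?s) n) \<boxdot>\<^bsub>A\<^esub> f)"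
    by (rule kappa_dinat) (use T in simp_all)
  also have "trl n \<bullet>\<^bsub>A\<^esub> (kappa ?x' ?s n \<bullet>\<^bsub>A\<^esub> (Id A (ih (?x' \<rhd> ?s) n) \<boxdot>\<^bsub>A\<^esub> f)) \<bullet>\<^bsub>A\<^esub> (ihm ?u (Id M n) \<boxdot>\<^bsub>A\<^esub> Id A ?x)
      = trl n \<bullet>\<^bsub>A\<^esub> kappa ?x' ?s n \<bullet>\<^bsub>A\<^esub> ((Id A (ih (?x' \<rhd> ?s) n) \<boxdot>\<^bsub>A\<^esub> f) \<bullet>\<^bsub>A\<^esub> (ihm ?u (Id M n) \<boxdot>\<^bsub>A\<^esub> Id A ?x))"
    using uA T by simp
  also have "(Id A (ih (?x' \<rhd> ?s) n) \<boxdot>\<^bsub>A\<^esub> f) \<bullet>\<^bsub>A\<^esub> (ihm ?u (Id M n) \<boxdot>\<^bsub>A\<^esub> Id A ?x) = (ihm ?u (Id M n) \<boxdot>\<^bsub>A\<^esub> Id A ?x') \<bullet>\<^bsub>A\<^esub> (Id A (ih m n) \<boxdot>\<^bsub>A\<^esub> f)"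
    using uA T by (simp flip: A.tensor_comp)
  finally show ?thesis using uA T by (simp add: betal_def)
qed

text \<open>Naturality of \<open>kappa\<close> is used twice: in s, to bring \<open>Slm h\<close>
  next to the functional \<open>trl\<close>, which converts it into h, and in n, to move h back past
  \<open>kappa\<close>.\<close>

lemma betal_nat:
  assumes g: "g \<in> Arr M" "Dom M g = m" "Cod M g = m'" and h: "h \<in> Arr M" "Dom M h = n'" "Cod M h = n"
    and u: "u \<in> Arr A" "Cod A u = ih (Sl n) m"
  shows "betal m' n' (ihm (Slm h) g \<bullet>\<^bsub>A\<^esub> u) = betal m n u \<bullet>\<^bsub>A\<^esub> (ihm g h \<boxdot>\<^bsub>A\<^esub> Id A (Dom A u))"
proof -
  let ?x = "Dom A u" and ?s = "Sl n" and ?s' = "Sl n'"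
  have O: "m \<in> Ob M" "m' \<in> Ob M" "n \<in> Ob M" "n' \<in> Ob M" "?x \<in> Ob A" using g h u by auto
  have sO: "?s \<in> Ob M" "?s' \<in> Ob M" using O by simp_all
  note S = Slm[OF h(1), unfolded h(2,3)]
  note T = O sO g h u S(1-3) kappa(1-3)[OF O(5) sO(1) O(3)] kappa(1-3)[OF O(5) sO(1) O(4)] kappa(1-3)[OF O(5) sO(2) O(4)]
  let ?u = "ev ?s m \<bullet> (u \<unrhd> Id M ?s)"
  have uA: "?u \<in> Arr M" "Dom M ?u = ?x \<rhd> ?s" "Cod M ?u = m" using T by simp_all
  have "ev ?s' m' \<bullet> ((ihm (Slm h) g \<bullet>\<^bsub>A\<^esub> u) \<unrhd> Id M ?s') = (ev ?s' m' \<bullet> (ihm (Slm h) g \<unrhd> Id M ?s')) \<bullet> (u \<unrhd> Id M ?s')"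
    using T by (simp add: whisker_right)
  also have "ev ?s' m' \<bullet> (ihm (Slm h) g \<unrhd> Id M ?s') = g \<bullet> ev ?s m \<bullet> (Id A (ih ?s m) \<unrhd> Slm h)"
    by (rule ev_nat) (use T in simp_all)
  also have "(g \<bullet> ev ?s m \<bullet> (Id A (ih ?s m) \<unrhd> Slm h)) \<bullet> (u \<unrhd> Id M ?s') = (g \<bullet> ?u) \<bullet> (Id A ?x \<unrhd> Slm h)"
    using T by (simp add: act_comp)
  finally have hat: "ev ?s' m' \<bullet> ((ihm (Slm h) g \<bullet>\<^bsub>A\<^esub> u) \<unrhd> Id M ?s') = (g \<bullet> ?u) \<bullet> (Id A ?x \<unrhd> Slm h)" .
  have gu: "g \<bullet> ?u \<in> Arr M" "Dom M (g \<bullet> ?u) = ?x \<rhd> ?s" "Cod M (g \<bullet> ?u) = m'" using uA T by simp_all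
  have "betal m' n' (ihm (Slm h) g \<bullet>\<^bsub>A\<^esub> u) = trl n' \<bullet>\<^bsub>A\<^esub> kappa ?x ?s' n' \<bullet>\<^bsub>A\<^esub> (ihm ((g \<bullet> ?u) \<bullet> (Id A ?x \<unrhd> Slm h)) (Id M n') \<boxdot>\<^bsub>A\<^esub> Id A ?x)"
    unfolding betal_def hat using T by simp
  also have "ihm ((g \<bullet> ?u) \<bullet> (Id A ?x \<unrhd> Slm h)) (Id M n') = ihm (Id A ?x \<unrhd> Slm h) (Id M n') \<bullet>\<^bsub>A\<^esub> ihm (g \<bullet> ?u) (Id M n')"
    using ihm_comp[of "g \<bullet> ?u" "Id A ?x \<unrhd> Slm h" "Id M n'" "Id M n'"] gu T by simp
  also have "(ihm (Id A ?x \<unrhd> Slm h) (Id M n') \<bullet>\<^bsub>A\<^esub> ihm (g \<bullet> ?u) (Id M n')) \<boxdot>\<^bsub>A\<^esub> Id A ?x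
     = (ihm (Id A ?x \<unrhd> Slm h) (Id M n') \<boxdot>\<^bsub>A\<^esub> Id A ?x) \<bullet>\<^bsub>A\<^esub> (ihm (g \<bullet> ?u) (Id M n') \<boxdot>\<^bsub>A\<^esub> Id A ?x)"
    using A.tensor_comp[of "ihm (g \<bullet> ?u) (Id M n')" "ihm (Id A ?x \<unrhd> Slm h) (Id M n')" "Id A ?x" "Id A ?x"] gu T by simp
  also have "trl n' \<bullet>\<^bsub>A\<^esub> kappa ?x ?s' n' \<bullet>\<^bsub>A\<^esub> (ihm (Id A ?x \<unrhd> Slm h) (Id M n') \<boxdot>\<^bsub>A\<^esub> Id A ?x) \<bullet>\<^bsub>A\<^esub> (ihm (g \<bullet> ?u) (Id M n') \<boxdot>\<^bsub>A\<^esub> Id A ?x)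
     = trl n' \<bullet>\<^bsub>A\<^esub> (kappa ?x ?s' n' \<bullet>\<^bsub>A\<^esub> (ihm (Id A ?x \<unrhd> Slm h) (Id M n') \<boxdot>\<^bsub>A\<^esub> Id A ?x)) \<bullet>\<^bsub>A\<^esub> (ihm (g \<bullet> ?u) (Id M n') \<boxdot>\<^bsub>A\<^esub> Id A ?x)"
    using gu T by simp
  also have "kappa ?x ?s' n' \<bullet>\<^bsub>A\<^esub> (ihm (Id A ?x \<unrhd> Slm h) (Id M n') \<boxdot>\<^bsub>A\<^esub> Id A ?x) = ihm (Slm h) (Id M n') \<bullet>\<^bsub>A\<^esub> kappa ?x ?s n'"
    by (rule kappa_nat) (use T in simp_all)
  also have "trl n' \<bullet>\<^bsub>A\<^esub> (ihm (Slm h) (Id M n') \<bullet>\<^bsub>A\<^esub> kappa ?x ?s n') \<bullet>\<^bsub>A\<^esub> (ihm (g \<bullet> ?u) (Id M n') \<boxdot>\<^bsub>A\<^esub> Id A ?x)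
     = (trl n' \<bullet>\<^bsub>A\<^esub> ihm (Slm h) (Id M n')) \<bullet>\<^bsub>A\<^esub> kappa ?x ?s n' \<bullet>\<^bsub>A\<^esub> (ihm (g \<bullet> ?u) (Id M n') \<boxdot>\<^bsub>A\<^esub> Id A ?x)"
    using gu T by simp
  also have "\<dots> = trl n \<bullet>\<^bsub>A\<^esub> (ihm (Id M ?s) h \<bullet>\<^bsub>A\<^esub> kappa ?x ?s n') \<bullet>\<^bsub>A\<^esub> (ihm (g \<bullet> ?u) (Id M n') \<boxdot>\<^bsub>A\<^esub> Id A ?x)"
    unfolding S(4) using gu T by simp
  also have "ihm (Id M ?s) h \<bullet>\<^bsub>A\<^esub> kappa ?x ?s n' = kappa ?x ?s n \<bullet>\<^bsub>A\<^esub> (ihm (Id A ?x \<unrhd> Id M ?s) h \<boxdot>\<^bsub>A\<^esub> Id A ?x)"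
    by (rule kappa_nat[symmetric]) (use T in simp_all)
  also have "trl n \<bullet>\<^bsub>A\<^esub> (kappa ?x ?s n \<bullet>\<^bsub>A\<^esub> (ihm (Id A ?x \<unrhd> Id M ?s) h \<boxdot>\<^bsub>A\<^esub> Id A ?x)) \<bullet>\<^bsub>A\<^esub> (ihm (g \<bullet> ?u) (Id M n') \<boxdot>\<^bsub>A\<^esub> Id A ?x)
     = trl n \<bullet>\<^bsub>A\<^esub> kappa ?x ?s n \<bullet>\<^bsub>A\<^esub> ((ihm (Id A ?x \<unrhd> Id M ?s) h \<boxdot>\<^bsub>A\<^esub> Id A ?x) \<bullet>\<^bsub>A\<^esub> (ihm (g \<bullet> ?u) (Id M n') \<boxdot>\<^bsub>A\<^esub> Id A ?x))"
    using gu T by simp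
  also have "(ihm (Id A ?x \<unrhd> Id M ?s) h \<boxdot>\<^bsub>A\<^esub> Id A ?x) \<bullet>\<^bsub>A\<^esub> (ihm (g \<bullet> ?u) (Id M n') \<boxdot>\<^bsub>A\<^esub> Id A ?x)
     = (ihm (Id A ?x \<unrhd> Id M ?s) h \<bullet>\<^bsub>A\<^esub> ihm (g \<bullet> ?u) (Id M n')) \<boxdot>\<^bsub>A\<^esub> Id A ?x"
    using A.tensor_comp[of "ihm (g \<bullet> ?u) (Id M n')" "ihm (Id A ?x \<unrhd> Id M ?s) h" "Id A ?x" "Id A ?x"] gu T by simp
  also have "ihm (Id A ?x \<unrhd> Id M ?s) h \<bullet>\<^bsub>A\<^esub> ihm (g \<bullet> ?u) (Id M n') = ihm ?u (Id M n) \<bullet>\<^bsub>A\<^esub> ihm g h"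
    using ihm_comp[of "g \<bullet> ?u" "Id M (?x \<rhd> ?s)" "Id M n'" h] ihm_comp[of g ?u h "Id M n"] gu uA T by simp
  also have "(ihm ?u (Id M n) \<bullet>\<^bsub>A\<^esub> ihm g h) \<boxdot>\<^bsub>A\<^esub> Id A ?x = (ihm ?u (Id M n) \<boxdot>\<^bsub>A\<^esub> Id A ?x) \<bullet>\<^bsub>A\<^esub> (ihm g h \<boxdot>\<^bsub>A\<^esub> Id A ?x)"
    using A.tensor_comp[of "ihm g h" "ihm ?u (Id M n)" "Id A ?x" "Id A ?x"] uA T by simp
  finally show ?thesis using uA T by (simp add: betal_def)
qed

text \<open>The same comparison of two representing objects as for the right functor, now for x and
  Hom(IHom(m, n) \<otimes> x, 1), with the pairing on the other side.\<close>

theorem left_relative_Serre: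
  assumes D: "left_duality A D"
  shows "\<exists>\<phi>. is_left_relative_Serre_functor K A M D H \<lparr>omap = Sl, amap = Slm\<rparr> \<phi>"
proof -
  define \<phi> where "\<phi> x = (SOME u. u \<in> Hom A (Dual D (ih (fst x) (snd x))) (ih (Sl (snd x)) (fst x)) \<and>
    betal (fst x) (snd x) u = Ev D (ih (fst x) (snd x)))" for x
  have d: "is_right_dual A (Dual D (ih m n)) (ih m n) (Ev D (ih m n)) (Coev D (ih m n))" if "m \<in> Ob M" "n \<in> Ob M" for m n
    using D that unfolding left_duality_def is_left_dual_def by simp
  have \<phi>: "\<phi> (m, n) \<in> Arr A" "Dom A (\<phi> (m, n)) = Dual D (ih m n)" "Cod A (\<phi> (m, n)) = ih (Sl n) m"
    "betal m n (\<phi> (m, n)) = Ev D (ih m n)" if mn: "m \<in> Ob M" "n \<in> Ob M" for m n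
  proof -
    note E = A.right_dualD(1-8)[OF d[OF mn]]
    from someI_ex[OF betal_surj[OF mn E(1) E(3-5)]]
    have "\<phi> (m, n) \<in> Hom A (Dual D (ih m n)) (ih (Sl n) m) \<and> betal m n (\<phi> (m, n)) = Ev D (ih m n)"
      unfolding \<phi>_def by simp
    then show "\<phi> (m, n) \<in> Arr A" "Dom A (\<phi> (m, n)) = Dual D (ih m n)" "Cod A (\<phi> (m, n)) = ih (Sl n) m"
      "betal m n (\<phi> (m, n)) = Ev D (ih m n)" by (simp_all add: Hom_iff)
  qed
  have iso: "is_iso A (\<phi> (m, n))" if mn: "m \<in> Ob M" "n \<in> Ob M" for m n
  proof -
    note E = A.right_dualD(1-8)[OF d[OF mn]] and P = \<phi>[OF mn]
    let ?J = "ih (Sl n) m" and ?I = "ih m n"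
    have JO: "?J \<in> Ob A" using mn by simp
    have J: "Id A ?J \<in> Arr A" "Cod A (Id A ?J) = ?J" "Dom A (Id A ?J) = ?J" using JO by simp_all
    note B = betal[OF mn J(1,2), unfolded J(3)]
    obtain p where p: "p \<in> Arr A" "Dom A p = ?J" "Cod A p = Dual D ?I" "Ev D ?I \<bullet>\<^bsub>A\<^esub> (Id A ?I \<boxdot>\<^bsub>A\<^esub> p) = betal m n (Id A ?J)"
      using A.pairing_surj[OF d[OF mn] B JO] by blast
    have "betal m n (\<phi> (m, n) \<bullet>\<^bsub>A\<^esub> p) = betal m n (Id A ?J)"
      using betal_comp[OF mn P(1,3) p(1)] p P by simp
    then have 1: "\<phi> (m, n) \<bullet>\<^bsub>A\<^esub> p = Id A ?J" by (rule betal_inj[OF mn, rotated -1]) (use p(1-3) P(1-3) J in simp_all)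
    have "Ev D ?I \<bullet>\<^bsub>A\<^esub> (Id A ?I \<boxdot>\<^bsub>A\<^esub> (p \<bullet>\<^bsub>A\<^esub> \<phi> (m, n))) = (Ev D ?I \<bullet>\<^bsub>A\<^esub> (Id A ?I \<boxdot>\<^bsub>A\<^esub> p)) \<bullet>\<^bsub>A\<^esub> (Id A ?I \<boxdot>\<^bsub>A\<^esub> \<phi> (m, n))"
      using p(1-3) P(1-3) E A.tensor_comp[of "Id A ?I" "Id A ?I" "\<phi> (m, n)" p] by simp
    also have "\<dots> = betal m n (Id A ?J \<bullet>\<^bsub>A\<^esub> \<phi> (m, n))"
      unfolding p(4) using betal_comp[OF mn J(1,2) P(1)] P(3) J(3) by simp
    also have "\<dots> = Ev D ?I \<bullet>\<^bsub>A\<^esub> (Id A ?I \<boxdot>\<^bsub>A\<^esub> Id A (Dual D ?I))" using P E by simp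
    finally have 2: "p \<bullet>\<^bsub>A\<^esub> \<phi> (m, n) = Id A (Dual D ?I)"
      by (rule A.pairing_inj[OF d[OF mn], rotated -1]) (use p(1-3) P(1-3) E in simp_all)
    show ?thesis by (rule A.is_isoI[OF _ _ 2 1]) (use p P in \<open>simp_all add: Hom_iff\<close>)
  qed
  have nat: "\<phi> (m', n') \<bullet>\<^bsub>A\<^esub> amap (left_dual_ftor A D) (ihm g h) = ihm (Slm h) g \<bullet>\<^bsub>A\<^esub> \<phi> (m, n)"
    if g: "g \<in> Arr M" "Dom M g = m" "Cod M g = m'" and h: "h \<in> Arr M" "Dom M h = n'" "Cod M h = n" for g h m m' n n'
  proof -
    have O: "m \<in> Ob M" "m' \<in> Ob M" "n \<in> Ob M" "n' \<in> Ob M" using g h by auto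
    note E = A.right_dualD(1-8)[OF d[OF O(1,3)]] and E' = A.right_dualD(1-8)[OF d[OF O(2,4)]]
      and P = \<phi>[OF O(1,3)] and P' = \<phi>[OF O(2,4)] and S = Slm(1-3)[OF h(1), unfolded h(2,3)]
    have gh: "ihm g h \<in> Arr A" "Dom A (ihm g h) = ih m' n'" "Cod A (ihm g h) = ih m n" using g h by simp_all
    note R = A.left_dual_ftor_pairing[OF D gh]
    show ?thesis
    proof (rule betal_inj[OF O(2,4)])
      show "betal m' n' (\<phi> (m', n') \<bullet>\<^bsub>A\<^esub> amap (left_dual_ftor A D) (ihm g h)) = betal m' n' (ihm (Slm h) g \<bullet>\<^bsub>A\<^esub> \<phi> (m, n))"
        using betal_comp[OF O(2,4) P'(1,3) R(1)] betal_nat[OF g h P(1,3)] P(2,4) P'(2,4) R(3,4) by simp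
    qed (use P(1-3) P'(1-3) R(1-3) S g h O in simp_all)
  qed
  have "nat_iso (prod_cat M (op_cat M)) A (comp_ftor (left_dual_ftor A D) (IHom H))
       \<lparr>omap = (\<lambda>(m, n). ih (omap \<lparr>omap = Sl, amap = Slm\<rparr> n) m),
        amap = (\<lambda>(g, h). ihm (amap \<lparr>omap = Sl, amap = Slm\<rparr> h) g)\<rparr> \<phi>"
    unfolding nat_iso_def
  proof (intro conjI ballI)
    fix x assume "x \<in> Ob (prod_cat M (op_cat M))"
    then obtain m n where x: "x = (m, n)" "m \<in> Ob M" "n \<in> Ob M" by (cases x) auto
    show "\<phi> x \<in> Hom A (omap (comp_ftor (left_dual_ftor A D) (IHom H)) x)
       (omap \<lparr>omap = (\<lambda>(m, n). ih (omap \<lparr>omap = Sl, amap = Slm\<rparr> n) m),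
        amap = (\<lambda>(g, h). ihm (amap \<lparr>omap = Sl, amap = Slm\<rparr> h) g)\<rparr> x)"
      using \<phi>(1-3)[OF x(2,3)] x(1) by (simp add: Hom_iff comp_ftor_def left_dual_ftor_def)
    show "is_iso A (\<phi> x)" using iso[OF x(2,3)] x(1) by simp
  next
    fix x y f assume f: "f \<in> Hom (prod_cat M (op_cat M)) x y"
    obtain g h where gh: "f = (g, h)" by (cases f)
    have t: "g \<in> Arr M" "h \<in> Arr M" "x = (Dom M g, Cod M h)" "y = (Cod M g, Dom M h)"
      using f unfolding gh Hom_iff by auto
    show "\<phi> y \<bullet>\<^bsub>A\<^esub> amap (comp_ftor (left_dual_ftor A D) (IHom H)) f = amap \<lparr>omap = (\<lambda>(m, n). ih (omap \<lparr>omap = Sl, amap = Slm\<rparr> n) m),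
        amap = (\<lambda>(g, h). ihm (amap \<lparr>omap = Sl, amap = Slm\<rparr> h) g)\<rparr> f \<bullet>\<^bsub>A\<^esub> \<phi> x"
      using nat[OF t(1) refl refl t(2) refl refl] unfolding t(3,4) gh by (simp add: comp_ftor_def)
  qed
  then show ?thesis unfolding is_left_relative_Serre_functor_def using linear_functor_Sl by blast
qed

end

section \<open>Existence of Serre functors characterises exactness\<close>

context inner_action
begin

text \<open>With a the common source of h and h', arrows into IHom(Cod e, s) are arrows from a.(Cod
  e) to s, and IHom(e, s) restricts them along a.e, which is epi since a has a left dual.\<close>

lemma ihm_epi_mono:
  assumes rig: "rigid A" and e: "is_epi M e" and s: "s \<in> Ob M"
    and h: "h \<in> Arr A" "Cod A h = ih (Cod M e) s" and h': "h' \<in> Arr A" "Cod A h' = ih (Cod M e) s" "Dom A h = Dom A h'"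
    and eq: "ihm e (Id M s) \<bullet>\<^bsub>A\<^esub> h = ihm e (Id M s) \<bullet>\<^bsub>A\<^esub> h'"
  shows "h = h'"
proof -
  have eA: "e \<in> Arr M" using e by (simp add: is_epi_def)
  have aO: "Dom A h \<in> Ob A" using h by simp
  obtain d x c where d: "is_right_dual A d (Dom A h) x c"
    using rig aO unfolding rigid_def is_left_dual_def by blast
  have "(ev (Cod M e) s \<bullet> (h \<unrhd> Id M (Cod M e))) \<bullet> (Id A (Dom A h) \<unrhd> e)
     = (ev (Cod M e) s \<bullet> (h' \<unrhd> Id M (Cod M e))) \<bullet> (Id A (Dom A h) \<unrhd> e)"
    using ihm_nat_ev'[OF eA s h] ihm_nat_ev'[OF eA s h'(1,2)] unfolding eq h'(3) using h h' eA s aO by simp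
  then have "ev (Cod M e) s \<bullet> (h \<unrhd> Id M (Cod M e)) = ev (Cod M e) s \<bullet> (h' \<unrhd> Id M (Cod M e))"
    by (rule M.epi_cancel[OF act_epi[OF d e], rotated -1]) (use h h' eA s aO in simp_all)
  then show ?thesis by (intro ev_inj[of "Cod M e" s]) (use h h' eA s in simp_all)
qed

text \<open>Under \<phi> the transpose of f = IHom(m, e) becomes IHom(e, S m), a monomorphism.
  Transposition is contravariant and faithful, so g f = g' f makes the transposes of g and g' agree,
  and with them g and g'.\<close>

lemma right_relative_Serre_ihm_epi:
  assumes rig: "rigid A" and D: "right_duality A D" and S: "is_right_relative_Serre_functor K A M D H S \<phi>"
    and e: "is_epi M e" and m: "m \<in> Ob M"
  shows "is_epi A (ihm (Id M m) e)"
proof -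
  let ?f = "ihm (Id M m) e" and ?s = "omap S m"
  let ?T = "amap (right_dual_ftor A D)"
  have eA: "e \<in> Arr M" using e by (simp add: is_epi_def)
  have fA: "?f \<in> Arr A" "Dom A ?f = ih m (Dom M e)" "Cod A ?f = ih m (Cod M e)" using eA m by simp_all
  have Sf: "is_functor M M S" using S by (simp add: is_right_relative_Serre_functor_def linear_functor_def)
  have sO: "?s \<in> Ob M" and sI: "amap S (Id M m) = Id M ?s" using is_functorD(1,5)[OF Sf m] by simp_all
  have \<phi>: "nat_iso (prod_cat M (op_cat M)) A (comp_ftor (right_dual_ftor A D) (IHom H))
       \<lparr>omap = (\<lambda>(m, n). ih n (omap S m)), amap = (\<lambda>(g, h). ihm h (amap S g))\<rparr> \<phi>"
    using S by (simp add: is_right_relative_Serre_functor_def)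
  note c = category_prod_cat[OF M.category_axioms cat_op]
  have p: "is_iso A (\<phi> (m, n))" "\<phi> (m, n) \<in> Arr A" "Dom A (\<phi> (m, n)) = Dual D (ih m n)" "Cod A (\<phi> (m, n)) = ih n ?s"
    if "n \<in> Ob M" for n
    using nat_isoD(1,2)[OF \<phi>, of "(m, n)"] m that by (simp_all add: Hom_iff comp_ftor_def right_dual_ftor_def)
  have nat: "\<phi> (m, Dom M e) \<bullet>\<^bsub>A\<^esub> ?T ?f = ihm e (Id M ?s) \<bullet>\<^bsub>A\<^esub> \<phi> (m, Cod M e)"
    using nat_isoD(3)[OF \<phi> c, of "(Id M m, e)"] eA m by (simp add: comp_ftor_def sI)
  note Tf = A.right_dual_ftor_pairing[OF D fA]
  have mono: "x = y" if x: "x \<in> Arr A" "Cod A x = Dual D (ih m (Cod M e))" and y: "y \<in> Arr A" "Cod A y = Dual D (ih m (Cod M e))"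
    and xy: "Dom A x = Dom A y" "?T ?f \<bullet>\<^bsub>A\<^esub> x = ?T ?f \<bullet>\<^bsub>A\<^esub> y" for x y
  proof -
    have nO: "Dom M e \<in> Ob M" "Cod M e \<in> Ob M" using eA by simp_all
    note p1 = p[OF nO(1)] and p2 = p[OF nO(2)]
    have "ihm e (Id M ?s) \<bullet>\<^bsub>A\<^esub> (\<phi> (m, Cod M e) \<bullet>\<^bsub>A\<^esub> z) = \<phi> (m, Dom M e) \<bullet>\<^bsub>A\<^esub> (?T ?f \<bullet>\<^bsub>A\<^esub> z)"
      if "z \<in> Arr A" "Cod A z = Dual D (ih m (Cod M e))" for z
      using A.comp_extend[OF nat, of z] that Tf(1-3) p1 p2 eA sO by simp
    from this[OF x] this[OF y] have "ihm e (Id M ?s) \<bullet>\<^bsub>A\<^esub> (\<phi> (m, Cod M e) \<bullet>\<^bsub>A\<^esub> x) = ihm e (Id M ?s) \<bullet>\<^bsub>A\<^esub> (\<phi> (m, Cod M e) \<bullet>\<^bsub>A\<^esub> y)"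
      by (simp only: xy(2))
    then have "\<phi> (m, Cod M e) \<bullet>\<^bsub>A\<^esub> x = \<phi> (m, Cod M e) \<bullet>\<^bsub>A\<^esub> y"
      by (rule ihm_epi_mono[OF rig e sO, rotated -1]) (use x y xy(1) p2 in simp_all)
    then show ?thesis
      by (rule A.iso_cancel_left[OF p2(1), rotated -1]) (use x y xy(1) p2 in simp_all)
  qed
  show ?thesis unfolding is_epi_def
  proof (intro conjI ballI impI)
    fix z g g' assume z: "z \<in> Ob A" and "g \<in> Hom A (Cod A ?f) z" "g' \<in> Hom A (Cod A ?f) z" and gg: "g \<bullet>\<^bsub>A\<^esub> ?f = g' \<bullet>\<^bsub>A\<^esub> ?f"
    then have g: "g \<in> Arr A" "Dom A g = ih m (Cod M e)" "Cod A g = z" and g': "g' \<in> Arr A" "Dom A g' = ih m (Cod M e)" "Cod A g' = z"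
      using HomD[of g A] HomD[of g' A] fA(3) by auto
    let ?a = "ih m (Dom M e)" and ?b = "ih m (Cod M e)"
    have d: "is_right_dual A x (Dual D x) (Ev D x) (Coev D x)" if "x \<in> Ob A" for x
      using D that by (simp add: right_duality_def)
    have aO: "?a \<in> Ob A" "?b \<in> Ob A" using eA m by simp_all
    note da = A.right_dualD(1-5)[OF d[OF aO(1)]] and db = A.right_dualD(1-5)[OF d[OF aO(2)]]
      and dz = A.right_dualD(1-5)[OF d[OF z]]
    note Tg = A.right_dual_ftor_pairing[OF D g] and Tg' = A.right_dual_ftor_pairing[OF D g']
    \<comment> \<open>Contravariance of transposition in paired form: both adjointness relations are
      applied in turn, with the interchange law in between.\<close>
    have tr: "Ev D ?a \<bullet>\<^bsub>A\<^esub> ((?T ?f \<bullet>\<^bsub>A\<^esub> ?T h) \<boxdot>\<^bsub>A\<^esub> Id A ?a) = Ev D z \<bullet>\<^bsub>A\<^esub> (Id A (Dual D z) \<boxdot>\<^bsub>A\<^esub> (h \<bullet>\<^bsub>A\<^esub> ?f))"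
      if h: "h \<in> Arr A" "Dom A h = ih m (Cod M e)" "Cod A h = z" for h
    proof -
      note Th = A.right_dual_ftor_pairing[OF D h]
      have "Ev D ?a \<bullet>\<^bsub>A\<^esub> ((?T ?f \<bullet>\<^bsub>A\<^esub> ?T h) \<boxdot>\<^bsub>A\<^esub> Id A ?a) = (Ev D ?a \<bullet>\<^bsub>A\<^esub> (?T ?f \<boxdot>\<^bsub>A\<^esub> Id A ?a)) \<bullet>\<^bsub>A\<^esub> (?T h \<boxdot>\<^bsub>A\<^esub> Id A ?a)"
        using A.tensor_comp[of "?T h" "?T ?f" "Id A ?a" "Id A ?a"] Th(1-3) Tf(1-3) da by simp
      also have "\<dots> = Ev D ?b \<bullet>\<^bsub>A\<^esub> (Id A (Dual D ?b) \<boxdot>\<^bsub>A\<^esub> ?f) \<bullet>\<^bsub>A\<^esub> (?T h \<boxdot>\<^bsub>A\<^esub> Id A ?a)"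
        unfolding Tf(4) using Th(1-3) da db fA by simp
      also have "(Id A (Dual D ?b) \<boxdot>\<^bsub>A\<^esub> ?f) \<bullet>\<^bsub>A\<^esub> (?T h \<boxdot>\<^bsub>A\<^esub> Id A ?a) = (?T h \<boxdot>\<^bsub>A\<^esub> Id A ?b) \<bullet>\<^bsub>A\<^esub> (Id A (Dual D z) \<boxdot>\<^bsub>A\<^esub> ?f)"
        using A.tensor_comp[of "?T h" "Id A (Dual D ?b)" "Id A ?a" ?f] A.tensor_comp[of "Id A (Dual D z)" "?T h" ?f "Id A ?b"]
          Th(1-3) da db dz fA by simp
      also have "Ev D ?b \<bullet>\<^bsub>A\<^esub> (?T h \<boxdot>\<^bsub>A\<^esub> Id A ?b) \<bullet>\<^bsub>A\<^esub> (Id A (Dual D z) \<boxdot>\<^bsub>A\<^esub> ?f) = (Ev D ?b \<bullet>\<^bsub>A\<^esub> (?T h \<boxdot>\<^bsub>A\<^esub> Id A ?b)) \<bullet>\<^bsub>A\<^esub> (Id A (Dual D z) \<boxdot>\<^bsub>A\<^esub> ?f)"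
        using Th(1-3) da db dz fA by simp
      also have "\<dots> = Ev D z \<bullet>\<^bsub>A\<^esub> (Id A (Dual D z) \<boxdot>\<^bsub>A\<^esub> (h \<bullet>\<^bsub>A\<^esub> ?f))"
        unfolding Th(4) using A.tensor_comp[of "Id A (Dual D z)" "Id A (Dual D z)" ?f h] h fA dz by simp
      finally show ?thesis .
    qed
    have "?T ?f \<bullet>\<^bsub>A\<^esub> ?T g = ?T ?f \<bullet>\<^bsub>A\<^esub> ?T g'"
      by (rule A.rpairing_inj[OF d[OF aO(1)]]) (use tr[OF g] tr[OF g'] gg Tg(1-3) Tg'(1-3) Tf(1-3) in simp_all)
    then have T: "?T g = ?T g'" by (rule mono[rotated -1]) (use Tg(1-3) Tg'(1-3) in simp_all)
    \<comment> \<open>Equal transposes give equal arrows by the pairing on the other side, since z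
      is a left dual of its right dual.\<close>
    have "Ev D z \<bullet>\<^bsub>A\<^esub> (Id A (Dual D z) \<boxdot>\<^bsub>A\<^esub> g) = Ev D z \<bullet>\<^bsub>A\<^esub> (Id A (Dual D z) \<boxdot>\<^bsub>A\<^esub> g')"
      by (rule trans[OF Tg(4)[symmetric] Tg'(4)[folded T]])
    then show "g = g'" by (rule A.pairing_inj[OF d[OF z], rotated -1]) (use g g' in simp_all)
  qed (rule fA(1))
qed

lemma right_relative_Serre_exact:
  assumes rig: "rigid A" and D: "right_duality A D" and S: "is_right_relative_Serre_functor K A M D H S \<phi>"
  shows "exact_module_category A M"
  unfolding exact_module_category_def projective_def[of M]
proof (intro allI impI conjI ballI; elim conjE)
  fix p m e f assume p: "projective A p" and m: "m \<in> Ob M"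
  have pO: "p \<in> Ob A" using p by (simp add: projective_def)
  show "p \<rhd> m \<in> Ob M" using pO m by simp
  assume e: "is_epi M e" and f: "f \<in> Hom M (p \<rhd> m) (Cod M e)"
  have eA: "e \<in> Arr M" using e by (simp add: is_epi_def)
  obtain u where u: "u \<in> Arr A" "Dom A u = p" "Cod A u = ih m (Cod M e)" "ev m (Cod M e) \<bullet> (u \<unrhd> Id M m) = f"
    by (rule ev_surj[of m "Cod M e" p f]) (use HomD[OF f] m eA pO in simp_all)
  obtain v where v: "v \<in> Arr A" "Dom A v = p" "Cod A v = Dom A (ihm (Id M m) e)" "ihm (Id M m) e \<bullet>\<^bsub>A\<^esub> v = u"
    by (rule A.projective_lift[OF p right_relative_Serre_ihm_epi[OF rig D S e m] u(1,2)]) (use u(3) eA m in simp_all)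
  have vc: "Cod A v = ih m (Dom M e)" using v(3) eA m by simp
  have "e \<bullet> (ev m (Dom M e) \<bullet> (v \<unrhd> Id M m)) = f"
    using ihm_nat_ev[OF eA m v(1) vc] unfolding v(4) u(4) by simp
  then show "\<exists>g\<in>Hom M (p \<rhd> m) (Dom M e). e \<bullet> g = f"
    using v(1,2) vc eA m by (intro bexI[of _ "ev m (Dom M e) \<bullet> (v \<unrhd> Id M m)"]) (simp_all add: Hom_iff)
qed

end

lemma finite_action_module_category:
  fixes K :: "'k ring" and A :: "('oa, 'ma, 'k, 'z) moncat_scheme" and M :: "('oa, 'ma, 'o, 'm, 'k, 'w) modcat_scheme"
  assumes A: "finite_tensor_category K A" and M: "module_category K A M"
  shows "finite_action K A M"
proof -
  have fA: "finite_linear_category K A" and mA: "monoidal_linear_category K A" and rA: "rigid A"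
    using A by (simp_all add: finite_tensor_category_def)
  have fM: "finite_linear_category K M" using M unfolding module_category_def by (rule conjunct1)
  then have lM: "linear_category K M" by (simp add: finite_linear_category_def)
  have "lin_action K A M"
    using M unfolding module_category_def by (intro lin_action.intro lin_action_axioms.intro mA lM) blast+
  moreover have "finite_action_axioms K A M"
    using M unfolding module_category_def
    by (intro finite_action_axioms.intro rA finite_linear_category_fin_ab[OF fA] finite_linear_category_fin_ab[OF fM]) blast
  ultimately show ?thesis by (rule finite_action.intro)
qed

text \<open>A simultaneous choice of duals with their structure maps; rigidity asserts existence
  only object by object.\<close>

lemma rigid_dualities:
  assumes "rigid A" obtains D E where "right_duality A D" "left_duality A E"
proof -
  have "\<exists>x. is_right_dual A c (fst x) (fst (snd x)) (snd (snd x))" "\<exists>x. is_left_dual A c (fst x) (fst (snd x)) (snd (snd x))"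
    if "c \<in> Ob A" for c
    using assms that unfolding rigid_def by simp_all
  then obtain r l where "\<forall>c\<in>Ob A. is_right_dual A c (fst (r c)) (fst (snd (r c))) (snd (snd (r c)))"
    "\<forall>c\<in>Ob A. is_left_dual A c (fst (l c)) (fst (snd (l c))) (snd (snd (l c)))"
    by (metis (no_types))
  then show thesis
    by (intro that[of "\<lparr>Dual = \<lambda>c. fst (r c), Ev = \<lambda>c. fst (snd (r c)), Coev = \<lambda>c. snd (snd (r c))\<rparr>"
          "\<lparr>Dual = \<lambda>c. fst (l c), Ev = \<lambda>c. fst (snd (l c)), Coev = \<lambda>c. snd (snd (l c))\<rparr>"])
      (simp_all add: right_duality_def left_duality_def)
qed

theorem proposition4p24:
  fixes K :: "'k ring"
    and A :: "('oa, 'ma, 'k) moncat"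
    and M :: "('oa, 'ma, 'o, 'm, 'k) modcat"
  assumes "algebraically_closed K"
    and "finite_tensor_category K A"
    and "module_category K A M"
  shows "has_left_relative_Serre_functor K A M \<and> has_right_relative_Serre_functor K A M
    \<longleftrightarrow> exact_module_category A M"
proof
  interpret F: finite_action K A M by (rule finite_action_module_category[OF assms(2,3)])
  {
    assume "has_left_relative_Serre_functor K A M \<and> has_right_relative_Serre_functor K A M"
    then obtain D H S \<phi> where D: "right_duality A D" and H: "is_inner_hom K A M H"
      and S: "is_right_relative_Serre_functor K A M D H S \<phi>"
      unfolding has_right_relative_Serre_functor_def by blast
    \<comment> \<open>The inner Hom is the one that accompanies the given Serre functor, not the
      constructed one.\<close>
    interpret inner_action K A M H
      by (intro inner_action.intro F.lin_action_axioms inner_action_axioms.intro H)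
    show "exact_module_category A M" by (rule right_relative_Serre_exact[OF F.rigid D S])
  next
    assume ex: "exact_module_category A M"
    \<comment> \<open>In this direction an inner Hom has to be supplied; the constructed one serves
      for both Serre functors.\<close>
    interpret E: exact_action K A M F.inner_Hom
      by (intro exact_action.intro inner_action.intro inner_action_axioms.intro exact_action_axioms.intro
          F.finite_action_axioms F.lin_action_axioms F.is_inner_hom_inner_Hom ex)
    obtain D D' where "right_duality A D" "left_duality A D'" by (rule rigid_dualities[OF F.rigid])
    then show "has_left_relative_Serre_functor K A M \<and> has_right_relative_Serre_functor K A M"
      unfolding has_left_relative_Serre_functor_def has_right_relative_Serre_functor_def
      using E.inner_hom E.left_relative_Serre E.right_relative_Serre by blast
  }
qed

end
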